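(* Consider a legitimate link of deterministic length $r_\ell>0$ (transmitter at the origin) in the presence of colluding eavesdroppers placed according to an arbitrary spatial process $\Pi_{\mathrm e}$ in $\mathbb{R}^2$, with distances $R_{\mathrm e,1}\le R_{\mathrm e,2}\le\cdots$ to the origin. For a given realization of $\Pi_{\mathrm e}$, the maximum secrecy rate of the legitimate link is $$\mathcal{R}_{\mathrm s}=\left[\log_{2}\left(1+\frac{P_\ell\, g(r_\ell)}{\sigma_\ell^2}\right)-\log_{2}\left(1+\frac{P_\ell\sum_{i=1}^{\infty}g(R_{\mathrm e,i})}{\sigma_{\mathrm e}^2}\right)\right]^{+},$$ where $P_{\mathrm{rx},\mathrm e}=P_\ell\sum_{i=1}^{\infty}g(R_{\mathrm e,i})$ is the aggregate power received by all the eavesdroppers and $[t]^+=\max\{t,0\}$.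
   Context: Power gain: $g:(0,\infty)\to(0,\infty)$ is continuous, strictly decreasing, with $\lim_{r\to\infty}g(r)=0$ (path loss only). Channel model: the transmitter encodes a discrete random message $s$ into a random codeword $x^n=(x(1),\dots,x(n))\in\mathbb{C}^n$ satisfying $\frac1n\sum_{t=1}^n\mathbb{E}\{|x(t)|^2\}\le P_\ell$. The legitimate receiver observes $y_\ell(t)=\sqrt{g(r_\ell)}\,x(t)+w_\ell(t)$ with $w_\ell(t)$ i.i.d. circularly symmetric complex Gaussian of variance $\sigma_\ell^2>0$, and forms an estimate $\hat s_\ell$ of $s$ from $y_\ell^n$. The colluding eavesdroppers jointly observe the vector $\mathbf{y}_{\mathrm e}(t)=\mathbf{h}_{\mathrm e}x(t)+\mathbf{w}_{\mathrm e}(t)$, where $\mathbf{h}_{\mathrm e}=[\sqrt{g(R_{\mathrm e,1})},\sqrt{g(R_{\mathrm e,2})},\dots]^T$ and $\mathbf{w}_{\mathrm e}(t)$ has i.i.d. circularly symmetric complex Gaussian entries of variance $\sigma_{\mathrm e}^2>0$, i.i.d. in $t$. Codeword, $w_\ell$, and $\mathbf{w}_{\mathrm e}$ are mutually independent. The gains are fixed (the realization of $\Pi_{\mathrm e}$ is given). Maximum secrecy rate: the rate of a code is $\mathcal{R}=H(s)/n$ ($H$ is entropy in bits). A rate $\mathcal{R}^*$ is achievable with strong secrecy if for every $\epsilon>0$, for all sufficiently large $n$, there is an encoder–decoder pair with rate $\mathcal{R}$ such that $\mathcal{R}\ge\mathcal{R}^*-\epsilon$, $H(s\mid\mathbf{y}_{\mathrm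 e}^n)\ge H(s)-\epsilon$, and $\mathbb{P}\{\hat s_\ell\ne s\}\le\epsilon$. The maximum secrecy rate $\mathcal{R}_{\mathrm s}$ is the maximum rate achievable with strong secrecy, in bits per complex dimension. If $\sum_i g(R_{\mathrm e,i})=\infty$, the formula is read as $\mathcal{R}_{\mathrm s}=0$.
   Formalization: The discrete random message s is taken to be uniform on a finite alphabet, so H(s) is the log of its size; for arbitrary message laws, a message that is almost surely constant but has huge entropy makes every rate achievable, so no maximum secrecy rate would exist. *)

theory Defs
  imports "HOL-Probability.Probability"
begin

text \<open>Law of a circularly symmetric complex Gaussian variable \<open>w\<close> with variance
  \<open>E |w|\<^sup>2 = v\<close> (so the real and imaginary parts are independent, each of variance \<open>v/2\<close>).\<close>

definition complex_gaussian :: "real \<Rightarrow> complex measure" where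
  "complex_gaussian v =
     density lborel (\<lambda>z. ennreal (exp (- (cmod z)\<^sup>2 / v) / (pi * v)))"

section \<open>Wiretap codes of block length \<open>n\<close>\<close>

text \<open>The block is indexed by \<open>t < n\<close>. A stochastic encoder together with its message is
  represented by the joint law \<open>C\<close> of the message \<open>s\<close> (coded as a natural number) and the
  random codeword \<open>x\<^sup>n\<close>; the encoder is the conditional law of \<open>x\<^sup>n\<close> given \<open>s\<close>.

  The message is uniform on a finite nonempty alphabet, as usual in channel coding. This cannot
  be dropped: if \<open>s\<close> may have any law, let \<open>s\<close> be \<open>0\<close> with probability \<open>1 - \<epsilon>\<close> and otherwise
  uniform on a huge alphabet, and always send the zero codeword. Then \<open>H(s)/n\<close> is arbitrarily
  large, the secrecy is perfect and the constant decoder errs with probability only \<open>\<epsilon>\<close>.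

  The second moment in the power constraint is a nonnegative integral, so that codewords of
  infinite power are excluded.\<close>

definition wiretap_encoder :: "nat \<Rightarrow> real \<Rightarrow> (nat \<times> (nat \<Rightarrow> complex)) measure \<Rightarrow> bool" where
  "wiretap_encoder n P C \<longleftrightarrow>
     prob_space C \<and>
     sets C = sets (count_space UNIV \<Otimes>\<^sub>M (\<Pi>\<^sub>M t\<in>{..<n}. borel)) \<and>
     (\<exists>S. finite S \<and> S \<noteq> {} \<and>
        distr C (count_space UNIV) fst = measure_pmf (pmf_of_set S)) \<and>
     (\<Sum>t<n. \<integral>\<^sup>+ c. ennreal ((cmod (snd c t))\<^sup>2) \<partial>C) / of_nat n \<le> ennreal P"

definition wiretap_decoder :: "nat \<Rightarrow> ((nat \<Rightarrow> complex) \<Rightarrow> nat) \<Rightarrow> bool" where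
  "wiretap_decoder n dec \<longleftrightarrow> dec \<in> (\<Pi>\<^sub>M t\<in>{..<n}. borel) \<rightarrow>\<^sub>M count_space UNIV"

section \<open>The Gaussian channel to the receiver and to the colluding eavesdroppers\<close>

text \<open>Sample points are \<open>((s, x\<^sup>n), w\<^sub>\<ell>, w\<^sub>e)\<close>; \<open>w\<^sub>e (t, i)\<close> is the noise of eavesdropper \<open>i\<close>
  at time \<open>t\<close>. The index set \<open>I\<close> of the eavesdroppers may be infinite. The product measure
  makes the codeword, the receiver noise and the eavesdropper noise independent.\<close>

type_synonym wiretap_sample =
  "(nat \<times> (nat \<Rightarrow> complex)) \<times> (nat \<Rightarrow> complex) \<times> (nat \<times> nat \<Rightarrow> complex)"

definition wiretap_space ::
  "nat \<Rightarrow> nat set \<Rightarrow> real \<Rightarrow> real \<Rightarrow> (nat \<times> (nat \<Rightarrow> complex)) measure \<Rightarrow> wiretap_sample measure"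
where
  "wiretap_space n I vl ve C =
     C \<Otimes>\<^sub>M (\<Pi>\<^sub>M t\<in>{..<n}. complex_gaussian vl) \<Otimes>\<^sub>M (\<Pi>\<^sub>M ti\<in>{..<n} \<times> I. complex_gaussian ve)"

definition message :: "wiretap_sample \<Rightarrow> nat" where
  "message \<omega> = fst (fst \<omega>)"

definition receiver_output :: "nat \<Rightarrow> real \<Rightarrow> wiretap_sample \<Rightarrow> nat \<Rightarrow> complex" where
  "receiver_output n hl \<omega> =
     (\<lambda>t\<in>{..<n}. complex_of_real hl * snd (fst \<omega>) t + fst (snd \<omega>) t)"

definition eavesdropper_output ::
  "nat \<Rightarrow> nat set \<Rightarrow> (nat \<Rightarrow> real) \<Rightarrow> wiretap_sample \<Rightarrow> nat \<times> nat \<Rightarrow> complex"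
where
  "eavesdropper_output n I he \<omega> =
     (\<lambda>(t, i)\<in>{..<n} \<times> I. complex_of_real (he i) * snd (fst \<omega>) t + snd (snd \<omega>) (t, i))"

section \<open>Entropy, equivocation and the maximum secrecy rate\<close>

definition message_entropy :: "wiretap_sample measure \<Rightarrow> real" where
  "message_entropy \<Omega> = prob_space.entropy \<Omega> 2 (count_space UNIV) message"

text \<open>\<open>H(s | y\<^sub>e\<^sup>n)\<close>. For infinitely many eavesdroppers there is no Lebesgue measure on the space
  of observations, so the law of the observation itself is taken as reference measure (the
  conditional entropy does not depend on this choice). With it the library's definition reads
  \<open>- E log\<^sub>2 p(s | y\<^sub>e\<^sup>n)\<close>.\<close>

definition equivocation ::
  "nat \<Rightarrow> nat set \<Rightarrow> (nat \<Rightarrow> real) \<Rightarrow> wiretap_sample measure \<Rightarrow> real"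
where
  "equivocation n I he \<Omega> =
     prob_space.conditional_entropy \<Omega> 2
       (count_space UNIV)
       (distr \<Omega> (\<Pi>\<^sub>M ti\<in>{..<n} \<times> I. borel) (eavesdropper_output n I he))
       message (eavesdropper_output n I he)"

definition achievable_with_strong_secrecy ::
  "real \<Rightarrow> real \<Rightarrow> real \<Rightarrow> nat set \<Rightarrow> (nat \<Rightarrow> real) \<Rightarrow> real \<Rightarrow> real \<Rightarrow> bool"
where
  "achievable_with_strong_secrecy P hl vl I he ve rate \<longleftrightarrow>
     (\<forall>\<epsilon>>0. \<forall>\<^sub>F n in sequentially. \<exists>C dec.
        wiretap_encoder n P C \<and> wiretap_decoder n dec \<and>
        (let \<Omega> = wiretap_space n I vl ve C in
           message_entropy \<Omega> / real n \<ge> rate - \<epsilon> \<and>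
           equivocation n I he \<Omega> \<ge> message_entropy \<Omega> - \<epsilon> \<and>
           measure \<Omega> {\<omega> \<in> space \<Omega>. dec (receiver_output n hl \<omega>) \<noteq> message \<omega>} \<le> \<epsilon>))"

definition is_maximum_secrecy_rate ::
  "real \<Rightarrow> real \<Rightarrow> real \<Rightarrow> nat set \<Rightarrow> (nat \<Rightarrow> real) \<Rightarrow> real \<Rightarrow> real \<Rightarrow> bool"
where
  "is_maximum_secrecy_rate P hl vl I he ve rate \<longleftrightarrow>
     achievable_with_strong_secrecy P hl vl I he ve rate \<and>
     (\<forall>rate'. achievable_with_strong_secrecy P hl vl I he ve rate' \<longrightarrow> rate' \<le> rate)"

end

theory Submission
  imports Defs
begin

text \<open>Achievability is random wiretap coding. A codebook of \<open>m m'\<close> Gaussian words is drawn at random; the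
  message selects a block of \<open>m'\<close> words and the encoder picks one of them uniformly. Under the
  likelihood ratio with respect to the Gaussian output law, the average over a block is close to
  \<open>1\<close> in \<open>L\<^sup>1\<close> as soon as \<open>ln m' / n\<close> exceeds the information of the eavesdroppers (soft covering),
  so that all messages produce nearly the same observation; the receiver decodes by thresholding
  the same ratio. The exponents come from fractional moments of Gaussian likelihoods, and a Markov
  bound selects one codebook that is good for power, leakage and error at once. The eavesdroppers
  are reduced to a single one of gain slightly above the sum of their gains: every finite
  set of observations is a randomised function of that one, and cylinder sets approximate all events.

  For the converse, a finite set of eavesdroppers is replaced by its combined observation \<open>T\<close>. The
  receiver noise may be coupled to the noise of \<open>T\<close> without changing the error
  probability, and the entropy of the message is then bounded by comparison with a law in which
  the message is independent of the observations. Finite sets suffice, since the partial sums of the gains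
  converge to the infinite sum or diverge.\<close>

section \<open>Complex Gaussian densities\<close>

text \<open>Error probability and equivocation depend only on the law of the receiver output with
  the message and on the law of the eavesdropper observations with the message, not on how the two
  noises are coupled. The converse exploits this freedom: its coupling makes the weaker observation
  a degraded version of the stronger one, up to a limit in one case, and only then is the bound
  tight. It integrates a single inequality \<open>ln u \<le> u - 1\<close> for a likelihood ratio
  \<open>u\<close> that contains the indicator of correct decoding; this does the work of Fano's
  inequality and of Gaussian entropy maximisation at once.

  Infinitely many observations have no Lebesgue density, so secrecy is argued through probabilities
  of events: a cylinder event has the same probability as a test with values in [0, 1] applied to
  one Gaussian observation. Building that test starts from a fictitious observation of positive
  precision, and the slack in the total gain pays for it.

  Passing from statistical distance to bits costs a factor of order \<open>ln m\<close>, linear in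
  \<open>n\<close>. The soft covering error is exponentially small and absorbs it; hence strong
  secrecy.\<close>

definition cn_density :: "real \<Rightarrow> complex \<Rightarrow> real" where
  "cn_density v z = exp (- (cmod z)\<^sup>2 / v) / (pi * v)"

lemma complex_gaussian_cn: "complex_gaussian v = density lborel (\<lambda>z. ennreal (cn_density v z))"
  by (simp add: complex_gaussian_def cn_density_def)

lemma cn_density_pos: "v > 0 \<Longrightarrow> cn_density v z > 0"
  by (simp add: cn_density_def)

lemma cn_density_nonneg: "v > 0 \<Longrightarrow> cn_density v z \<ge> 0"
  by (simp add: cn_density_def)

lemma cn_density_measurable [measurable]: "cn_density v \<in> borel_measurable borel"
  unfolding cn_density_def by measurable

lemma cn_density_minus: "cn_density v (- z) = cn_density v z"
  by (simp add: cn_density_def)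

lemma sets_complex_gaussian [simp, measurable_cong]: "sets (complex_gaussian v) = sets borel"
  by (simp add: complex_gaussian_def)

lemma space_complex_gaussian [simp]: "space (complex_gaussian v) = UNIV"
  by (simp add: complex_gaussian_def)

lemma nn_integral_complex_gaussian:
  "f \<in> borel_measurable borel \<Longrightarrow>
    (\<integral>\<^sup>+z. f z \<partial>complex_gaussian v) = (\<integral>\<^sup>+z. ennreal (cn_density v z) * f z \<partial>lborel)"
  unfolding complex_gaussian_cn by (rule nn_integral_density) auto

text \<open>The Jacobian is \<open>c\<^sup>2\<close> rather than \<open>\<bar>c\<bar>\<close>
  because \<open>complex\<close> has real dimension two.\<close>

lemma nn_integral_lborel_affine:
  fixes f :: "complex \<Rightarrow> ennreal" and c :: real
  assumes f [measurable]: "f \<in> borel_measurable borel" and c: "c \<noteq> 0"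
  shows "(\<integral>\<^sup>+z. f z \<partial>lborel) = (\<integral>\<^sup>+z. ennreal (c\<^sup>2) * f (t + of_real c * z) \<partial>lborel)"
proof -
  have "(\<integral>\<^sup>+z. f z \<partial>lborel)
      = (\<integral>\<^sup>+z. f z \<partial>density (distr lborel borel (\<lambda>x. t + c *\<^sub>R x)) (\<lambda>_. \<bar>c\<bar>^DIM(complex)))"
    using lborel_affine[OF c, of t] by simp
  also have "\<dots> = (\<integral>\<^sup>+z. ennreal (c\<^sup>2) * f (t + c *\<^sub>R z) \<partial>lborel)"
    by (simp add: nn_integral_density nn_integral_distr)
  finally show ?thesis
    by (simp add: scaleR_conv_of_real)
qed

lemma nn_integral_lborel_shift:
  fixes f :: "complex \<Rightarrow> ennreal"
  assumes "f \<in> borel_measurable borel"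
  shows "(\<integral>\<^sup>+z. f (t + z) \<partial>lborel) = (\<integral>\<^sup>+z. f z \<partial>lborel)"
  using nn_integral_lborel_affine[OF assms, of 1 t] by simp

lemma nn_integral_lborel_complex_prod:
  fixes f g :: "real \<Rightarrow> real"
  assumes [measurable]: "f \<in> borel_measurable borel" "g \<in> borel_measurable borel"
    and "\<And>x. f x \<ge> 0" "\<And>x. g x \<ge> 0"
  shows "(\<integral>\<^sup>+z. ennreal (f (Re z) * g (Im z)) \<partial>lborel)
       = (\<integral>\<^sup>+x. ennreal (f x) \<partial>lborel) * (\<integral>\<^sup>+x. ennreal (g x) \<partial>lborel)"
proof -
  define F where "F b = (if b = (1::complex) then \<lambda>x. ennreal (f x) else (\<lambda>x. ennreal (g x)))" for b
  have "(\<integral>\<^sup>+z. (\<Prod>b\<in>Basis. F b (z \<bullet> b)) \<partial>lborel)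
      = (\<Prod>b\<in>Basis. (\<integral>\<^sup>+x. F b x \<partial>lborel))"
    by (rule nn_integral_lborel_prod) (auto simp: F_def)
  moreover have "1 \<noteq> \<i>"
    using complex_i_not_one by metis
  ultimately show ?thesis
    using assms(3,4) by (simp add: Basis_complex_def F_def ennreal_mult inner_complex_def)
qed

text \<open>The variance \<open>v\<close> of the complex variable splits evenly over the two real
  coordinates, hence \<open>sqrt (v / 2)\<close>. Normalisation and second moment are inherited from
  \<open>normal_density\<close> in this way.\<close>

lemma cn_density_prod:
  assumes "v > 0"
  shows "cn_density v z = normal_density 0 (sqrt (v / 2)) (Re z) * normal_density 0 (sqrt (v / 2)) (Im z)"
  using assms
  by (simp add: cn_density_def normal_density_def cmod_power2 exp_add[symmetric] add_divide_distrib
      real_sqrt_mult[symmetric] real_sqrt_divide field_simps)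

lemma nn_integral_normal_density:
  "\<sigma> > 0 \<Longrightarrow> (\<integral>\<^sup>+x. ennreal (normal_density \<mu> \<sigma> x) \<partial>lborel) = 1"
  by (subst nn_integral_eq_integral) (auto simp: integral_normal_density)

lemma nn_integral_normal_second_moment:
  assumes "\<sigma> > 0"
  shows "(\<integral>\<^sup>+x. ennreal (x\<^sup>2 * normal_density 0 \<sigma> x) \<partial>lborel) = ennreal (\<sigma>\<^sup>2)"
proof -
  have "has_bochner_integral lborel (\<lambda>x. normal_density 0 \<sigma> x * (x - 0)^(2 * 1)) (fact (2 * 1) / ((2 / \<sigma>\<^sup>2)^1 * fact 1))"
    by (rule normal_moment_even[OF assms])
  then have "has_bochner_integral lborel (\<lambda>x. x\<^sup>2 * normal_density 0 \<sigma> x) (\<sigma>\<^sup>2)"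
    by (simp add: mult.commute)
  then show ?thesis
    by (subst nn_integral_eq_integral) (auto simp: has_bochner_integral_iff)
qed

lemma nn_integral_cn: "v > 0 \<Longrightarrow> (\<integral>\<^sup>+z. ennreal (cn_density v z) \<partial>lborel) = 1"
  by (simp add: cn_density_prod nn_integral_lborel_complex_prod nn_integral_normal_density)

lemma nn_integral_cn_shift:
  "v > 0 \<Longrightarrow> (\<integral>\<^sup>+z. ennreal (cn_density v (z - m)) \<partial>lborel) = 1"
  using nn_integral_lborel_shift[of "\<lambda>z. ennreal (cn_density v z)" "- m"] nn_integral_cn[of v] by simp

lemma prob_space_complex_gaussian: "v > 0 \<Longrightarrow> prob_space (complex_gaussian v)"
  by (rule prob_spaceI) (simp add: complex_gaussian_cn emeasure_density nn_integral_cn)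

lemma complex_gaussian_second_moment:
  assumes v: "v > 0"
  shows "(\<integral>\<^sup>+z. ennreal ((cmod z)\<^sup>2) \<partial>complex_gaussian v) = ennreal v"
proof -
  let ?n = "normal_density 0 (sqrt (v / 2))"
  have s: "sqrt (v / 2) > 0" using v by simp
  have nn: "\<And>x. 0 \<le> ?n x"
    by simp
  have "(\<integral>\<^sup>+z. ennreal ((cmod z)\<^sup>2) \<partial>complex_gaussian v)
      = (\<integral>\<^sup>+z. ennreal ((Re z)\<^sup>2 * ?n (Re z) * ?n (Im z)) + ennreal (?n (Re z) * ((Im z)\<^sup>2 * ?n (Im z))) \<partial>lborel)"
    using v nn
    by (simp add: nn_integral_complex_gaussian cn_density_prod cmod_power2 ennreal_mult[symmetric]
        ennreal_plus[symmetric] algebra_simps del: ennreal_plus)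
  also have "\<dots> = ennreal (v / 2) + ennreal (v / 2)"
    using nn_integral_lborel_complex_prod[of "\<lambda>x. x\<^sup>2 * ?n x" ?n] nn_integral_lborel_complex_prod[of ?n "\<lambda>x. x\<^sup>2 * ?n x"] s v nn
    by (subst nn_integral_add) (auto simp: nn_integral_normal_density nn_integral_normal_second_moment)
  finally show ?thesis
    using v by (simp add: ennreal_plus[symmetric] del: ennreal_plus)
qed

text \<open>The integrals for \<open>c\<close> and \<open>- c\<close> agree by symmetry of the
  density, and in their sum the cross term cancels by the parallelogram law. This keeps the
  computation within nonnegative integrals.\<close>

lemma complex_gaussian_second_moment_shift:
  assumes v: "v > 0"
  shows "(\<integral>\<^sup>+z. ennreal ((cmod (u + of_real c * z))\<^sup>2) \<partial>complex_gaussian v) = ennreal ((cmod u)\<^sup>2 + c\<^sup>2 * v)"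
proof -
  interpret prob_space "complex_gaussian v" by (rule prob_space_complex_gaussian[OF v])
  let ?F = "\<lambda>c::real. \<integral>\<^sup>+z. ennreal ((cmod (u + of_real c * z))\<^sup>2) \<partial>complex_gaussian v"
  have sym: "?F (- c) = ?F c"
    using nn_integral_lborel_affine[of "\<lambda>z. ennreal (cn_density v z) * ennreal ((cmod (u + of_real c * z))\<^sup>2)" "-1" 0]
    by (simp add: nn_integral_complex_gaussian cn_density_minus)
  have "?F c + ?F (- c)
      = (\<integral>\<^sup>+z. ennreal (2 * (cmod u)\<^sup>2) + ennreal (2 * c\<^sup>2) * ennreal ((cmod z)\<^sup>2) \<partial>complex_gaussian v)"
  proof (subst nn_integral_add[symmetric]; (intro nn_integral_cong)?)
    fix z
    have "(cmod (u + of_real c * z))\<^sup>2 + (cmod (u + of_real (- c) * z))\<^sup>2 = 2 * (cmod u)\<^sup>2 + 2 * c\<^sup>2 * (cmod z)\<^sup>2"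
      unfolding cmod_power2 by (simp add: power2_eq_square algebra_simps)
    then show "ennreal ((cmod (u + of_real c * z))\<^sup>2) + ennreal ((cmod (u + of_real (- c) * z))\<^sup>2)
        = ennreal (2 * (cmod u)\<^sup>2) + ennreal (2 * c\<^sup>2) * ennreal ((cmod z)\<^sup>2)"
      by (simp add: ennreal_plus[symmetric] ennreal_mult[symmetric] del: ennreal_plus)
  qed auto
  also have "\<dots> = ennreal (2 * (cmod u)\<^sup>2) + ennreal (2 * c\<^sup>2) * ennreal v"
    by (subst nn_integral_add)
       (auto simp: emeasure_space_1[simplified] nn_integral_cmult complex_gaussian_second_moment[OF v])
  also have "\<dots> = ennreal ((cmod u)\<^sup>2 + c\<^sup>2 * v) + ennreal ((cmod u)\<^sup>2 + c\<^sup>2 * v)"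
    using v by (simp add: ennreal_plus[symmetric] ennreal_mult[symmetric] algebra_simps del: ennreal_plus)
  finally have "2 * ?F c = 2 * ennreal ((cmod u)\<^sup>2 + c\<^sup>2 * v)"
    unfolding sym mult_2 .
  then show ?thesis
    using ennreal_mult_cancel_left[of 2] by simp
qed

text \<open>Completing the square: the joint law of a Gaussian input \<open>u\<close> and the output \<open>y = c u + w\<close>
  factors into the law of \<open>y\<close> and the posterior law of \<open>u\<close>.\<close>

lemma cn_density_bayes:
  assumes a: "a > 0" and b: "b > 0" and k: "k = b + c\<^sup>2 * a"
  shows "cn_density a u * cn_density b (y - of_real c * u) = cn_density k y * cn_density (a * b / k) (u - of_real (c * a / k) * y)"
proof -
  have kp: "k > 0" using a b k by (simp add: add_pos_nonneg)
  obtain u1 u2 where u: "u = Complex u1 u2" by (cases u)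
  obtain y1 y2 where y: "y = Complex y1 y2" by (cases y)
  \<comment> \<open>Since \<open>c\<close> is real, the exponents can be compared separately in the
    real and in the imaginary coordinate; this is the scalar identity.\<close>
  have one: "u1\<^sup>2 / a + (y1 - c * u1)\<^sup>2 / b = y1\<^sup>2 / k + (u1 - c * a / k * y1)\<^sup>2 / (a * b / k)" for u1 y1 :: real
  proof -
    have "b * k * u1\<^sup>2 + a * k * (y1 - c * u1)\<^sup>2 = a * b * y1\<^sup>2 + (k * u1 - c * a * y1)\<^sup>2"
      unfolding k by (simp add: power2_eq_square algebra_simps)
    moreover have "(u1 - c * a / k * y1) = (k * u1 - c * a * y1) / k"
      using kp by (simp add: field_simps)
    ultimately have "(u1 - c * a / k * y1)\<^sup>2 = (b * k * u1\<^sup>2 + a * k * (y1 - c * u1)\<^sup>2 - a * b * y1\<^sup>2) / k\<^sup>2"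
      by (simp add: power_divide)
    moreover have "(b * k * u1\<^sup>2 + a * k * (y1 - c * u1)\<^sup>2 - a * b * y1\<^sup>2) / k\<^sup>2 / (a * b / k)
        = u1\<^sup>2 / a + (y1 - c * u1)\<^sup>2 / b - y1\<^sup>2 / k"
      using a b kp by (simp add: field_simps) (simp add: power2_eq_square algebra_simps)?
    ultimately show ?thesis by simp
  qed
  have "(cmod u)\<^sup>2 / a + (cmod (y - of_real c * u))\<^sup>2 / b
      = (cmod y)\<^sup>2 / k + (cmod (u - of_real (c * a / k) * y))\<^sup>2 / (a * b / k)"
    using one[of u1 y1] one[of u2 y2] by (simp add: u y cmod_power2 add_divide_distrib distrib_right)
  then have "- (cmod u)\<^sup>2 / a + - (cmod (y - of_real c * u))\<^sup>2 / b
      = - (cmod y)\<^sup>2 / k + - (cmod (u - of_real (c * a / k) * y))\<^sup>2 / (a * b / k)"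
    by linarith
  then have "exp (- (cmod u)\<^sup>2 / a) * exp (- (cmod (y - of_real c * u))\<^sup>2 / b)
      = exp (- (cmod y)\<^sup>2 / k) * exp (- (cmod (u - of_real (c * a / k) * y))\<^sup>2 / (a * b / k))"
    unfolding exp_add[symmetric] by simp
  moreover have "pi * a * (pi * b) = pi * k * (pi * (a * b / k))"
    using kp by simp
  ultimately show ?thesis
    unfolding cn_density_def times_divide_times_eq by metis
qed

text \<open>After \<open>cn_density_bayes\<close> only the posterior factor depends on
  \<open>u\<close>, and it integrates to 1.\<close>

lemma cn_density_convolution:
  assumes a: "a > 0" and b: "b > 0"
  shows "(\<integral>\<^sup>+u. ennreal (cn_density a u) * ennreal (cn_density b (y - of_real c * u)) \<partial>lborel) = ennreal (cn_density (b + c\<^sup>2 * a) y)"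
proof -
  define k where "k = b + c\<^sup>2 * a"
  have kp: "k > 0" using a b unfolding k_def by (simp add: add_pos_nonneg)
  have "(\<integral>\<^sup>+u. ennreal (cn_density a u) * ennreal (cn_density b (y - of_real c * u)) \<partial>lborel)
     = (\<integral>\<^sup>+u. ennreal (cn_density k y) * ennreal (cn_density (a * b / k) (u - of_real (c * a / k) * y)) \<partial>lborel)"
    using cn_density_bayes[OF a b k_def] a b kp
    by (simp add: ennreal_mult[symmetric] cn_density_nonneg)
  also have "\<dots> = ennreal (cn_density k y)"
    using a b kp by (subst nn_integral_cmult) (auto simp: nn_integral_cn_shift)
  finally show ?thesis by (simp add: k_def)
qed

lemma cn_density_scale:
  assumes "v > 0" "c \<noteq> 0"
  shows "cn_density v z = c\<^sup>2 * cn_density (c\<^sup>2 * v) (of_real c * z)"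
  using assms by (simp add: cn_density_def norm_mult power_mult_distrib)

section \<open>Powers, tilts and fractional moments of Gaussian densities\<close>

lemma cn_density_powr:
  assumes "v > 0" "s > 0"
  shows "cn_density v z powr s = cn_density (v / s) z * ((pi * v) powr (1 - s) / s)"
proof -
  have "cn_density v z powr s = exp (- (cmod z)\<^sup>2 / v * s) / (pi * v) powr s"
    using assms by (simp add: cn_density_def powr_divide) (simp add: powr_def mult.commute)
  also have "\<dots> = cn_density (v / s) z * ((pi * v) powr (1 - s) / s)"
    using assms by (simp add: cn_density_def powr_diff divide_simps) 
  finally show ?thesis .
qed

text \<open>The condition on \<open>s\<close> keeps the combined exponent negative. The product is
  then a constant times the Gaussian density of variance \<open>k'\<close> divided by
  \<open>1 - s * k' / k\<close>.\<close>

lemma cn_density_tilt: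
  assumes k': "k' > 0" and k: "k > 0" and s: "s * k' < k"
  shows "(\<integral>\<^sup>+y. ennreal (cn_density k' y * cn_density k y powr (- s)) \<partial>lborel)
       = ennreal ((pi * k) powr s / (1 - s * k' / k))"
proof -
  define d where "d = 1 - s * k' / k"
  have d: "d > 0" using s k by (simp add: d_def)
  have *: "cn_density k' y * cn_density k y powr (- s) = ((pi * k) powr s / d) * cn_density (k' / d) y" for y
  proof -
    have "cn_density k y powr (- s) = exp (s * (cmod y)\<^sup>2 / k) * (pi * k) powr s"
      using k by (simp add: cn_density_def powr_divide powr_minus) (simp add: powr_def exp_minus ln_div field_simps)
    moreover have "- (cmod y)\<^sup>2 / k' + s * (cmod y)\<^sup>2 / k = - (cmod y)\<^sup>2 / (k' / d)"
      using k k' d by (simp add: d_def divide_simps) (simp add: algebra_simps)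
    then have "exp (- (cmod y)\<^sup>2 / k') * exp (s * (cmod y)\<^sup>2 / k) = exp (- (cmod y)\<^sup>2 / (k' / d))"
      by (simp add: exp_add[symmetric])
    ultimately show ?thesis
      using k' d by (simp add: cn_density_def)
  qed
  have "(\<integral>\<^sup>+y. ennreal (cn_density k' y * cn_density k y powr (- s)) \<partial>lborel)
      = (\<integral>\<^sup>+y. ennreal ((pi * k) powr s / d) * ennreal (cn_density (k' / d) y) \<partial>lborel)"
    unfolding * using k k' d by (simp add: ennreal_mult[symmetric] cn_density_nonneg)
  also have "\<dots> = ennreal ((pi * k) powr s / d)"
    using k' d by (subst nn_integral_cmult) (auto simp: nn_integral_cn)
  finally show ?thesis by (simp add: d_def)
qed

text \<open>The moment is taken under independent input and output. Here \<open>ln (k / v)\<close>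
  is the mutual information, in nats, of a Gaussian input over this channel, so the main factor is
  the exponential of \<open>s\<close> times the information, while the loss
  \<open>1 / (1 - s\<^sup>2)\<close> is only of second order in \<open>s\<close>. Positive
  \<open>s\<close> controls the upper tail of the likelihood ratio, negative \<open>s\<close> the
  lower tail.\<close>

lemma gaussian_likelihood_moment:
  assumes P: "P > 0" and v: "v > 0" and s: "\<bar>s\<bar> < 1" and k: "k = v + h\<^sup>2 * P"
  shows "(\<integral>\<^sup>+y. (\<integral>\<^sup>+x. ennreal ((cn_density v (y - of_real h * x) / cn_density k y) powr (1 + s)) \<partial>complex_gaussian P)
            \<partial>complex_gaussian k) \<le> ennreal ((k / v) powr s / (1 - s\<^sup>2))"
proof -
  define v' where "v' = v / (1 + s)"
  define k' where "k' = v' + h\<^sup>2 * P"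
  define A where "A = (pi * v) powr (- s) / (1 + s)"
  have s1: "1 + s > 0" "1 - s > 0" using s by auto
  have v': "v' > 0" using v s1 by (simp add: v'_def)
  have kp: "k > 0" and k'p: "k' > 0" using k v v' P by (auto simp: k'_def add_pos_nonneg)
  have A: "A \<ge> 0" using s1 by (simp add: A_def)
  \<comment> \<open>The exact moment carries the factor \<open>k / ((1 + s) * (k - s * k'))\<close>.
    This identity yields both the positivity that the tilt requires and, as
    \<open>h\<^sup>2 * P \<le> k\<close>, the bound by \<open>1 / (1 - s\<^sup>2)\<close>.\<close>
  have eq: "(1 + s) * (k - s * k') = k - s\<^sup>2 * (h\<^sup>2 * P)"
    using s1 by (simp add: k k'_def v'_def field_simps power2_eq_square)
  have "s\<^sup>2 < 1" using s by (simp add: abs_square_less_1)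
  have "s\<^sup>2 * (h\<^sup>2 * P) \<le> s\<^sup>2 * k"
    using v by (intro mult_left_mono) (auto simp: k)
  moreover have "s\<^sup>2 * k < k"
    using \<open>s\<^sup>2 < 1\<close> kp by simp
  ultimately have pos: "(1 + s) * (k - s * k') > 0"
    unfolding eq by linarith
  then have sk: "s * k' < k"
    using s1 by (simp add: zero_less_mult_iff)
  have pw: "(cn_density v z / cn_density k y) powr (1 + s) * cn_density k y = A * cn_density v' z * cn_density k y powr (- s)" for z y
  proof -
    have "(cn_density v z / cn_density k y) powr (1 + s) * cn_density k y = cn_density v z powr (1 + s) / cn_density k y powr (1 + s) * cn_density k y"
      using v kp by (simp add: powr_divide cn_density_nonneg)
    also have "cn_density k y powr (1 + s) = cn_density k y powr 1 * cn_density k y powr s"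
      by (simp add: powr_add)
    also have "cn_density k y powr 1 = cn_density k y"
      using kp by (simp add: cn_density_nonneg)
    finally show ?thesis
      using cn_density_powr[OF v s1(1), of z] cn_density_pos[OF kp, of y]
      by (simp add: A_def v'_def powr_minus divide_inverse)
  qed
  have "(\<integral>\<^sup>+y. (\<integral>\<^sup>+x. ennreal ((cn_density v (y - of_real h * x) / cn_density k y) powr (1 + s)) \<partial>complex_gaussian P)
            \<partial>complex_gaussian k)
      = (\<integral>\<^sup>+y. (\<integral>\<^sup>+x. ennreal (cn_density k y) * (ennreal (cn_density P x) * ennreal ((cn_density v (y - of_real h * x) / cn_density k y) powr (1 + s))) \<partial>lborel)
            \<partial>lborel)"
    by (simp add: nn_integral_complex_gaussian nn_integral_cmult)
  also have "\<dots> = (\<integral>\<^sup>+y. (\<integral>\<^sup>+x. ennreal (A * cn_density k y powr (- s)) * (ennreal (cn_density P x) * ennreal (cn_density v' (y - of_real h * x))) \<partial>lborel)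
            \<partial>lborel)"
  proof (intro nn_integral_cong)
    fix x y
    have "cn_density k y * (cn_density P x * (cn_density v (y - of_real h * x) / cn_density k y) powr (1 + s))
        = (A * cn_density k y powr (- s)) * (cn_density P x * cn_density v' (y - of_real h * x))"
      using pw[of "y - of_real h * x" y] by (simp add: mult_ac)
    then show "ennreal (cn_density k y) * (ennreal (cn_density P x) * ennreal ((cn_density v (y - of_real h * x) / cn_density k y) powr (1 + s)))
        = ennreal (A * cn_density k y powr (- s)) * (ennreal (cn_density P x) * ennreal (cn_density v' (y - of_real h * x)))"
      using P kp v' A by (simp add: ennreal_mult[symmetric] cn_density_nonneg)
  qed
  also have "\<dots> = (\<integral>\<^sup>+y. ennreal A * ennreal (cn_density k' y * cn_density k y powr (- s)) \<partial>lborel)"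
  proof (intro nn_integral_cong)
    fix y
    show "(\<integral>\<^sup>+x. ennreal (A * cn_density k y powr (- s)) * (ennreal (cn_density P x) * ennreal (cn_density v' (y - of_real h * x))) \<partial>lborel)
        = ennreal A * ennreal (cn_density k' y * cn_density k y powr (- s))"
      using A k'p cn_density_convolution[OF P v', of y h] by (subst nn_integral_cmult)
        (auto simp: k'_def[symmetric] ennreal_mult[symmetric] cn_density_nonneg mult.assoc mult.commute[of "cn_density k' y"])
  qed
  also have "\<dots> = ennreal A * ennreal ((pi * k) powr s / (1 - s * k' / k))"
    by (subst nn_integral_cmult) (auto simp: cn_density_tilt[OF k'p kp sk])
  also have "\<dots> = ennreal (A * ((pi * k) powr s / (1 - s * k' / k)))"
    using A by (subst ennreal_mult) (use sk kp in auto)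
  also have "A * ((pi * k) powr s / (1 - s * k' / k)) = (k / v) powr s * (k / ((1 + s) * (k - s * k')))"
  proof -
    have "(pi * v) powr (- s) * (pi * k) powr s = (k / v) powr s"
      using kp v by (simp add: powr_mult powr_divide powr_minus field_simps)
    moreover have "1 / (1 + s) * (1 / (1 - s * k' / k)) = k / ((1 + s) * (k - s * k'))"
      using kp s1 sk by (simp add: field_simps)
    moreover have "A * ((pi * k) powr s / (1 - s * k' / k))
        = ((pi * v) powr (- s) * (pi * k) powr s) * (1 / (1 + s) * (1 / (1 - s * k' / k)))"
      by (simp add: A_def)
    ultimately show ?thesis
      by simp
  qed
  also have "\<dots> \<le> (k / v) powr s / (1 - s\<^sup>2)"
  proof -
    have "(1 - s\<^sup>2) * k \<le> (1 + s) * (k - s * k')"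
      unfolding eq using \<open>s\<^sup>2 * (h\<^sup>2 * P) \<le> s\<^sup>2 * k\<close> by (simp add: algebra_simps)
    then have "k / ((1 + s) * (k - s * k')) \<le> 1 / (1 - s\<^sup>2)"
      using pos \<open>s\<^sup>2 < 1\<close> by (simp add: divide_simps mult.commute)
    then show ?thesis
      using mult_left_mono[of _ _ "(k / v) powr s"] by fastforce
  qed
  finally show ?thesis
    by (simp add: ennreal_leI)
qed

text \<open>The posterior mean \<open>T\<close> combines an observation \<open>z\<close> of gain \<open>h\<close> with an observation \<open>t\<close> of
  precision \<open>q\<close>; conversely \<open>(z, t)\<close> is obtained from \<open>T\<close> by adding noise to form \<open>z\<close> and solving for \<open>t\<close>.\<close>

definition combined_test :: "real \<Rightarrow> real \<Rightarrow> real \<Rightarrow> (complex \<Rightarrow> complex \<Rightarrow> ennreal) \<Rightarrow> complex \<Rightarrow> ennreal" where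
  "combined_test v h q f T = (let p = q + h\<^sup>2 / v in
     \<integral>\<^sup>+z. f z (of_real (p / q) * T - of_real (h / (v * q)) * z)
            * ennreal (cn_density (v - h\<^sup>2 / p) (z - of_real h * T)) \<partial>lborel)"

text \<open>\<open>T\<close> is a sufficient statistic for \<open>x\<close>: given \<open>T\<close>,
  the observation \<open>z\<close> is Gaussian with mean \<open>h * T\<close> and variance
  \<open>v - h\<^sup>2 / (q + h\<^sup>2 / v)\<close>, free of \<open>x\<close>. Averaging
  \<open>f\<close> over this kernel therefore gives one test of \<open>T\<close> that serves all
  \<open>x\<close>, and the precisions \<open>q\<close> and \<open>h\<^sup>2 / v\<close>
  add.\<close>

lemma combined_test:
  fixes f :: "complex \<Rightarrow> complex \<Rightarrow> ennreal"
  assumes v: "v > 0" and q: "q > 0" and f [measurable]: "case_prod f \<in> borel_measurable (borel \<Otimes>\<^sub>M borel)"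
  shows "(\<integral>\<^sup>+T. combined_test v h q f T * ennreal (cn_density (1 / (q + h\<^sup>2 / v)) (T - x)) \<partial>lborel)
       = (\<integral>\<^sup>+z. (\<integral>\<^sup>+t. f z t * ennreal (cn_density (1 / q) (t - x)) \<partial>lborel) * ennreal (cn_density v (z - of_real h * x)) \<partial>lborel)"
proof -
  define p where "p = q + h\<^sup>2 / v"
  define w where "w = v - h\<^sup>2 / p"
  have p: "p > 0" using v q by (simp add: p_def add_pos_nonneg)
  have r: "1 - h\<^sup>2 / (v * p) = q / p"
  proof -
    have "v * p - h\<^sup>2 = v * q" using v by (simp add: p_def field_simps)
    moreover have "1 - h\<^sup>2 / (v * p) = (v * p - h\<^sup>2) / (v * p)"
      using v p by (simp add: diff_divide_distrib)
    ultimately show ?thesis using v by simp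
  qed
  have w_eq: "w = v * (q / p)"
  proof -
    have "v * (1 - h\<^sup>2 / (v * p)) = v - h\<^sup>2 / p"
      using v by (simp add: right_diff_distrib)
    then show ?thesis
      by (simp only: r w_def)
  qed
  have w: "w > 0" using v q p by (simp add: w_eq)
  have [measurable]: "(\<lambda>x. f (g x) (g' x)) \<in> borel_measurable M"
    if "g \<in> borel_measurable M" "g' \<in> borel_measurable M" for g g' and M :: "'a measure"
    using measurable_compose[OF measurable_Pair[OF that] f] by simp
  \<comment> \<open>\<open>cn_density_bayes\<close> is applied with input variance
    \<open>1 / p\<close> and noise variance \<open>w\<close>, which add up to output variance
    \<open>v\<close>. The factor \<open>(q / p)\<^sup>2\<close> is the Jacobian of passing from
    \<open>t\<close> to \<open>T\<close> at fixed \<open>z\<close>.\<close>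
  have key: "(q / p)\<^sup>2 * (cn_density w (z - of_real h * T) * cn_density (1 / p) (T - x)) = cn_density v (z - of_real h * x) * cn_density (1 / q) (t - x)"
    if T: "T = of_real (h / (v * p)) * z + of_real (q / p) * t" for z t T
  proof -
    have k: "v = w + h\<^sup>2 * (1 / p)" by (simp add: w_def)
    have "T - x - of_real (h * (1 / p) / v) * (z - of_real h * x) = of_real (q / p) * t - of_real (1 - h\<^sup>2 / (v * p)) * x"
      by (simp add: T power2_eq_square diff_divide_distrib algebra_simps)
    also have "\<dots> = of_real (q / p) * (t - x)"
      unfolding r by (simp add: diff_divide_distrib algebra_simps)
    finally have 1: "T - x - of_real (h * (1 / p) / v) * (z - of_real h * x) = of_real (q / p) * (t - x)" .
    have 2: "1 / p * w / v = (q / p)\<^sup>2 * (1 / q)"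
      using v q by (simp add: w_eq power2_eq_square)
    have "cn_density w (z - of_real h * T) * cn_density (1 / p) (T - x)
        = cn_density v (z - of_real h * x) * cn_density ((q / p)\<^sup>2 * (1 / q)) (of_real (q / p) * (t - x))"
      using cn_density_bayes[OF _ w k, of "T - x" "z - of_real h * x"] p
      unfolding 1 2 by (simp add: algebra_simps)
    then show ?thesis
      using cn_density_scale[of "1 / q" "q / p" "t - x"] p q by simp
  qed
  have "(\<integral>\<^sup>+T. combined_test v h q f T * ennreal (cn_density (1 / p) (T - x)) \<partial>lborel)
      = (\<integral>\<^sup>+T. (\<integral>\<^sup>+z. f z (of_real (p / q) * T - of_real (h / (v * q)) * z)
            * ennreal (cn_density w (z - of_real h * T)) * ennreal (cn_density (1 / p) (T - x)) \<partial>lborel) \<partial>lborel)"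
    by (simp add: combined_test_def p_def[symmetric] w_def[symmetric] Let_def nn_integral_multc)
  also have "\<dots> = (\<integral>\<^sup>+z. (\<integral>\<^sup>+T. f z (of_real (p / q) * T - of_real (h / (v * q)) * z)
            * ennreal (cn_density w (z - of_real h * T)) * ennreal (cn_density (1 / p) (T - x)) \<partial>lborel) \<partial>lborel)"
    by (intro lborel_pair.Fubini') measurable
  also have "\<dots> = (\<integral>\<^sup>+z. (\<integral>\<^sup>+t. f z t * ennreal (cn_density (1 / q) (t - x)) * ennreal (cn_density v (z - of_real h * x)) \<partial>lborel) \<partial>lborel)"
  proof (rule nn_integral_cong)
    fix z
    show "(\<integral>\<^sup>+T. f z (of_real (p / q) * T - of_real (h / (v * q)) * z)
            * ennreal (cn_density w (z - of_real h * T)) * ennreal (cn_density (1 / p) (T - x)) \<partial>lborel)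
        = (\<integral>\<^sup>+t. f z t * ennreal (cn_density (1 / q) (t - x)) * ennreal (cn_density v (z - of_real h * x)) \<partial>lborel)"
    proof -
      let ?F = "\<lambda>T. f z (of_real (p / q) * T - of_real (h / (v * q)) * z)
            * ennreal (cn_density w (z - of_real h * T)) * ennreal (cn_density (1 / p) (T - x))"
      have "(\<integral>\<^sup>+T. ?F T \<partial>lborel)
          = (\<integral>\<^sup>+t. ennreal ((q / p)\<^sup>2) * ?F (of_real (h / (v * p)) * z + of_real (q / p) * t) \<partial>lborel)"
        using p q by (intro nn_integral_lborel_affine) auto
      also have "\<dots> = (\<integral>\<^sup>+t. f z t * ennreal (cn_density (1 / q) (t - x)) * ennreal (cn_density v (z - of_real h * x)) \<partial>lborel)"
      proof (intro nn_integral_cong)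
        fix t
        define T where "T = of_real (h / (v * p)) * z + of_real (q / p) * t"
        have *: "of_real (p / q) * T - of_real (h / (v * q)) * z = t"
          using p q v by (simp add: T_def field_simps)
        have "ennreal ((q / p)\<^sup>2) * (ennreal (cn_density w (z - of_real h * T)) * ennreal (cn_density (1 / p) (T - x)))
            = ennreal (cn_density (1 / q) (t - x)) * ennreal (cn_density v (z - of_real h * x))"
          using key[OF T_def] p q v w
          by (simp add: ennreal_mult[symmetric] cn_density_nonneg mult.commute)
        then show "ennreal ((q / p)\<^sup>2) * ?F (of_real (h / (v * p)) * z + of_real (q / p) * t)
          = f z t * ennreal (cn_density (1 / q) (t - x)) * ennreal (cn_density v (z - of_real h * x))"
          unfolding T_def[symmetric] * by (metis (no_types, lifting) mult.assoc mult.left_commute)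
      qed
      finally show ?thesis .
    qed
  qed
  also have "\<dots> = (\<integral>\<^sup>+z. (\<integral>\<^sup>+t. f z t * ennreal (cn_density (1 / q) (t - x)) \<partial>lborel) * ennreal (cn_density v (z - of_real h * x)) \<partial>lborel)"
    by (simp add: nn_integral_multc)
  finally show ?thesis by (simp add: p_def)
qed

section \<open>Products of Gaussian measures\<close>

definition cgauss :: "complex \<Rightarrow> real \<Rightarrow> complex measure" where
  "cgauss m v = density lborel (\<lambda>y. ennreal (cn_density v (y - m)))"

lemma sets_cgauss [simp, measurable_cong]: "sets (cgauss m v) = sets borel"
  by (simp add: cgauss_def)

lemma space_cgauss [simp]: "space (cgauss m v) = UNIV"
  by (simp add: cgauss_def)

lemma complex_gaussian_eq_cgauss: "complex_gaussian v = cgauss 0 v"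
  by (simp add: cgauss_def complex_gaussian_cn)

lemma prob_space_cgauss: "v > 0 \<Longrightarrow> prob_space (cgauss m v)"
  by (rule prob_spaceI) (simp add: cgauss_def emeasure_density nn_integral_cn_shift)

lemma distr_complex_gaussian_shift:
  "distr (complex_gaussian v) borel (\<lambda>w. m + w) = cgauss m v"
proof (rule measure_eqI)
  fix A assume "A \<in> sets (distr (complex_gaussian v) borel (\<lambda>w. m + w))"
  then have [measurable]: "A \<in> sets borel" by simp
  have "emeasure (distr (complex_gaussian v) borel (\<lambda>w. m + w)) A
      = (\<integral>\<^sup>+w. indicator A (m + w) \<partial>complex_gaussian v)"
    by (subst nn_integral_indicator[symmetric], simp, subst nn_integral_distr) auto
  also have "\<dots> = (\<integral>\<^sup>+w. ennreal (cn_density v w) * indicator A (m + w) \<partial>lborel)"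
    by (rule nn_integral_complex_gaussian) simp
  also have "\<dots> = (\<integral>\<^sup>+y. ennreal (cn_density v (y - m)) * indicator A y \<partial>lborel)"
    using nn_integral_lborel_shift[of "\<lambda>y. ennreal (cn_density v (y - m)) * indicator A y" m] by simp
  finally show "emeasure (distr (complex_gaussian v) borel (\<lambda>w. m + w)) A = emeasure (cgauss m v) A"
    by (simp add: cgauss_def emeasure_density)
qed simp

text \<open>\<open>K\<close> may be infinite, as it is for the noise of infinitely many
  eavesdroppers, so the two measures are compared on cylinders over finite subsets.\<close>

lemma distr_PiM_pointwise:
  assumes N: "\<And>i. prob_space (N i)" and f [measurable]: "\<And>i. f i \<in> measurable (N i) (N' i)"
  shows "distr (PiM K N) (PiM K N') (\<lambda>x. \<lambda>i\<in>K. f i (x i)) = PiM K (\<lambda>i. distr (N i) (N' i) (f i))"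
proof -
  interpret N: product_prob_space N K
    by (rule product_prob_spaceI) (rule N)
  interpret D: product_prob_space "\<lambda>i. distr (N i) (N' i) (f i)" K
    by (rule product_prob_spaceI) (intro prob_space.prob_space_distr N f)
  have [measurable]: "(\<lambda>x. \<lambda>i\<in>K. f i (x i)) \<in> measurable (PiM K N) (PiM K N')"
    by (rule measurable_restrict) measurable
  show ?thesis
  proof (rule D.PiM_eq)
    show "sets (distr (PiM K N) (PiM K N') (\<lambda>x. \<lambda>i\<in>K. f i (x i)))
        = sets (PiM K (\<lambda>i. distr (N i) (N' i) (f i)))"
      by (simp cong: sets_PiM_cong)
    fix J F assume J: "finite J" "J \<subseteq> K" and F: "\<And>j. j \<in> J \<Longrightarrow> F j \<in> sets (distr (N j) (N' j) (f j))"
    have emb: "prod_emb K (\<lambda>i. distr (N i) (N' i) (f i)) J (Pi\<^sub>E J F) = prod_emb K N' J (Pi\<^sub>E J F)"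
      by (simp add: prod_emb_def)
    have "emeasure (distr (PiM K N) (PiM K N') (\<lambda>x. \<lambda>i\<in>K. f i (x i))) (prod_emb K N' J (Pi\<^sub>E J F))
       = emeasure (PiM K N) ((\<lambda>x. \<lambda>i\<in>K. f i (x i)) -` (prod_emb K N' J (Pi\<^sub>E J F)) \<inter> space (PiM K N))"
      using J F by (intro emeasure_distr) (auto intro!: sets_PiM_I)
    also have "(\<lambda>x. \<lambda>i\<in>K. f i (x i)) -` (prod_emb K N' J (Pi\<^sub>E J F)) \<inter> space (PiM K N)
        = prod_emb K N J (Pi\<^sub>E J (\<lambda>i. f i -` F i \<inter> space (N i)))"
      using J F measurable_space[OF f] by (auto simp: prod_emb_def space_PiM PiE_iff subset_eq) 
    also have "emeasure (PiM K N) \<dots> = (\<Prod>j\<in>J. emeasure (N j) (f j -` F j \<inter> space (N j)))"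
      using J F by (intro N.emeasure_PiM_emb) auto
    also have "\<dots> = (\<Prod>j\<in>J. emeasure (distr (N j) (N' j) (f j)) (F j))"
      using F by (intro prod.cong) (auto simp: emeasure_distr)
    finally show "emeasure (distr (PiM K N) (PiM K N') (\<lambda>x. \<lambda>i\<in>K. f i (x i)))
        (prod_emb K (\<lambda>i. distr (N i) (N' i) (f i)) J (Pi\<^sub>E J F))
      = (\<Prod>j\<in>J. emeasure (distr (N j) (N' j) (f j)) (F j))"
      unfolding emb .
  qed
qed

lemma distr_PiM_complex_gaussian_shift:
  assumes "v > 0"
  shows "distr (PiM K (\<lambda>_. complex_gaussian v)) (PiM K (\<lambda>_. borel)) (\<lambda>w. \<lambda>i\<in>K. m i + w i)
       = PiM K (\<lambda>i. cgauss (m i) v)"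
  using assms distr_PiM_pointwise[of "\<lambda>_. complex_gaussian v" "\<lambda>i w. m i + w" "\<lambda>_. borel" K]
  by (simp add: prob_space_complex_gaussian distr_complex_gaussian_shift)

text \<open>The index set has to be finite: infinite products of equivalent measures can be mutually
  singular. Densities of products are therefore used on finitely many coordinates
  throughout.\<close>

lemma density_PiM:
  assumes K: "finite K" and N: "\<And>i. sigma_finite_measure (N i)"
    and f [measurable]: "\<And>i. f i \<in> borel_measurable (N i)"
    and D: "\<And>i. sigma_finite_measure (density (N i) (f i))"
  shows "density (PiM K N) (\<lambda>x. \<Prod>i\<in>K. f i (x i)) = PiM K (\<lambda>i. density (N i) (f i))"
proof -
  interpret N: product_sigma_finite N
    by (simp add: product_sigma_finite_def N)
  interpret D: product_sigma_finite "\<lambda>i. density (N i) (f i)"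
    by (simp add: product_sigma_finite_def D)
  have [measurable]: "(\<lambda>x. \<Prod>i\<in>K. f i (x i)) \<in> borel_measurable (PiM K N)"
  proof (intro borel_measurable_prod_ennreal)
    fix i assume "i \<in> K"
    then show "(\<lambda>x. f i (x i)) \<in> borel_measurable (PiM K N)"
      by (intro measurable_compose[OF measurable_component_singleton, where g = "f i"] f)
  qed
  show ?thesis
  proof (rule D.PiM_eqI[OF K])
    show "sets (density (PiM K N) (\<lambda>x. \<Prod>i\<in>K. f i (x i))) = sets (PiM K (\<lambda>i. density (N i) (f i)))"
      by (simp cong: sets_PiM_cong)
    fix A assume "\<And>i. i \<in> K \<Longrightarrow> A i \<in> sets (density (N i) (f i))"
    then have A [measurable]: "\<And>i. i \<in> K \<Longrightarrow> A i \<in> sets (N i)" by simp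
    have "emeasure (density (PiM K N) (\<lambda>x. \<Prod>i\<in>K. f i (x i))) (Pi\<^sub>E K A)
        = (\<integral>\<^sup>+x. (\<Prod>i\<in>K. f i (x i)) * indicator (Pi\<^sub>E K A) x \<partial>PiM K N)"
      using K by (intro emeasure_density) (auto intro!: sets_PiM_I_finite)
    also have "\<dots> = (\<integral>\<^sup>+x. (\<Prod>i\<in>K. f i (x i) * indicator (A i) (x i)) \<partial>PiM K N)"
    proof (intro nn_integral_cong)
      fix x assume "x \<in> space (PiM K N)"
      then have "x \<in> Pi\<^sub>E K A \<longleftrightarrow> (\<forall>i\<in>K. x i \<in> A i)"
        by (auto simp: space_PiM PiE_iff)
      then have "(indicator (Pi\<^sub>E K A) x :: ennreal) = (\<Prod>i\<in>K. indicator (A i) (x i))"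
        using K by (auto simp: indicator_def prod_zero_iff)
      then show "(\<Prod>i\<in>K. f i (x i)) * indicator (Pi\<^sub>E K A) x = (\<Prod>i\<in>K. f i (x i) * indicator (A i) (x i))"
        by (simp add: prod.distrib)
    qed
    also have "\<dots> = (\<Prod>i\<in>K. \<integral>\<^sup>+x. f i x * indicator (A i) x \<partial>N i)"
      using K by (intro N.product_nn_integral_prod) auto
    also have "\<dots> = (\<Prod>i\<in>K. emeasure (density (N i) (f i)) (A i))"
      by (intro prod.cong) (auto simp: emeasure_density)
    finally show "emeasure (density (PiM K N) (\<lambda>x. \<Prod>i\<in>K. f i (x i))) (Pi\<^sub>E K A)
      = (\<Prod>i\<in>K. emeasure (density (N i) (f i)) (A i))" .
  qed
qed

lemma PiM_cgauss_density:
  assumes "finite K" "\<And>i. v i > 0"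
  shows "PiM K (\<lambda>i. cgauss (m i) (v i)) = density (PiM K (\<lambda>_. lborel)) (\<lambda>y. ennreal (\<Prod>i\<in>K. cn_density (v i) (y i - m i)))"
proof -
  have "PiM K (\<lambda>i. cgauss (m i) (v i)) = density (PiM K (\<lambda>_. lborel)) (\<lambda>y. \<Prod>i\<in>K. ennreal (cn_density (v i) (y i - m i)))"
    unfolding cgauss_def using assms
    by (intro density_PiM[symmetric] sigma_finite_lborel)
       (auto simp: cgauss_def[symmetric] prob_space_cgauss prob_space_imp_sigma_finite)
  then show ?thesis
    using assms by (simp add: prod_ennreal cn_density_nonneg)
qed

lemma nn_integral_PiM_cgauss:
  assumes "finite K" "\<And>i. v i > 0" "f \<in> borel_measurable (PiM K (\<lambda>_. borel))"
  shows "(\<integral>\<^sup>+y. f y \<partial>PiM K (\<lambda>i. cgauss (m i) (v i)))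
       = (\<integral>\<^sup>+y. ennreal (\<Prod>i\<in>K. cn_density (v i) (y i - m i)) * f y \<partial>PiM K (\<lambda>_. lborel))"
proof -
  have [measurable_cong]: "sets (PiM K (\<lambda>_. lborel)) = sets (PiM K (\<lambda>_. borel :: complex measure))"
    by (simp cong: sets_PiM_cong)
  show ?thesis
    unfolding PiM_cgauss_density[OF assms(1,2)] using assms(3)
    by (intro nn_integral_density) measurable
qed

lemma nn_integral_PiM_shift:
  assumes v: "v > 0" and f [measurable]: "f \<in> borel_measurable (PiM K (\<lambda>_. borel))"
  shows "(\<integral>\<^sup>+w. f (\<lambda>i\<in>K. m i + w i) \<partial>PiM K (\<lambda>_. complex_gaussian v)) = (\<integral>\<^sup>+y. f y \<partial>PiM K (\<lambda>i. cgauss (m i) v))"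
  unfolding distr_PiM_complex_gaussian_shift[OF v, symmetric]
  by (subst nn_integral_distr) (auto intro!: measurable_restrict)

section \<open>Independent samples\<close>

text \<open>Pairwise independence of the random words is what both the variance bound and the
  collision term of the decoding error rest on.\<close>

lemma distr_PiM_two_components:
  assumes A: "prob_space A" and jk: "j \<in> K" "k \<in> K" "j \<noteq> k"
  shows "distr (PiM K (\<lambda>_. A)) (A \<Otimes>\<^sub>M A) (\<lambda>c. (c j, c k)) = A \<Otimes>\<^sub>M A"
proof -
  interpret A: prob_space A by fact
  interpret P: product_prob_space "\<lambda>_. A" K
    by (rule product_prob_spaceI) (rule A)
  note jk(1,2) [simp]
  have [measurable]: "(\<lambda>c. (c j, c k)) \<in> measurable (PiM K (\<lambda>_. A)) (A \<Otimes>\<^sub>M A)"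
    by (intro measurable_Pair measurable_component_singleton) auto
  show ?thesis
  proof (rule pair_measure_eqI[symmetric])
    fix X Y assume XY: "X \<in> sets A" "Y \<in> sets A"
    have "emeasure (distr (PiM K (\<lambda>_. A)) (A \<Otimes>\<^sub>M A) (\<lambda>c. (c j, c k))) (X \<times> Y)
        = emeasure (PiM K (\<lambda>_. A)) ((\<lambda>c. (c j, c k)) -` (X \<times> Y) \<inter> space (PiM K (\<lambda>_. A)))"
      using XY by (intro emeasure_distr) auto
    also have "(\<lambda>c. (c j, c k)) -` (X \<times> Y) \<inter> space (PiM K (\<lambda>_. A))
        = {c \<in> space (PiM K (\<lambda>_. A)). \<forall>i\<in>{j, k}. c i \<in> (if i = j then X else Y)}"
      using \<open>j \<noteq> k\<close> \<open>j \<noteq> k\<close>[symmetric] by auto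
    also have "emeasure (PiM K (\<lambda>_. A)) \<dots> = (\<Prod>i\<in>{j, k}. emeasure A (if i = j then X else Y))"
      using XY by (intro P.emeasure_PiM_Collect) auto
    also have "\<dots> = emeasure A X * emeasure A Y"
      using jk(3) by simp
    finally show "emeasure A X * emeasure A Y
      = emeasure (distr (PiM K (\<lambda>_. A)) (A \<Otimes>\<^sub>M A) (\<lambda>c. (c j, c k))) (X \<times> Y)" by simp
  qed (auto simp: prob_space_imp_sigma_finite A)
qed

lemma nn_integral_PiM_component:
  assumes A: "prob_space A" and "j \<in> K" and f [measurable]: "f \<in> borel_measurable A"
  shows "(\<integral>\<^sup>+c. f (c j) \<partial>PiM K (\<lambda>_. A)) = (\<integral>\<^sup>+x. f x \<partial>A)"
proof -
  note assms(2) [simp]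
  have "(\<integral>\<^sup>+x. f x \<partial>A) = (\<integral>\<^sup>+x. f x \<partial>distr (PiM K (\<lambda>_. A)) A (\<lambda>c. c j))"
    using distr_PiM_component[of K "\<lambda>_. A" j] A by simp
  also have "\<dots> = (\<integral>\<^sup>+c. f (c j) \<partial>PiM K (\<lambda>_. A))"
    by (intro nn_integral_distr) auto
  finally show ?thesis ..
qed

lemma nn_integral_PiM_two_components:
  assumes A: "prob_space A" and jk: "j \<in> K" "k \<in> K" "j \<noteq> k"
    and f [measurable]: "case_prod f \<in> borel_measurable (A \<Otimes>\<^sub>M A)"
  shows "(\<integral>\<^sup>+c. f (c j) (c k) \<partial>PiM K (\<lambda>_. A)) = (\<integral>\<^sup>+x. \<integral>\<^sup>+y. f x y \<partial>A \<partial>A)"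
proof -
  interpret A: prob_space A by fact
  note jk(1,2) [simp]
  have "(\<integral>\<^sup>+x. \<integral>\<^sup>+y. f x y \<partial>A \<partial>A) = (\<integral>\<^sup>+p. case_prod f p \<partial>(A \<Otimes>\<^sub>M A))"
    by (subst A.nn_integral_fst[symmetric]) auto
  also have "\<dots> = (\<integral>\<^sup>+p. case_prod f p \<partial>distr (PiM K (\<lambda>_. A)) (A \<Otimes>\<^sub>M A) (\<lambda>c. (c j, c k)))"
    by (simp add: distr_PiM_two_components[OF A jk])
  also have "\<dots> = (\<integral>\<^sup>+c. f (c j) (c k) \<partial>PiM K (\<lambda>_. A))"
    by (subst nn_integral_distr) auto
  finally show ?thesis ..
qed

text \<open>The off-diagonal covariances vanish, and each diagonal term is at most the second moment
  of \<open>f\<close>, hence at most \<open>\<gamma>\<close> times its mean.\<close>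

lemma iid_average_second_moment:
  fixes f :: "'a \<Rightarrow> real"
  assumes A: "prob_space A" and K: "finite K" "K \<noteq> {}"
    and f [measurable]: "f \<in> borel_measurable A" and f0: "\<And>x. 0 \<le> f x" and fg: "\<And>x. f x \<le> \<gamma>"
    and f1: "(\<integral>x. f x \<partial>A) \<le> 1"
  shows "(\<integral>\<^sup>+c. ennreal (((\<Sum>k\<in>K. f (c k)) / card K - (\<integral>x. f x \<partial>A))\<^sup>2) \<partial>PiM K (\<lambda>_. A)) \<le> ennreal (\<gamma> / card K)"
proof -
  interpret A: prob_space A by fact
  interpret P: product_prob_space "\<lambda>_. A" K
    by (rule product_prob_spaceI) (rule A)
  let ?B = "PiM K (\<lambda>_. A)"
  define m where "m = (\<integral>x. f x \<partial>A)"
  have g0: "\<gamma> \<ge> 0" using f0 fg order_trans by blast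
  have int: "integrable A f"
    using f0 fg by (intro A.integrable_const_bound[where B = \<gamma>]) auto
  have m: "0 \<le> m" "m \<le> 1" using f0 f1 by (auto simp: m_def)
  have bnd: "\<bar>f x - m\<bar> \<le> \<gamma> + 1" for x
    using f0[of x] fg[of x] m g0 by linarith
  have bnd2: "\<bar>(f x - m) * (f y - m)\<bar> \<le> (\<gamma> + 1) * (\<gamma> + 1)" for x y
    unfolding abs_mult using g0 by (intro mult_mono bnd) auto
  have [measurable]: "(\<lambda>c. f (c k)) \<in> borel_measurable ?B" if "k \<in> K" for k
    using that by measurable
  have int2: "integrable ?B (\<lambda>c. (f (c j) - m) * (f (c k) - m))" if "j \<in> K" "k \<in> K" for j k
    using that bnd2 by (intro P.P.integrable_const_bound[where B = "(\<gamma> + 1) * (\<gamma> + 1)"]) auto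
  have cov: "(\<integral>c. (f (c j) - m) * (f (c k) - m) \<partial>?B) \<le> (if j = k then \<gamma> else 0)" if jk: "j \<in> K" "k \<in> K" for j k
  proof (cases "j = k")
    case True
    have "(\<integral>c. (f (c j) - m) * (f (c k) - m) \<partial>?B) = (\<integral>x. (f x - m) * (f x - m) \<partial>distr ?B A (\<lambda>c. c j))"
      using jk True by (subst integral_distr) auto
    also have "\<dots> = (\<integral>x. (f x - m) * (f x - m) \<partial>A)"
      using distr_PiM_component[of K "\<lambda>_. A" j] A jk by simp
    also have "\<dots> = (\<integral>x. f x * f x - 2 * m * f x + m * m \<partial>A)"
      by (intro Bochner_Integration.integral_cong) (auto simp: algebra_simps)
    also have "\<dots> = (\<integral>x. f x * f x \<partial>A) - 2 * m * m + m * m"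
    proof -
      have "integrable A (\<lambda>x. f x * f x)"
        using f0 fg g0 by (intro A.integrable_const_bound[where B = "\<gamma> * \<gamma>"]) (auto intro!: mult_mono)
      then show ?thesis
        using int by (simp add: m_def A.prob_space)
    qed
    also have "\<dots> \<le> (\<integral>x. f x * f x \<partial>A)"
      using m by simp
    also have "\<dots> \<le> (\<integral>x. \<gamma> * f x \<partial>A)"
      using int f0 fg g0 by (intro integral_mono A.integrable_const_bound[where B = "\<gamma> * \<gamma>"]) 
        (auto intro!: mult_mono mult_right_mono)
    also have "\<dots> \<le> \<gamma>"
      using m g0 mult_left_mono[of m 1 \<gamma>] by (simp add: m_def)
    finally show ?thesis using True by simp
  next
    case False
    have "(\<integral>c. (f (c j) - m) * (f (c k) - m) \<partial>?B)
        = (\<integral>p. (f (fst p) - m) * (f (snd p) - m) \<partial>distr ?B (A \<Otimes>\<^sub>M A) (\<lambda>c. (c j, c k)))"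
      using jk by (subst integral_distr) auto
    also have "\<dots> = (\<integral>p. (f (fst p) - m) * (f (snd p) - m) \<partial>(A \<Otimes>\<^sub>M A))"
      by (simp add: distr_PiM_two_components[OF A jk False])
    also have "\<dots> = (\<integral>x. \<integral>y. (f x - m) * (f y - m) \<partial>A \<partial>A)"
    proof -
      interpret AA: pair_prob_space A A ..
      have "integrable (A \<Otimes>\<^sub>M A) (\<lambda>p. (f (fst p) - m) * (f (snd p) - m))"
        using bnd2 by (intro AA.integrable_const_bound[where B = "(\<gamma> + 1) * (\<gamma> + 1)"]) auto
      then show ?thesis
        by (subst AA.integral_fst'[symmetric]) auto
    qed
    also have "\<dots> = 0"
      using int by (simp add: m_def A.prob_space)
    finally show ?thesis using False by simp
  qed
  have card: "real (card K) > 0" using K by (simp add: card_gt_0_iff)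
  have sq: "((\<Sum>k\<in>K. f (c k)) / card K - m)\<^sup>2 = (\<Sum>j\<in>K. \<Sum>k\<in>K. (f (c j) - m) * (f (c k) - m)) / (real (card K))\<^sup>2" for c
  proof -
    have "(\<Sum>k\<in>K. f (c k)) / card K - m = (\<Sum>k\<in>K. f (c k) - m) / card K"
      using card by (simp add: sum_subtractf field_simps)
    then show ?thesis
      by (simp add: power_divide power2_eq_square sum_product)
  qed
  have "(\<integral>\<^sup>+c. ennreal (((\<Sum>k\<in>K. f (c k)) / card K - m)\<^sup>2) \<partial>?B)
      = ennreal (\<integral>c. ((\<Sum>k\<in>K. f (c k)) / card K - m)\<^sup>2 \<partial>?B)"
  proof (rule nn_integral_eq_integral)
    show "integrable ?B (\<lambda>c. ((\<Sum>k\<in>K. f (c k)) / card K - m)\<^sup>2)"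
      unfolding sq by (rule integrable_divide_zero, rule Bochner_Integration.integrable_sum, rule Bochner_Integration.integrable_sum, rule int2)
  qed simp
  also have "(\<integral>c. ((\<Sum>k\<in>K. f (c k)) / card K - m)\<^sup>2 \<partial>?B)
      = (\<Sum>j\<in>K. \<Sum>k\<in>K. (\<integral>c. (f (c j) - m) * (f (c k) - m) \<partial>?B)) / (real (card K))\<^sup>2"
    unfolding sq using int2 by (simp add: Bochner_Integration.integral_sum)
  also have "\<dots> \<le> (\<Sum>j\<in>K. \<Sum>k\<in>K. (if j = k then \<gamma> else 0)) / (real (card K))\<^sup>2"
    using cov by (intro divide_right_mono sum_mono) auto
  also have "\<dots> = \<gamma> / card K"
    using K card by (simp add: power2_eq_square)
  finally show ?thesis
    by (simp add: m_def ennreal_leI)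
qed

text \<open>Soft covering by truncation: the part of \<open>f\<close> below \<open>\<gamma>\<close> has a small variance, the part above \<open>\<gamma>\<close>
  a small mean.\<close>

lemma iid_average_deviation:
  fixes f :: "'a \<Rightarrow> real"
  assumes A: "prob_space A" and K: "finite K" "K \<noteq> {}"
    and f [measurable]: "f \<in> borel_measurable A" and f0: "\<And>x. 0 \<le> f x"
    and f1: "(\<integral>\<^sup>+x. ennreal (f x) \<partial>A) = 1" and g: "\<gamma> > 0"
  shows "(\<integral>\<^sup>+c. ennreal \<bar>(\<Sum>k\<in>K. f (c k)) / card K - 1\<bar> \<partial>PiM K (\<lambda>_. A))
      \<le> ennreal (sqrt (\<gamma> / card K)) + 2 * (\<integral>\<^sup>+x. ennreal (f x) * indicator {x. f x > \<gamma>} x \<partial>A)"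
proof -
  interpret A: prob_space A by fact
  interpret P: product_prob_space "\<lambda>_. A" K
    by (rule product_prob_spaceI) (rule A)
  let ?B = "PiM K (\<lambda>_. A)"
  define T where "T x = (if f x > \<gamma> then 0 else f x)" for x
  define U where "U x = (if f x > \<gamma> then f x else 0)" for x
  have [measurable]: "T \<in> borel_measurable A" "U \<in> borel_measurable A"
    unfolding T_def U_def by measurable
  have TU: "f x = T x + U x" "T x \<ge> 0" "U x \<ge> 0" "T x \<le> \<gamma>" for x
    using f0[of x] g by (auto simp: T_def U_def)
  have intf: "integrable A f"
    using f1 f0 by (intro integrableI_nonneg) auto
  have If: "(\<integral>x. f x \<partial>A) = 1"
    using f1 f0 by (intro integral_eq_nn_integral[THEN trans]) auto
  have intT: "integrable A T"
    using TU by (intro A.integrable_const_bound[where B = \<gamma>]) auto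
  have intU: "integrable A U"
    using intf by (rule Bochner_Integration.integrable_bound) (use TU in \<open>auto simp: U_def\<close>)
  define m where "m = (\<integral>x. T x \<partial>A)"
  define u where "u = (\<integral>x. U x \<partial>A)"
  have mu: "m + u = 1"
    using If intT intU by (simp add: m_def u_def TU(1))
  have u0: "u \<ge> 0" using TU by (simp add: u_def)
  have nnu: "(\<integral>\<^sup>+x. ennreal (U x) \<partial>A) = ennreal u"
    unfolding u_def using intU TU by (intro nn_integral_eq_integral) auto
  \<comment> \<open>With this \<open>d\<close> the bound
    \<open>\<bar>t\<bar> \<le> t\<^sup>2 / (2 * d) + d / 2\<close> turns the second moment, at most
    \<open>d\<^sup>2\<close>, into a first moment of at most \<open>d\<close>. It plays the part of
    the Cauchy-Schwarz inequality for nonnegative integrals.\<close>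
  define d where "d = sqrt (\<gamma> / card K)"
  have card: "real (card K) > 0" using K by (simp add: card_gt_0_iff)
  have d: "d > 0" using g card by (simp add: d_def)
  have [measurable]: "(\<lambda>c. T (c k)) \<in> borel_measurable ?B" "(\<lambda>c. U (c k)) \<in> borel_measurable ?B"
     if "k \<in> K" for k
    using that by measurable
  have pt: "\<bar>(\<Sum>k\<in>K. f (c k)) / card K - 1\<bar>
      \<le> (1 / (2 * d)) * ((\<Sum>k\<in>K. T (c k)) / card K - m)\<^sup>2 + (d / 2 + (1 / card K) * (\<Sum>k\<in>K. U (c k)) + u)" for c
  proof -
    define t where "t = (\<Sum>k\<in>K. T (c k)) / card K - m"
    have "(\<Sum>k\<in>K. f (c k)) / card K - 1 = t + (1 / card K) * (\<Sum>k\<in>K. U (c k)) - u"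
      using mu by (simp add: t_def TU(1) sum.distrib add_divide_distrib)
    moreover have "(1 / card K) * (\<Sum>k\<in>K. U (c k)) \<ge> 0"
      using TU by (intro mult_nonneg_nonneg sum_nonneg) auto
    moreover have "\<bar>t\<bar> \<le> (1 / (2 * d)) * t\<^sup>2 + d / 2"
    proof -
      have "0 \<le> (\<bar>t\<bar> - d)\<^sup>2" by simp
      then have "2 * d * \<bar>t\<bar> \<le> t\<^sup>2 + d\<^sup>2"
        by (simp add: power2_diff algebra_simps)
      then show ?thesis using d by (simp add: field_simps power2_eq_square)
    qed
    ultimately show ?thesis
      using u0 unfolding t_def[symmetric] by linarith
  qed
  have "(\<integral>\<^sup>+c. ennreal \<bar>(\<Sum>k\<in>K. f (c k)) / card K - 1\<bar> \<partial>?B)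
      \<le> (\<integral>\<^sup>+c. ennreal (1 / (2 * d)) * ennreal (((\<Sum>k\<in>K. T (c k)) / card K - m)\<^sup>2)
            + (ennreal (d / 2) + ennreal (1 / card K) * (\<Sum>k\<in>K. ennreal (U (c k))) + ennreal u) \<partial>?B)"
  proof (intro nn_integral_mono)
    fix c
    have "ennreal \<bar>(\<Sum>k\<in>K. f (c k)) / card K - 1\<bar>
        \<le> ennreal ((1 / (2 * d)) * ((\<Sum>k\<in>K. T (c k)) / card K - m)\<^sup>2 + (d / 2 + (1 / card K) * (\<Sum>k\<in>K. U (c k)) + u))"
      using pt by (rule ennreal_leI)
    also have "\<dots> = ennreal (1 / (2 * d)) * ennreal (((\<Sum>k\<in>K. T (c k)) / card K - m)\<^sup>2)
            + (ennreal (d / 2) + ennreal (1 / card K) * (\<Sum>k\<in>K. ennreal (U (c k))) + ennreal u)"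
    proof -
      have "(\<Sum>k\<in>K. U (c k)) \<ge> 0" using TU by (intro sum_nonneg) auto
      then show ?thesis
        using d u0 TU by (simp add: ennreal_plus ennreal_mult sum_ennreal del: times_divide_eq_left)
    qed
    finally show "ennreal \<bar>(\<Sum>k\<in>K. f (c k)) / card K - 1\<bar> \<le> \<dots>" .
  qed
  also have "\<dots> = ennreal (1 / (2 * d)) * (\<integral>\<^sup>+c. ennreal (((\<Sum>k\<in>K. T (c k)) / card K - m)\<^sup>2) \<partial>?B)
       + (ennreal (d / 2) + ennreal (1 / card K) * (\<Sum>k\<in>K. \<integral>\<^sup>+c. ennreal (U (c k)) \<partial>?B) + ennreal u)"
    by (simp add: nn_integral_add nn_integral_cmult nn_integral_sum P.P.emeasure_space_1)
  also have "(\<Sum>k\<in>K. \<integral>\<^sup>+c. ennreal (U (c k)) \<partial>?B) = (\<Sum>k\<in>K. ennreal u)"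
  proof (rule sum.cong[OF refl])
    fix k assume "k \<in> K"
    then show "(\<integral>\<^sup>+c. ennreal (U (c k)) \<partial>?B) = ennreal u"
      unfolding nnu[symmetric] by (intro nn_integral_PiM_component[OF A]) auto
  qed
  also have "ennreal (1 / card K) * (\<Sum>k\<in>K. ennreal u) = ennreal u"
  proof -
    have "(\<Sum>k\<in>K. ennreal u) = ennreal (card K * u)"
      using u0 by (subst sum_ennreal) auto
    then show ?thesis
      using card u0 by (simp flip: ennreal_mult)
  qed
  also have "ennreal (1 / (2 * d)) * (\<integral>\<^sup>+c. ennreal (((\<Sum>k\<in>K. T (c k)) / card K - m)\<^sup>2) \<partial>?B)
      \<le> ennreal (1 / (2 * d)) * ennreal (\<gamma> / card K)"
    unfolding m_def using TU mu u0
    by (intro mult_left_mono iid_average_second_moment A K) (auto simp: m_def[symmetric])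
  also have "ennreal (1 / (2 * d)) * ennreal (\<gamma> / card K) = ennreal (d / 2)"
  proof -
    have "\<gamma> / card K = d * d" using g card by (simp add: d_def)
    then show ?thesis using d g by (simp add: ennreal_mult[symmetric])
  qed
  also have "ennreal (d / 2) + (ennreal (d / 2) + ennreal u + ennreal u) = ennreal d + 2 * ennreal u"
  proof -
    have "ennreal (d / 2) + ennreal (d / 2) = ennreal d"
      using d by (subst ennreal_plus[symmetric]) auto
    then show ?thesis
      by (metis add.assoc mult_2)
  qed
  also have "ennreal u = (\<integral>\<^sup>+x. ennreal (f x) * indicator {x. f x > \<gamma>} x \<partial>A)"
    unfolding nnu[symmetric]
  proof (rule nn_integral_cong)
    fix x show "ennreal (U x) = ennreal (f x) * indicator {x. f x > \<gamma>} x"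
      by (cases "f x > \<gamma>") (simp_all add: U_def)
  qed
  finally show ?thesis
    unfolding d_def by (simp add: add_mono)
qed

section \<open>Equivocation of a uniform message\<close>

text \<open>Makes \<open>r * ln r\<close> integrable for every posterior probability
  \<open>r\<close>.\<close>

lemma abs_mult_ln_le_1:
  fixes x :: real
  assumes "0 \<le> x" "x \<le> 1"
  shows "\<bar>x * ln x\<bar> \<le> 1"
proof (cases "x = 0")
  case False
  then have x: "x > 0" using assms by simp
  have "ln (1 / x) \<le> 1 / x - 1" using x by (intro ln_le_minus_one) auto
  then have "- (x * ln x) \<le> 1 - x"
    using x by (simp add: ln_div field_simps)
  moreover have "x * ln x \<le> 0"
    using x assms by (simp add: mult_nonneg_nonpos)
  ultimately show ?thesis using x by linarith
qed simp

text \<open>The measure that assigns to \<open>A\<close> the probability of \<open>X = s\<close>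
  together with \<open>Y \<in> A\<close> is dominated by the law of \<open>Y\<close>, so it has a
  Radon-Nikodym derivative. As the message is discrete, one derivative per value describes the
  conditional law, on an arbitrary observation space.\<close>

lemma (in prob_space) posterior_of_value_exists:
  fixes X :: "'a \<Rightarrow> nat" and Y :: "'a \<Rightarrow> 'b"
  assumes X [measurable]: "X \<in> measurable M (count_space UNIV)" and Y [measurable]: "Y \<in> measurable M T"
  shows "\<exists>r :: 'b \<Rightarrow> real. r \<in> borel_measurable T \<and> (\<forall>z. 0 \<le> r z \<and> r z \<le> 1) \<and>
    (\<forall>A\<in>sets T. emeasure M {\<omega> \<in> space M. X \<omega> = s \<and> Y \<omega> \<in> A}
       = (\<integral>\<^sup>+z. ennreal (r z) * indicator A z \<partial>distr M T Y))"
proof -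
  define L where "L = distr M T Y"
  have sL [measurable_cong, simp]: "sets L = sets T" by (simp add: L_def)
  interpret L: prob_space L unfolding L_def by (rule prob_space_distr) fact
  define R where "R = distr (density M (\<lambda>\<omega>. indicator {s} (X \<omega>))) T Y"
  have sR [simp]: "sets R = sets L" by (simp add: R_def)
  have [measurable]: "(\<lambda>\<omega>. indicator {s} (X \<omega>) :: ennreal) \<in> borel_measurable M"
    by (rule measurable_compose[OF X]) simp
  have R: "emeasure R A = emeasure M {\<omega> \<in> space M. X \<omega> = s \<and> Y \<omega> \<in> A}" if [measurable]: "A \<in> sets T" for A
  proof -
    have "emeasure R A = emeasure (density M (\<lambda>\<omega>. indicator {s} (X \<omega>))) (Y -` A \<inter> space M)"
      unfolding R_def by (subst emeasure_distr) auto
    also have "\<dots> = (\<integral>\<^sup>+\<omega>. indicator {s} (X \<omega>) * indicator (Y -` A \<inter> space M) \<omega> \<partial>M)"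
      by (subst emeasure_density) auto
    also have "\<dots> = (\<integral>\<^sup>+\<omega>. indicator {\<omega> \<in> space M. X \<omega> = s \<and> Y \<omega> \<in> A} \<omega> \<partial>M)"
      by (intro nn_integral_cong) (auto simp: indicator_def)
    also have "\<dots> = emeasure M {\<omega> \<in> space M. X \<omega> = s \<and> Y \<omega> \<in> A}"
      by (rule nn_integral_indicator) measurable
    finally show ?thesis .
  qed
  have RL: "emeasure R A \<le> emeasure L A" if A [measurable]: "A \<in> sets T" for A
  proof -
    have "emeasure L A = emeasure M {\<omega> \<in> space M. Y \<omega> \<in> A}"
      unfolding L_def by (subst emeasure_distr) (auto intro!: arg_cong[where f = "emeasure M"])
    then show ?thesis
      unfolding R[OF A] by (auto intro!: emeasure_mono)
  qed
  have ac: "absolutely_continuous L R"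
    unfolding absolutely_continuous_def
  proof
    fix N assume N: "N \<in> null_sets L"
    then have N': "N \<in> sets T" "emeasure L N = 0" by (auto dest: null_setsD2)
    with RL[of N] have "emeasure R N = 0" by simp
    with N' show "N \<in> null_sets R" by (intro null_setsI) auto
  qed
  define D where "D = RN_deriv L R"
  have D [measurable]: "D \<in> borel_measurable T"
    using borel_measurable_RN_deriv[of L R] by (simp add: D_def measurable_def)
  have dens: "density L D = R"
    unfolding D_def by (rule L.density_RN_deriv[OF ac]) simp
  have RD: "emeasure R A = (\<integral>\<^sup>+z. D z * indicator A z \<partial>L)" if "A \<in> sets T" for A
    unfolding dens[symmetric] using that by (intro emeasure_density) auto
  \<comment> \<open>Truncation at 1 changes the derivative only on a null set and makes the bounds
    valid at every point.\<close>
  define r where "r z = enn2real (min (D z) 1)" for z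
  have r: "ennreal (r z) = min (D z) 1" for z
    by (simp add: r_def ennreal_enn2real_if min_def top_unique split: if_splits)
  have le1: "AE z in L. D z \<le> 1"
  proof -
    let ?A = "{z \<in> space T. D z > 1}"
    have [measurable]: "?A \<in> sets T" by measurable
    have "(\<integral>\<^sup>+z. (D z - 1) * indicator ?A z \<partial>L) = (\<integral>\<^sup>+z. D z * indicator ?A z - indicator ?A z \<partial>L)"
      by (intro nn_integral_cong) (auto simp: indicator_def)
    also have "\<dots> = (\<integral>\<^sup>+z. D z * indicator ?A z \<partial>L) - (\<integral>\<^sup>+z. indicator ?A z \<partial>L)"
      by (intro nn_integral_diff) (auto simp: L.emeasure_finite split: split_indicator)
    also have "\<dots> = emeasure R ?A - emeasure L ?A"
      by (simp add: RD)
    also have "\<dots> = 0"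
    proof (rule diff_eq_0_ennreal)
      show le: "emeasure R ?A \<le> emeasure L ?A" by (rule RL) measurable
      show "emeasure R ?A < top"
        by (rule le_less_trans[OF le]) (simp add: less_top[symmetric])
    qed
    finally have "AE z in L. (D z - 1) * indicator ?A z = 0"
      by (subst (asm) nn_integral_0_iff_AE) auto
    then show ?thesis
    proof (rule AE_mp, intro AE_I2 impI)
      fix z assume "z \<in> space L" "(D z - 1) * indicator ?A z = 0"
      then show "D z \<le> 1"
        by (cases "D z > 1") (auto simp: L_def diff_eq_0_iff_ennreal)
    qed
  qed
  show ?thesis
  proof (intro exI conjI allI ballI)
    show "r \<in> borel_measurable T" unfolding r_def by measurable
    show "0 \<le> r z" for z by (simp add: r_def)
    show "r z \<le> 1" for z
      using r[of z] by (metis ennreal_le_1 min.cobounded2)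
    fix A assume A: "A \<in> sets T"
    have "(\<integral>\<^sup>+z. ennreal (r z) * indicator A z \<partial>L) = (\<integral>\<^sup>+z. D z * indicator A z \<partial>L)"
      by (rule nn_integral_cong_AE) (use le1 in \<open>auto simp: r min_absorb1\<close>)
    then show "emeasure M {\<omega> \<in> space M. X \<omega> = s \<and> Y \<omega> \<in> A} = (\<integral>\<^sup>+z. ennreal (r z) * indicator A z \<partial>distr M T Y)"
      using R[OF A] RD[OF A] by (simp add: L_def)
  qed
qed

text \<open>\<open>r s z\<close> is a version of the probability of \<open>X = s\<close> given
  \<open>Y = z\<close>. Bounds and support are demanded pointwise, so that \<open>r * ln r\<close>
  is bounded everywhere and sums over messages reduce to \<open>S\<close>.\<close>

definition is_posterior ::
  "'a measure \<Rightarrow> ('a \<Rightarrow> nat) \<Rightarrow> ('a \<Rightarrow> 'b) \<Rightarrow> 'b measure \<Rightarrow> nat set \<Rightarrow> (nat \<Rightarrow> 'b \<Rightarrow> real) \<Rightarrow> bool" where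
  "is_posterior M X Y T S r \<longleftrightarrow> (\<forall>s. r s \<in> borel_measurable T) \<and> (\<forall>s z. 0 \<le> r s z \<and> r s z \<le> 1) \<and>
    (\<forall>s z. s \<notin> S \<longrightarrow> r s z = 0) \<and>
    (\<forall>s. \<forall>A\<in>sets T. emeasure M {\<omega> \<in> space M. X \<omega> = s \<and> Y \<omega> \<in> A}
       = (\<integral>\<^sup>+z. ennreal (r s z) * indicator A z \<partial>distr M T Y))"

context prob_space
begin

context
  fixes X :: "'a \<Rightarrow> nat" and Y :: "'a \<Rightarrow> 'b" and T S
  assumes X [measurable]: "X \<in> measurable M (count_space UNIV)" and Y [measurable]: "Y \<in> measurable M T"
    and S: "finite S" "S \<noteq> {}"
    and XS: "distr M (count_space UNIV) X = measure_pmf (pmf_of_set S)"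
begin

lemma uniform_message_prob: "emeasure M {\<omega> \<in> space M. X \<omega> = s} = ennreal (indicator S s / card S)"
proof -
  have "emeasure M {\<omega> \<in> space M. X \<omega> = s} = emeasure (distr M (count_space UNIV) X) {s}"
    by (subst emeasure_distr) (auto intro!: arg_cong[where f = "emeasure M"])
  also have "\<dots> = ennreal (indicator S s / card S)"
    unfolding XS using S by (simp add: emeasure_pmf_single)
  finally show ?thesis .
qed

lemma uniform_message_entropy: "entropy 2 (count_space UNIV) X = log 2 (card S)"
proof -
  interpret information_space M 2 by standard simp
  have "distributed M (count_space UNIV) X (\<lambda>x. indicator S x / measure (count_space UNIV) S)"
    unfolding distributed_def XS measure_pmf_eq_density
    using S by (auto intro!: density_cong simp: measure_count_space AE_count_space)
  from entropy_uniform[OF this] show ?thesis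
    using S by (simp add: measure_count_space)
qed

text \<open>A value outside \<open>S\<close> has probability 0, so its derivative may be replaced by
  the constant 0.\<close>

lemma posterior_exists: "\<exists>r. is_posterior M X Y T S r"
proof -
  define Q where "Q s f \<longleftrightarrow> f \<in> borel_measurable T \<and> (\<forall>z. 0 \<le> f z \<and> f z \<le> 1) \<and>
    (\<forall>A\<in>sets T. emeasure M {\<omega> \<in> space M. X \<omega> = s \<and> Y \<omega> \<in> A}
       = (\<integral>\<^sup>+z. ennreal (f z) * indicator A z \<partial>distr M T Y))" for s and f :: "'b \<Rightarrow> real"
  have "\<forall>s. \<exists>f. Q s f"
    using posterior_of_value_exists[OF X Y] unfolding Q_def by auto
  then obtain r where "\<And>s. Q s (r s)"
    by metis
  then have r: "\<And>s. r s \<in> borel_measurable T" "\<And>s z. 0 \<le> r s z \<and> r s z \<le> 1"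
    "\<And>s A. A \<in> sets T \<Longrightarrow> emeasure M {\<omega> \<in> space M. X \<omega> = s \<and> Y \<omega> \<in> A}
       = (\<integral>\<^sup>+z. ennreal (r s z) * indicator A z \<partial>distr M T Y)"
    unfolding Q_def by blast+
  define r' where "r' s z = (if s \<in> S then r s z else 0)" for s z
  have "emeasure M {\<omega> \<in> space M. X \<omega> = s \<and> Y \<omega> \<in> A} = (\<integral>\<^sup>+z. ennreal (r' s z) * indicator A z \<partial>distr M T Y)"
    if "A \<in> sets T" for s A
  proof (cases "s \<in> S")
    case False
    have "emeasure M {\<omega> \<in> space M. X \<omega> = s \<and> Y \<omega> \<in> A} \<le> emeasure M {\<omega> \<in> space M. X \<omega> = s}"
      by (intro emeasure_mono) auto
    then show ?thesis using False by (simp add: r'_def uniform_message_prob)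
  qed (simp add: r'_def r(3)[OF that])
  then have "is_posterior M X Y T S r'"
    unfolding is_posterior_def
  proof (intro conjI allI ballI impI)
    show "r' s \<in> borel_measurable T" for s
      using r(1)[of s] by (cases "s \<in> S") (simp_all add: r'_def[abs_def])
  qed (use r(2) in \<open>auto simp: r'_def\<close>)
  then show ?thesis by blast
qed

context
  fixes r
  assumes r: "is_posterior M X Y T S r"
begin

lemma posterior_measurable [measurable]: "r s \<in> borel_measurable T"
  and posterior_nonneg: "0 \<le> r s z" and posterior_le_1: "r s z \<le> 1"
  and posterior_zero: "s \<notin> S \<Longrightarrow> r s z = 0"
  and posterior_emeasure: "A \<in> sets T \<Longrightarrow> emeasure M {\<omega> \<in> space M. X \<omega> = s \<and> Y \<omega> \<in> A}
       = (\<integral>\<^sup>+z. ennreal (r s z) * indicator A z \<partial>distr M T Y)"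
  using r by (auto simp: is_posterior_def)

text \<open>Disintegration: the joint law of \<open>X\<close> and \<open>Y\<close> has density
  \<open>r\<close> with respect to counting measure times the law of \<open>Y\<close>. Each message
  contributes one slice, obtained by restricting the measure to the event
  \<open>X = s\<close>.\<close>

lemma posterior_nn_integral:
  assumes g [measurable]: "\<And>s. g s \<in> borel_measurable T"
  shows "(\<integral>\<^sup>+\<omega>. g (X \<omega>) (Y \<omega>) \<partial>M) = (\<Sum>s\<in>S. \<integral>\<^sup>+z. ennreal (r s z) * g s z \<partial>distr M T Y)"
proof -
  have [measurable]: "(\<lambda>\<omega>. g (X \<omega>) (Y \<omega>)) \<in> borel_measurable M"
    by (rule measurable_compose_countable[OF _ X]) measurable
  have out: "AE \<omega> in M. X \<omega> \<in> S"
  proof -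
    have "AE x in distr M (count_space UNIV) X. x \<in> S"
      unfolding XS using S by (simp add: AE_measure_pmf_iff)
    then show ?thesis by (subst (asm) AE_distr_iff) auto
  qed
  have [measurable]: "(\<lambda>\<omega>. indicator {s} (X \<omega>) :: ennreal) \<in> borel_measurable M" for s
    by (rule measurable_compose[OF X]) simp
  have slice: "(\<integral>\<^sup>+\<omega>. g s (Y \<omega>) * indicator {s} (X \<omega>) \<partial>M) = (\<integral>\<^sup>+z. ennreal (r s z) * g s z \<partial>distr M T Y)" for s
  proof -
    have eq: "distr (density M (\<lambda>\<omega>. indicator {s} (X \<omega>))) T Y = density (distr M T Y) (\<lambda>z. ennreal (r s z))"
    proof (rule measure_eqI)
      fix A assume "A \<in> sets (distr (density M (\<lambda>\<omega>. indicator {s} (X \<omega>))) T Y)"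
      then have A [measurable]: "A \<in> sets T" by simp
      have "emeasure (distr (density M (\<lambda>\<omega>. indicator {s} (X \<omega>))) T Y) A
          = emeasure (density M (\<lambda>\<omega>. indicator {s} (X \<omega>))) (Y -` A \<inter> space M)"
        by (subst emeasure_distr) auto
      also have "\<dots> = (\<integral>\<^sup>+\<omega>. indicator {s} (X \<omega>) * indicator (Y -` A \<inter> space M) \<omega> \<partial>M)"
        by (subst emeasure_density) auto
      also have "\<dots> = (\<integral>\<^sup>+\<omega>. indicator {\<omega> \<in> space M. X \<omega> = s \<and> Y \<omega> \<in> A} \<omega> \<partial>M)"
        by (intro nn_integral_cong) (auto simp: indicator_def)
      also have "\<dots> = emeasure M {\<omega> \<in> space M. X \<omega> = s \<and> Y \<omega> \<in> A}"
        by (rule nn_integral_indicator) measurable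
      also have "\<dots> = emeasure (density (distr M T Y) (\<lambda>z. ennreal (r s z))) A"
        by (simp add: posterior_emeasure emeasure_density)
      finally show "emeasure (distr (density M (\<lambda>\<omega>. indicator {s} (X \<omega>))) T Y) A
        = emeasure (density (distr M T Y) (\<lambda>z. ennreal (r s z))) A" .
    qed simp
    have "(\<integral>\<^sup>+\<omega>. g s (Y \<omega>) * indicator {s} (X \<omega>) \<partial>M)
        = (\<integral>\<^sup>+\<omega>. g s (Y \<omega>) \<partial>density M (\<lambda>\<omega>. indicator {s} (X \<omega>)))"
      by (subst nn_integral_density) (auto simp: mult.commute)
    also have "\<dots> = (\<integral>\<^sup>+z. g s z \<partial>distr (density M (\<lambda>\<omega>. indicator {s} (X \<omega>))) T Y)"
      by (subst nn_integral_distr) auto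
    also have "\<dots> = (\<integral>\<^sup>+z. ennreal (r s z) * g s z \<partial>distr M T Y)"
      unfolding eq by (subst nn_integral_density) auto
    finally show ?thesis .
  qed
  have "(\<integral>\<^sup>+\<omega>. g (X \<omega>) (Y \<omega>) \<partial>M) = (\<integral>\<^sup>+\<omega>. (\<Sum>s\<in>S. g s (Y \<omega>) * indicator {s} (X \<omega>)) \<partial>M)"
  proof (rule nn_integral_cong_AE, rule AE_mp[OF out], intro AE_I2 impI)
    fix \<omega> assume "X \<omega> \<in> S"
    have "(\<Sum>s\<in>S. g s (Y \<omega>) * indicator {s} (X \<omega>)) = (\<Sum>s\<in>S. if s = X \<omega> then g s (Y \<omega>) else 0)"
      by (intro sum.cong) (auto simp: indicator_def)
    then show "g (X \<omega>) (Y \<omega>) = (\<Sum>s\<in>S. g s (Y \<omega>) * indicator {s} (X \<omega>))"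
      using S \<open>X \<omega> \<in> S\<close> by simp
  qed
  also have "\<dots> = (\<Sum>s\<in>S. \<integral>\<^sup>+z. ennreal (r s z) * g s z \<partial>distr M T Y)"
    by (subst nn_integral_sum) (auto simp: slice)
  finally show ?thesis .
qed

text \<open>Relative to its own law the observation has density 1, so the quotient of joint and
  marginal density in the definition of conditional entropy is the posterior itself.\<close>

lemma posterior_conditional_entropy:
  "conditional_entropy 2 (count_space UNIV) (distr M T Y) X Y
    = - (\<Sum>s\<in>S. \<integral>z. r s z * log 2 (r s z) \<partial>distr M T Y)"
proof -
  interpret information_space M 2 by standard simp
  let ?L = "distr M T Y"
  let ?C = "count_space (UNIV :: nat set)"
  interpret L: prob_space ?L by (rule prob_space_distr) fact
  interpret C: sigma_finite_measure ?C by (rule sigma_finite_measure_count_space)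
  interpret CL: pair_sigma_finite ?C ?L ..
  have rm [measurable]: "(\<lambda>p. r (fst p) (snd p)) \<in> borel_measurable (?C \<Otimes>\<^sub>M ?L)"
    by (rule measurable_compose_countable[of "\<lambda>s p. r s (snd p)" _ _ fst]) auto
  have Py: "distributed M ?L Y (\<lambda>_. ennreal 1)"
    unfolding distributed_def by (simp add: density_1 distr_cong[OF refl sets_distr])
  have Pxy: "distributed M (?C \<Otimes>\<^sub>M ?L) (\<lambda>\<omega>. (X \<omega>, Y \<omega>)) (\<lambda>p. ennreal (r (fst p) (snd p)))"
    unfolding distributed_def
  proof (intro conjI)
    show XY [measurable]: "(\<lambda>\<omega>. (X \<omega>, Y \<omega>)) \<in> measurable M (?C \<Otimes>\<^sub>M ?L)" by measurable
    show "(\<lambda>p. ennreal (r (fst p) (snd p))) \<in> borel_measurable (?C \<Otimes>\<^sub>M ?L)"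
      using rm by (rule measurable_compose) simp
    show "distr M (?C \<Otimes>\<^sub>M ?L) (\<lambda>\<omega>. (X \<omega>, Y \<omega>)) = density (?C \<Otimes>\<^sub>M ?L) (\<lambda>p. ennreal (r (fst p) (snd p)))"
    proof (rule measure_eqI)
      fix A assume "A \<in> sets (distr M (?C \<Otimes>\<^sub>M ?L) (\<lambda>\<omega>. (X \<omega>, Y \<omega>)))"
      then have A [measurable]: "A \<in> sets (?C \<Otimes>\<^sub>M ?L)" by simp
      have [measurable]: "(\<lambda>z. indicator A (s, z) :: ennreal) \<in> borel_measurable T" for s
      proof -
        have "(\<lambda>z. indicator A (s, z) :: ennreal) \<in> borel_measurable ?L"
          by measurable
        then show ?thesis by (simp add: measurable_def)
      qed
      have "emeasure (distr M (?C \<Otimes>\<^sub>M ?L) (\<lambda>\<omega>. (X \<omega>, Y \<omega>))) A = (\<integral>\<^sup>+\<omega>. indicator A (X \<omega>, Y \<omega>) \<partial>M)"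
        by (subst nn_integral_indicator[symmetric], simp, subst nn_integral_distr) auto
      also have "\<dots> = (\<Sum>s\<in>S. \<integral>\<^sup>+z. ennreal (r s z) * indicator A (s, z) \<partial>?L)"
        by (rule posterior_nn_integral) measurable
      also have "\<dots> = (\<integral>\<^sup>+s. \<integral>\<^sup>+z. ennreal (r s z) * indicator A (s, z) \<partial>?L \<partial>?C)"
        using S posterior_zero by (subst nn_integral_count_space'[of S]) auto
      also have "\<dots> = (\<integral>\<^sup>+p. ennreal (r (fst p) (snd p)) * indicator A p \<partial>(?C \<Otimes>\<^sub>M ?L))"
      proof (subst L.nn_integral_fst[symmetric])
        show "(\<lambda>p. ennreal (r (fst p) (snd p)) * indicator A p) \<in> borel_measurable (?C \<Otimes>\<^sub>M ?L)"
          by (intro borel_measurable_times_ennreal measurable_compose[OF rm] borel_measurable_indicator A) simp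
      qed simp
      also have "\<dots> = emeasure (density (?C \<Otimes>\<^sub>M ?L) (\<lambda>p. ennreal (r (fst p) (snd p)))) A"
        by (rule emeasure_density[symmetric, OF measurable_compose[OF rm] A]) simp
      finally show "emeasure (distr M (?C \<Otimes>\<^sub>M ?L) (\<lambda>\<omega>. (X \<omega>, Y \<omega>))) A
        = emeasure (density (?C \<Otimes>\<^sub>M ?L) (\<lambda>p. ennreal (r (fst p) (snd p)))) A" .
    qed simp
  qed
  let ?f = "\<lambda>s z. r s z * log 2 (r s z)"
  have fb: "\<bar>?f s z\<bar> \<le> 1 / ln 2" for s z
    using divide_right_mono[OF abs_mult_ln_le_1[OF posterior_nonneg[of s z] posterior_le_1[of s z]], of "ln 2"]
    by (simp add: log_def)
  have intf: "integrable (?C \<Otimes>\<^sub>M ?L) (\<lambda>p. ?f (fst p) (snd p))"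
  proof (rule integrableI_bounded_set[of "S \<times> space ?L" _ _ "1 / ln 2"])
    have "emeasure (?C \<Otimes>\<^sub>M ?L) (S \<times> space ?L) = emeasure ?C S * emeasure ?L (space ?L)"
      by (rule L.emeasure_pair_measure_Times) auto
    then show "emeasure (?C \<Otimes>\<^sub>M ?L) (S \<times> space ?L) < \<infinity>"
      using S L.emeasure_space_1 by (simp add: of_nat_less_top)
    show "AE p in ?C \<Otimes>\<^sub>M ?L. p \<in> S \<times> space ?L \<longrightarrow> norm (?f (fst p) (snd p)) \<le> 1 / ln 2"
      using fb by auto
    show "AE p in ?C \<Otimes>\<^sub>M ?L. p \<notin> S \<times> space ?L \<longrightarrow> ?f (fst p) (snd p) = 0"
      using posterior_zero by (intro AE_I2) (fastforce simp: space_pair_measure)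
    show "S \<times> space ?L \<in> sets (?C \<Otimes>\<^sub>M ?L)" by (rule pair_measureI) simp_all
    show "(\<lambda>p. ?f (fst p) (snd p)) \<in> borel_measurable (?C \<Otimes>\<^sub>M ?L)"
    proof -
      have m: "(\<lambda>x::real. x * log 2 x) \<in> borel_measurable borel" by measurable
      show ?thesis by (rule measurable_compose[OF rm m])
    qed
  qed
  have "conditional_entropy 2 ?C ?L X Y = - (\<integral>(s, z). r (fst (s, z)) (snd (s, z)) * log 2 (r (fst (s, z)) (snd (s, z)) / 1) \<partial>(?C \<Otimes>\<^sub>M ?L))"
    by (rule conditional_entropy_generic_eq[OF _ _ Py _ Pxy])
       (auto simp: posterior_nonneg intro: sigma_finite_measure_count_space L.sigma_finite_measure_axioms)
  also have "(\<integral>(s, z). r (fst (s, z)) (snd (s, z)) * log 2 (r (fst (s, z)) (snd (s, z)) / 1) \<partial>(?C \<Otimes>\<^sub>M ?L))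
      = (\<integral>p. ?f (fst p) (snd p) \<partial>(?C \<Otimes>\<^sub>M ?L))"
    by (intro Bochner_Integration.integral_cong) auto
  also have "\<dots> = (\<integral>s. \<integral>z. ?f s z \<partial>?L \<partial>?C)"
    using CL.integral_fst'[OF intf] by simp
  also have "\<dots> = (\<Sum>s\<in>S. \<integral>z. ?f s z \<partial>?L)"
  proof -
    have sub: "{s \<in> UNIV. (\<integral>z. ?f s z \<partial>?L) \<noteq> 0} \<subseteq> S"
      using posterior_zero by fastforce
    then show ?thesis
      using S by (subst lebesgue_integral_count_space_finite_support)
        (auto intro: finite_subset intro!: sum.mono_neutral_left)
  qed
  finally show ?thesis .
qed

end
end
end

section \<open>The wiretap channel\<close>

lemma sets_PiM_complex_gaussian [measurable_cong]:
  "sets (PiM K (\<lambda>_. complex_gaussian v)) = sets (PiM K (\<lambda>_. borel))"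
  by (rule sets_PiM_cong) auto

lemma prob_space_PiM_complex_gaussian: "v > 0 \<Longrightarrow> prob_space (PiM K (\<lambda>_. complex_gaussian v))"
  by (intro prob_space_PiM prob_space_complex_gaussian)

lemma eavesdropper_map_measurable:
  "(\<lambda>p. \<lambda>(t, i)\<in>{..<n} \<times> I. complex_of_real (he i) * fst p t + snd p (t, i))
    \<in> measurable ((\<Pi>\<^sub>M t\<in>{..<n}. borel) \<Otimes>\<^sub>M (\<Pi>\<^sub>M ti\<in>{..<n} \<times> I. borel)) (\<Pi>\<^sub>M ti\<in>{..<n} \<times> I. borel)"
proof (rule measurable_restrict)
  fix ti assume ti: "ti \<in> {..<n} \<times> I"
  then obtain t i where "ti = (t, i)" "t \<in> {..<n}" "i \<in> I" by auto
  then show "(\<lambda>p. case ti of (t, i) \<Rightarrow> complex_of_real (he i) * fst p t + snd p (t, i))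
    \<in> borel_measurable ((\<Pi>\<^sub>M t\<in>{..<n}. borel) \<Otimes>\<^sub>M (\<Pi>\<^sub>M ti\<in>{..<n} \<times> I. borel))"
    by simp
qed

context
  fixes n P and C :: "(nat \<times> (nat \<Rightarrow> complex)) measure" and vl ve :: real and I :: "nat set"
  assumes C: "wiretap_encoder n P C" and vl: "vl > 0" and ve: "ve > 0"
begin

lemma sets_encoder [measurable_cong]: "sets C = sets (count_space UNIV \<Otimes>\<^sub>M (\<Pi>\<^sub>M t\<in>{..<n}. borel))"
  using C by (simp add: wiretap_encoder_def)

lemma prob_space_wiretap_space: "prob_space (wiretap_space n I vl ve C)"
proof -
  have "prob_space C" using C by (simp add: wiretap_encoder_def)
  then show ?thesis
    unfolding wiretap_space_def
    by (intro prob_space_pair prob_space_PiM_complex_gaussian vl ve)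
qed

lemma sets_wiretap_space: "sets (wiretap_space n I vl ve C)
  = sets ((count_space UNIV \<Otimes>\<^sub>M (\<Pi>\<^sub>M t\<in>{..<n}. borel)) \<Otimes>\<^sub>M (\<Pi>\<^sub>M t\<in>{..<n}. borel) \<Otimes>\<^sub>M (\<Pi>\<^sub>M ti\<in>{..<n} \<times> I. borel))"
  unfolding wiretap_space_def
  by (intro sets_pair_measure_cong sets_encoder sets_PiM_complex_gaussian)

lemma message_measurable [measurable]: "message \<in> measurable (wiretap_space n I vl ve C) (count_space UNIV)"
  unfolding message_def measurable_cong_sets[OF sets_wiretap_space refl] by measurable

lemma receiver_output_measurable [measurable]:
  "receiver_output n hl \<in> measurable (wiretap_space n I vl ve C) (\<Pi>\<^sub>M t\<in>{..<n}. borel)"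
  unfolding receiver_output_def measurable_cong_sets[OF sets_wiretap_space refl]
  by (rule measurable_restrict) measurable

lemma eavesdropper_output_measurable [measurable]:
  "eavesdropper_output n I he \<in> measurable (wiretap_space n I vl ve C) (\<Pi>\<^sub>M ti\<in>{..<n} \<times> I. borel)"
  unfolding eavesdropper_output_def measurable_cong_sets[OF sets_wiretap_space refl]
proof -
  have "(\<lambda>\<omega>. (snd (fst \<omega>), snd (snd \<omega>))) \<in> measurable
     ((count_space UNIV \<Otimes>\<^sub>M (\<Pi>\<^sub>M t\<in>{..<n}. borel)) \<Otimes>\<^sub>M (\<Pi>\<^sub>M t\<in>{..<n}. borel) \<Otimes>\<^sub>M (\<Pi>\<^sub>M ti\<in>{..<n} \<times> I. borel))
     ((\<Pi>\<^sub>M t\<in>{..<n}. (borel :: complex measure)) \<Otimes>\<^sub>M (\<Pi>\<^sub>M ti\<in>{..<n} \<times> I. (borel :: complex measure)))"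
    by (intro measurable_Pair measurable_compose[OF measurable_fst measurable_snd] measurable_compose[OF measurable_snd measurable_snd])
  from measurable_compose[OF this eavesdropper_map_measurable[where n = n and I = I and he = he]]
  show "(\<lambda>\<omega>. \<lambda>(t, i)\<in>{..<n} \<times> I. complex_of_real (he i) * snd (fst \<omega>) t + snd (snd \<omega>) (t, i)) \<in> measurable
     ((count_space UNIV \<Otimes>\<^sub>M (\<Pi>\<^sub>M t\<in>{..<n}. borel)) \<Otimes>\<^sub>M (\<Pi>\<^sub>M t\<in>{..<n}. borel) \<Otimes>\<^sub>M (\<Pi>\<^sub>M ti\<in>{..<n} \<times> I. borel))
     (\<Pi>\<^sub>M ti\<in>{..<n} \<times> I. borel)"
    by (simp only: fst_conv snd_conv)
qed

text \<open>With the receiver noise integrated out, everything that concerns only the message and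
  the eavesdroppers lives on a space that does not mention \<open>vl\<close>.\<close>

lemma distr_wiretap_space_eavesdropper:
  "distr (wiretap_space n I vl ve C) (C \<Otimes>\<^sub>M (\<Pi>\<^sub>M ti\<in>{..<n} \<times> I. complex_gaussian ve)) (\<lambda>\<omega>. (fst \<omega>, snd (snd \<omega>)))
    = C \<Otimes>\<^sub>M (\<Pi>\<^sub>M ti\<in>{..<n} \<times> I. complex_gaussian ve)"
proof -
  let ?L = "\<Pi>\<^sub>M t\<in>{..<n}. complex_gaussian vl" and ?E = "\<Pi>\<^sub>M ti\<in>{..<n} \<times> I. complex_gaussian ve"
  interpret C: prob_space C using C by (simp add: wiretap_encoder_def)
  interpret L: prob_space ?L by (intro prob_space_PiM_complex_gaussian vl)
  interpret E: prob_space ?E by (intro prob_space_PiM_complex_gaussian ve)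
  interpret LE: pair_prob_space ?L ?E ..
  interpret CE: pair_prob_space C ?E ..
  show ?thesis
  proof (rule pair_measure_eqI[symmetric])
    fix A B assume AB [measurable]: "A \<in> sets C" "B \<in> sets ?E"
    have "emeasure (distr (wiretap_space n I vl ve C) (C \<Otimes>\<^sub>M ?E) (\<lambda>\<omega>. (fst \<omega>, snd (snd \<omega>)))) (A \<times> B)
        = emeasure (wiretap_space n I vl ve C) (A \<times> (space ?L \<times> B))"
      using sets.sets_into_space[OF AB(1)] sets.sets_into_space[OF AB(2)]
      by (subst emeasure_distr)
         (auto simp: wiretap_space_def space_pair_measure intro!: arg_cong2[where f = emeasure])
    also have "\<dots> = emeasure C A * emeasure ?E B"
      unfolding wiretap_space_def
      by (simp add: LE.emeasure_pair_measure_Times E.emeasure_pair_measure_Times L.emeasure_space_1)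
    finally show "emeasure C A * emeasure ?E B
      = emeasure (distr (wiretap_space n I vl ve C) (C \<Otimes>\<^sub>M ?E) (\<lambda>\<omega>. (fst \<omega>, snd (snd \<omega>)))) (A \<times> B)" by simp
  qed (auto simp: C.sigma_finite_measure_axioms E.sigma_finite_measure_axioms)
qed

lemma distr_message:
  "distr (wiretap_space n I vl ve C) (count_space UNIV) message = distr C (count_space UNIV) fst"
proof -
  let ?E = "\<Pi>\<^sub>M ti\<in>{..<n} \<times> I. complex_gaussian ve"
  interpret C: prob_space C using C by (simp add: wiretap_encoder_def)
  interpret E: prob_space ?E by (intro prob_space_PiM_complex_gaussian ve)
  have "distr (wiretap_space n I vl ve C) (count_space UNIV) message
      = distr (distr (wiretap_space n I vl ve C) (C \<Otimes>\<^sub>M ?E) (\<lambda>\<omega>. (fst \<omega>, snd (snd \<omega>)))) (count_space UNIV) (fst \<circ> fst)"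
    by (subst distr_distr) (auto simp: wiretap_space_def message_def comp_def intro!: distr_cong)
  also have "\<dots> = distr (distr (C \<Otimes>\<^sub>M ?E) C fst) (count_space UNIV) fst"
    unfolding distr_wiretap_space_eavesdropper by (subst distr_distr) auto
  also have "distr (C \<Otimes>\<^sub>M ?E) C fst = C"
    by (rule E.distr_pair_fst)
  finally show ?thesis .
qed

lemma distr_message_output:
  "distr (wiretap_space n I vl ve C) (count_space UNIV \<Otimes>\<^sub>M (\<Pi>\<^sub>M ti\<in>{..<n} \<times> I. borel))
      (\<lambda>\<omega>. (message \<omega>, eavesdropper_output n I he \<omega>))
    = distr (C \<Otimes>\<^sub>M (\<Pi>\<^sub>M ti\<in>{..<n} \<times> I. complex_gaussian ve)) (count_space UNIV \<Otimes>\<^sub>M (\<Pi>\<^sub>M ti\<in>{..<n} \<times> I. borel))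
      (\<lambda>p. (fst (fst p), \<lambda>(t, i)\<in>{..<n} \<times> I. complex_of_real (he i) * snd (fst p) t + snd p (t, i)))"
proof -
  let ?E = "\<Pi>\<^sub>M ti\<in>{..<n} \<times> I. complex_gaussian ve"
  have m: "(\<lambda>p. (fst (fst p), \<lambda>(t, i)\<in>{..<n} \<times> I. complex_of_real (he i) * snd (fst p) t + snd p (t, i)))
    \<in> measurable (C \<Otimes>\<^sub>M ?E) (count_space UNIV \<Otimes>\<^sub>M (\<Pi>\<^sub>M ti\<in>{..<n} \<times> I. borel))"
  proof (rule measurable_Pair)
    have "(\<lambda>p. (snd (fst p), snd p)) \<in> measurable (C \<Otimes>\<^sub>M ?E) ((\<Pi>\<^sub>M t\<in>{..<n}. borel) \<Otimes>\<^sub>M (\<Pi>\<^sub>M ti\<in>{..<n} \<times> I. borel))"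
      by measurable
    from measurable_compose[OF this eavesdropper_map_measurable[where n = n and I = I and he = he]]
    show "(\<lambda>p. \<lambda>(t, i)\<in>{..<n} \<times> I. complex_of_real (he i) * snd (fst p) t + snd p (t, i))
      \<in> measurable (C \<Otimes>\<^sub>M ?E) (\<Pi>\<^sub>M ti\<in>{..<n} \<times> I. borel)"
      by (simp only: fst_conv snd_conv)
  qed measurable
  show ?thesis
    by (subst distr_wiretap_space_eavesdropper[symmetric], subst distr_distr[OF m])
       (auto simp: wiretap_space_def message_def eavesdropper_output_def comp_def)
qed

end

text \<open>Lets the converse weaken the independent part of the receiver noise without touching the
  secrecy condition, since neither the message nor the eavesdropper observation involves that
  noise.\<close>

lemma equivocation_receiver_noise_irrelevant:
  assumes C: "wiretap_encoder n P C" and v: "vl > 0" "vl' > 0" "ve > 0"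
  shows "equivocation n I he (wiretap_space n I vl ve C) = equivocation n I he (wiretap_space n I vl' ve C)"
proof -
  let ?W = "\<lambda>vl. wiretap_space n I vl ve C" and ?Z = "\<Pi>\<^sub>M ti\<in>{..<n} \<times> I. (borel :: complex measure)"
  let ?f = "\<lambda>\<omega>. (message \<omega>, eavesdropper_output n I he \<omega>)"
  interpret W: prob_space "?W vl" by (rule prob_space_wiretap_space[OF C v(1,3)])
  interpret W': prob_space "?W vl'" by (rule prob_space_wiretap_space[OF C v(2,3)])
  note [measurable] = message_measurable[OF C v(1,3)] message_measurable[OF C v(2,3)]
    eavesdropper_output_measurable[OF C v(1,3)] eavesdropper_output_measurable[OF C v(2,3)]
  have J: "distr (?W vl) (count_space UNIV \<Otimes>\<^sub>M ?Z) ?f = distr (?W vl') (count_space UNIV \<Otimes>\<^sub>M ?Z) ?f"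
    by (simp add: distr_message_output[OF C] v)
  have Z: "distr (?W vl) ?Z (eavesdropper_output n I he) = distr (?W vl') ?Z (eavesdropper_output n I he)"
    using arg_cong[OF J, of "\<lambda>M. distr M ?Z snd"] by (simp add: distr_distr comp_def)
  \<comment> \<open>The law of the observation is also the reference measure of the conditional
    entropy, so it has to be exchanged in the target of the joint law as well.\<close>
  have J': "distr (?W vl) (count_space UNIV \<Otimes>\<^sub>M distr (?W vl) ?Z (eavesdropper_output n I he)) ?f
      = distr (?W vl') (count_space UNIV \<Otimes>\<^sub>M distr (?W vl') ?Z (eavesdropper_output n I he)) ?f"
    using J by (subst (1 2) distr_cong[OF refl sets_pair_measure_cong[OF refl sets_distr] refl])
  have Z': "distr (?W vl) (distr (?W vl) ?Z (eavesdropper_output n I he)) (eavesdropper_output n I he)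
      = distr (?W vl') (distr (?W vl') ?Z (eavesdropper_output n I he)) (eavesdropper_output n I he)"
  proof -
    have c: "distr M (distr M T f) f = distr M T f" for M :: "'m measure" and T :: "'t measure" and f
      by (rule distr_cong) auto
    show ?thesis unfolding c by (rule Z)
  qed
  show ?thesis
    unfolding equivocation_def W.conditional_entropy_def W'.conditional_entropy_def Z J'[unfolded Z] Z'[unfolded Z] ..
qed

section \<open>Sums of Gaussian noises\<close>

lemma sets_PiM_lborel [measurable_cong]:
  "sets (PiM K (\<lambda>_. lborel)) = sets (PiM K (\<lambda>_. borel :: complex measure))"
  by (rule sets_PiM_cong) auto

lemma sigma_finite_PiM_lborel:
  "finite K \<Longrightarrow> sigma_finite_measure (PiM K (\<lambda>_. lborel :: complex measure))"
  by (intro product_sigma_finite.sigma_finite)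
     (auto simp: product_sigma_finite_def sigma_finite_lborel)

lemma cn_density_prod_measurable:
  assumes "\<And>i. i \<in> K \<Longrightarrow> f i \<in> borel_measurable M"
  shows "(\<lambda>x. \<Prod>i\<in>K. cn_density (v i) (f i x)) \<in> borel_measurable M"
proof (rule borel_measurable_prod)
  fix i assume "i \<in> K"
  from assms[OF this] show "(\<lambda>x. cn_density (v i) (f i x)) \<in> borel_measurable M"
    by (rule measurable_compose) simp
qed

lemma shifted_density_measurable:
  assumes g: "\<And>t. t \<in> K \<Longrightarrow> g t \<in> borel_measurable N" and f: "f \<in> borel_measurable (PiM K (\<lambda>_. borel))"
  shows "(\<lambda>q. ennreal (\<Prod>t\<in>K. cn_density (v t) (snd q t - g t (fst q))) * f (snd q))
    \<in> borel_measurable (N \<Otimes>\<^sub>M PiM K (\<lambda>_. lborel))"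
proof (intro borel_measurable_times_ennreal)
  have "f \<in> borel_measurable (PiM K (\<lambda>_. lborel))"
    using f by (simp add: measurable_cong_sets[OF sets_PiM_lborel refl])
  then show "(\<lambda>q. f (snd q)) \<in> borel_measurable (N \<Otimes>\<^sub>M PiM K (\<lambda>_. lborel))"
    by (rule measurable_compose[OF measurable_snd])
  have "(\<lambda>q. \<Prod>t\<in>K. cn_density (v t) (snd q t - g t (fst q))) \<in> borel_measurable (N \<Otimes>\<^sub>M PiM K (\<lambda>_. lborel))"
  proof (rule cn_density_prod_measurable)
    fix t assume t: "t \<in> K"
    have "(\<lambda>y. y t) \<in> measurable (PiM K (\<lambda>_. lborel)) (borel :: complex measure)"
      unfolding measurable_cong_sets[OF sets_PiM_lborel refl]
      by (rule measurable_component_singleton[OF t])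
    from measurable_compose[OF measurable_snd this] measurable_compose[OF measurable_fst g[OF t]]
    show "(\<lambda>q. snd q t - g t (fst q)) \<in> borel_measurable (N \<Otimes>\<^sub>M PiM K (\<lambda>_. lborel))"
      by (intro borel_measurable_diff)
  qed
  then show "(\<lambda>q. ennreal (\<Prod>t\<in>K. cn_density (v t) (snd q t - g t (fst q)))) \<in> borel_measurable (N \<Otimes>\<^sub>M PiM K (\<lambda>_. lborel))"
    by (rule measurable_compose) simp
qed

lemma selected_sum_measurable:
  "(\<lambda>w. m + (\<Sum>p\<in>F. if fst p = t then of_real (c (snd p)) * w p else (0::complex)))
    \<in> borel_measurable (PiM F (\<lambda>_. complex_gaussian a))"
proof (intro borel_measurable_add borel_measurable_const borel_measurable_sum)
  fix p assume p: "p \<in> F"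
  have "(\<lambda>w. w p) \<in> borel_measurable (PiM F (\<lambda>_. complex_gaussian a))"
    using measurable_component_singleton[OF p, of "\<lambda>_. complex_gaussian a"]
    by (simp add: measurable_cong_sets[OF refl sets_complex_gaussian])
  then show "(\<lambda>w. if fst p = t then of_real (c (snd p)) * w p else (0::complex))
    \<in> borel_measurable (PiM F (\<lambda>_. complex_gaussian a))"
    by (cases "fst p = t") auto
qed

text \<open>Only the density factor at \<open>t0\<close> depends on the added noise. After Fubini
  its integral is the scalar Gaussian convolution.\<close>

lemma nn_integral_cgauss_convolution:
  assumes K: "finite K" "t0 \<in> K" and v: "\<And>t. v t > 0" and a: "a > 0"
    and f: "f \<in> borel_measurable (PiM K (\<lambda>_. borel))"
  shows "(\<integral>\<^sup>+w. (\<integral>\<^sup>+y. f y \<partial>PiM K (\<lambda>t. cgauss (m t + (if t = t0 then of_real c * w else 0)) (v t))) \<partial>complex_gaussian a)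
       = (\<integral>\<^sup>+y. f y \<partial>PiM K (\<lambda>t. cgauss (m t) (v t + (if t = t0 then c\<^sup>2 * a else 0))))"
proof -
  let ?L = "PiM K (\<lambda>_. lborel :: complex measure)"
  let ?m = "\<lambda>w t. m t + (if t = t0 then of_real c * w else 0)"
  interpret L: sigma_finite_measure ?L by (rule sigma_finite_PiM_lborel[OF K(1)])
  interpret A: prob_space "complex_gaussian a" by (rule prob_space_complex_gaussian[OF a])
  interpret AL: pair_sigma_finite "complex_gaussian a" ?L ..
  have fL: "f \<in> borel_measurable ?L"
    using f by (simp add: measurable_cong_sets[OF sets_PiM_lborel refl])
  have pm: "(\<lambda>p. ennreal (\<Prod>t\<in>K. cn_density (v t) (snd p t - ?m (fst p) t)) * f (snd p)) \<in> borel_measurable (complex_gaussian a \<Otimes>\<^sub>M ?L)"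
  proof (rule shifted_density_measurable[OF _ f])
    fix t show "(\<lambda>w. ?m w t) \<in> borel_measurable (complex_gaussian a)"
      by (cases "t = t0") auto
  qed
  have v2: "v t + (if t = t0 then c\<^sup>2 * a else 0) > 0" for t
    using v[of t] a by (simp add: add_pos_nonneg)
  have "(\<integral>\<^sup>+w. (\<integral>\<^sup>+y. f y \<partial>PiM K (\<lambda>t. cgauss (?m w t) (v t))) \<partial>complex_gaussian a)
      = (\<integral>\<^sup>+w. (\<integral>\<^sup>+y. ennreal (\<Prod>t\<in>K. cn_density (v t) (y t - ?m w t)) * f y \<partial>?L) \<partial>complex_gaussian a)"
    by (intro nn_integral_cong nn_integral_PiM_cgauss K v f)
  also have "\<dots> = (\<integral>\<^sup>+y. (\<integral>\<^sup>+w. ennreal (\<Prod>t\<in>K. cn_density (v t) (y t - ?m w t)) * f y \<partial>complex_gaussian a) \<partial>?L)"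
    by (rule AL.Fubini'[symmetric], unfold case_prod_beta', rule pm)
  also have "\<dots> = (\<integral>\<^sup>+y. ennreal (\<Prod>t\<in>K. cn_density (v t + (if t = t0 then c\<^sup>2 * a else 0)) (y t - m t)) * f y \<partial>?L)"
  proof (rule nn_integral_cong)
    fix y
    define R where "R = (\<Prod>t\<in>K - {t0}. cn_density (v t) (y t - m t))"
    have R0: "R \<ge> 0" unfolding R_def using v by (intro prod_nonneg) (simp add: cn_density_nonneg)
    have 1: "(\<Prod>t\<in>K. cn_density (v t) (y t - ?m w t)) = cn_density (v t0) (y t0 - m t0 - of_real c * w) * R" for w
      using K by (simp add: prod.remove[of K t0] R_def algebra_simps)
    have 2: "(\<Prod>t\<in>K. cn_density (v t + (if t = t0 then c\<^sup>2 * a else 0)) (y t - m t)) = cn_density (v t0 + c\<^sup>2 * a) (y t0 - m t0) * R"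
      using K by (simp add: prod.remove[of K t0] R_def)
    have "(\<integral>\<^sup>+w. ennreal (\<Prod>t\<in>K. cn_density (v t) (y t - ?m w t)) * f y \<partial>complex_gaussian a)
       = (\<integral>\<^sup>+w. ennreal (cn_density (v t0) (y t0 - m t0 - of_real c * w)) * (ennreal R * f y) \<partial>complex_gaussian a)"
      unfolding 1 using v R0 by (simp add: ennreal_mult cn_density_nonneg mult.assoc)
    also have "\<dots> = (\<integral>\<^sup>+w. ennreal (cn_density (v t0) (y t0 - m t0 - of_real c * w)) \<partial>complex_gaussian a) * (ennreal R * f y)"
      by (rule nn_integral_multc) measurable
    also have "(\<integral>\<^sup>+w. ennreal (cn_density (v t0) (y t0 - m t0 - of_real c * w)) \<partial>complex_gaussian a)
        = ennreal (cn_density (v t0 + c\<^sup>2 * a) (y t0 - m t0))"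
      using cn_density_convolution[OF a v[of t0]] by (simp add: nn_integral_complex_gaussian)
    finally show "(\<integral>\<^sup>+w. ennreal (\<Prod>t\<in>K. cn_density (v t) (y t - ?m w t)) * f y \<partial>complex_gaussian a)
      = ennreal (\<Prod>t\<in>K. cn_density (v t + (if t = t0 then c\<^sup>2 * a else 0)) (y t - m t)) * f y"
      unfolding 2 using v a R0 by (simp add: ennreal_mult cn_density_nonneg mult.assoc add_pos_nonneg)
  qed
  also have "\<dots> = (\<integral>\<^sup>+y. f y \<partial>PiM K (\<lambda>t. cgauss (m t) (v t + (if t = t0 then c\<^sup>2 * a else 0))))"
    by (intro nn_integral_PiM_cgauss[symmetric] K v2 f)
  finally show ?thesis .
qed

text \<open>The noises are absorbed one index pair at a time. All sums run over the whole of
  \<open>F\<close> with a condition on the time, so that inserting a pair changes mean and variance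
  at a single time only.\<close>

lemma nn_integral_noise_sum_finite:
  fixes c :: "'i \<Rightarrow> real" and K :: "'t set"
  assumes K: "finite K" and F: "finite F" "F \<subseteq> K \<times> UNIV" and v: "v > 0" and a: "a > 0"
    and f: "f \<in> borel_measurable (PiM K (\<lambda>_. borel))"
  shows "(\<integral>\<^sup>+w. (\<integral>\<^sup>+y. f y \<partial>PiM K (\<lambda>t. cgauss (m t + (\<Sum>p\<in>F. if fst p = t then of_real (c (snd p)) * w p else 0)) v))
            \<partial>PiM F (\<lambda>_. complex_gaussian a))
       = (\<integral>\<^sup>+y. f y \<partial>PiM K (\<lambda>t. cgauss (m t) (v + (\<Sum>p\<in>F. if fst p = t then (c (snd p))\<^sup>2 * a else 0))))"
  using F
proof (induction F arbitrary: m rule: finite_induct)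
  case empty
  show ?case by (simp add: PiM_empty nn_integral_count_space_finite)
next
  case (insert p F)
  obtain t0 i where p: "p = (t0, i)" by (cases p)
  have t0: "t0 \<in> K" and FK: "F \<subseteq> K \<times> UNIV" using insert.prems p by auto
  let ?A = "\<lambda>_. complex_gaussian a"
  interpret A: product_sigma_finite ?A
    by (simp add: product_sigma_finite_def prob_space_imp_sigma_finite prob_space_complex_gaussian a)
  let ?L = "PiM K (\<lambda>_. lborel :: complex measure)"
  interpret L: sigma_finite_measure ?L by (rule sigma_finite_PiM_lborel[OF K])
  have fL: "f \<in> borel_measurable ?L"
    using f by (simp add: measurable_cong_sets[OF sets_PiM_lborel refl])
  let ?s = "\<lambda>F w t. (\<Sum>p\<in>F. if fst p = t then of_real (c (snd p)) * w p else (0::complex))"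
  have meas: "(\<lambda>w. \<integral>\<^sup>+y. f y \<partial>PiM K (\<lambda>t. cgauss (m t + ?s (insert p F) w t) v)) \<in> borel_measurable (PiM (insert p F) ?A)"
  proof -
    have "(\<lambda>q. ennreal (\<Prod>t\<in>K. cn_density v (snd q t - (m t + ?s (insert p F) (fst q) t))) * f (snd q)) \<in> borel_measurable (PiM (insert p F) ?A \<Otimes>\<^sub>M ?L)"
      by (rule shifted_density_measurable[OF _ f]) (rule selected_sum_measurable)
    from L.borel_measurable_nn_integral_fst[OF this]
    show ?thesis
      unfolding nn_integral_PiM_cgauss[OF K v f] fst_conv snd_conv .
  qed
  have sum_upd: "?s (insert p F) (w(p := x)) t = (if t = t0 then of_real (c i) * x else 0) + ?s F w t" for w x t
    using insert.hyps by (auto simp: p intro!: sum.cong)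
  have "(\<integral>\<^sup>+w. (\<integral>\<^sup>+y. f y \<partial>PiM K (\<lambda>t. cgauss (m t + ?s (insert p F) w t) v)) \<partial>PiM (insert p F) ?A)
      = (\<integral>\<^sup>+x. (\<integral>\<^sup>+w. (\<integral>\<^sup>+y. f y \<partial>PiM K (\<lambda>t. cgauss (m t + ?s (insert p F) (w(p := x)) t) v)) \<partial>PiM F ?A) \<partial>complex_gaussian a)"
    by (rule A.product_nn_integral_insert_rev[OF insert.hyps meas])
  also have "\<dots> = (\<integral>\<^sup>+x. (\<integral>\<^sup>+w. (\<integral>\<^sup>+y. f y \<partial>PiM K (\<lambda>t. cgauss ((m t + (if t = t0 then of_real (c i) * x else 0)) + ?s F w t) v)) \<partial>PiM F ?A) \<partial>complex_gaussian a)"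
    unfolding sum_upd by (simp add: add.assoc)
  also have "\<dots> = (\<integral>\<^sup>+x. (\<integral>\<^sup>+y. f y \<partial>PiM K (\<lambda>t. cgauss (m t + (if t = t0 then of_real (c i) * x else 0)) (v + (\<Sum>p\<in>F. if fst p = t then (c (snd p))\<^sup>2 * a else 0)))) \<partial>complex_gaussian a)"
    by (rule nn_integral_cong) (rule insert.IH[OF FK])
  also have "\<dots> = (\<integral>\<^sup>+y. f y \<partial>PiM K (\<lambda>t. cgauss (m t) ((v + (\<Sum>p\<in>F. if fst p = t then (c (snd p))\<^sup>2 * a else 0)) + (if t = t0 then (c i)\<^sup>2 * a else 0))))"
    using v a by (intro nn_integral_cgauss_convolution K t0 f) (auto intro!: add_pos_nonneg sum_nonneg)
  also have "\<dots> = (\<integral>\<^sup>+y. f y \<partial>PiM K (\<lambda>t. cgauss (m t) (v + (\<Sum>p\<in>insert p F. if fst p = t then (c (snd p))\<^sup>2 * a else 0))))"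
  proof -
    have "(v + (\<Sum>p\<in>F. if fst p = t then (c (snd p))\<^sup>2 * a else 0)) + (if t = t0 then (c i)\<^sup>2 * a else 0)
        = v + (\<Sum>p\<in>insert p F. if fst p = t then (c (snd p))\<^sup>2 * a else 0)" for t
      using insert.hyps by (auto simp: p)
    then show ?thesis by (simp only:)
  qed
  finally show ?case .
qed

lemma nn_integral_PiM_restrict:
  assumes A: "prob_space A" and F: "finite F" "F \<subseteq> K" and g: "g \<in> borel_measurable (PiM F (\<lambda>_. A))"
  shows "(\<integral>\<^sup>+w. g (restrict w F) \<partial>PiM K (\<lambda>_. A)) = (\<integral>\<^sup>+w. g w \<partial>PiM F (\<lambda>_. A))"
proof -
  interpret product_prob_space "\<lambda>_. A" K
    by (rule product_prob_spaceI) (rule A)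
  show ?thesis
    using nn_integral_distr[OF measurable_restrict_subset[OF F(2)], of g "\<lambda>_. A"] g
    by (simp add: distr_PiM_restrict_finite[OF F])
qed

text \<open>The weighted sum of the eavesdropper noises, scaled by \<open>b\<close> and added to
  independent noise, is again white Gaussian noise with added variances. If \<open>v\<close> is the
  receiver variance minus the share of the first part, the total has the law of the receiver noise
  although it is correlated with the eavesdropper noise.\<close>

lemma nn_integral_noise_sum:
  fixes he :: "nat \<Rightarrow> real"
  assumes J: "finite J" "J \<subseteq> I" and v: "v > 0" and a: "a > 0"
    and f: "f \<in> borel_measurable (\<Pi>\<^sub>M t\<in>{..<n::nat}. borel)"
  shows "(\<integral>\<^sup>+w. (\<integral>\<^sup>+V. f (\<lambda>t\<in>{..<n}. m t + of_real b * (\<Sum>i\<in>J. of_real (he i) * w (t, i)) + V t)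
              \<partial>(\<Pi>\<^sub>M t\<in>{..<n}. complex_gaussian v)) \<partial>(\<Pi>\<^sub>M ti\<in>{..<n} \<times> I. complex_gaussian a))
       = (\<integral>\<^sup>+y. f y \<partial>PiM {..<n} (\<lambda>t. cgauss (m t) (v + b\<^sup>2 * (\<Sum>i\<in>J. (he i)\<^sup>2) * a)))"
proof -
  let ?K = "{..<n}" and ?F = "{..<n} \<times> J"
  have F: "finite ?F" "?F \<subseteq> ?K \<times> UNIV" "?F \<subseteq> ?K \<times> I" using J by auto
  let ?s = "\<lambda>w t. \<Sum>p\<in>?F. if fst p = t then of_real (b * he (snd p)) * w p else (0::complex)"
  have s: "?s w t = of_real b * (\<Sum>i\<in>J. of_real (he i) * w (t, i))" if "t \<in> ?K" for w t
  proof -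
    have "?s w t = (\<Sum>t'\<in>?K. \<Sum>i\<in>J. if t' = t then of_real (b * he i) * w (t', i) else 0)"
      unfolding sum.cartesian_product by (intro sum.cong) auto
    also have "\<dots> = (\<Sum>t'\<in>?K. if t' = t then \<Sum>i\<in>J. of_real (b * he i) * w (t', i) else 0)"
      by (intro sum.cong) auto
    also have "\<dots> = (\<Sum>i\<in>J. of_real (b * he i) * w (t, i))"
      using that by simp
    finally show ?thesis by (simp add: sum_distrib_left mult.assoc)
  qed
  have s2: "(\<Sum>p\<in>?F. if fst p = t then (b * he (snd p))\<^sup>2 * a else 0) = b\<^sup>2 * (\<Sum>i\<in>J. (he i)\<^sup>2) * a" if "t \<in> ?K" for t
  proof -
    have "(\<Sum>p\<in>?F. if fst p = t then (b * he (snd p))\<^sup>2 * a else 0)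
        = (\<Sum>t'\<in>?K. \<Sum>i\<in>J. if t' = t then (b * he i)\<^sup>2 * a else 0)"
      by (simp add: sum.cartesian_product case_prod_beta')
    also have "\<dots> = (\<Sum>t'\<in>?K. if t' = t then \<Sum>i\<in>J. (b * he i)\<^sup>2 * a else 0)"
      by (intro sum.cong) auto
    also have "\<dots> = (\<Sum>i\<in>J. (b * he i)\<^sup>2 * a)"
      using that by simp
    finally show ?thesis by (simp add: sum_distrib_left sum_distrib_right power_mult_distrib)
  qed
  have [measurable]: "f \<in> borel_measurable (PiM ?K (\<lambda>_. borel))" by (rule f)
  let ?L = "PiM ?K (\<lambda>_. lborel :: complex measure)"
  interpret L: sigma_finite_measure ?L by (rule sigma_finite_PiM_lborel) simp
  have fL: "f \<in> borel_measurable ?L"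
    using f by (simp add: measurable_cong_sets[OF sets_PiM_lborel refl])
  define G where "G w = (\<integral>\<^sup>+y. f y \<partial>PiM ?K (\<lambda>t. cgauss (m t + ?s w t) v))" for w
  have G: "G \<in> borel_measurable (PiM ?F (\<lambda>_. complex_gaussian a))"
  proof -
    have "(\<lambda>q. ennreal (\<Prod>t\<in>?K. cn_density v (snd q t - (m t + ?s (fst q) t))) * f (snd q)) \<in> borel_measurable (PiM ?F (\<lambda>_. complex_gaussian a) \<Otimes>\<^sub>M ?L)"
      by (rule shifted_density_measurable[OF _ f]) (rule selected_sum_measurable)
    from L.borel_measurable_nn_integral_fst[OF this]
    show ?thesis
      unfolding G_def nn_integral_PiM_cgauss[OF finite_lessThan v f] fst_conv snd_conv .
  qed
  have "(\<integral>\<^sup>+w. (\<integral>\<^sup>+V. f (\<lambda>t\<in>?K. m t + of_real b * (\<Sum>i\<in>J. of_real (he i) * w (t, i)) + V t)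
              \<partial>(\<Pi>\<^sub>M t\<in>?K. complex_gaussian v)) \<partial>(\<Pi>\<^sub>M ti\<in>?K \<times> I. complex_gaussian a))
      = (\<integral>\<^sup>+w. G (restrict w ?F) \<partial>(\<Pi>\<^sub>M ti\<in>?K \<times> I. complex_gaussian a))"
  proof (rule nn_integral_cong)
    fix w
    have sr: "?s (restrict w ?F) t = ?s w t" for t by (intro sum.cong) auto
    have "(\<lambda>t\<in>?K. m t + of_real b * (\<Sum>i\<in>J. of_real (he i) * w (t, i)) + V t) = (\<lambda>t\<in>?K. (m t + ?s w t) + V t)" for V
      using s[of _ w] by (intro restrict_ext) simp
    then show "(\<integral>\<^sup>+V. f (\<lambda>t\<in>?K. m t + of_real b * (\<Sum>i\<in>J. of_real (he i) * w (t, i)) + V t)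
              \<partial>(\<Pi>\<^sub>M t\<in>?K. complex_gaussian v)) = G (restrict w ?F)"
      unfolding G_def sr by (simp only: nn_integral_PiM_shift[OF v f])
  qed
  also have "\<dots> = (\<integral>\<^sup>+w. G w \<partial>PiM ?F (\<lambda>_. complex_gaussian a))"
    by (rule nn_integral_PiM_restrict[OF prob_space_complex_gaussian[OF a] F(1,3) G])
  also have "\<dots> = (\<integral>\<^sup>+y. f y \<partial>PiM ?K (\<lambda>t. cgauss (m t) (v + (\<Sum>p\<in>?F. if fst p = t then (b * he (snd p))\<^sup>2 * a else 0))))"
    unfolding G_def by (rule nn_integral_noise_sum_finite[OF _ F(1,2) v a f]) simp
  also have "PiM ?K (\<lambda>t. cgauss (m t) (v + (\<Sum>p\<in>?F. if fst p = t then (b * he (snd p))\<^sup>2 * a else 0)))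
      = PiM ?K (\<lambda>t. cgauss (m t) (v + b\<^sup>2 * (\<Sum>i\<in>J. (he i)\<^sup>2) * a))"
    using s2 by (intro PiM_cong) auto
  finally show ?thesis .
qed

lemma cgauss_second_moment:
  assumes v: "v > 0"
  shows "(\<integral>\<^sup>+y. ennreal ((cmod y)\<^sup>2) \<partial>cgauss m v) = ennreal ((cmod m)\<^sup>2 + v)"
  unfolding distr_complex_gaussian_shift[symmetric]
  using complex_gaussian_second_moment_shift[OF v, of m 1] by (subst nn_integral_distr) auto

lemma nn_integral_PiM_cgauss_norm:
  fixes v :: real
  assumes K: "finite K" and v: "v > 0"
  shows "(\<integral>\<^sup>+y. ennreal (\<Sum>t\<in>K. (cmod (y t))\<^sup>2) \<partial>PiM K (\<lambda>t. cgauss (m t) v)) = ennreal ((\<Sum>t\<in>K. (cmod (m t))\<^sup>2) + card K * v)"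
proof -
  let ?M = "\<lambda>t. cgauss (m t) v"
  have cm: "(\<lambda>y. y t) \<in> measurable (PiM K ?M) (?M t)" if "t \<in> K" for t
    using that by (rule measurable_component_singleton)
  have m: "(\<lambda>y. ennreal ((cmod (y t))\<^sup>2)) \<in> borel_measurable (PiM K ?M)" if "t \<in> K" for t
    by (rule measurable_compose[OF cm[OF that]]) (simp add: measurable_cong_sets[OF sets_cgauss refl])
  have "(\<integral>\<^sup>+y. ennreal (\<Sum>t\<in>K. (cmod (y t))\<^sup>2) \<partial>PiM K ?M) = (\<integral>\<^sup>+y. (\<Sum>t\<in>K. ennreal ((cmod (y t))\<^sup>2)) \<partial>PiM K ?M)"
    by simp
  also have "\<dots> = (\<Sum>t\<in>K. \<integral>\<^sup>+y. ennreal ((cmod (y t))\<^sup>2) \<partial>PiM K ?M)"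
    by (rule nn_integral_sum) (rule m)
  also have "\<dots> = (\<Sum>t\<in>K. ennreal ((cmod (m t))\<^sup>2 + v))"
  proof (rule sum.cong[OF refl])
    fix t assume t: "t \<in> K"
    have "(\<integral>\<^sup>+y. ennreal ((cmod y)\<^sup>2) \<partial>distr (PiM K ?M) (?M t) (\<lambda>y. y t)) = (\<integral>\<^sup>+y. ennreal ((cmod (y t))\<^sup>2) \<partial>PiM K ?M)"
      by (rule nn_integral_distr[OF cm[OF t]]) (simp add: measurable_cong_sets[OF sets_cgauss refl])
    moreover have "distr (PiM K ?M) (?M t) (\<lambda>y. y t) = ?M t"
      using t by (intro distr_PiM_component prob_space_cgauss v)
    ultimately show "(\<integral>\<^sup>+y. ennreal ((cmod (y t))\<^sup>2) \<partial>PiM K ?M) = ennreal ((cmod (m t))\<^sup>2 + v)"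
      using cgauss_second_moment[OF v] by simp
  qed
  also have "\<dots> = ennreal ((\<Sum>t\<in>K. (cmod (m t))\<^sup>2) + card K * v)"
    using v by (subst sum_ennreal) (auto simp: sum.distrib)
  finally show ?thesis .
qed

section \<open>The converse\<close>

context
  fixes n P and C :: "(nat \<times> (nat \<Rightarrow> complex)) measure" and vl ve :: real and I :: "nat set"
  assumes C: "wiretap_encoder n P C" and vl: "vl > 0" and ve: "ve > 0"
begin

text \<open>The receiver noise \<open>V\<close> is made the innermost variable because the change of
  measure in the converse acts on \<open>V\<close> with codeword and eavesdropper noise
  fixed.\<close>

lemma nn_integral_wiretap_space:
  assumes f: "f \<in> borel_measurable (wiretap_space n I vl ve C)"
  shows "(\<integral>\<^sup>+\<omega>. f \<omega> \<partial>wiretap_space n I vl ve C)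
    = (\<integral>\<^sup>+c. (\<integral>\<^sup>+w. (\<integral>\<^sup>+V. f (c, V, w) \<partial>(\<Pi>\<^sub>M t\<in>{..<n}. complex_gaussian vl))
        \<partial>(\<Pi>\<^sub>M ti\<in>{..<n} \<times> I. complex_gaussian ve)) \<partial>C)"
proof -
  let ?L = "\<Pi>\<^sub>M t\<in>{..<n}. complex_gaussian vl" and ?E = "\<Pi>\<^sub>M ti\<in>{..<n} \<times> I. complex_gaussian ve"
  interpret C: prob_space C using C by (simp add: wiretap_encoder_def)
  interpret L: prob_space ?L by (intro prob_space_PiM_complex_gaussian vl)
  interpret E: prob_space ?E by (intro prob_space_PiM_complex_gaussian ve)
  interpret LE: pair_prob_space ?L ?E ..
  have f': "f \<in> borel_measurable (C \<Otimes>\<^sub>M (?L \<Otimes>\<^sub>M ?E))"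
    using f by (simp only: wiretap_space_def)
  have "(\<integral>\<^sup>+\<omega>. f \<omega> \<partial>wiretap_space n I vl ve C) = (\<integral>\<^sup>+c. (\<integral>\<^sup>+p. f (c, p) \<partial>(?L \<Otimes>\<^sub>M ?E)) \<partial>C)"
    unfolding wiretap_space_def by (rule LE.nn_integral_fst[OF f', symmetric])
  also have "\<dots> = (\<integral>\<^sup>+c. (\<integral>\<^sup>+w. (\<integral>\<^sup>+V. f (c, V, w) \<partial>?L) \<partial>?E) \<partial>C)"
  proof (rule nn_integral_cong)
    fix c assume c: "c \<in> space C"
    have "(\<lambda>p. f (c, p)) \<in> borel_measurable (?L \<Otimes>\<^sub>M ?E)"
      by (rule measurable_compose[OF measurable_Pair1'[OF c] f'])
    then show "(\<integral>\<^sup>+p. f (c, p) \<partial>(?L \<Otimes>\<^sub>M ?E)) = (\<integral>\<^sup>+w. (\<integral>\<^sup>+V. f (c, V, w) \<partial>?L) \<partial>?E)"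
      by (rule LE.nn_integral_snd[symmetric])
  qed
  finally show ?thesis .
qed

lemma wiretap_coordinates_measurable:
  shows "t < n \<Longrightarrow> (\<lambda>\<omega>. snd (fst \<omega>) t) \<in> borel_measurable (wiretap_space n I vl ve C)"
    and "t < n \<Longrightarrow> (\<lambda>\<omega>. fst (snd \<omega>) t) \<in> borel_measurable (wiretap_space n I vl ve C)"
    and "t < n \<Longrightarrow> i \<in> I \<Longrightarrow> (\<lambda>\<omega>. snd (snd \<omega>) (t, i)) \<in> borel_measurable (wiretap_space n I vl ve C)"
  unfolding measurable_cong_sets[OF sets_wiretap_space[OF C vl ve] refl]
  by (rule measurable_compose[OF _ measurable_component_singleton], 
      (rule measurable_compose[OF measurable_fst measurable_snd] measurable_compose[OF measurable_snd measurable_fst]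
        measurable_compose[OF measurable_snd measurable_snd]), simp)+

lemma noisy_output_measurable:
  assumes "J \<subseteq> I"
  shows "(\<lambda>\<omega>. \<lambda>t\<in>{..<n}. of_real g * snd (fst \<omega>) t + of_real b * (\<Sum>i\<in>J. of_real (he i) * snd (snd \<omega>) (t, i)) + fst (snd \<omega>) t)
    \<in> measurable (wiretap_space n I vl ve C) (\<Pi>\<^sub>M t\<in>{..<n}. borel)"
  using assms
  by (intro measurable_restrict borel_measurable_add borel_measurable_times borel_measurable_const borel_measurable_sum
      wiretap_coordinates_measurable) auto

text \<open>\<open>F\<close> sees only the message and the output, so the correlation with the
  eavesdropper noise is invisible to it. Applied to the error event, this shows that the coupling
  keeps the error probability.\<close>

lemma nn_integral_wiretap_receiver:
  fixes F :: "nat \<Rightarrow> (nat \<Rightarrow> complex) \<Rightarrow> ennreal"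
  assumes J: "finite J" "J \<subseteq> I" and F: "\<And>s. F s \<in> borel_measurable (\<Pi>\<^sub>M t\<in>{..<n}. borel)"
  shows "(\<integral>\<^sup>+\<omega>. F (message \<omega>) (\<lambda>t\<in>{..<n}. of_real g * snd (fst \<omega>) t
            + of_real b * (\<Sum>i\<in>J. of_real (he i) * snd (snd \<omega>) (t, i)) + fst (snd \<omega>) t) \<partial>wiretap_space n I vl ve C)
       = (\<integral>\<^sup>+c. (\<integral>\<^sup>+y. F (fst c) y \<partial>PiM {..<n} (\<lambda>t. cgauss (of_real g * snd c t) (vl + b\<^sup>2 * (\<Sum>i\<in>J. (he i)\<^sup>2) * ve))) \<partial>C)"
proof -
  have "(\<lambda>\<omega>. F (message \<omega>) (\<lambda>t\<in>{..<n}. of_real g * snd (fst \<omega>) t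
            + of_real b * (\<Sum>i\<in>J. of_real (he i) * snd (snd \<omega>) (t, i)) + fst (snd \<omega>) t))
      \<in> borel_measurable (wiretap_space n I vl ve C)"
    by (rule measurable_compose_countable[OF _ message_measurable[OF C vl ve]])
       (rule measurable_compose[OF noisy_output_measurable[OF J(2)] F])
  from nn_integral_wiretap_space[OF this] show ?thesis
    by (simp only: message_def fst_conv snd_conv nn_integral_noise_sum[OF J vl ve F])
qed

lemma receiver_output_eq_noisy_output:
  "receiver_output n hl = (\<lambda>\<omega>. \<lambda>t\<in>{..<n}. of_real hl * snd (fst \<omega>) t + of_real 0 * (\<Sum>i\<in>{}. of_real (he i) * snd (snd \<omega>) (t, i)) + fst (snd \<omega>) t)"
  unfolding receiver_output_def by simp

lemma nn_integral_receiver_output: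
  fixes F :: "nat \<Rightarrow> (nat \<Rightarrow> complex) \<Rightarrow> ennreal"
  assumes F: "\<And>s. F s \<in> borel_measurable (\<Pi>\<^sub>M t\<in>{..<n}. borel)"
  shows "(\<integral>\<^sup>+\<omega>. F (message \<omega>) (receiver_output n hl \<omega>) \<partial>wiretap_space n I vl ve C)
       = (\<integral>\<^sup>+c. (\<integral>\<^sup>+y. F (fst c) y \<partial>PiM {..<n} (\<lambda>t. cgauss (of_real hl * snd c t) vl)) \<partial>C)"
  using nn_integral_wiretap_receiver[of "{}" F hl 0 "\<lambda>_. 0", OF _ _ F]
  by (simp add: receiver_output_eq_noisy_output[of hl "\<lambda>_. 0"])

lemma nn_integral_wiretap_energy:
  assumes J: "finite J" "J \<subseteq> I" and P: "P \<ge> 0" and n: "n > 0"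
  shows "(\<integral>\<^sup>+\<omega>. ennreal (\<Sum>t<n. (cmod (of_real g * snd (fst \<omega>) t
            + of_real b * (\<Sum>i\<in>J. of_real (he i) * snd (snd \<omega>) (t, i)) + fst (snd \<omega>) t))\<^sup>2) \<partial>wiretap_space n I vl ve C)
      \<le> ennreal (n * (g\<^sup>2 * P + (vl + b\<^sup>2 * (\<Sum>i\<in>J. (he i)\<^sup>2) * ve)))"
proof -
  interpret C: prob_space C using C by (simp add: wiretap_encoder_def)
  let ?v = "vl + b\<^sup>2 * (\<Sum>i\<in>J. (he i)\<^sup>2) * ve"
  let ?F = "\<lambda>y::nat \<Rightarrow> complex. ennreal (\<Sum>t<n. (cmod (y t))\<^sup>2)"
  have v: "?v > 0" using vl ve by (intro add_pos_nonneg mult_nonneg_nonneg sum_nonneg) auto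
  have F: "?F \<in> borel_measurable (\<Pi>\<^sub>M t\<in>{..<n}. borel)"
    by (intro measurable_compose[OF _ measurable_ennreal] borel_measurable_sum borel_measurable_power borel_measurable_norm
        measurable_component_singleton) auto
  have xm: "(\<lambda>c. (cmod (snd c t))\<^sup>2) \<in> borel_measurable C" if "t < n" for t
    unfolding measurable_cong_sets[OF sets_encoder[OF C vl ve] refl]
    using that by (intro borel_measurable_power borel_measurable_norm
        measurable_compose[OF measurable_snd measurable_component_singleton]) auto
  have "(\<integral>\<^sup>+\<omega>. ennreal (\<Sum>t<n. (cmod (of_real g * snd (fst \<omega>) t
            + of_real b * (\<Sum>i\<in>J. of_real (he i) * snd (snd \<omega>) (t, i)) + fst (snd \<omega>) t))\<^sup>2) \<partial>wiretap_space n I vl ve C)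
     = (\<integral>\<^sup>+\<omega>. ?F (\<lambda>t\<in>{..<n}. of_real g * snd (fst \<omega>) t
            + of_real b * (\<Sum>i\<in>J. of_real (he i) * snd (snd \<omega>) (t, i)) + fst (snd \<omega>) t) \<partial>wiretap_space n I vl ve C)"
    by simp
  also have "\<dots> = (\<integral>\<^sup>+c. (\<integral>\<^sup>+y. ?F y \<partial>PiM {..<n} (\<lambda>t. cgauss (of_real g * snd c t) ?v)) \<partial>C)"
    by (rule nn_integral_wiretap_receiver[OF J F])
  also have "\<dots> = (\<integral>\<^sup>+c. ennreal ((\<Sum>t<n. (cmod (of_real g * snd c t))\<^sup>2) + n * ?v) \<partial>C)"
    by (simp add: nn_integral_PiM_cgauss_norm[OF finite_lessThan v])
  also have "\<dots> = (\<integral>\<^sup>+c. ennreal (g\<^sup>2) * (\<Sum>t<n. ennreal ((cmod (snd c t))\<^sup>2)) + ennreal (n * ?v) \<partial>C)"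
    using v by (intro nn_integral_cong)
      (simp add: norm_mult power_mult_distrib sum_distrib_left[symmetric] ennreal_plus ennreal_mult sum_nonneg)
  also have "\<dots> = ennreal (g\<^sup>2) * (\<Sum>t<n. \<integral>\<^sup>+c. ennreal ((cmod (snd c t))\<^sup>2) \<partial>C) + ennreal (n * ?v)"
  proof -
    have xm': "(\<lambda>c. ennreal ((cmod (snd c t))\<^sup>2)) \<in> borel_measurable C" if "t \<in> {..<n}" for t
      using that by (intro measurable_compose[OF xm measurable_ennreal]) simp
    have sm: "(\<lambda>c. \<Sum>t<n. ennreal ((cmod (snd c t))\<^sup>2)) \<in> borel_measurable C"
      by (rule borel_measurable_sum) (rule xm')
    have "(\<integral>\<^sup>+c. ennreal (g\<^sup>2) * (\<Sum>t<n. ennreal ((cmod (snd c t))\<^sup>2)) + ennreal (n * ?v) \<partial>C)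
        = (\<integral>\<^sup>+c. ennreal (g\<^sup>2) * (\<Sum>t<n. ennreal ((cmod (snd c t))\<^sup>2)) \<partial>C) + (\<integral>\<^sup>+c. ennreal (n * ?v) \<partial>C)"
      by (intro nn_integral_add borel_measurable_times_ennreal sm borel_measurable_const)
    moreover have "(\<integral>\<^sup>+c. ennreal (g\<^sup>2) * (\<Sum>t<n. ennreal ((cmod (snd c t))\<^sup>2)) \<partial>C)
        = ennreal (g\<^sup>2) * (\<integral>\<^sup>+c. (\<Sum>t<n. ennreal ((cmod (snd c t))\<^sup>2)) \<partial>C)"
      by (rule nn_integral_cmult[OF sm])
    moreover have "(\<integral>\<^sup>+c. (\<Sum>t<n. ennreal ((cmod (snd c t))\<^sup>2)) \<partial>C) = (\<Sum>t<n. \<integral>\<^sup>+c. ennreal ((cmod (snd c t))\<^sup>2) \<partial>C)"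
      by (rule nn_integral_sum) (rule xm')
    ultimately show ?thesis
      by (simp add: C.emeasure_space_1)
  qed
  also have "(\<Sum>t<n. \<integral>\<^sup>+c. ennreal ((cmod (snd c t))\<^sup>2) \<partial>C) \<le> ennreal (n * P)"
  proof -
    have "(\<Sum>t<n. \<integral>\<^sup>+c. ennreal ((cmod (snd c t))\<^sup>2) \<partial>C) / of_nat n \<le> ennreal P"
      using C by (simp add: wiretap_encoder_def)
    then have "of_nat n * ((\<Sum>t<n. \<integral>\<^sup>+c. ennreal ((cmod (snd c t))\<^sup>2) \<partial>C) / of_nat n) \<le> of_nat n * ennreal P"
      by (rule mult_left_mono) simp
    moreover have "of_nat n * (Q / of_nat n) = (Q :: ennreal)" for Q
      using n by (simp add: ennreal_times_divide mult.commute[of _ Q] mult_divide_eq_ennreal)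
    ultimately have "(\<Sum>t<n. \<integral>\<^sup>+c. ennreal ((cmod (snd c t))\<^sup>2) \<partial>C) \<le> ennreal P * of_nat n"
      by (simp only: mult.commute)
    also have "\<dots> = ennreal (n * P)"
      using P by (simp only: ennreal_of_nat_eq_real_of_nat ennreal_mult of_nat_0_le_iff mult.commute)
    finally show ?thesis .
  qed
  then have "ennreal (g\<^sup>2) * (\<Sum>t<n. \<integral>\<^sup>+c. ennreal ((cmod (snd c t))\<^sup>2) \<partial>C) + ennreal (n * ?v)
      \<le> ennreal (g\<^sup>2) * ennreal (n * P) + ennreal (n * ?v)"
    by (intro add_mono mult_left_mono) auto
  also have "\<dots> = ennreal (n * (g\<^sup>2 * P + ?v))"
  proof -
    have *: "ennreal (g\<^sup>2) * ennreal (n * P) + ennreal (n * w) = ennreal (n * (g\<^sup>2 * P + w))" if "w > 0" for w :: real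
    proof -
      have "ennreal (g\<^sup>2) * ennreal (n * P) + ennreal (n * w) = ennreal (g\<^sup>2 * (n * P) + n * w)"
      proof -
        have "ennreal (g\<^sup>2) * ennreal (n * P) = ennreal (g\<^sup>2 * (n * P))"
          using P by (intro ennreal_mult[symmetric]) auto
        moreover have "ennreal (g\<^sup>2 * (n * P)) + ennreal (n * w) = ennreal (g\<^sup>2 * (n * P) + n * w)"
          using P that by (intro ennreal_plus[symmetric]) auto
        ultimately show ?thesis by simp
      qed
      also have "g\<^sup>2 * (n * P) + n * w = n * (g\<^sup>2 * P + w)"
        by (simp add: algebra_simps)
      finally show ?thesis .
    qed
    show ?thesis by (rule *[OF v])
  qed
  finally show ?thesis .
qed

end

lemma encoder_message_set:
  assumes "wiretap_encoder n P C"
  obtains S where "finite S" "S \<noteq> {}" "distr C (count_space UNIV) fst = measure_pmf (pmf_of_set S)"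
  using assms unfolding wiretap_encoder_def by blast

text \<open>Importance weighting: the product is the likelihood ratio that moves the output from
  means \<open>m t\<close> and variance \<open>v\<close> to means \<open>a t\<close> and variance
  \<open>k\<close>. In the converse \<open>a t\<close> is an estimate of the output made from the
  eavesdropper observations.\<close>

lemma nn_integral_output_density_ratio:
  fixes F :: "(nat \<Rightarrow> complex) \<Rightarrow> ennreal"
  assumes v: "v > 0" and k: "k > 0" and F: "F \<in> borel_measurable (\<Pi>\<^sub>M t\<in>{..<n::nat}. borel)"
  shows "(\<integral>\<^sup>+V. F (\<lambda>t\<in>{..<n}. m t + V t) * ennreal (\<Prod>t<n. cn_density k (m t + V t - a t) / cn_density v (V t)) \<partial>(\<Pi>\<^sub>M t\<in>{..<n}. complex_gaussian v))
       = (\<integral>\<^sup>+V. F (\<lambda>t\<in>{..<n}. a t + V t) \<partial>(\<Pi>\<^sub>M t\<in>{..<n}. complex_gaussian k))"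
proof -
  let ?G = "\<lambda>y. F y * ennreal (\<Prod>t<n. cn_density k (y t - a t) / cn_density v (y t - m t))"
  have yt: "(\<lambda>y. y t - b) \<in> borel_measurable (\<Pi>\<^sub>M t\<in>{..<n}. (borel :: complex measure))" if "t < n" for t b
    using that by (intro borel_measurable_diff measurable_component_singleton borel_measurable_const) auto
  have G: "?G \<in> borel_measurable (\<Pi>\<^sub>M t\<in>{..<n}. borel)"
  proof (intro borel_measurable_times_ennreal F measurable_compose[OF _ measurable_ennreal] borel_measurable_prod borel_measurable_divide)
    fix t assume "t \<in> {..<n}"
    then have t: "t < n" by simp
    show "(\<lambda>y. cn_density k (y t - a t)) \<in> borel_measurable (\<Pi>\<^sub>M t\<in>{..<n}. borel)"
      by (rule measurable_compose[OF yt[OF t] cn_density_measurable])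
    show "(\<lambda>y. cn_density v (y t - m t)) \<in> borel_measurable (\<Pi>\<^sub>M t\<in>{..<n}. borel)"
      by (rule measurable_compose[OF yt[OF t] cn_density_measurable])
  qed
  have "(\<integral>\<^sup>+V. F (\<lambda>t\<in>{..<n}. m t + V t) * ennreal (\<Prod>t<n. cn_density k (m t + V t - a t) / cn_density v (V t)) \<partial>(\<Pi>\<^sub>M t\<in>{..<n}. complex_gaussian v))
      = (\<integral>\<^sup>+V. ?G (\<lambda>t\<in>{..<n}. m t + V t) \<partial>(\<Pi>\<^sub>M t\<in>{..<n}. complex_gaussian v))"
    by (intro nn_integral_cong) (simp cong: prod.cong_simp)
  also have "\<dots> = (\<integral>\<^sup>+y. ?G y \<partial>PiM {..<n} (\<lambda>t. cgauss (m t) v))"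
    by (rule nn_integral_PiM_shift[OF v G])
  also have "\<dots> = (\<integral>\<^sup>+y. ennreal (\<Prod>t<n. cn_density v (y t - m t)) * ?G y \<partial>PiM {..<n} (\<lambda>_. lborel))"
    by (rule nn_integral_PiM_cgauss[OF finite_lessThan v G])
  also have "\<dots> = (\<integral>\<^sup>+y. ennreal (\<Prod>t<n. cn_density k (y t - a t)) * F y \<partial>PiM {..<n} (\<lambda>_. lborel))"
  proof (rule nn_integral_cong)
    fix y
    have "(\<Prod>t<n. cn_density v (y t - m t)) * (\<Prod>t<n. cn_density k (y t - a t) / cn_density v (y t - m t)) = (\<Prod>t<n. cn_density k (y t - a t))"
      unfolding prod.distrib[symmetric] using cn_density_pos[OF v] by (intro prod.cong) (auto simp: less_imp_neq[THEN not_sym])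
    then show "ennreal (\<Prod>t<n. cn_density v (y t - m t)) * ?G y = ennreal (\<Prod>t<n. cn_density k (y t - a t)) * F y"
      using v k by (simp add: mult.left_commute[of _ "F y"] ennreal_mult[symmetric] prod_nonneg cn_density_nonneg mult.commute)
  qed
  also have "\<dots> = (\<integral>\<^sup>+y. F y \<partial>PiM {..<n} (\<lambda>t. cgauss (a t) k))"
    by (rule nn_integral_PiM_cgauss[OF finite_lessThan k F, symmetric])
  also have "\<dots> = (\<integral>\<^sup>+V. F (\<lambda>t\<in>{..<n}. a t + V t) \<partial>(\<Pi>\<^sub>M t\<in>{..<n}. complex_gaussian k))"
    by (rule nn_integral_PiM_shift[OF k F, symmetric])
  finally show ?thesis .
qed

lemma ln_cn: "v > 0 \<Longrightarrow> ln (cn_density v z) = - (cmod z)\<^sup>2 / v - ln (pi * v)"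
  by (simp add: cn_density_def ln_div)

lemma measurable_nat_pair:
  fixes f g :: "'a \<Rightarrow> nat"
  assumes "f \<in> measurable M (count_space UNIV)" "g \<in> measurable M (count_space UNIV)" "range (case_prod h) \<subseteq> space N"
  shows "(\<lambda>\<omega>. h (f \<omega>) (g \<omega>)) \<in> measurable M N"
proof (rule measurable_compose_countable[OF _ assms(1)])
  fix i
  have "h i \<in> measurable (count_space UNIV) N"
    using assms(3) by (auto simp: image_subset_iff)
  then show "(\<lambda>\<omega>. h i (g \<omega>)) \<in> measurable M N"
    by (rule measurable_compose[OF assms(2)])
qed

lemma sets_nat_eq:
  fixes f g :: "'a \<Rightarrow> nat"
  assumes "f \<in> measurable M (count_space UNIV)" "g \<in> measurable M (count_space UNIV)"
  shows "{\<omega> \<in> space M. f \<omega> = g \<omega>} \<in> sets M" "{\<omega> \<in> space M. f \<omega> \<noteq> g \<omega>} \<in> sets M"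
  using measurable_nat_pair[OF assms, of "(=)" "count_space UNIV"] measurable_nat_pair[OF assms, of "(\<noteq>)" "count_space UNIV"]
  by (auto intro!: predE simp: pred_def)

text \<open>The joint law of message, codeword and eavesdropper observations is kept, but the receiver noise is
  coupled to the eavesdropper noise: \<open>b N + V\<close>, where \<open>N\<close> is the noise of the combined observation \<open>T\<close>, has the
  law of the receiver noise. Comparing with the law under which the message is independent of
  the observations and \<open>y\<close> is Gaussian with mean \<open>a T\<close> gives a bound for the message entropy.\<close>

lemma converse_code:
  fixes he :: "nat \<Rightarrow> real"
  assumes C: "wiretap_encoder n P C" and dec: "wiretap_decoder n dec" and n: "n > 0" and P: "P \<ge> 0"
    and vl: "vl > 0" and ve: "ve > 0" and J: "finite J" "J \<subseteq> I"
    and h2: "h2 = (\<Sum>i\<in>J. (he i)\<^sup>2)" and v': "v' = vl - b\<^sup>2 * h2 * ve" "v' > 0"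
    and k: "k = (hl - a * h2)\<^sup>2 * P + (b - a)\<^sup>2 * h2 * ve + v'"
    and sec: "equivocation n I he (wiretap_space n I vl ve C) \<ge> message_entropy (wiretap_space n I vl ve C) - e"
    and err: "measure (wiretap_space n I vl ve C)
        {\<omega> \<in> space (wiretap_space n I vl ve C). dec (receiver_output n hl \<omega>) \<noteq> message \<omega>} \<le> e"
  shows "(1 - e) * (ln 2 * message_entropy (wiretap_space n I vl ve C)) \<le> e * ln 2 + n * ln (k / v') + 1"
proof -
  obtain S where S: "finite S" "S \<noteq> {}" and CS: "distr C (count_space UNIV) fst = measure_pmf (pmf_of_set S)"
    by (rule encoder_message_set[OF C])
  define M where "M = real (card S)"
  have M: "M \<ge> 1" "ln M \<ge> 0"
    using S by (auto simp: M_def Suc_le_eq card_gt_0_iff)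
  let ?W0 = "wiretap_space n I vl ve C"
  \<comment> \<open>In \<open>W\<close> the independent receiver noise has only variance
    \<open>v'\<close>. The rest of the receiver noise enters the coupled output \<open>Y\<close> as
    \<open>b\<close> times the combined eavesdropper noise.\<close>
  define W where "W = wiretap_space n I v' ve C"
  let ?Zs = "\<Pi>\<^sub>M ti\<in>{..<n} \<times> I. (borel :: complex measure)"
  let ?Ys = "\<Pi>\<^sub>M t\<in>{..<n}. (borel :: complex measure)"
  let ?Z = "eavesdropper_output n I he"
  let ?L = "distr W ?Zs ?Z"
  interpret W0: prob_space ?W0 by (rule prob_space_wiretap_space[OF C vl ve])
  interpret W: prob_space W unfolding W_def by (rule prob_space_wiretap_space[OF C v'(2) ve])
  have msg: "message \<in> measurable W (count_space UNIV)"
    unfolding W_def by (rule message_measurable[OF C v'(2) ve])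
  have Zm: "?Z \<in> measurable W ?Zs"
    unfolding W_def by (rule eavesdropper_output_measurable[OF C v'(2) ve])
  interpret L: prob_space ?L by (rule W.prob_space_distr[OF Zm])
  have WS: "distr W (count_space UNIV) message = measure_pmf (pmf_of_set S)"
    unfolding W_def distr_message[OF C v'(2) ve] by (rule CS)
  have W0S: "distr ?W0 (count_space UNIV) message = measure_pmf (pmf_of_set S)"
    unfolding distr_message[OF C vl ve] by (rule CS)
  have H: "message_entropy ?W0 = log 2 M"
    unfolding message_entropy_def M_def
    by (rule W0.uniform_message_entropy[OF message_measurable[OF C vl ve] eavesdropper_output_measurable[OF C vl ve, where he = he] S W0S])
  note ctx = msg Zm S WS
  obtain r where r: "is_posterior W message ?Z ?Zs S r"
    using W.posterior_exists[OF ctx] by blast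
  note r_meas = W.posterior_measurable[OF ctx r] and r0 = W.posterior_nonneg[OF ctx r]
    and r1 = W.posterior_le_1[OF ctx r]
  have equi: "equivocation n I he ?W0 = - (\<Sum>s\<in>S. \<integral>z. r s z * log 2 (r s z) \<partial>?L)"
    using equivocation_receiver_noise_irrelevant[OF C vl v'(2) ve, of I he] W.posterior_conditional_entropy[OF ctx r]
    by (simp only: equivocation_def[of n I he W] W_def[symmetric])

  have h20: "h2 \<ge> 0" unfolding h2 by (intro sum_nonneg) auto
  have kp: "k > 0" unfolding k using P h20 ve v'(2) by (intro add_nonneg_pos add_nonneg_nonneg mult_nonneg_nonneg) auto

  define x where "x t \<omega> = snd (fst \<omega>) t" for t :: nat and \<omega> :: wiretap_sample
  define V where "V t \<omega> = fst (snd \<omega>) t" for t :: nat and \<omega> :: wiretap_sample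
  define T where "T z t = (\<Sum>i\<in>J. of_real (he i) * z (t, i))" for z :: "nat \<times> nat \<Rightarrow> complex" and t :: nat
  define Y where "Y \<omega> = (\<lambda>t\<in>{..<n}. of_real hl * x t \<omega> + of_real b * T (snd (snd \<omega>)) t + V t \<omega>)" for \<omega>
  \<comment> \<open>\<open>U t\<close> is what remains of the coupled output after subtraction of
    the linear estimate \<open>a * T\<close>; \<open>k\<close> bounds its mean square per
    symbol.\<close>
  define U where "U t \<omega> = of_real hl * x t \<omega> + of_real b * T (snd (snd \<omega>)) t + V t \<omega> - of_real a * T (?Z \<omega>) t" for t \<omega>
  have TZ: "T (?Z \<omega>) t = of_real h2 * x t \<omega> + T (snd (snd \<omega>)) t" if "t < n" for t \<omega>
  proof -
    have "T (?Z \<omega>) t = (\<Sum>i\<in>J. of_real (he i) * (of_real (he i) * x t \<omega> + snd (snd \<omega>) (t, i)))"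
      unfolding T_def eavesdropper_output_def x_def using that J by (intro sum.cong) auto
    also have "\<dots> = of_real h2 * x t \<omega> + T (snd (snd \<omega>)) t"
      unfolding h2 T_def by (simp add: distrib_left sum.distrib sum_distrib_right power2_eq_square mult.assoc)
    finally show ?thesis .
  qed
  have U: "U t \<omega> = of_real (hl - a * h2) * x t \<omega> + of_real (b - a) * T (snd (snd \<omega>)) t + V t \<omega>" if "t < n" for t \<omega>
    unfolding U_def TZ[OF that] by (simp add: algebra_simps)

  have Ym: "Y \<in> measurable W ?Ys"
    unfolding Y_def x_def V_def T_def W_def by (rule noisy_output_measurable[OF C v'(2) ve J(2)])
  have dm: "dec \<in> measurable ?Ys (count_space UNIV)"
    using dec by (simp add: wiretap_decoder_def)
  have decY: "(\<lambda>\<omega>. dec (Y \<omega>)) \<in> measurable W (count_space UNIV)"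
    by (rule measurable_compose[OF Ym dm])
  have Vm: "V t \<in> borel_measurable W" if "t < n" for t
    unfolding V_def W_def by (rule wiretap_coordinates_measurable[OF C v'(2) ve that])
  have Um: "U t \<in> borel_measurable W" if "t < n" for t
  proof -
    have "(\<lambda>\<omega>. of_real (hl - a * h2) * x t \<omega> + of_real (b - a) * T (snd (snd \<omega>)) t + V t \<omega>) \<in> borel_measurable W"
      unfolding x_def V_def T_def W_def using that J
      by (intro borel_measurable_add borel_measurable_times borel_measurable_const borel_measurable_sum
        wiretap_coordinates_measurable[OF C v'(2) ve]) auto
    moreover have "U t = (\<lambda>\<omega>. of_real (hl - a * h2) * x t \<omega> + of_real (b - a) * T (snd (snd \<omega>)) t + V t \<omega>)"
      by (rule ext) (rule U[OF that])
    ultimately show ?thesis by (simp only:)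
  qed
  have rm: "(\<lambda>\<omega>. r (message \<omega>) (?Z \<omega>)) \<in> borel_measurable W"
    by (rule measurable_compose_countable[OF _ msg]) (rule measurable_compose[OF Zm r_meas])

  define A where "A = {\<omega> \<in> space W. dec (Y \<omega>) = message \<omega>}"
  have Am: "A \<in> sets W"
    unfolding A_def by (rule sets_nat_eq[OF decY msg])
  \<comment> \<open>The decoder is run on the coupled output instead of the true one; both have the
    same joint law with the message.\<close>
  have PA: "measure W A \<ge> 1 - e"
  proof -
    let ?F = "\<lambda>s y. indicator {d. d \<noteq> s} (dec y) :: ennreal"
    have F: "?F s \<in> borel_measurable ?Ys" for s
      by (rule measurable_compose[OF dm]) simp
    have vv: "v' + b\<^sup>2 * (\<Sum>i\<in>J. (he i)\<^sup>2) * ve = vl" by (simp add: v'(1) h2)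
    have "emeasure W {\<omega> \<in> space W. dec (Y \<omega>) \<noteq> message \<omega>} = (\<integral>\<^sup>+\<omega>. indicator {\<omega> \<in> space W. dec (Y \<omega>) \<noteq> message \<omega>} \<omega> \<partial>W)"
      by (rule nn_integral_indicator[symmetric]) (rule sets_nat_eq[OF decY msg])
    also have "\<dots> = (\<integral>\<^sup>+\<omega>. ?F (message \<omega>) (Y \<omega>) \<partial>W)"
      by (intro nn_integral_cong) (auto simp: indicator_def)
    also have "\<dots> = (\<integral>\<^sup>+c. (\<integral>\<^sup>+y. ?F (fst c) y \<partial>PiM {..<n} (\<lambda>t. cgauss (of_real hl * snd c t) vl)) \<partial>C)"
      using nn_integral_wiretap_receiver[OF C v'(2) ve J F, where g = hl and b = b and he = he, unfolded vv]
      by (simp only: W_def Y_def x_def V_def T_def)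
    also have "\<dots> = (\<integral>\<^sup>+\<omega>. ?F (message \<omega>) (receiver_output n hl \<omega>) \<partial>?W0)"
      by (rule nn_integral_receiver_output[OF C vl ve F, symmetric])
    also have "\<dots> = (\<integral>\<^sup>+\<omega>. indicator {\<omega> \<in> space ?W0. dec (receiver_output n hl \<omega>) \<noteq> message \<omega>} \<omega> \<partial>?W0)"
      by (intro nn_integral_cong) (auto simp: indicator_def)
    also have "\<dots> = emeasure ?W0 {\<omega> \<in> space ?W0. dec (receiver_output n hl \<omega>) \<noteq> message \<omega>}"
      by (rule nn_integral_indicator)
        (rule sets_nat_eq[OF measurable_compose[OF receiver_output_measurable[OF C vl ve] dm] message_measurable[OF C vl ve]])
    finally have "measure W {\<omega> \<in> space W. dec (Y \<omega>) \<noteq> message \<omega>} \<le> e"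
      using err by (simp add: measure_def)
    moreover have "{\<omega> \<in> space W. dec (Y \<omega>) \<noteq> message \<omega>} = space W - A"
      by (auto simp: A_def)
    ultimately show ?thesis
      using W.prob_compl[OF Am] by simp
  qed

  \<comment> \<open>Ratio of the comparison density of the output, Gaussian about
    \<open>a * T\<close> with variance \<open>k\<close>, to its true density given the codeword and
    the eavesdropper noise.\<close>
  define R where "R \<omega> = (\<Prod>t<n. cn_density k (U t \<omega>) / cn_density v' (V t \<omega>))" for \<omega>
  have R0: "R \<omega> > 0" for \<omega>
    unfolding R_def using cn_density_pos[OF kp] cn_density_pos[OF v'(2)] by (intro prod_pos) simp
  have Rm: "R \<in> borel_measurable W"
    unfolding R_def by (intro borel_measurable_prod borel_measurable_divide measurable_compose[OF _ cn_density_measurable] Um Vm) simp_all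
  define F where "F s y = ennreal (1 + M * (if dec y = s then 1 else 0))" for s y
  have Fm: "F s \<in> borel_measurable ?Ys" for s
    unfolding F_def by (rule measurable_compose[OF dm]) simp
  \<comment> \<open>The weight \<open>R / (M * r)\<close> turns the true law into the comparison
    law, where the message is uniform and independent of the observations. The factor
    \<open>1 + M\<close> times the indicator of correct decoding dominates \<open>M\<close> raised
    to that indicator, yet has a small mean: under independence a guess is right with probability at
    most \<open>1 / M\<close>.\<close>
  define q where "q \<omega> = 1 / (M * r (message \<omega>) (?Z \<omega>)) * ((1 + M * (if dec (Y \<omega>) = message \<omega> then 1 else 0)) * R \<omega>)" for \<omega>
  have eqm: "(\<lambda>\<omega>. if dec (Y \<omega>) = message \<omega> then 1 else 0 :: real) \<in> borel_measurable W"
    by (rule measurable_nat_pair[OF decY msg]) simp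
  have qm: "q \<in> borel_measurable W"
    unfolding q_def by (intro borel_measurable_times borel_measurable_divide borel_measurable_const borel_measurable_add
      rm Rm eqm)
  have q0: "q \<omega> \<ge> 0" for \<omega>
    unfolding q_def using M R0[of \<omega>] r0 by (intro mult_nonneg_nonneg divide_nonneg_nonneg add_nonneg_nonneg) (auto intro: less_imp_le)

  let ?N = "\<Pi>\<^sub>M t\<in>{..<n}. complex_gaussian k" and ?V = "\<Pi>\<^sub>M t\<in>{..<n}. complex_gaussian v'"
  interpret N: prob_space ?N by (intro prob_space_PiM_complex_gaussian kp)
  interpret PV: prob_space ?V by (intro prob_space_PiM_complex_gaussian v')
  define G where "G c s z = (\<integral>\<^sup>+V. ennreal (c z) * F s (\<lambda>t\<in>{..<n}. of_real a * T z t + V t) \<partial>?N)"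
    for c :: "(nat \<times> nat \<Rightarrow> complex) \<Rightarrow> real" and s z
  have Gm: "G c s \<in> borel_measurable ?Zs" if c: "c \<in> borel_measurable ?Zs" for c s
  proof -
    have "(\<lambda>p. ennreal (c (fst p)) * F s (\<lambda>t\<in>{..<n}. of_real a * T (fst p) t + snd p t)) \<in> borel_measurable (?Zs \<Otimes>\<^sub>M ?N)"
    proof (intro borel_measurable_times_ennreal measurable_compose[OF _ measurable_ennreal] measurable_compose[OF measurable_fst c]
        measurable_compose[OF _ Fm] measurable_restrict borel_measurable_add borel_measurable_times borel_measurable_const)
      fix t assume t: "t \<in> {..<n}"
      show "(\<lambda>p. T (fst p) t) \<in> borel_measurable (?Zs \<Otimes>\<^sub>M ?N)"
        unfolding T_def using t J
        by (intro borel_measurable_sum borel_measurable_times borel_measurable_const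
            measurable_compose[OF measurable_fst measurable_component_singleton]) auto
      have "(\<lambda>V. V t) \<in> borel_measurable ?N"
        unfolding measurable_cong_sets[OF sets_PiM_complex_gaussian refl] using t by (rule measurable_component_singleton)
      then show "(\<lambda>p. snd p t) \<in> borel_measurable (?Zs \<Otimes>\<^sub>M ?N)"
        by (rule measurable_compose[OF measurable_snd])
    qed
    from N.borel_measurable_nn_integral_fst[OF this] show ?thesis
      unfolding G_def[abs_def] fst_conv snd_conv .
  qed
  have Fshift: "(\<lambda>V. F s (\<lambda>t\<in>{..<n}. of_real a * T z t + V t)) \<in> borel_measurable ?N" for s z
  proof (intro measurable_compose[OF _ Fm] measurable_restrict borel_measurable_add borel_measurable_const)
    fix t assume "t \<in> {..<n}"
    then show "(\<lambda>V. V t) \<in> borel_measurable ?N"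
      unfolding measurable_cong_sets[OF sets_PiM_complex_gaussian refl] by (rule measurable_component_singleton)
  qed
  have Gc: "G c s z = ennreal (c z) * (\<integral>\<^sup>+V. F s (\<lambda>t\<in>{..<n}. of_real a * T z t + V t) \<partial>?N)" for c s z
    unfolding G_def by (rule nn_integral_cmult[OF Fshift])
  let ?c = "\<lambda>s z. 1 / (M * r s z)"
  have cm: "?c s \<in> borel_measurable ?Zs" for s
    by (intro borel_measurable_divide borel_measurable_times borel_measurable_const r_meas)
  have G_W: "(\<lambda>\<omega>. G (?c (message \<omega>)) (message \<omega>) (?Z \<omega>)) \<in> borel_measurable W"
    by (rule measurable_compose_countable[OF _ msg]) (rule measurable_compose[OF Zm Gm[OF cm]])
  \<comment> \<open>Integration over \<open>V\<close> replaces the output law by the comparison law;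
    the posterior identity then cancels \<open>r\<close> and leaves the weight \<open>1 / M\<close>
    for every message. Of the bound 2, one unit comes from the constant 1 and at most one from
    correct guesses, as \<open>dec\<close> names a single message.\<close>
  have q_int: "(\<integral>\<^sup>+\<omega>. ennreal (q \<omega>) \<partial>W) \<le> 2"
  proof -
    define z0 where "z0 c w = (\<lambda>(t, i)\<in>{..<n} \<times> I. complex_of_real (he i) * snd c t + w (t, i))"
      for c :: "nat \<times> (nat \<Rightarrow> complex)" and w
    have z0: "?Z (c, V, w) = z0 c w" for c V w
      by (simp add: eavesdropper_output_def z0_def)
    have "(\<integral>\<^sup>+\<omega>. ennreal (q \<omega>) \<partial>W) = (\<integral>\<^sup>+c. (\<integral>\<^sup>+w. (\<integral>\<^sup>+V. ennreal (q (c, V, w)) \<partial>?V)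
        \<partial>(\<Pi>\<^sub>M ti\<in>{..<n} \<times> I. complex_gaussian ve)) \<partial>C)"
      unfolding W_def
      by (rule nn_integral_wiretap_space[OF C v'(2) ve]) (rule measurable_compose[OF qm[unfolded W_def] measurable_ennreal])
    also have "\<dots> = (\<integral>\<^sup>+c. (\<integral>\<^sup>+w. (\<integral>\<^sup>+V. G (?c (message (c, V, w))) (message (c, V, w)) (?Z (c, V, w)) \<partial>?V)
        \<partial>(\<Pi>\<^sub>M ti\<in>{..<n} \<times> I. complex_gaussian ve)) \<partial>C)"
    proof (rule nn_integral_cong, rule nn_integral_cong)
      fix c :: "nat \<times> (nat \<Rightarrow> complex)" and w :: "nat \<times> nat \<Rightarrow> complex"
      let ?s = "fst c"
      let ?m = "\<lambda>t. of_real hl * snd c t + of_real b * T w t"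
      let ?F = "\<lambda>y. ennreal (?c ?s (z0 c w)) * F ?s y"
      have c0: "?c ?s (z0 c w) \<ge> 0" using M r0[of ?s "z0 c w"] by simp
      have "(\<integral>\<^sup>+V. ennreal (q (c, V, w)) \<partial>?V)
          = (\<integral>\<^sup>+V. ?F (\<lambda>t\<in>{..<n}. ?m t + V t) * ennreal (\<Prod>t<n. cn_density k (?m t + V t - of_real a * T (z0 c w) t) / cn_density v' (V t)) \<partial>?V)"
      proof (rule nn_integral_cong)
        fix V'
        have "q (c, V', w) = ?c ?s (z0 c w) * (1 + M * (if dec (\<lambda>t\<in>{..<n}. ?m t + V' t) = ?s then 1 else 0))
            * (\<Prod>t<n. cn_density k (?m t + V' t - of_real a * T (z0 c w) t) / cn_density v' (V' t))"
          by (simp add: q_def R_def Y_def U_def x_def V_def z0 message_def mult.assoc)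
        moreover have "(\<Prod>t<n. cn_density k (?m t + V' t - of_real a * T (z0 c w) t) / cn_density v' (V' t)) \<ge> 0"
          using kp v'(2) by (intro prod_nonneg) (simp add: cn_density_nonneg)
        ultimately show "ennreal (q (c, V', w)) = ?F (\<lambda>t\<in>{..<n}. ?m t + V' t)
            * ennreal (\<Prod>t<n. cn_density k (?m t + V' t - of_real a * T (z0 c w) t) / cn_density v' (V' t))"
          unfolding F_def using c0 M by (simp only: ennreal_mult[symmetric] mult_nonneg_nonneg add_nonneg_nonneg zero_le_one split: if_splits) auto
      qed
      also have "\<dots> = (\<integral>\<^sup>+V. ?F (\<lambda>t\<in>{..<n}. of_real a * T (z0 c w) t + V t) \<partial>?N)"
        by (rule nn_integral_output_density_ratio[OF v'(2) kp]) (intro borel_measurable_times_ennreal borel_measurable_const Fm)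
      also have "\<dots> = G (?c ?s) ?s (z0 c w)"
        by (simp add: G_def)
      also have "\<dots> = (\<integral>\<^sup>+V. G (?c (message (c, V, w))) (message (c, V, w)) (?Z (c, V, w)) \<partial>?V)"
        unfolding z0 message_def fst_conv by (simp add: PV.emeasure_space_1)
      finally show "(\<integral>\<^sup>+V. ennreal (q (c, V, w)) \<partial>?V)
          = (\<integral>\<^sup>+V. G (?c (message (c, V, w))) (message (c, V, w)) (?Z (c, V, w)) \<partial>?V)" .
    qed
    also have "\<dots> = (\<integral>\<^sup>+\<omega>. G (?c (message \<omega>)) (message \<omega>) (?Z \<omega>) \<partial>W)"
      unfolding W_def by (rule nn_integral_wiretap_space[OF C v'(2) ve G_W[unfolded W_def], symmetric])
    also have "\<dots> = (\<Sum>s\<in>S. \<integral>\<^sup>+z. ennreal (r s z) * G (?c s) s z \<partial>?L)"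
      by (rule W.posterior_nn_integral[OF ctx r Gm[OF cm]])
    also have "\<dots> \<le> (\<Sum>s\<in>S. \<integral>\<^sup>+z. G (\<lambda>_. 1 / M) s z \<partial>?L)"
    proof (intro sum_mono nn_integral_mono)
      fix s z
      have "ennreal (r s z) * ennreal (?c s z) \<le> ennreal (1 / M)"
        using M r0[of s z] by (cases "r s z = 0") (simp_all add: ennreal_mult[symmetric])
      then show "ennreal (r s z) * G (?c s) s z \<le> G (\<lambda>_. 1 / M) s z"
        unfolding Gc mult.assoc[symmetric] by (rule mult_right_mono) simp
    qed
    also have "\<dots> = (\<integral>\<^sup>+z. (\<Sum>s\<in>S. G (\<lambda>_. 1 / M) s z) \<partial>?L)"
      by (rule nn_integral_sum[symmetric]) (simp add: Gm)
    also have "\<dots> \<le> (\<integral>\<^sup>+z. 2 \<partial>?L)"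
    proof (rule nn_integral_mono)
      fix z
      have "(\<Sum>s\<in>S. G (\<lambda>_. 1 / M) s z)
          = (\<integral>\<^sup>+V. (\<Sum>s\<in>S. ennreal (1 / M) * F s (\<lambda>t\<in>{..<n}. of_real a * T z t + V t)) \<partial>?N)"
        unfolding G_def by (rule nn_integral_sum[symmetric]) (intro borel_measurable_times_ennreal borel_measurable_const Fshift)
      also have "\<dots> \<le> (\<integral>\<^sup>+V. 2 \<partial>?N)"
      proof (rule nn_integral_mono)
        fix V'
        let ?y = "\<lambda>t\<in>{..<n}. of_real a * T z t + V' t"
        have "(\<Sum>s\<in>S. ennreal (1 / M) * F s ?y) = ennreal (\<Sum>s\<in>S. 1 / M + (if dec ?y = s then 1 else 0))"
        proof -
          have "ennreal (1 / M) * F s ?y = ennreal (1 / M + (if dec ?y = s then 1 else 0))" for s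
          proof -
            have "ennreal (1 / M) * F s ?y = ennreal (1 / M * (1 + M * (if dec ?y = s then 1 else 0)))"
              unfolding F_def using M by (intro ennreal_mult[symmetric]) auto
            also have "1 / M * (1 + M * (if dec ?y = s then 1 else 0)) = 1 / M + (if dec ?y = s then 1 else 0)"
              using M by (simp add: field_simps)
            finally show ?thesis .
          qed
          then show ?thesis
            using M by (simp only:) (rule sum_ennreal, simp)
        qed
        also have "(\<Sum>s\<in>S. 1 / M + (if dec ?y = s then 1 else 0)) = 1 + (if dec ?y \<in> S then 1 else 0)"
          using S M by (simp add: sum.distrib M_def)
        also have "ennreal (1 + (if dec ?y \<in> S then 1 else 0)) \<le> ennreal 2"
          by (intro ennreal_leI) simp
        also have "ennreal 2 = 2" by simp
        finally show "(\<Sum>s\<in>S. ennreal (1 / M) * F s ?y) \<le> 2" .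
      qed
      finally show "(\<Sum>s\<in>S. G (\<lambda>_. 1 / M) s z) \<le> 2"
        by (simp add: N.emeasure_space_1)
    qed
    also have "(\<integral>\<^sup>+z. 2 \<partial>?L) = 2"
      by (simp only: nn_integral_const L.emeasure_space_1 mult_1_right)
    finally show ?thesis .
  qed
  have energyU: "(\<integral>\<^sup>+\<omega>. ennreal (\<Sum>t<n. (cmod (U t \<omega>))\<^sup>2) \<partial>W) \<le> ennreal (n * k)"
  proof -
    have "(\<integral>\<^sup>+\<omega>. ennreal (\<Sum>t<n. (cmod (U t \<omega>))\<^sup>2) \<partial>W)
        = (\<integral>\<^sup>+\<omega>. ennreal (\<Sum>t<n. (cmod (of_real (hl - a * h2) * snd (fst \<omega>) t
            + of_real (b - a) * (\<Sum>i\<in>J. of_real (he i) * snd (snd \<omega>) (t, i)) + fst (snd \<omega>) t))\<^sup>2) \<partial>W)"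
      using U by (intro nn_integral_cong arg_cong[where f = ennreal] sum.cong) (simp_all add: x_def V_def T_def)
    also have "\<dots> \<le> ennreal (n * ((hl - a * h2)\<^sup>2 * P + (v' + (b - a)\<^sup>2 * (\<Sum>i\<in>J. (he i)\<^sup>2) * ve)))"
      unfolding W_def by (rule nn_integral_wiretap_energy[OF C v'(2) ve J P n])
    finally show ?thesis by (simp add: k h2 add_ac)
  qed
  have energyV: "(\<integral>\<^sup>+\<omega>. ennreal (\<Sum>t<n. (cmod (V t \<omega>))\<^sup>2) \<partial>W) = ennreal (n * v')"
  proof -
    let ?F = "\<lambda>(_::nat) y::nat \<Rightarrow> complex. ennreal (\<Sum>t<n. (cmod (y t))\<^sup>2)"
    have F: "?F s \<in> borel_measurable ?Ys" for s
      by (intro measurable_compose[OF _ measurable_ennreal] borel_measurable_sum borel_measurable_power borel_measurable_norm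
        measurable_component_singleton) auto
    interpret C: prob_space C using C by (simp add: wiretap_encoder_def)
    have "(\<integral>\<^sup>+\<omega>. ennreal (\<Sum>t<n. (cmod (V t \<omega>))\<^sup>2) \<partial>W) = (\<integral>\<^sup>+\<omega>. ?F (message \<omega>) (receiver_output n 0 \<omega>) \<partial>W)"
      by (simp add: receiver_output_def V_def)
    also have "\<dots> = (\<integral>\<^sup>+c. (\<integral>\<^sup>+y. ?F (fst c) y \<partial>PiM {..<n} (\<lambda>t. cgauss (of_real 0 * snd c t) v')) \<partial>C)"
      unfolding W_def by (rule nn_integral_receiver_output[OF C v'(2) ve F])
    also have "\<dots> = ennreal (n * v')"
      by (simp add: nn_integral_PiM_cgauss_norm[OF finite_lessThan v'(2)] C.emeasure_space_1)
    finally show ?thesis .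
  qed
  have lr0: "0 \<le> (\<integral>z. - (r s z * ln (r s z)) \<partial>?L)" for s
  proof (rule Bochner_Integration.integral_nonneg)
    show "0 \<le> - (r s z * ln (r s z))" for z
      using r0[of s z] r1[of s z] by (cases "r s z = 0") (auto intro!: mult_nonneg_nonpos)
  qed
  have lr_sum: "(\<Sum>s\<in>S. \<integral>z. - (r s z * ln (r s z)) \<partial>?L) = ln 2 * equivocation n I he ?W0"
    unfolding equi by (simp add: log_def sum_distrib_left sum_negf[symmetric])
  have equi0: "equivocation n I he ?W0 \<ge> 0"
  proof -
    have "0 \<le> (\<Sum>s\<in>S. \<integral>z. - (r s z * ln (r s z)) \<partial>?L)"
      by (rule sum_nonneg) (rule lr0)
    then show ?thesis
      unfolding lr_sum by (simp add: zero_le_mult_iff)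
  qed
  have post_int: "(\<integral>\<^sup>+\<omega>. ennreal (- ln (r (message \<omega>) (?Z \<omega>))) \<partial>W) = ennreal (ln 2 * equivocation n I he ?W0)"
  proof -
    have "(\<integral>\<^sup>+\<omega>. ennreal (- ln (r (message \<omega>) (?Z \<omega>))) \<partial>W) = (\<Sum>s\<in>S. \<integral>\<^sup>+z. ennreal (r s z) * ennreal (- ln (r s z)) \<partial>?L)"
      by (rule W.posterior_nn_integral[OF ctx r])
         (intro measurable_compose[OF _ measurable_ennreal] borel_measurable_uminus borel_measurable_ln r_meas)
    also have "\<dots> = (\<Sum>s\<in>S. ennreal (\<integral>z. - (r s z * ln (r s z)) \<partial>?L))"
    proof (rule sum.cong[OF refl])
      fix s
      have m: "(\<lambda>z. - (r s z * ln (r s z))) \<in> borel_measurable ?L"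
        unfolding measurable_distr_eq1 by (intro borel_measurable_uminus borel_measurable_times borel_measurable_ln r_meas)
      have nn: "0 \<le> - (r s z * ln (r s z))" for z
        using r0[of s z] r1[of s z] by (cases "r s z = 0") (auto intro!: mult_nonneg_nonpos)
      have "(\<integral>\<^sup>+z. ennreal (r s z) * ennreal (- ln (r s z)) \<partial>?L) = (\<integral>\<^sup>+z. ennreal (- (r s z * ln (r s z))) \<partial>?L)"
        using r0[of s] by (intro nn_integral_cong) (simp add: ennreal_mult'[symmetric])
      also have "\<dots> = ennreal (\<integral>z. - (r s z * ln (r s z)) \<partial>?L)"
      proof (rule nn_integral_eq_integral)
        show "integrable ?L (\<lambda>z. - (r s z * ln (r s z)))"
        proof (rule L.integrable_const_bound[where B = 1, OF _ m], rule AE_I2)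
          fix z
          show "norm (- (r s z * ln (r s z))) \<le> 1"
            unfolding real_norm_def abs_minus_cancel by (rule abs_mult_ln_le_1[OF r0 r1])
        qed
        show "AE z in ?L. 0 \<le> - (r s z * ln (r s z))"
          by (rule AE_I2) (rule nn)
      qed
      finally show "(\<integral>\<^sup>+z. ennreal (r s z) * ennreal (- ln (r s z)) \<partial>?L) = ennreal (\<integral>z. - (r s z * ln (r s z)) \<partial>?L)" .
    qed
    also have "\<dots> = ennreal (\<Sum>s\<in>S. \<integral>z. - (r s z * ln (r s z)) \<partial>?L)"
      by (rule sum_ennreal) (rule lr0)
    finally show ?thesis unfolding lr_sum .
  qed
  \<comment> \<open>Division by \<open>r\<close> is legitimate almost surely: the message that was
    sent has posterior 0 only on a null set.\<close>
  have r_pos: "AE \<omega> in W. r (message \<omega>) (?Z \<omega>) > 0"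
  proof -
    have "(\<integral>\<^sup>+\<omega>. indicator {0} (r (message \<omega>) (?Z \<omega>)) \<partial>W) = (\<Sum>s\<in>S. \<integral>\<^sup>+z. ennreal (r s z) * indicator {0} (r s z) \<partial>?L)"
      by (rule W.posterior_nn_integral[OF ctx r]) (rule measurable_compose[OF r_meas], simp)
    also have "\<dots> = 0"
    proof -
      have "ennreal (r s z) * indicator {0} (r s z) = 0" for s z
        by (cases "r s z = 0") simp_all
      then show ?thesis by (simp only:) simp
    qed
    finally have z: "(\<integral>\<^sup>+\<omega>. indicator {0} (r (message \<omega>) (?Z \<omega>)) \<partial>W) = 0" .
    have m: "(\<lambda>\<omega>. indicator {0} (r (message \<omega>) (?Z \<omega>)) :: ennreal) \<in> borel_measurable W"
      by (rule measurable_compose[OF rm]) simp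
    have "AE \<omega> in W. indicator {0} (r (message \<omega>) (?Z \<omega>)) = (0 :: ennreal)"
      by (rule nn_integral_0_iff_AE[OF m, THEN iffD1, OF z])
    then show ?thesis
      by (rule AE_mp, intro AE_I2 impI) (use r0 in \<open>auto simp: indicator_def less_le split: if_splits\<close>)
  qed
  let ?SU = "\<lambda>\<omega>. \<Sum>t<n. (cmod (U t \<omega>))\<^sup>2" and ?SV = "\<lambda>\<omega>. \<Sum>t<n. (cmod (V t \<omega>))\<^sup>2"
  have kv: "k \<ge> v'" unfolding k using P h20 ve by simp
  define D where "D = ln M + n * ln (k / v')"
  have D0: "D \<ge> 0" using M kv v'(2) by (simp add: D_def)
  \<comment> \<open>This is \<open>ln u \<le> u - 1\<close> together with \<open>u \<le> q\<close>,
    rearranged so that every summand on either side is nonnegative and can be integrated as such.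
    After integration the energy terms are \<open>n\<close> on the left and at most \<open>n\<close>
    on the right, and they cancel.\<close>
  have pointwise: "indicator A \<omega> * ln M + - ln (r (message \<omega>) (?Z \<omega>)) + ?SV \<omega> / v' + 1
      \<le> D + ?SU \<omega> / k + q \<omega>" if "r (message \<omega>) (?Z \<omega>) > 0" "\<omega> \<in> space W" for \<omega>
  proof -
    let ?r = "r (message \<omega>) (?Z \<omega>)"
    define u where "u = M powr (indicator A \<omega>) * R \<omega> / (M * ?r)"
    have u: "u > 0" unfolding u_def using M R0 that(1) by simp
    have "ln (R \<omega>) = (\<Sum>t<n. ln (cn_density k (U t \<omega>)) - ln (cn_density v' (V t \<omega>)))"
      unfolding R_def using cn_density_pos[OF kp] cn_density_pos[OF v'(2)] by (simp add: ln_prod ln_div less_imp_neq[THEN not_sym])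
    also have "\<dots> = - ?SU \<omega> / k + ?SV \<omega> / v' - n * ln (k / v')"
      using kp v'(2) by (simp add: ln_cn sum.distrib sum_subtractf sum_divide_distrib sum_negf ln_mult ln_div algebra_simps)
    finally have lnR: "ln (R \<omega>) = - ?SU \<omega> / k + ?SV \<omega> / v' - n * ln (k / v')" .
    have "ln u = indicator A \<omega> * ln M + ln (R \<omega>) - ln M - ln ?r"
      unfolding u_def using M R0[of \<omega>] that(1) by (simp add: ln_mult ln_div ln_powr)
    moreover have "ln u \<le> u - 1" by (rule ln_le_minus_one[OF u])
    moreover have "u \<le> q \<omega>"
    proof -
      have "M powr (indicator A \<omega>) \<le> 1 + M * (if dec (Y \<omega>) = message \<omega> then 1 else 0)"
        using M that(2) by (auto simp: A_def indicator_def)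
      then have "M powr (indicator A \<omega>) * (R \<omega> / (M * ?r)) \<le> (1 + M * (if dec (Y \<omega>) = message \<omega> then 1 else 0)) * (R \<omega> / (M * ?r))"
        using M R0[of \<omega>] that(1) by (intro mult_right_mono) (auto intro!: divide_nonneg_nonneg intro: less_imp_le)
      then show ?thesis by (simp add: u_def q_def mult.commute)
    qed
    ultimately show ?thesis unfolding D_def lnR by linarith
  qed
  have s1: "ennreal a + ennreal b + ennreal c * ennreal d + 1 = ennreal (a + b + c * d + 1)"
    if "a \<ge> 0" "b \<ge> 0" "c \<ge> 0" "d \<ge> 0" for a b c d :: real
    using that by (simp only: ennreal_mult[symmetric] ennreal_plus[symmetric] mult_nonneg_nonneg add_nonneg_nonneg
        ennreal_1[symmetric] zero_le_one)
  have s2: "ennreal a + ennreal c * ennreal d + ennreal b = ennreal (a + c * d + b)"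
    if "a \<ge> 0" "b \<ge> 0" "c \<ge> 0" "d \<ge> 0" for a b c d :: real
    using that by (simp only: ennreal_mult[symmetric] ennreal_plus[symmetric] mult_nonneg_nonneg add_nonneg_nonneg)
  have mA: "(\<lambda>\<omega>. ennreal (indicator A \<omega> * ln M)) \<in> borel_measurable W"
    by (intro measurable_compose[OF _ measurable_ennreal] borel_measurable_times borel_measurable_indicator borel_measurable_const Am)
  have mr: "(\<lambda>\<omega>. ennreal (- ln (r (message \<omega>) (?Z \<omega>)))) \<in> borel_measurable W"
    by (intro measurable_compose[OF _ measurable_ennreal] borel_measurable_uminus borel_measurable_ln rm)
  have mU: "(\<lambda>\<omega>. ennreal (?SU \<omega>)) \<in> borel_measurable W" and mV: "(\<lambda>\<omega>. ennreal (?SV \<omega>)) \<in> borel_measurable W"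
  proof -
    have "(\<lambda>\<omega>. (cmod (f t \<omega>))\<^sup>2) \<in> borel_measurable W" if "f t \<in> borel_measurable W" for f :: "nat \<Rightarrow> wiretap_sample \<Rightarrow> complex" and t
      by (intro borel_measurable_power measurable_compose[OF that borel_measurable_norm])
    then have sm: "(\<lambda>\<omega>. ennreal (\<Sum>t<n. (cmod (f t \<omega>))\<^sup>2)) \<in> borel_measurable W"
      if "\<And>t. t < n \<Longrightarrow> f t \<in> borel_measurable W" for f :: "nat \<Rightarrow> wiretap_sample \<Rightarrow> complex"
      by (intro measurable_compose[OF _ measurable_ennreal] borel_measurable_sum) (simp only: that lessThan_iff)
    show "(\<lambda>\<omega>. ennreal (?SU \<omega>)) \<in> borel_measurable W" by (rule sm) (rule Um)
    show "(\<lambda>\<omega>. ennreal (?SV \<omega>)) \<in> borel_measurable W" by (rule sm) (rule Vm)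
  qed
  have mq: "(\<lambda>\<omega>. ennreal (q \<omega>)) \<in> borel_measurable W"
    by (rule measurable_compose[OF qm measurable_ennreal])
  have "ennreal (measure W A * ln M) + ennreal (ln 2 * equivocation n I he ?W0) + ennreal n + 1
      = (\<integral>\<^sup>+\<omega>. ennreal (indicator A \<omega> * ln M) + ennreal (- ln (r (message \<omega>) (?Z \<omega>))) + ennreal (1 / v') * ennreal (?SV \<omega>) + 1 \<partial>W)"
  proof -
    have 1: "(\<integral>\<^sup>+\<omega>. ennreal (indicator A \<omega> * ln M) \<partial>W) = ennreal (measure W A * ln M)"
    proof -
      have "(\<integral>\<^sup>+\<omega>. ennreal (indicator A \<omega> * ln M) \<partial>W) = (\<integral>\<^sup>+\<omega>. ennreal (ln M) * indicator A \<omega> \<partial>W)"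
        by (intro nn_integral_cong) (auto simp: indicator_def)
      also have "\<dots> = ennreal (ln M) * emeasure W A"
        by (rule nn_integral_cmult_indicator[OF Am])
      finally show ?thesis
        using M by (simp add: W.emeasure_eq_measure ennreal_mult mult.commute)
    qed
    have 2: "(\<integral>\<^sup>+\<omega>. ennreal (1 / v') * ennreal (?SV \<omega>) \<partial>W) = ennreal n"
      unfolding nn_integral_cmult[OF mV] energyV using v'(2) by (subst ennreal_mult[symmetric]) auto
    show ?thesis
      by (simp only: nn_integral_add mA mr mV borel_measurable_add borel_measurable_times_ennreal borel_measurable_const
         1 2 post_int nn_integral_const W.emeasure_space_1 mult_1)
  qed
  also have "\<dots> \<le> (\<integral>\<^sup>+\<omega>. ennreal D + ennreal (1 / k) * ennreal (?SU \<omega>) + ennreal (q \<omega>) \<partial>W)"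
  proof (rule nn_integral_mono_AE, rule AE_mp[OF r_pos], intro AE_I2 impI)
    fix \<omega> assume \<omega>: "\<omega> \<in> space W" "r (message \<omega>) (?Z \<omega>) > 0"
    have SU: "?SU \<omega> \<ge> 0" and SV: "?SV \<omega> \<ge> 0" by (intro sum_nonneg; simp)+
    have nl: "- ln (r (message \<omega>) (?Z \<omega>)) \<ge> 0" using \<omega>(2) r1 by simp
    have "ennreal (indicator A \<omega> * ln M) + ennreal (- ln (r (message \<omega>) (?Z \<omega>))) + ennreal (1 / v') * ennreal (?SV \<omega>) + 1
        = ennreal (indicator A \<omega> * ln M + - ln (r (message \<omega>) (?Z \<omega>)) + ?SV \<omega> / v' + 1)"
      using SV nl M v'(2) by (subst s1) simp_all
    also have "\<dots> \<le> ennreal (D + ?SU \<omega> / k + q \<omega>)"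
      by (rule ennreal_leI[OF pointwise[OF \<omega>(2,1)]])
    also have "\<dots> = ennreal D + ennreal (1 / k) * ennreal (?SU \<omega>) + ennreal (q \<omega>)"
      using SU D0 q0[of \<omega>] kp by (subst s2) simp_all
    finally show "ennreal (indicator A \<omega> * ln M) + ennreal (- ln (r (message \<omega>) (?Z \<omega>))) + ennreal (1 / v') * ennreal (?SV \<omega>) + 1
      \<le> ennreal D + ennreal (1 / k) * ennreal (?SU \<omega>) + ennreal (q \<omega>)" .
  qed
  also have "\<dots> = ennreal D + ennreal (1 / k) * (\<integral>\<^sup>+\<omega>. ennreal (?SU \<omega>) \<partial>W) + (\<integral>\<^sup>+\<omega>. ennreal (q \<omega>) \<partial>W)"
    by (simp only: nn_integral_add mU mq nn_integral_cmult borel_measurable_add borel_measurable_times_ennreal borel_measurable_const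
         nn_integral_const W.emeasure_space_1 mult_1_right)
  also have "\<dots> \<le> ennreal D + ennreal (1 / k) * ennreal (n * k) + 2"
    by (intro add_mono mult_left_mono energyU q_int) auto
  also have "\<dots> = ennreal (D + n + 2)"
    using kp D0 s2[of D 2 "1 / k" "n * k"] by simp
  finally have "ennreal (measure W A * ln M + ln 2 * equivocation n I he ?W0 + n + 1) \<le> ennreal (D + n + 2)"
    using M equi0 s1[of "measure W A * ln M" "ln 2 * equivocation n I he ?W0" "real n" 1] by simp
  then have "measure W A * ln M + ln 2 * equivocation n I he ?W0 + n + 1 \<le> D + n + 2"
    using D0 by (subst (asm) ennreal_le_iff) auto
  moreover have "(1 - e) * ln M \<le> measure W A * ln M"
    using PA M by (intro mult_right_mono) auto
  moreover have "ln 2 * (log 2 M - e) \<le> ln 2 * equivocation n I he ?W0"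
    using sec unfolding H by (intro mult_left_mono) auto
  moreover have "ln 2 * log 2 M = ln M" by (simp add: log_def)
  ultimately show ?thesis
    unfolding H D_def by (simp add: algebra_simps)
qed

text \<open>Division by the block length removes the bounded terms of \<open>converse_code\<close>;
  afterwards the error and leakage level tends to 0. The coupling parameter \<open>b\<close> and the
  estimator coefficient \<open>a\<close> are still free and are optimised only in
  \<open>converse_finite\<close>.\<close>

lemma converse_rate:
  fixes he :: "nat \<Rightarrow> real"
  assumes ach: "achievable_with_strong_secrecy P hl vl I he ve rate" and P: "P \<ge> 0"
    and vl: "vl > 0" and ve: "ve > 0" and J: "finite J" "J \<subseteq> I"
    and h2: "h2 = (\<Sum>i\<in>J. (he i)\<^sup>2)" and v': "v' = vl - b\<^sup>2 * h2 * ve" "v' > 0"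
    and k: "k = (hl - a * h2)\<^sup>2 * P + (b - a)\<^sup>2 * h2 * ve + v'"
  shows "rate \<le> log 2 (k / v')"
proof -
  have bound: "(1 - e) * (rate - e) * ln 2 \<le> ln (k / v')" if e: "0 < e" "e < 1" for e
  proof -
    have ev: "\<forall>\<^sub>F n in sequentially. (1 - e) * (rate - e) * ln 2 \<le> ln (k / v') + (e * ln 2 + 1) / real n"
      using ach[unfolded achievable_with_strong_secrecy_def, rule_format, OF e(1)] eventually_gt_at_top[of 0]
    proof eventually_elim
      case (elim n)
      then obtain C dec where C: "wiretap_encoder n P C" "wiretap_decoder n dec"
        and H: "message_entropy (wiretap_space n I vl ve C) / real n \<ge> rate - e"
        and sec: "equivocation n I he (wiretap_space n I vl ve C) \<ge> message_entropy (wiretap_space n I vl ve C) - e"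
        and err: "measure (wiretap_space n I vl ve C) {\<omega> \<in> space (wiretap_space n I vl ve C).
            dec (receiver_output n hl \<omega>) \<noteq> message \<omega>} \<le> e"
        by (auto simp: Let_def)
      let ?H = "message_entropy (wiretap_space n I vl ve C)"
      have n: "real n > 0" using elim by simp
      have "(1 - e) * (ln 2 * ?H) \<le> e * ln 2 + n * ln (k / v') + 1"
        by (rule converse_code[OF C _ P vl ve J h2 v' k sec err]) (use elim in simp)
      moreover have "(1 - e) * (ln 2 * (n * (rate - e))) \<le> (1 - e) * (ln 2 * ?H)"
        using e H n by (intro mult_left_mono) (auto simp: field_simps)
      ultimately have "n * ((1 - e) * (rate - e) * ln 2) \<le> n * ln (k / v') + (e * ln 2 + 1)"
        by (simp add: algebra_simps)
      then have "n * ((1 - e) * (rate - e) * ln 2) / n \<le> (n * ln (k / v') + (e * ln 2 + 1)) / n"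
        using n by (intro divide_right_mono) auto
      then show ?case using n by (simp add: add_divide_distrib)
    qed
    have "(\<lambda>n. ln (k / v') + (e * ln 2 + 1) / real n) \<longlonglongrightarrow> ln (k / v') + 0"
      by (intro tendsto_add tendsto_const lim_const_over_n)
    from tendsto_lowerbound[OF this ev] show ?thesis by simp
  qed
  have "((\<lambda>e. (1 - e) * (rate - e) * ln 2) \<longlongrightarrow> (1 - 0) * (rate - 0) * ln 2) (at_right 0)"
    by (intro tendsto_intros)
  moreover have "\<forall>\<^sub>F e in at_right 0. (1 - e) * (rate - e) * ln 2 \<le> ln (k / v')"
    using eventually_at_right_less[of 0] eventually_at_right[of 0 "1::real"] bound
    by (intro eventually_at_rightI[of 0 1]) auto
  ultimately have "(1 - 0) * (rate - 0) * ln 2 \<le> ln (k / v')"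
    by (rule tendsto_upperbound) simp
  then show ?thesis by (simp add: log_def field_simps)
qed

text \<open>The two cases compare the gain-to-noise ratios of the receiver and of the combined
  eavesdroppers. In each of them the coupling is chosen to make the weaker observation a degraded
  version of the stronger one, in the second case only in the limit.\<close>

lemma converse_finite:
  fixes he :: "nat \<Rightarrow> real"
  assumes ach: "achievable_with_strong_secrecy P hl vl I he ve rate" and P: "P \<ge> 0" and hl: "hl > 0"
    and vl: "vl > 0" and ve: "ve > 0" and J: "finite J" "J \<subseteq> I"
  shows "rate \<le> max 0 (log 2 (1 + P * hl\<^sup>2 / vl) - log 2 (1 + P * (\<Sum>i\<in>J. (he i)\<^sup>2) / ve))"
proof -
  define h2 where "h2 = (\<Sum>i\<in>J. (he i)\<^sup>2)"
  have h20: "h2 \<ge> 0" unfolding h2_def by (intro sum_nonneg) auto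
  \<comment> \<open>Quotient of \<open>h2 / ve\<close> by \<open>hl\<^sup>2 / vl\<close>: below 1
    the combined eavesdroppers have the worse channel.\<close>
  define \<rho> where "\<rho> = vl * h2 / (hl\<^sup>2 * ve)"
  show ?thesis
  proof (cases "\<rho> < 1")
    case True
    \<comment> \<open>With this \<open>b\<close> the noise of \<open>T\<close> minus
      \<open>h2 / hl\<close> times the receiver noise is uncorrelated with the receiver noise, so
      that \<open>T\<close> is a degraded version of the output.\<close>
    define b where "b = vl / (hl * ve)"
    define D where "D = h2 * P + ve"
    \<comment> \<open>Coefficient of the best linear estimate of the output from \<open>T\<close> at
      full power \<open>P\<close>: covariance over variance, after cancelling a common factor
      \<open>h2\<close>.\<close>
    define a where "a = (hl * P + b * ve) / D"
    define v' where "v' = vl - b\<^sup>2 * h2 * ve"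
    define k where "k = (hl - a * h2)\<^sup>2 * P + (b - a)\<^sup>2 * h2 * ve + v'"
    have D: "D > 0" using h20 P ve by (simp add: D_def add_nonneg_pos)
    have v': "v' = vl * (1 - \<rho>)"
      using hl ve by (simp add: v'_def b_def \<rho>_def power2_eq_square field_simps)
    have v'0: "v' > 0" using v' vl True by simp
    have bh: "hl - b * h2 = hl * (1 - \<rho>)"
      using hl ve by (simp add: b_def \<rho>_def power2_eq_square field_simps)
    have 1: "hl - a * h2 = ve * (hl - b * h2) / D"
      using D by (simp add: a_def field_simps) (simp add: D_def algebra_simps)
    have 2: "b - a = - (P * (hl - b * h2)) / D"
      using D by (simp add: a_def field_simps) (simp add: D_def algebra_simps)
    have "k = (hl - b * h2)\<^sup>2 * (P * ve * D) / D\<^sup>2 + v'"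
      unfolding k_def 1 2 by (simp add: power_divide power_mult_distrib add_divide_distrib[symmetric] power2_eq_square D_def algebra_simps)
    also have "(hl - b * h2)\<^sup>2 * (P * ve * D) / D\<^sup>2 = hl\<^sup>2 * (1 - \<rho>)\<^sup>2 * (P * ve) / D"
      unfolding bh using D by (simp add: power_mult_distrib power2_eq_square)
    finally have k: "k = hl\<^sup>2 * (1 - \<rho>)\<^sup>2 * (P * ve) / D + v'" .
    have rh: "\<rho> * hl\<^sup>2 / vl = h2 / ve"
      using hl vl ve by (simp add: \<rho>_def)
    have "k / v' * (D / ve) = hl\<^sup>2 * (1 - \<rho>)\<^sup>2 * (P * ve) / D / v' * (D / ve) + D / ve"
      unfolding k using v'0 by (simp add: add_divide_distrib distrib_right)
    also have "hl\<^sup>2 * (1 - \<rho>)\<^sup>2 * (P * ve) / D / v' * (D / ve) = hl\<^sup>2 * (1 - \<rho>) * P / vl"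
      unfolding v' using D ve True by (simp add: power2_eq_square)
    also have "\<dots> = P * (hl\<^sup>2 / vl) - P * (\<rho> * hl\<^sup>2 / vl)"
      by (simp add: algebra_simps diff_divide_distrib)
    also have "\<dots> = P * (hl\<^sup>2 / vl) - P * (h2 / ve)"
      unfolding rh ..
    also have "\<dots> + D / ve = 1 + P * hl\<^sup>2 / vl"
      using ve by (simp add: D_def add_divide_distrib mult.commute)
    finally have kD: "k / v' * (D / ve) = 1 + P * hl\<^sup>2 / vl" .
    have De: "D / ve = 1 + P * h2 / ve"
      using ve by (simp add: D_def add_divide_distrib mult.commute)
    have "D / ve \<noteq> 0" using D ve by simp
    then have kv: "k / v' = (1 + P * hl\<^sup>2 / vl) / (1 + P * h2 / ve)"
      unfolding De[symmetric] kD[symmetric] by (rule nonzero_mult_div_cancel_right[symmetric])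
    have "rate \<le> log 2 (k / v')"
      by (rule converse_rate[OF ach P vl ve J h2_def v'_def v'0 k_def])
    also have "\<dots> = log 2 (1 + P * hl\<^sup>2 / vl) - log 2 (1 + P * h2 / ve)"
    proof -
      have "1 + P * hl\<^sup>2 / vl > 0" "1 + P * h2 / ve > 0"
        using P vl ve h20 by (auto intro!: add_pos_nonneg)
      then show ?thesis
        unfolding kv by (rule log_divide_pos)
    qed
    finally show ?thesis by (simp add: h2_def)
  next
    case False
    then have h2p: "h2 > 0" using h20 by (cases "h2 = 0") (auto simp: \<rho>_def)
    have rho: "hl\<^sup>2 * ve / h2 \<le> vl"
      using False hl ve h2p by (simp add: \<rho>_def field_simps)
    define q where "q = hl\<^sup>2 * P / vl"
    have q: "q \<ge> 0" using P vl by (simp add: q_def)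
    \<comment> \<open>Here the output is nearly a degraded version of \<open>T\<close>. The exact
      choice \<open>b = hl / h2\<close> would give \<open>v' = 0\<close> when
      \<open>\<rho> = 1\<close>, so \<open>b\<close> is scaled by \<open>\<theta> < 1\<close>, and
      \<open>\<theta>\<close> tends to 1 afterwards. Taking \<open>a = b\<close> removes the
      eavesdropper noise from the estimation error.\<close>
    have bound: "rate \<le> log 2 (1 + (1 - \<theta>) * q)" if th: "0 < \<theta>" "\<theta> < 1" for \<theta>
    proof -
      define b where "b = \<theta> * hl / h2"
      define v' where "v' = vl - b\<^sup>2 * h2 * ve"
      define k where "k = (hl - b * h2)\<^sup>2 * P + (b - b)\<^sup>2 * h2 * ve + v'"
      have "b\<^sup>2 * h2 * ve = \<theta>\<^sup>2 * (hl\<^sup>2 * ve / h2)"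
        using h2p by (simp add: b_def power2_eq_square)
      also have "\<dots> \<le> \<theta>\<^sup>2 * vl" by (intro mult_left_mono rho) simp
      finally have v'_ge: "v' \<ge> vl * (1 - \<theta>\<^sup>2)" by (simp add: v'_def algebra_simps)
      have "\<theta>\<^sup>2 < 1" using th by (simp add: power_less_one_iff)
      then have pos: "vl * (1 - \<theta>\<^sup>2) > 0" using vl by simp
      then have v'0: "v' > 0" using v'_ge by linarith
      have "k = (1 - \<theta>)\<^sup>2 * (hl\<^sup>2 * P) + v'"
        using h2p by (simp add: k_def b_def power2_eq_square algebra_simps)
      then have "k / v' = 1 + (1 - \<theta>)\<^sup>2 * (hl\<^sup>2 * P) / v'"
        using v'0 by (simp add: add_divide_distrib)
      also have "(1 - \<theta>)\<^sup>2 * (hl\<^sup>2 * P) / v' \<le> (1 - \<theta>)\<^sup>2 * (hl\<^sup>2 * P) / (vl * (1 - \<theta>\<^sup>2))"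
        using P pos v'_ge v'0 by (intro divide_left_mono) auto
      also have "\<dots> = (1 - \<theta>) * q / (1 + \<theta>)"
      proof -
        have "1 - \<theta>\<^sup>2 = (1 - \<theta>) * (1 + \<theta>)" by (simp add: power2_eq_square algebra_simps)
        then show ?thesis using th by (simp add: q_def power2_eq_square)
      qed
      also have "\<dots> \<le> (1 - \<theta>) * q"
        using th q mult_left_mono[of 1 "1 + \<theta>" "(1 - \<theta>) * q"] by (simp add: divide_le_eq)
      finally have kv: "k / v' \<le> 1 + (1 - \<theta>) * q" by simp
      have "k \<ge> v'" unfolding k_def using P by simp
      then have "k / v' > 0" using v'0 by simp
      have "rate \<le> log 2 (k / v')"
        by (rule converse_rate[OF ach P vl ve J h2_def v'_def v'0 k_def])
      also have "\<dots> \<le> log 2 (1 + (1 - \<theta>) * q)"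
        using kv \<open>k / v' > 0\<close> by simp
      finally show ?thesis .
    qed
    have "((\<lambda>\<theta>. log 2 (1 + (1 - \<theta>) * q)) \<longlongrightarrow> log 2 (1 + (1 - 1) * q)) (at_left 1)"
      by (intro tendsto_intros) auto
    moreover have "\<forall>\<^sub>F \<theta> in at_left 1. rate \<le> log 2 (1 + (1 - \<theta>) * q)"
      using bound by (intro eventually_at_leftI[of 0 1]) auto
    ultimately have "rate \<le> log 2 (1 + (1 - 1) * q)"
      by (rule tendsto_lowerbound) simp
    then show ?thesis by simp
  qed
qed

text \<open>Every finite set of eavesdroppers gives a bound, and the summable case is their limit
  along finite subsets. If the sum diverges, some finite set already has a better channel than the
  receiver and forces the bound 0.\<close>

lemma converse:
  fixes he :: "nat \<Rightarrow> real"
  assumes ach: "achievable_with_strong_secrecy P hl vl I he ve rate" and P: "P \<ge> 0" and hl: "hl > 0"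
    and vl: "vl > 0" and ve: "ve > 0"
  shows "rate \<le> (if (\<lambda>i. (he i)\<^sup>2) summable_on I
            then max 0 (log 2 (1 + P * hl\<^sup>2 / vl) - log 2 (1 + P * (\<Sum>\<^sub>\<infinity>i\<in>I. (he i)\<^sup>2) / ve)) else 0)"
proof (cases "(\<lambda>i. (he i)\<^sup>2) summable_on I")
  case True
  let ?S = "\<Sum>\<^sub>\<infinity>i\<in>I. (he i)\<^sup>2"
  have "?S \<ge> 0" by (intro infsum_nonneg) auto
  then have S: "1 + P * ?S / ve > 0" using P ve by (intro add_pos_nonneg) auto
  have "((\<lambda>J. \<Sum>i\<in>J. (he i)\<^sup>2) \<longlongrightarrow> ?S) (finite_subsets_at_top I)"
    using has_sum_infsum[OF True] by (simp add: has_sum_def)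
  then have t: "((\<lambda>J. 1 + P * (\<Sum>i\<in>J. (he i)\<^sup>2) / ve) \<longlongrightarrow> 1 + P * ?S / ve) (finite_subsets_at_top I)"
    by (rule tendsto_add[OF tendsto_const tendsto_divide[OF tendsto_mult[OF tendsto_const] tendsto_const]]) (use ve in simp)
  have "((\<lambda>J. max 0 (log 2 (1 + P * hl\<^sup>2 / vl) - log 2 (1 + P * (\<Sum>i\<in>J. (he i)\<^sup>2) / ve)))
      \<longlongrightarrow> max 0 (log 2 (1 + P * hl\<^sup>2 / vl) - log 2 (1 + P * ?S / ve))) (finite_subsets_at_top I)"
    by (rule tendsto_max[OF tendsto_const tendsto_diff[OF tendsto_const tendsto_log[OF tendsto_const t]]]) (use S in simp_all)
  moreover have "\<forall>\<^sub>F J in finite_subsets_at_top I. rate \<le> max 0 (log 2 (1 + P * hl\<^sup>2 / vl) - log 2 (1 + P * (\<Sum>i\<in>J. (he i)\<^sup>2) / ve))"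
    by (rule eventually_finite_subsets_at_top_weakI, rule converse_finite[OF ach P hl vl ve])
  ultimately have "rate \<le> max 0 (log 2 (1 + P * hl\<^sup>2 / vl) - log 2 (1 + P * ?S / ve))"
    by (rule tendsto_lowerbound) (rule finite_subsets_at_top_neq_bot)
  then show ?thesis unfolding if_P[OF True] .
next
  case False
  have "\<not> bdd_above (sum (\<lambda>i. (he i)\<^sup>2) ` {F. F \<subseteq> I \<and> finite F})"
    using False nonneg_bdd_above_summable_on[of I "\<lambda>i. (he i)\<^sup>2"] by auto
  then obtain y where "y \<in> sum (\<lambda>i. (he i)\<^sup>2) ` {F. F \<subseteq> I \<and> finite F}" "\<not> y \<le> hl\<^sup>2 * ve / vl"
    unfolding bdd_above_def by blast
  then obtain J where J: "finite J" "J \<subseteq> I" "(\<Sum>i\<in>J. (he i)\<^sup>2) > hl\<^sup>2 * ve / vl"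
    by auto
  have "hl\<^sup>2 / vl \<le> (\<Sum>i\<in>J. (he i)\<^sup>2) / ve"
    using J(3) vl ve by (simp add: field_simps)
  then have "P * (hl\<^sup>2 / vl) \<le> P * ((\<Sum>i\<in>J. (he i)\<^sup>2) / ve)"
    by (intro mult_left_mono P)
  moreover have "P * (hl\<^sup>2 / vl) \<ge> 0" using P vl by simp
  ultimately have "log 2 (1 + P * hl\<^sup>2 / vl) \<le> log 2 (1 + P * (\<Sum>i\<in>J. (he i)\<^sup>2) / ve)"
    by (subst log_le_cancel_iff) (auto intro!: add_pos_nonneg)
  then show ?thesis
    using converse_finite[OF ach P hl vl ve J(1,2)] False by simp
qed

section \<open>Degradation of the eavesdropper channel\<close>

text \<open>The sets that can be approximated from the algebra are closed under complements and
  countable disjoint unions. A union is first cut to finitely many members up to a small tail, and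
  then the errors of the members add up.\<close>

lemma algebra_approximation:
  assumes G: "algebra \<Omega> G" and L: "finite_measure L" and sets: "sets L = sigma_sets \<Omega> G" and A: "A \<in> sets L" and e: "e > 0"
  shows "\<exists>B\<in>G. measure L ((A - B) \<union> (B - A)) < (e :: real)"
proof -
  interpret G: algebra \<Omega> G by (rule G)
  interpret L: finite_measure L by (rule L)
  have GL: "B \<in> sets L" if "B \<in> G" for B using that by (simp add: sets sigma_sets.Basic)
  have sp: "space L = \<Omega>"
    using sets_eq_imp_space_eq[of L "sigma \<Omega> G"] G.space_closed sets by (simp add: sets_measure_of space_measure_of_conv)
  have "A \<in> sigma_sets \<Omega> G" using A sets by simp
  then have "\<forall>e>0. \<exists>B\<in>G. measure L ((A - B) \<union> (B - A)) < e"
  proof (induction rule: sigma_sets_induct_disjoint[OF G.Int_stable G.space_closed, consumes 1, case_names basic empty compl union])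
    case (basic A)
    then show ?case by (auto intro!: bexI[of _ A])
  next
    case empty
    then show ?case by (auto intro!: bexI[of _ "{}"])
  next
    case (compl A)
    show ?case
    proof (intro allI impI)
      fix e :: real assume "e > 0"
      then obtain B where B: "B \<in> G" "measure L ((A - B) \<union> (B - A)) < e" using compl.IH by blast
      have "A \<subseteq> \<Omega>" "B \<subseteq> \<Omega>"
        using compl.hyps B G.space_closed sets.sets_into_space[of A L] by (auto simp: sets sp)
      then have "(\<Omega> - A - (\<Omega> - B)) \<union> (\<Omega> - B - (\<Omega> - A)) = (A - B) \<union> (B - A)" by auto
      then show "\<exists>B\<in>G. measure L ((\<Omega> - A - B) \<union> (B - (\<Omega> - A))) < e"
        using B by (intro bexI[of _ "\<Omega> - B"]) auto
    qed
  next
    case (union A)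
    have AL: "A i \<in> sets L" for i using union.hyps(2) sets by auto
    show ?case
    proof (intro allI impI)
      fix e :: real assume e: "e > 0"
      have "(\<lambda>i. measure L (A i)) sums measure L (\<Union>i. A i)"
        using AL union.hyps(1) by (intro L.finite_measure_UNION) auto
      then have "(\<lambda>N. \<Sum>i<N. measure L (A i)) \<longlonglongrightarrow> measure L (\<Union>i. A i)"
        by (simp add: sums_def)
      then have "\<forall>\<^sub>F N in sequentially. (\<Sum>i<N. measure L (A i)) > measure L (\<Union>i. A i) - e / 2"
        using e by (intro order_tendstoD) auto
      then obtain N where N: "(\<Sum>i<N. measure L (A i)) > measure L (\<Union>i. A i) - e / 2"
        by (auto simp: eventually_sequentially)
      \<comment> \<open>The \<open>N\<close> members together use at most half of \<open>e\<close>,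
        the tail uses the other half. The summand 1 keeps the denominator positive for
        \<open>N = 0\<close>.\<close>
      define d where "d = e / (2 * (real N + 1))"
      have d: "d > 0" using e by (simp add: d_def)
      have "\<forall>i. \<exists>B. B \<in> G \<and> measure L ((A i - B) \<union> (B - A i)) < d" using union.IH d by blast
      then obtain B where B: "\<And>i. B i \<in> G" "\<And>i. measure L ((A i - B i) \<union> (B i - A i)) < d" by metis
      define B' where "B' = (\<Union>i<N. B i)"
      have B': "B' \<in> G" unfolding B'_def using B(1) by (intro G.finite_UN) auto
      let ?T = "(\<Union>i. A i) - (\<Union>i<N. A i)" and ?D = "\<lambda>i. (A i - B i) \<union> (B i - A i)"
      have T: "measure L ?T < e / 2"
      proof -
        have "measure L (\<Union>i<N. A i) = (\<Sum>i<N. measure L (A i))"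
          using AL union.hyps(1) by (intro L.finite_measure_finite_Union) (auto simp: disjoint_family_on_def)
        moreover have "measure L ?T = measure L (\<Union>i. A i) - measure L (\<Union>i<N. A i)"
          using AL by (intro L.finite_measure_Diff) auto
        ultimately show ?thesis using N by linarith
      qed
      have "measure L (((\<Union>i. A i) - B') \<union> (B' - (\<Union>i. A i))) \<le> measure L (?T \<union> (\<Union>i<N. ?D i))"
        using AL GL[OF B(1)] by (intro L.finite_measure_mono) (auto simp: B'_def intro!: sets.Un sets.Diff sets.countable_UN)
      also have "\<dots> \<le> measure L ?T + measure L (\<Union>i<N. ?D i)"
        using AL GL[OF B(1)] by (intro measure_Un_le) auto
      also have "measure L (\<Union>i<N. ?D i) \<le> (\<Sum>i<N. measure L (?D i))"
        using AL GL[OF B(1)] by (intro L.finite_measure_subadditive_finite) auto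
      also have "\<dots> \<le> (\<Sum>i<N. d)" using B(2) by (intro sum_mono less_imp_le)
      also have "\<dots> \<le> e / 2" using e by (simp add: d_def field_simps)
      finally have "measure L (((\<Union>i. A i) - B') \<union> (B' - (\<Union>i. A i))) < e" using T by linarith
      then show "\<exists>B\<in>G. measure L (((\<Union>i. A i) - B) \<union> (B - (\<Union>i. A i))) < e" using B' by blast
    qed
  qed
  then show ?thesis using e by blast
qed

lemma cylinder_approximation:
  fixes L :: "('i \<Rightarrow> complex) measure"
  assumes L: "finite_measure L" and sets: "sets L = sets (PiM K (\<lambda>_. borel))" and A: "A \<in> sets L" and e: "e > 0"
  obtains F B where "finite F" "F \<subseteq> K" "B \<in> sets (PiM F (\<lambda>_. borel))"
    "measure L ((A - prod_emb K (\<lambda>_. borel) F B) \<union> (prod_emb K (\<lambda>_. borel) F B - A)) < e"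
proof -
  \<comment> \<open>All probability measures on the Borel sets have the same cylinders. The standard
    Gaussian is taken as a representative, to obtain the generating algebra.\<close>
  interpret product_prob_space "\<lambda>_. complex_gaussian 1" K
    by (rule product_prob_spaceI) (simp add: prob_space_complex_gaussian)
  have "sets L = sigma_sets (space (PiM K (\<lambda>_. complex_gaussian 1))) generator"
    unfolding sets sets_PiM_complex_gaussian[of K 1, symmetric] by (rule sets_PiM_generator)
  from algebra_approximation[OF algebra_generator L this A e]
  obtain C where C: "C \<in> generator" "measure L ((A - C) \<union> (C - A)) < e" by blast
  from C(1) obtain F B where FB: "finite F" "F \<subseteq> K" "B \<in> sets (PiM F (\<lambda>_. complex_gaussian 1))"
    "C = prod_emb K (\<lambda>_. complex_gaussian 1) F B" by (auto elim!: generator.cases)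
  have "prod_emb K (\<lambda>_. complex_gaussian 1) F B = prod_emb K (\<lambda>_. borel) F B"
    by (simp add: prod_emb_def)
  then show ?thesis
    using that[of F B] FB C(2) by (simp add: sets_PiM_complex_gaussian)
qed

text \<open>\<open>combined_test\<close> averages \<open>f\<close> over a probability kernel, so a
  test stays a test at every stage of the merging.\<close>

lemma combined_test_le_1:
  assumes v: "v > 0" and q: "q > 0" and f: "\<And>z t. f z t \<le> 1"
  shows "combined_test v h q f T \<le> 1"
proof -
  let ?w = "v - h\<^sup>2 / (q + h\<^sup>2 / v)"
  have "h\<^sup>2 < v * (q + h\<^sup>2 / v)" using v q by (simp add: distrib_left)
  moreover have "q + h\<^sup>2 / v > 0" using v q by (simp add: add_pos_nonneg)
  ultimately have w: "?w > 0" by (simp add: divide_less_eq)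
  have "combined_test v h q f T \<le> (\<integral>\<^sup>+z. 1 * ennreal (cn_density ?w (z - of_real h * T)) \<partial>lborel)"
    unfolding combined_test_def Let_def by (intro nn_integral_mono mult_right_mono f) simp
  also have "\<dots> = 1" using nn_integral_cn_shift[OF w] by simp
  finally show ?thesis .
qed

lemma nn_integral_cgauss:
  assumes f: "f \<in> borel_measurable borel"
  shows "(\<integral>\<^sup>+t. f t \<partial>cgauss m v) = (\<integral>\<^sup>+t. f t * ennreal (cn_density v (t - m)) \<partial>lborel)"
  unfolding cgauss_def using f by (subst nn_integral_density) (auto simp: mult.commute)

lemma nn_integral_PiM_cgauss_remove:
  assumes K: "finite K" "t0 \<in> K" and v: "\<And>t. v t > 0" and f: "f \<in> borel_measurable (PiM K (\<lambda>_. borel))"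
  shows "(\<integral>\<^sup>+y. f y \<partial>PiM K (\<lambda>t. cgauss (m t) (v t)))
       = (\<integral>\<^sup>+y. (\<integral>\<^sup>+t. f (y(t0 := t)) * ennreal (cn_density (v t0) (t - m t0)) \<partial>lborel) \<partial>PiM (K - {t0}) (\<lambda>t. cgauss (m t) (v t)))"
proof -
  interpret product_sigma_finite "\<lambda>t. cgauss (m t) (v t)"
    by (simp add: product_sigma_finite_def prob_space_imp_sigma_finite prob_space_cgauss v)
  have ins: "insert t0 (K - {t0}) = K" using K by auto
  have sK: "sets (PiM K (\<lambda>t. cgauss (m t) (v t))) = sets (PiM K (\<lambda>_. borel))"
    by (rule sets_PiM_cong) auto
  have f': "f \<in> borel_measurable (PiM (insert t0 (K - {t0})) (\<lambda>t. cgauss (m t) (v t)))"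
    unfolding ins measurable_cong_sets[OF sK refl] by (rule f)
  have "(\<integral>\<^sup>+y. f y \<partial>PiM (insert t0 (K - {t0})) (\<lambda>t. cgauss (m t) (v t)))
      = (\<integral>\<^sup>+y. (\<integral>\<^sup>+t. f (y(t0 := t)) \<partial>cgauss (m t0) (v t0)) \<partial>PiM (K - {t0}) (\<lambda>t. cgauss (m t) (v t)))"
    by (rule product_nn_integral_insert[OF _ _ f']) (use K in auto)
  also have "\<dots> = (\<integral>\<^sup>+y. (\<integral>\<^sup>+t. f (y(t0 := t)) * ennreal (cn_density (v t0) (t - m t0)) \<partial>lborel) \<partial>PiM (K - {t0}) (\<lambda>t. cgauss (m t) (v t)))"
  proof (rule nn_integral_cong)
    fix y assume y: "y \<in> space (PiM (K - {t0}) (\<lambda>t. cgauss (m t) (v t)))"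
    have "(\<lambda>t. y(t0 := t)) \<in> measurable borel (PiM K (\<lambda>_. borel))"
    proof (rule measurable_PiM_single')
      show "(\<lambda>t. y(t0 := t)) \<in> space borel \<rightarrow> (\<Pi>\<^sub>E i\<in>K. space borel)"
        using y K by (auto simp: space_PiM PiE_iff extensional_def)
      fix i show "(\<lambda>t. (y(t0 := t)) i) \<in> borel_measurable borel"
        by (cases "i = t0") auto
    qed
    from measurable_compose[OF this f] have "(\<lambda>t. f (y(t0 := t))) \<in> borel_measurable borel" .
    then show "(\<integral>\<^sup>+t. f (y(t0 := t)) \<partial>cgauss (m t0) (v t0)) = (\<integral>\<^sup>+t. f (y(t0 := t)) * ennreal (cn_density (v t0) (t - m t0)) \<partial>lborel)"
      by (rule nn_integral_cgauss)
  qed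
  finally show ?thesis unfolding ins .
qed

text \<open>Each observation in \<open>F\<close> is merged with the running observation at its time,
  whose precision grows by the squared gain over \<open>ve\<close>. The test \<open>g\<close> is
  chosen before the means \<open>x\<close>; this uniformity is what makes the observations a
  randomised function of the single one.\<close>

lemma degraded_test_function:
  fixes he :: "'i \<Rightarrow> real" and K :: "'t set"
  assumes K: "finite K" and ve: "ve > 0" and F: "finite F" "F \<subseteq> K \<times> UNIV"
    and f: "case_prod f \<in> borel_measurable (PiM F (\<lambda>_. borel) \<Otimes>\<^sub>M PiM K (\<lambda>_. borel))" "\<And>w y. f w y \<le> 1"
    and q: "\<And>t. q t > 0"
  shows "\<exists>g. g \<in> borel_measurable (PiM K (\<lambda>_. borel)) \<and> (\<forall>y. g y \<le> 1) \<and>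
    (\<forall>x. (\<integral>\<^sup>+w. (\<integral>\<^sup>+y. f w y \<partial>PiM K (\<lambda>t. cgauss (x t) (1 / q t))) \<partial>PiM F (\<lambda>p. cgauss (of_real (he (snd p)) * x (fst p)) ve))
       = (\<integral>\<^sup>+y. g y \<partial>PiM K (\<lambda>t. cgauss (x t) (1 / (q t + (\<Sum>p\<in>F. if fst p = t then (he (snd p))\<^sup>2 / ve else 0))))))"
  using F f q
proof (induction F arbitrary: f q rule: finite_induct)
  case empty
  have "(\<lambda>y. f (\<lambda>_. undefined) y) \<in> borel_measurable (PiM K (\<lambda>_. borel))"
    using measurable_compose[OF measurable_Pair1' empty.prems(2), of "\<lambda>_. undefined"] by (simp add: space_PiM)
  then show ?case
    using empty.prems(3) by (intro exI[of _ "f (\<lambda>_. undefined)"]) (simp add: PiM_empty nn_integral_count_space_finite)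
next
  case (insert p0 F)
  obtain t0 i0 where p0: "p0 = (t0, i0)" by (cases p0)
  define h where "h = he i0"
  have t0: "t0 \<in> K" and FK: "F \<subseteq> K \<times> UNIV" using insert.prems p0 by auto
  note fm = insert.prems(2) and f1 = insert.prems(3) and q0 = insert.prems(4)
  let ?B = "\<lambda>J. PiM J (\<lambda>_. borel :: complex measure)"
  \<comment> \<open>Precisions of independent observations of the same mean add; only the time of
    the inserted pair is affected.\<close>
  define q' where "q' t = q t + (if t = t0 then h\<^sup>2 / ve else 0)" for t
  have q'0: "q' t > 0" for t using q0[of t] ve by (simp add: q'_def add_pos_nonneg)
  define f' where "f' w y = combined_test ve h (q t0) (\<lambda>z t. f (w(p0 := z)) (y(t0 := t))) (y t0)" for w y
  have f'1: "f' w y \<le> 1" for w y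
    unfolding f'_def by (rule combined_test_le_1[OF ve q0 f1])
  have comp: "(\<lambda>\<omega>. f ((a \<omega>)(p0 := b \<omega>)) ((c \<omega>)(t0 := d \<omega>))) \<in> borel_measurable N"
    if "a \<in> measurable N (?B F)" "b \<in> borel_measurable N" "c \<in> measurable N (?B K)" "d \<in> borel_measurable N" for a b c d and N :: "'n measure"
  proof -
    have "(\<lambda>\<omega>. (a \<omega>)(p0 := b \<omega>)) \<in> measurable N (?B (insert p0 F))"
      by (rule measurable_fun_upd[OF _ that(1,2)]) auto
    moreover have "(\<lambda>\<omega>. (c \<omega>)(t0 := d \<omega>)) \<in> measurable N (?B K)"
      by (rule measurable_fun_upd[OF _ that(3,4)]) (use t0 in auto)
    ultimately show ?thesis
      using measurable_compose[OF measurable_Pair fm] by simp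
  qed
  have t0m: "(\<lambda>y. y t0) \<in> borel_measurable (?B K)" by (rule measurable_component_singleton[OF t0])
  have f'm: "case_prod f' \<in> borel_measurable (?B F \<Otimes>\<^sub>M ?B K)"
  proof -
    let ?N = "(?B F \<Otimes>\<^sub>M ?B K) \<Otimes>\<^sub>M (lborel :: complex measure)"
    let ?p = "q t0 + h\<^sup>2 / ve"
    have a: "(\<lambda>\<omega>. fst (fst \<omega>)) \<in> measurable ?N (?B F)" by (rule measurable_compose[OF measurable_fst measurable_fst])
    have c: "(\<lambda>\<omega>. snd (fst \<omega>)) \<in> measurable ?N (?B K)" by (rule measurable_compose[OF measurable_fst measurable_snd])
    have b: "snd \<in> borel_measurable ?N"
      using measurable_snd[of "?B F \<Otimes>\<^sub>M ?B K" "lborel :: complex measure"] by (simp add: measurable_cong_sets[OF refl sets_lborel])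
    have y: "(\<lambda>\<omega>. snd (fst \<omega>) t0) \<in> borel_measurable ?N" by (rule measurable_compose[OF c t0m])
    have "(\<lambda>\<omega>. f ((fst (fst \<omega>))(p0 := snd \<omega>)) ((snd (fst \<omega>))(t0 := of_real (?p / q t0) * snd (fst \<omega>) t0 - of_real (h / (ve * q t0)) * snd \<omega>))
          * ennreal (cn_density (ve - h\<^sup>2 / ?p) (snd \<omega> - of_real h * snd (fst \<omega>) t0))) \<in> borel_measurable ?N"
      by (intro borel_measurable_times_ennreal comp a b c y borel_measurable_diff borel_measurable_times borel_measurable_const
         measurable_compose[OF _ measurable_ennreal] measurable_compose[OF _ cn_density_measurable])
    from lborel.borel_measurable_nn_integral_fst[OF this]
    show ?thesis
      unfolding f'_def combined_test_def Let_def case_prod_beta' fst_conv snd_conv .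
  qed
  from insert.IH[where q = q', OF FK f'm f'1 q'0] obtain g where g: "g \<in> borel_measurable (?B K)" "\<And>y. g y \<le> 1"
    "\<And>x. (\<integral>\<^sup>+w. (\<integral>\<^sup>+y. f' w y \<partial>PiM K (\<lambda>t. cgauss (x t) (1 / q' t))) \<partial>PiM F (\<lambda>p. cgauss (of_real (he (snd p)) * x (fst p)) ve))
       = (\<integral>\<^sup>+y. g y \<partial>PiM K (\<lambda>t. cgauss (x t) (1 / (q' t + (\<Sum>p\<in>F. if fst p = t then (he (snd p))\<^sup>2 / ve else 0)))))"
    by auto
  have prec: "q' t + (\<Sum>p\<in>F. if fst p = t then (he (snd p))\<^sup>2 / ve else 0)
      = q t + (\<Sum>p\<in>insert p0 F. if fst p = t then (he (snd p))\<^sup>2 / ve else 0)" for t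
    using insert.hyps by (auto simp: q'_def p0 h_def)
  have step: "(\<integral>\<^sup>+w. (\<integral>\<^sup>+y. f w y \<partial>PiM K (\<lambda>t. cgauss (x t) (1 / q t))) \<partial>PiM (insert p0 F) (\<lambda>p. cgauss (of_real (he (snd p)) * x (fst p)) ve))
      = (\<integral>\<^sup>+w. (\<integral>\<^sup>+y. f' w y \<partial>PiM K (\<lambda>t. cgauss (x t) (1 / q' t))) \<partial>PiM F (\<lambda>p. cgauss (of_real (he (snd p)) * x (fst p)) ve))" for x
  proof -
    let ?Z = "\<lambda>p. cgauss (of_real (he (snd p)) * x (fst p)) ve"
    let ?Y = "\<lambda>q. PiM K (\<lambda>t. cgauss (x t) (1 / q t))"
    let ?K = "K - {t0}"
    let ?Y' = "PiM ?K (\<lambda>t. cgauss (x t) (1 / q t))"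
    interpret Z: product_sigma_finite ?Z
      by (simp add: product_sigma_finite_def prob_space_imp_sigma_finite prob_space_cgauss ve)
    have sZ: "sets (PiM J ?Z) = sets (?B J)" for J by (rule sets_PiM_cong) auto
    have sY: "sets (?Y q) = sets (?B K)" for q by (rule sets_PiM_cong) auto
    have sY': "sets ?Y' = sets (?B ?K)" by (rule sets_PiM_cong) auto
    have iq: "1 / q t > 0" "1 / q' t > 0" for t using q0[of t] q'0[of t] by auto
    interpret Y: prob_space "?Y q" by (intro prob_space_PiM prob_space_cgauss iq)
    interpret Y': prob_space ?Y' by (intro prob_space_PiM prob_space_cgauss iq)
    have m1: "(\<lambda>w. \<integral>\<^sup>+y. f w y \<partial>?Y q) \<in> borel_measurable (PiM (insert p0 F) ?Z)"
    proof -
      have "case_prod f \<in> borel_measurable (PiM (insert p0 F) ?Z \<Otimes>\<^sub>M ?Y q)"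
        unfolding measurable_cong_sets[OF sets_pair_measure_cong[OF sZ sY] refl] by (rule fm)
      from Y.borel_measurable_nn_integral_fst[OF this] show ?thesis by simp
    qed
    have "(\<integral>\<^sup>+w. (\<integral>\<^sup>+y. f w y \<partial>?Y q) \<partial>PiM (insert p0 F) ?Z)
        = (\<integral>\<^sup>+w. (\<integral>\<^sup>+z. (\<integral>\<^sup>+y. f (w(p0 := z)) y \<partial>?Y q) \<partial>?Z p0) \<partial>PiM F ?Z)"
      by (rule Z.product_nn_integral_insert[OF insert.hyps m1])
    also have "\<dots> = (\<integral>\<^sup>+w. (\<integral>\<^sup>+y. f' w y \<partial>?Y q') \<partial>PiM F ?Z)"
    proof (rule nn_integral_cong)
      fix w assume "w \<in> space (PiM F ?Z)"
      then have w: "w \<in> space (?B F)" using sets_eq_imp_space_eq[OF sZ] by blast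
      have wc: "(\<lambda>_. w) \<in> measurable N (?B F)" for N :: "'n measure" by (rule measurable_const[OF w])
      have fw: "f (w(p0 := z)) \<in> borel_measurable (?B K)" for z
      proof -
        have "w(p0 := z) \<in> space (?B (insert p0 F))"
          using w by (auto simp: space_PiM PiE_iff extensional_def)
        from measurable_compose[OF measurable_Pair1'[OF this] fm] show ?thesis by simp
      qed
      have yK: "(\<lambda>p. snd (fst p)) \<in> measurable ((borel \<Otimes>\<^sub>M ?Y') \<Otimes>\<^sub>M lborel) (?B ?K)"
        using measurable_compose[OF measurable_fst measurable_snd] by (simp add: measurable_cong_sets[OF refl sY'])
      have f'w: "f' w \<in> borel_measurable (?B K)"
        using measurable_compose[OF measurable_Pair1'[OF w] f'm] by simp
      have comp': "(\<lambda>\<omega>. f (w(p0 := b \<omega>)) ((c \<omega>)(t0 := d \<omega>))) \<in> borel_measurable N"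
        if "b \<in> borel_measurable N" "c \<in> measurable N (?B ?K)" "d \<in> borel_measurable N" for b c d and N :: "'n measure"
      proof -
        have "(\<lambda>\<omega>. w(p0 := b \<omega>)) \<in> measurable N (?B (insert p0 F))"
          by (rule measurable_fun_upd[OF _ wc that(1)]) auto
        moreover have "(\<lambda>\<omega>. (c \<omega>)(t0 := d \<omega>)) \<in> measurable N (?B K)"
          by (rule measurable_fun_upd[OF _ that(2,3)]) (use t0 in auto)
        ultimately show ?thesis
          using measurable_compose[OF measurable_Pair fm] by simp
      qed
      let ?f = "\<lambda>y z t. f (w(p0 := z)) (y(t0 := t))"
      let ?inner = "\<lambda>z y. (\<integral>\<^sup>+t. ?f y z t * ennreal (cn_density (1 / q t0) (t - x t0)) \<partial>lborel)"
      have innerm: "(\<lambda>p. ?inner (fst p) (snd p)) \<in> borel_measurable (borel \<Otimes>\<^sub>M ?Y')"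
      proof -
        have b: "(\<lambda>p. fst (fst p)) \<in> borel_measurable ((borel \<Otimes>\<^sub>M ?Y') \<Otimes>\<^sub>M lborel)"
          by (rule measurable_compose[OF measurable_fst measurable_fst])
        have d: "snd \<in> borel_measurable ((borel \<Otimes>\<^sub>M ?Y') \<Otimes>\<^sub>M (lborel :: complex measure))"
          using measurable_snd[of "borel \<Otimes>\<^sub>M ?Y'" "lborel :: complex measure"] by (simp add: measurable_cong_sets[OF refl sets_lborel])
        have "(\<lambda>p. ?f (snd (fst p)) (fst (fst p)) (snd p) * ennreal (cn_density (1 / q t0) (snd p - x t0))) \<in> borel_measurable ((borel \<Otimes>\<^sub>M ?Y') \<Otimes>\<^sub>M lborel)"
          by (intro borel_measurable_times_ennreal comp' b yK d borel_measurable_diff borel_measurable_const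
             measurable_compose[OF _ measurable_ennreal] measurable_compose[OF _ cn_density_measurable])
        from lborel.borel_measurable_nn_integral_fst[OF this] show ?thesis by (simp only: fst_conv snd_conv)
      qed
      have innerm': "(\<lambda>p. ?inner (fst p) (snd p)) \<in> borel_measurable (?Z p0 \<Otimes>\<^sub>M ?Y')"
        using innerm by (simp add: measurable_cong_sets[OF sets_pair_measure_cong[OF sets_cgauss refl] refl])
      interpret Zp: prob_space "?Z p0" by (intro prob_space_cgauss ve)
      interpret ZY: pair_prob_space "?Z p0" ?Y' ..
      have "(\<integral>\<^sup>+z. (\<integral>\<^sup>+y. f (w(p0 := z)) y \<partial>?Y q) \<partial>?Z p0) = (\<integral>\<^sup>+z. (\<integral>\<^sup>+y. ?inner z y \<partial>?Y') \<partial>?Z p0)"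
        by (intro nn_integral_cong nn_integral_PiM_cgauss_remove K t0 iq fw)
      also have "\<dots> = (\<integral>\<^sup>+y. (\<integral>\<^sup>+z. ?inner z y \<partial>?Z p0) \<partial>?Y')"
        by (rule ZY.Fubini'[symmetric], unfold case_prod_beta', rule innerm')
      also have "\<dots> = (\<integral>\<^sup>+y. (\<integral>\<^sup>+T. f' w (y(t0 := T)) * ennreal (cn_density (1 / q' t0) (T - x t0)) \<partial>lborel) \<partial>?Y')"
      proof (rule nn_integral_cong)
        fix y assume y: "y \<in> space ?Y'"
        then have y': "y \<in> space (?B ?K)" using sets_eq_imp_space_eq[OF sY'] by blast
        have im: "(\<lambda>z. ?inner z y) \<in> borel_measurable borel"
          using measurable_compose[OF measurable_Pair2'[OF y] innerm] by (simp only: fst_conv snd_conv)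
        have fb: "case_prod (?f y) \<in> borel_measurable (borel \<Otimes>\<^sub>M borel)"
          unfolding case_prod_beta'
          by (intro comp' measurable_fst measurable_snd measurable_const y')
        have "(\<integral>\<^sup>+z. ?inner z y \<partial>?Z p0) = (\<integral>\<^sup>+z. ?inner z y * ennreal (cn_density ve (z - of_real h * x t0)) \<partial>lborel)"
          using nn_integral_cgauss[OF im] by (simp only: p0 fst_conv snd_conv h_def)
        also have "\<dots> = (\<integral>\<^sup>+T. combined_test ve h (q t0) (?f y) T * ennreal (cn_density (1 / q' t0) (T - x t0)) \<partial>lborel)"
          using combined_test[OF ve q0[of t0] fb, where h = h and x = "x t0"] by (simp add: q'_def)
        also have "\<dots> = (\<integral>\<^sup>+T. f' w (y(t0 := T)) * ennreal (cn_density (1 / q' t0) (T - x t0)) \<partial>lborel)"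
          by (simp add: f'_def)
        finally show "(\<integral>\<^sup>+z. ?inner z y \<partial>?Z p0) = (\<integral>\<^sup>+T. f' w (y(t0 := T)) * ennreal (cn_density (1 / q' t0) (T - x t0)) \<partial>lborel)" .
      qed
      also have "?Y' = PiM ?K (\<lambda>t. cgauss (x t) (1 / q' t))"
        by (rule PiM_cong) (auto simp: q'_def)
      also have "(\<integral>\<^sup>+y. (\<integral>\<^sup>+T. f' w (y(t0 := T)) * ennreal (cn_density (1 / q' t0) (T - x t0)) \<partial>lborel) \<partial>PiM ?K (\<lambda>t. cgauss (x t) (1 / q' t)))
          = (\<integral>\<^sup>+y. f' w y \<partial>?Y q')"
        by (intro nn_integral_PiM_cgauss_remove[symmetric] K t0 iq f'w)
      finally show "(\<integral>\<^sup>+z. (\<integral>\<^sup>+y. f (w(p0 := z)) y \<partial>?Y q) \<partial>?Z p0) = (\<integral>\<^sup>+y. f' w y \<partial>?Y q')" .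
    qed
    finally show ?thesis .
  qed
  show ?case
    using g unfolding step g(3) prec by (intro exI[of _ g]) auto
qed

text \<open>\<open>G\<close> strictly exceeds all finite sums because the merging has to start from
  an observation of positive precision \<open>q t\<close>. The indicator of \<open>B\<close> ignores
  this fictitious observation, and after merging every time has precision \<open>G\<close>, the same
  for all cylinders.\<close>

lemma eavesdropper_cylinder_test:
  fixes he :: "nat \<Rightarrow> real"
  assumes ve: "ve > 0" and G: "\<And>J. finite J \<Longrightarrow> J \<subseteq> I \<Longrightarrow> (\<Sum>i\<in>J. (he i)\<^sup>2 / ve) < G"
    and F: "finite F" "F \<subseteq> {..<n::nat} \<times> I" and B: "B \<in> sets (PiM F (\<lambda>_. borel))"
  shows "\<exists>g. g \<in> borel_measurable (\<Pi>\<^sub>M t\<in>{..<n}. borel) \<and> (\<forall>y. g y \<le> 1) \<and>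
    (\<forall>x. emeasure (PiM ({..<n} \<times> I) (\<lambda>p. cgauss (of_real (he (snd p)) * x (fst p)) ve)) (prod_emb ({..<n} \<times> I) (\<lambda>_. borel) F B)
       = (\<integral>\<^sup>+y. g y \<partial>PiM {..<n} (\<lambda>t. cgauss (x t) (1 / G))))"
proof -
  define q where "q t = G - (\<Sum>p\<in>F. if fst p = t then (he (snd p))\<^sup>2 / ve else 0)" for t
  have q: "q t > 0" for t
  proof -
    let ?F = "{p \<in> F. fst p = t}"
    have "(\<Sum>p\<in>F. if fst p = t then (he (snd p))\<^sup>2 / ve else 0) = (\<Sum>p\<in>?F. (he (snd p))\<^sup>2 / ve)"
      using F(1) by (simp add: sum.inter_filter)
    also have "\<dots> = (\<Sum>i\<in>snd ` ?F. (he i)\<^sup>2 / ve)"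
      by (subst sum.reindex) (auto simp: inj_on_def)
    also have "\<dots> < G"
      using F by (intro G) auto
    finally show ?thesis by (simp add: q_def)
  qed
  let ?f = "\<lambda>w (y :: nat \<Rightarrow> complex). indicator B w :: ennreal"
  have f: "case_prod ?f \<in> borel_measurable (PiM F (\<lambda>_. borel) \<Otimes>\<^sub>M PiM {..<n} (\<lambda>_. borel))"
    unfolding case_prod_beta' by (rule measurable_compose[OF measurable_fst borel_measurable_indicator[OF B]])
  have F': "F \<subseteq> {..<n} \<times> UNIV" using F by auto
  have f1: "?f w y \<le> 1" for w y by (simp add: indicator_def)
  from degraded_test_function[where q = q and f = ?f and he = he, OF finite_lessThan ve F(1) F' f f1 q]
  obtain g where g: "g \<in> borel_measurable (\<Pi>\<^sub>M t\<in>{..<n}. borel)" "\<And>y. g y \<le> 1"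
    "\<And>x. (\<integral>\<^sup>+w. (\<integral>\<^sup>+y. ?f w y \<partial>PiM {..<n} (\<lambda>t. cgauss (x t) (1 / q t))) \<partial>PiM F (\<lambda>p. cgauss (of_real (he (snd p)) * x (fst p)) ve))
       = (\<integral>\<^sup>+y. g y \<partial>PiM {..<n} (\<lambda>t. cgauss (x t) (1 / (q t + (\<Sum>p\<in>F. if fst p = t then (he (snd p))\<^sup>2 / ve else 0)))))"
    by blast
  have "emeasure (PiM ({..<n} \<times> I) (\<lambda>p. cgauss (of_real (he (snd p)) * x (fst p)) ve)) (prod_emb ({..<n} \<times> I) (\<lambda>_. borel) F B)
       = (\<integral>\<^sup>+y. g y \<partial>PiM {..<n} (\<lambda>t. cgauss (x t) (1 / G)))" for x
  proof -
    let ?Z = "\<lambda>p. cgauss (of_real (he (snd p)) * x (fst p)) ve"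
    interpret product_prob_space ?Z "{..<n} \<times> I"
      by (rule product_prob_spaceI) (rule prob_space_cgauss[OF ve])
    have iq: "1 / q t > 0" for t using q[of t] by simp
    interpret Y: prob_space "PiM {..<n} (\<lambda>t. cgauss (x t) (1 / q t))"
      by (intro prob_space_PiM prob_space_cgauss iq)
    have sB: "sets (PiM F ?Z) = sets (PiM F (\<lambda>_. borel))" by (rule sets_PiM_cong) auto
    have B': "B \<in> sets (PiM F ?Z)" unfolding sB by (rule B)
    have emb: "prod_emb ({..<n} \<times> I) (\<lambda>_. borel) F B = prod_emb ({..<n} \<times> I) ?Z F B"
      by (simp add: prod_emb_def)
    have "emeasure (PiM ({..<n} \<times> I) ?Z) (prod_emb ({..<n} \<times> I) (\<lambda>_. borel) F B) = emeasure (PiM F ?Z) B"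
      unfolding emb by (rule emeasure_PiM_emb'[OF F(2,1) B'])
    also have "\<dots> = (\<integral>\<^sup>+w. (\<integral>\<^sup>+y. ?f w y \<partial>PiM {..<n} (\<lambda>t. cgauss (x t) (1 / q t))) \<partial>PiM F ?Z)"
      using B' by (simp only: nn_integral_const Y.emeasure_space_1 mult_1_right nn_integral_indicator)
    also have "\<dots> = (\<integral>\<^sup>+y. g y \<partial>PiM {..<n} (\<lambda>t. cgauss (x t) (1 / (q t + (\<Sum>p\<in>F. if fst p = t then (he (snd p))\<^sup>2 / ve else 0)))))"
      by (rule g(3))
    finally show ?thesis by (simp add: q_def)
  qed
  with g(1,2) show ?thesis by blast
qed

section \<open>Leakage and statistical distance\<close>

text \<open>Mutual information can only come from points where the posterior exceeds the uniform
  prior. There the integrand is at most \<open>1 + ln (card S)\<close> times the excess, elsewhere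
  it is nonpositive, so a one-sided comparison of probabilities suffices. The price for passing from
  distance to bits is logarithmic in the number of messages.\<close>

lemma (in prob_space) leakage_bound:
  fixes X :: "'a \<Rightarrow> nat" and Y :: "'a \<Rightarrow> 'b"
  assumes X: "X \<in> measurable M (count_space UNIV)" and Y: "Y \<in> measurable M T"
    and S: "finite S" "S \<noteq> {}" and XS: "distr M (count_space UNIV) X = measure_pmf (pmf_of_set S)"
    and \<delta>: "\<And>s A. s \<in> S \<Longrightarrow> A \<in> sets T \<Longrightarrow>
      measure M {\<omega> \<in> space M. X \<omega> = s \<and> Y \<omega> \<in> A} \<le> measure (distr M T Y) A / card S + \<delta> s"
  shows "entropy 2 (count_space UNIV) X - conditional_entropy 2 (count_space UNIV) (distr M T Y) X Y
    \<le> (1 + ln (card S)) / ln 2 * (\<Sum>s\<in>S. \<delta> s)"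
proof -
  note ctx = X Y S XS
  let ?L = "distr M T Y"
  interpret L: prob_space ?L by (rule prob_space_distr[OF Y])
  obtain r where r: "is_posterior M X Y T S r" using posterior_exists[OF ctx] by blast
  note r_meas = posterior_measurable[OF ctx r] and r0 = posterior_nonneg[OF ctx r] and r1 = posterior_le_1[OF ctx r]
  have rL: "r s \<in> borel_measurable ?L" for s unfolding measurable_distr_eq1 by (rule r_meas)
  define m where "m = real (card S)"
  have m: "m \<ge> 1" using S by (simp add: m_def Suc_le_eq card_gt_0_iff)
  have mu: "measure M {\<omega> \<in> space M. X \<omega> = s \<and> Y \<omega> \<in> A} = (\<integral>z. r s z * indicator A z \<partial>?L)"
    and ri: "integrable ?L (\<lambda>z. r s z * indicator A z)" if A: "A \<in> sets T" for s A
  proof -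
    have rm: "(\<lambda>z. r s z * indicator A z) \<in> borel_measurable ?L"
      using A by (intro borel_measurable_times rL borel_measurable_indicator) simp
    show int: "integrable ?L (\<lambda>z. r s z * indicator A z)"
    proof (rule L.integrable_const_bound[where B = 1, OF _ rm], rule AE_I2)
      fix z show "norm (r s z * indicator A z) \<le> 1"
        using r0[of s z] r1[of s z] by (cases "z \<in> A") simp_all
    qed
    have "emeasure M {\<omega> \<in> space M. X \<omega> = s \<and> Y \<omega> \<in> A} = (\<integral>\<^sup>+z. ennreal (r s z) * indicator A z \<partial>?L)"
      by (rule posterior_emeasure[OF ctx r A])
    also have "\<dots> = (\<integral>\<^sup>+z. ennreal (r s z * indicator A z) \<partial>?L)"
    proof (rule nn_integral_cong)
      fix z show "ennreal (r s z) * indicator A z = ennreal (r s z * indicator A z)"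
        by (cases "z \<in> A") simp_all
    qed
    also have "\<dots> = ennreal (\<integral>z. r s z * indicator A z \<partial>?L)"
    proof (rule nn_integral_eq_integral[OF int], rule AE_I2)
      fix z show "0 \<le> r s z * indicator A z"
        using r0[of s z] by (cases "z \<in> A") simp_all
    qed
    finally have em: "emeasure M {\<omega> \<in> space M. X \<omega> = s \<and> Y \<omega> \<in> A} = ennreal (\<integral>z. r s z * indicator A z \<partial>?L)" .
    show "measure M {\<omega> \<in> space M. X \<omega> = s \<and> Y \<omega> \<in> A} = (\<integral>z. r s z * indicator A z \<partial>?L)"
    proof -
      have "0 \<le> (\<integral>z. r s z * indicator A z \<partial>?L)"
      proof (rule Bochner_Integration.integral_nonneg)
        fix z show "0 \<le> r s z * indicator A z"
          using r0[of s z] by (cases "z \<in> A") simp_all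
      qed
      then show ?thesis
        unfolding measure_def em by (rule enn2real_ennreal)
    qed
  qed
  have main: "(\<integral>z. r s z * ln (r s z) \<partial>?L) + ln m / m \<le> (1 + ln m) * \<delta> s" if s: "s \<in> S" for s
  proof -
    \<comment> \<open>The event on which the posterior of \<open>s\<close> exceeds the prior; the
      hypothesis on \<open>\<delta> s\<close> is applied to it alone.\<close>
    define A where "A = {z \<in> space T. r s z > 1 / m}"
    have A: "A \<in> sets T"
    proof -
      have "A = r s -` {1 / m<..} \<inter> space T" by (auto simp: A_def)
      then show ?thesis by (simp only: measurable_sets[OF r_meas open_greaterThan[THEN borel_open]])
    qed
    have rln: "(\<lambda>z. r s z * ln (r s z)) \<in> borel_measurable ?L"
      by (intro borel_measurable_times borel_measurable_ln rL)
    have irln: "integrable ?L (\<lambda>z. r s z * ln (r s z))"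
    proof (rule L.integrable_const_bound[where B = 1, OF _ rln], rule AE_I2)
      fix z show "norm (r s z * ln (r s z)) \<le> 1"
        unfolding real_norm_def by (rule abs_mult_ln_le_1[OF r0 r1])
    qed
    have r_all: "(\<integral>z. r s z \<partial>?L) = 1 / m" and ir: "integrable ?L (r s)"
    proof -
      have e: "(\<integral>z. r s z \<partial>?L) = (\<integral>z. r s z * indicator (space T) z \<partial>?L)"
        by (intro Bochner_Integration.integral_cong) auto
      have eq: "{\<omega> \<in> space M. X \<omega> = s \<and> Y \<omega> \<in> space T} = {\<omega> \<in> space M. X \<omega> = s}"
        using measurable_space[OF Y] by auto
      show "(\<integral>z. r s z \<partial>?L) = 1 / m"
        unfolding e mu[OF sets.top, symmetric] eq
        using uniform_message_prob[OF ctx, of s] s by (simp add: measure_def m_def)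
      show "integrable ?L (r s)"
      proof (rule L.integrable_const_bound[where B = 1, OF _ rL], rule AE_I2)
        fix z show "norm (r s z) \<le> 1" using r0[of s z] r1[of s z] by simp
      qed
    qed
    have iA: "integrable ?L (indicator A :: _ \<Rightarrow> real)"
    proof (rule L.integrable_const_bound[where B = 1], rule AE_I2)
      show "(indicator A :: _ \<Rightarrow> real) \<in> borel_measurable ?L"
        using A by (intro borel_measurable_indicator) simp
    qed (simp add: indicator_def)
    have "(\<integral>z. r s z * ln (r s z) \<partial>?L) + ln m / m = (\<integral>z. r s z * ln (r s z) + ln m * r s z \<partial>?L)"
      by (simp only: Bochner_Integration.integral_add[OF irln integrable_mult_right[OF ir]] integral_mult_right_zero r_all
          times_divide_eq_right mult_1_right)
    also have "\<dots> \<le> (\<integral>z. (1 + ln m) * (r s z * indicator A z - indicator A z / m) \<partial>?L)"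
    proof (rule integral_mono)
      show "integrable ?L (\<lambda>z. r s z * ln (r s z) + ln m * r s z)"
        by (intro Bochner_Integration.integrable_add irln integrable_mult_right ir)
      show "integrable ?L (\<lambda>z. (1 + ln m) * (r s z * indicator A z - indicator A z / m))"
        by (intro integrable_mult_right Bochner_Integration.integrable_diff ri A integrable_divide_zero iA)
      fix z assume z: "z \<in> space ?L"
      let ?r = "r s z"
      show "?r * ln ?r + ln m * ?r \<le> (1 + ln m) * (?r * indicator A z - indicator A z / m)"
      proof (cases "?r > 1 / m")
        case True
        then have "?r > 0" using m by (smt (verit) divide_nonneg_nonneg)
        \<comment> \<open>For \<open>1 < u \<le> m\<close>, splitting \<open>u * ln u\<close> into
          \<open>(u - 1) * ln u + ln u\<close> and bounding the two logarithms by
          \<open>ln m\<close> and by \<open>u - 1\<close> makes the bound proportional to the excess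
          \<open>u - 1\<close>.\<close>
        define u where "u = m * ?r"
        have u: "u > 1" using True m by (simp add: u_def field_simps)
        have um: "u \<le> m" using r1[of s z] m by (simp add: u_def)
        have lu: "ln u = ln m + ln ?r" using m \<open>?r > 0\<close> by (simp add: u_def ln_mult)
        have "u * ln u = (u - 1) * ln u + ln u" by (simp add: algebra_simps)
        also have "\<dots> \<le> (u - 1) * ln m + (u - 1)"
          using u um ln_le_minus_one[of u] by (intro add_mono mult_left_mono) auto
        finally have "u * ln u / m \<le> ((u - 1) * ln m + (u - 1)) / m"
          using m by (intro divide_right_mono) auto
        moreover have "u * ln u / m = ?r * ln ?r + ln m * ?r"
        proof -
          have "u / m = ?r" using m by (simp add: u_def)
          then have "u * ln u / m = ?r * ln u" by (metis times_divide_eq_left)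
          then show ?thesis unfolding lu by (simp add: algebra_simps)
        qed
        moreover have "((u - 1) * ln m + (u - 1)) / m = (1 + ln m) * (?r - 1 / m)"
          using m by (simp add: u_def field_simps)
        ultimately show ?thesis using True z by (simp add: A_def)
      next
        case False
        have "?r * (ln ?r + ln m) \<le> 0"
        proof (cases "?r = 0")
          case f: False
          then have "?r > 0" using r0[of s z] by simp
          then have "ln ?r + ln m = ln (m * ?r)" using m by (simp add: ln_mult)
          also have "\<dots> \<le> 0" using False m \<open>?r > 0\<close> by (simp add: field_simps)
          finally show ?thesis using \<open>?r > 0\<close> by (simp add: mult_nonneg_nonpos)
        qed simp
        then show ?thesis using False by (simp add: A_def algebra_simps)
      qed
    qed
    also have "\<dots> = (1 + ln m) * (measure M {\<omega> \<in> space M. X \<omega> = s \<and> Y \<omega> \<in> A} - measure ?L A / m)"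
    proof -
      have "(\<integral>z. indicator A z / m \<partial>?L) = measure ?L A / m"
        using A by (simp only: integral_divide_zero Bochner_Integration.integral_indicator) (simp add: Int_absorb2[OF sets.sets_into_space])
      then show ?thesis
        by (simp only: integral_mult_right_zero Bochner_Integration.integral_diff[OF ri[OF A] integrable_divide_zero[OF iA]] mu[OF A])
    qed
    also have "\<dots> \<le> (1 + ln m) * \<delta> s"
      using \<delta>[OF s A] m by (intro mult_left_mono) (auto simp: m_def)
    finally show ?thesis .
  qed
  have "ln m + (\<Sum>s\<in>S. \<integral>z. r s z * ln (r s z) \<partial>?L) = (\<Sum>s\<in>S. (\<integral>z. r s z * ln (r s z) \<partial>?L) + ln m / m)"
    using m by (simp add: sum.distrib m_def)
  also have "\<dots> \<le> (\<Sum>s\<in>S. (1 + ln m) * \<delta> s)"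
    by (rule sum_mono) (rule main)
  finally have "(ln m + (\<Sum>s\<in>S. \<integral>z. r s z * ln (r s z) \<partial>?L)) / ln 2 \<le> (1 + ln m) * (\<Sum>s\<in>S. \<delta> s) / ln 2"
    by (intro divide_right_mono) (simp_all add: sum_distrib_left)
  moreover have "entropy 2 (count_space UNIV) X - conditional_entropy 2 (count_space UNIV) ?L X Y
      = (ln m + (\<Sum>s\<in>S. \<integral>z. r s z * ln (r s z) \<partial>?L)) / ln 2"
    unfolding uniform_message_entropy[OF ctx] posterior_conditional_entropy[OF ctx r]
    by (simp add: m_def log_def add_divide_distrib sum_divide_distrib)
  ultimately show ?thesis by (simp add: m_def)
qed

section \<open>Codes given by a codebook\<close>

text \<open>The first index is the message, the second the private randomness of the encoder; with
  \<open>KK\<close> a rectangle both are uniform and independent. \<open>restrict\<close> turns the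
  word into an element of the product space over \<open>{..<n}\<close>.\<close>

definition codebook_law :: "nat \<Rightarrow> (nat \<times> nat) set \<Rightarrow> (nat \<times> nat \<Rightarrow> nat \<Rightarrow> complex) \<Rightarrow> (nat \<times> (nat \<Rightarrow> complex)) measure" where
  "codebook_law n KK c = distr (measure_pmf (pmf_of_set KK)) (count_space UNIV \<Otimes>\<^sub>M (\<Pi>\<^sub>M t\<in>{..<n}. borel))
     (\<lambda>j. (fst j, restrict (c j) {..<n}))"

lemma codebook_measurable:
  "(\<lambda>j. (fst j, restrict (c j) {..<n})) \<in> measurable (measure_pmf p) (count_space UNIV \<Otimes>\<^sub>M (\<Pi>\<^sub>M t\<in>{..<n}. (borel :: complex measure)))"
  by (simp add: space_pair_measure space_PiM)

lemma nn_integral_codebook_law: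
  assumes KK: "finite KK" "KK \<noteq> {}"
    and f: "f \<in> borel_measurable (count_space UNIV \<Otimes>\<^sub>M (\<Pi>\<^sub>M t\<in>{..<n}. borel))"
  shows "(\<integral>\<^sup>+c. f c \<partial>codebook_law n KK c) = (\<Sum>j\<in>KK. f (fst j, restrict (c j) {..<n})) / card KK"
proof -
  have "(\<integral>\<^sup>+c. f c \<partial>codebook_law n KK c) = (\<integral>\<^sup>+j. f (fst j, restrict (c j) {..<n}) \<partial>measure_pmf (pmf_of_set KK))"
    unfolding codebook_law_def
    by (rule nn_integral_distr[OF codebook_measurable]) (simp only: measurable_distr_eq1 f)
  also have "\<dots> = (\<Sum>j\<in>KK. f (fst j, restrict (c j) {..<n})) / card KK"
    by (rule nn_integral_pmf_of_set) (use KK in auto)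
  finally show ?thesis .
qed

lemma distr_codebook_law_fst:
  assumes "m > 0" "m' > 0"
  shows "distr (codebook_law n ({..<m} \<times> {..<m'}) c) (count_space UNIV) fst = measure_pmf (pmf_of_set {..<m})"
proof -
  let ?KK = "{..<m} \<times> {..<m'}"
  have "distr (codebook_law n ?KK c) (count_space UNIV) fst = distr (measure_pmf (pmf_of_set ?KK)) (count_space UNIV) fst"
    unfolding codebook_law_def
    by (subst distr_distr[OF _ codebook_measurable]) (auto simp: comp_def)
  also have "\<dots> = measure_pmf (map_pmf fst (pmf_of_set ?KK))"
    by (simp add: map_pmf_rep_eq)
  also have "map_pmf fst (pmf_of_set ?KK) = pmf_of_set {..<m}"
  proof (rule pmf_eqI)
    fix s
    have "?KK \<inter> fst -` {s} = (if s < m then {s} \<times> {..<m'} else {})" by auto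
    then show "pmf (map_pmf fst (pmf_of_set ?KK)) s = pmf (pmf_of_set {..<m}) s"
      using assms by (subst pmf_map, subst measure_pmf_of_set) (auto simp: card_cartesian_product lessThan_empty_iff)
  qed
  finally show ?thesis .
qed

text \<open>The power constraint averages over the message and the private index, hence over the
  whole codebook. Individual words may exceed \<open>P\<close>.\<close>

lemma codebook_encoder:
  assumes n: "n > 0" and m: "m > 0" "m' > 0" and P: "P \<ge> 0"
    and pow: "(\<Sum>j\<in>{..<m} \<times> {..<m'}. \<Sum>t<n. (cmod (c j t))\<^sup>2) \<le> real (m * m') * real n * P"
  shows "wiretap_encoder n P (codebook_law n ({..<m} \<times> {..<m'}) c)"
  unfolding wiretap_encoder_def
proof (intro conjI)
  let ?KK = "{..<m} \<times> {..<m'}"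
  let ?C = "codebook_law n ?KK c"
  have KK: "finite ?KK" "?KK \<noteq> {}" using m by auto
  have card: "card ?KK = m * m'" by (simp add: card_cartesian_product)
  show "prob_space ?C"
    unfolding codebook_law_def by (rule prob_space.prob_space_distr[OF measure_pmf.prob_space_axioms codebook_measurable])
  show "sets ?C = sets (count_space UNIV \<Otimes>\<^sub>M (\<Pi>\<^sub>M t\<in>{..<n}. borel))" by (simp add: codebook_law_def)
  show "\<exists>S. finite S \<and> S \<noteq> {} \<and> distr ?C (count_space UNIV) fst = measure_pmf (pmf_of_set S)"
    using m distr_codebook_law_fst[OF m] by (intro exI[of _ "{..<m}"]) auto
  have "(\<integral>\<^sup>+c. ennreal ((cmod (snd c t))\<^sup>2) \<partial>?C) = (\<Sum>j\<in>?KK. ennreal ((cmod (c j t))\<^sup>2)) / (m * m')" if "t < n" for t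
  proof -
    have "(\<lambda>c. ennreal ((cmod (snd c t))\<^sup>2)) \<in> borel_measurable (count_space UNIV \<Otimes>\<^sub>M (\<Pi>\<^sub>M t\<in>{..<n}. (borel :: complex measure)))"
      using that by (intro measurable_compose[OF _ measurable_ennreal] borel_measurable_power measurable_compose[OF _ borel_measurable_norm]
          measurable_compose[OF measurable_snd measurable_component_singleton]) auto
    from nn_integral_codebook_law[OF KK this, of c] show ?thesis
      using that by (simp add: card_cartesian_product)
  qed
  then have "(\<Sum>t<n. \<integral>\<^sup>+c. ennreal ((cmod (snd c t))\<^sup>2) \<partial>?C) = (\<Sum>t<n. ennreal ((\<Sum>j\<in>?KK. (cmod (c j t))\<^sup>2) / (m * m')))"
    using m by (intro sum.cong) (auto simp: ennreal_of_nat_eq_real_of_nat divide_ennreal[symmetric] sum_nonneg simp flip: of_nat_mult)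
  also have "\<dots> = ennreal ((\<Sum>t<n. \<Sum>j\<in>?KK. (cmod (c j t))\<^sup>2) / (m * m'))"
    by (subst sum_ennreal) (auto simp: sum_divide_distrib intro!: divide_nonneg_nonneg sum_nonneg)
  also have "\<dots> / of_nat n = ennreal ((\<Sum>t<n. \<Sum>j\<in>?KK. (cmod (c j t))\<^sup>2) / (m * m') / n)"
    using n by (subst ennreal_of_nat_eq_real_of_nat, subst divide_ennreal) (auto intro!: divide_nonneg_nonneg sum_nonneg)
  also have "\<dots> \<le> ennreal P"
  proof (rule ennreal_leI)
    have "(\<Sum>t<n. \<Sum>j\<in>?KK. (cmod (c j t))\<^sup>2) = (\<Sum>j\<in>?KK. \<Sum>t<n. (cmod (c j t))\<^sup>2)" by (rule sum.swap)
    then have "(\<Sum>t<n. \<Sum>j\<in>?KK. (cmod (c j t))\<^sup>2) \<le> real (m * m') * real n * P" using pow by simp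
    then show "(\<Sum>t<n. \<Sum>j\<in>?KK. (cmod (c j t))\<^sup>2) / (m * m') / n \<le> P"
      using n m by (simp add: field_simps)
  qed
  finally show "(\<Sum>t<n. \<integral>\<^sup>+c. ennreal ((cmod (snd c t))\<^sup>2) \<partial>?C) / of_nat n \<le> ennreal P" .
qed

lemma nn_integral_eavesdropper_output:
  fixes h :: "nat \<Rightarrow> (nat \<times> nat \<Rightarrow> complex) \<Rightarrow> ennreal"
  assumes C: "wiretap_encoder n P C" and vl: "vl > 0" and ve: "ve > 0"
    and h: "\<And>s. h s \<in> borel_measurable (\<Pi>\<^sub>M ti\<in>{..<n} \<times> I. borel)"
  shows "(\<integral>\<^sup>+\<omega>. h (message \<omega>) (eavesdropper_output n I he \<omega>) \<partial>wiretap_space n I vl ve C)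
    = (\<integral>\<^sup>+c. (\<integral>\<^sup>+z. h (fst c) z \<partial>PiM ({..<n} \<times> I) (\<lambda>p. cgauss (of_real (he (snd p)) * snd c (fst p)) ve)) \<partial>C)"
proof -
  interpret L: prob_space "\<Pi>\<^sub>M t\<in>{..<n}. complex_gaussian vl" by (rule prob_space_PiM_complex_gaussian[OF vl])
  have m: "(\<lambda>\<omega>. h (message \<omega>) (eavesdropper_output n I he \<omega>)) \<in> borel_measurable (wiretap_space n I vl ve C)"
    by (rule measurable_compose_countable[OF _ message_measurable[OF C vl ve]])
       (rule measurable_compose[OF eavesdropper_output_measurable[OF C vl ve] h])
  have out: "eavesdropper_output n I he (c, V, w) = (\<lambda>p\<in>{..<n} \<times> I. of_real (he (snd p)) * snd c (fst p) + w p)" for c V w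
    by (auto simp: eavesdropper_output_def fun_eq_iff)
  show ?thesis
    unfolding nn_integral_wiretap_space[OF C vl ve m]
    unfolding out message_def fst_conv
    by (simp only: nn_integral_const L.emeasure_space_1 mult_1_right nn_integral_PiM_shift[OF ve h])
qed

lemma codebook_message_entropy:
  assumes C: "wiretap_encoder n P (codebook_law n ({..<m} \<times> {..<m'}) c)" and m: "m > 0" "m' > 0" and vl: "vl > 0" and ve: "ve > 0"
  shows "message_entropy (wiretap_space n I vl ve (codebook_law n ({..<m} \<times> {..<m'}) c)) = log 2 m"
proof -
  let ?W = "wiretap_space n I vl ve (codebook_law n ({..<m} \<times> {..<m'}) c)"
  interpret W: prob_space ?W by (rule prob_space_wiretap_space[OF C vl ve])
  have "{..<m} \<noteq> {}" using m by auto
  from W.uniform_message_entropy[OF message_measurable[OF C vl ve] eavesdropper_output_measurable[OF C vl ve, where he = "\<lambda>_. 0"] finite_lessThan this]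
  show ?thesis
    unfolding message_entropy_def distr_message[OF C vl ve] distr_codebook_law_fst[OF m] by simp
qed

section \<open>Likelihood ratios\<close>

text \<open>Likelihood ratio of the channel law given the word \<open>x\<close> to the Gaussian
  output law of variance \<open>k\<close>. For \<open>k = v + h\<^sup>2 * P\<close> its logarithm is
  the information density of a Gaussian input of power \<open>P\<close>.\<close>

definition lik :: "nat \<Rightarrow> real \<Rightarrow> real \<Rightarrow> real \<Rightarrow> (nat \<Rightarrow> complex) \<Rightarrow> (nat \<Rightarrow> complex) \<Rightarrow> real" where
  "lik n h v k x y = (\<Prod>t<n. cn_density v (y t - of_real h * x t) / cn_density k (y t))"

lemma lik_nonneg: "v > 0 \<Longrightarrow> k > 0 \<Longrightarrow> lik n h v k x y \<ge> 0"
  unfolding lik_def by (intro prod_nonneg) (simp add: cn_density_nonneg)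

lemma lik_measurable:
  assumes a: "a \<in> measurable N (\<Pi>\<^sub>M t\<in>{..<n}. borel)" and b: "b \<in> measurable N (\<Pi>\<^sub>M t\<in>{..<n}. borel)"
  shows "(\<lambda>\<omega>. lik n h v k (a \<omega>) (b \<omega>)) \<in> borel_measurable N"
  unfolding lik_def
proof (intro borel_measurable_prod borel_measurable_divide measurable_compose[OF _ cn_density_measurable] borel_measurable_diff
    borel_measurable_times borel_measurable_const)
  fix t assume t: "t \<in> {..<n}"
  show "(\<lambda>\<omega>. a \<omega> t) \<in> borel_measurable N" by (rule measurable_compose[OF a measurable_component_singleton[OF t]])
  show "(\<lambda>\<omega>. b \<omega> t) \<in> borel_measurable N" "(\<lambda>\<omega>. b \<omega> t) \<in> borel_measurable N"
    by (rule measurable_compose[OF b measurable_component_singleton[OF t]])+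
qed

lemma nn_integral_lik:
  assumes v: "v > 0" and k: "k > 0" and f: "f \<in> borel_measurable (\<Pi>\<^sub>M t\<in>{..<n}. borel)"
  shows "(\<integral>\<^sup>+y. f y \<partial>PiM {..<n} (\<lambda>t. cgauss (of_real h * x t) v))
       = (\<integral>\<^sup>+y. ennreal (lik n h v k x y) * f y \<partial>(\<Pi>\<^sub>M t\<in>{..<n}. complex_gaussian k))"
proof -
  let ?Ys = "\<Pi>\<^sub>M t\<in>{..<n}. (borel :: complex measure)"
  have lm: "(\<lambda>y. lik n h v k x y) \<in> borel_measurable ?Ys"
    unfolding lik_def
    by (intro borel_measurable_prod borel_measurable_divide measurable_compose[OF _ cn_density_measurable] borel_measurable_diff
      borel_measurable_const measurable_component_singleton)
  have fm: "(\<lambda>y. ennreal (lik n h v k x y) * f y) \<in> borel_measurable ?Ys"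
    by (intro borel_measurable_times_ennreal measurable_compose[OF lm measurable_ennreal] f)
  have "(\<integral>\<^sup>+y. ennreal (lik n h v k x y) * f y \<partial>(\<Pi>\<^sub>M t\<in>{..<n}. complex_gaussian k))
      = (\<integral>\<^sup>+y. ennreal (\<Prod>t<n. cn_density k (y t - 0)) * (ennreal (lik n h v k x y) * f y) \<partial>PiM {..<n} (\<lambda>_. lborel))"
    unfolding complex_gaussian_eq_cgauss by (rule nn_integral_PiM_cgauss[OF finite_lessThan k fm])
  also have "\<dots> = (\<integral>\<^sup>+y. ennreal (\<Prod>t<n. cn_density v (y t - of_real h * x t)) * f y \<partial>PiM {..<n} (\<lambda>_. lborel))"
  proof (rule nn_integral_cong)
    fix y
    have "(\<Prod>t<n. cn_density k (y t - 0)) * lik n h v k x y = (\<Prod>t<n. cn_density v (y t - of_real h * x t))"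
      unfolding lik_def prod.distrib[symmetric] using cn_density_pos[OF k] by (intro prod.cong) (auto simp: less_imp_neq[THEN not_sym])
    moreover have "(\<Prod>t<n. cn_density k (y t - 0)) \<ge> 0" using k by (intro prod_nonneg) (simp add: cn_density_nonneg)
    ultimately have "ennreal (\<Prod>t<n. cn_density k (y t - 0)) * ennreal (lik n h v k x y) = ennreal (\<Prod>t<n. cn_density v (y t - of_real h * x t))"
      using lik_nonneg[OF v k] by (simp only: ennreal_mult[symmetric])
    then show "ennreal (\<Prod>t<n. cn_density k (y t - 0)) * (ennreal (lik n h v k x y) * f y) = ennreal (\<Prod>t<n. cn_density v (y t - of_real h * x t)) * f y"
      by (simp only: mult.assoc[symmetric])
  qed
  also have "\<dots> = (\<integral>\<^sup>+y. f y \<partial>PiM {..<n} (\<lambda>t. cgauss (of_real h * x t) v))"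
    by (rule nn_integral_PiM_cgauss[OF finite_lessThan v f, symmetric])
  finally show ?thesis ..
qed

lemma nn_integral_PiM_complex_gaussian_prod:
  fixes f :: "nat \<Rightarrow> complex \<Rightarrow> real"
  assumes v: "v > 0" and f: "\<And>t. t < n \<Longrightarrow> f t \<in> borel_measurable borel" and f0: "\<And>t x. f t x \<ge> 0"
  shows "(\<integral>\<^sup>+x. ennreal (\<Prod>t<n. f t (x t)) \<partial>(\<Pi>\<^sub>M t\<in>{..<n}. complex_gaussian v))
       = (\<Prod>t<n. \<integral>\<^sup>+x. ennreal (f t x) \<partial>complex_gaussian v)"
proof -
  interpret product_sigma_finite "\<lambda>_::nat. complex_gaussian v"
    by (simp add: product_sigma_finite_def prob_space_imp_sigma_finite prob_space_complex_gaussian v)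
  have "(\<integral>\<^sup>+x. ennreal (\<Prod>t<n. f t (x t)) \<partial>(\<Pi>\<^sub>M t\<in>{..<n}. complex_gaussian v))
      = (\<integral>\<^sup>+x. (\<Prod>t<n. ennreal (f t (x t))) \<partial>(\<Pi>\<^sub>M t\<in>{..<n}. complex_gaussian v))"
    using f0 by (simp add: prod_ennreal)
  also have "\<dots> = (\<Prod>t<n. \<integral>\<^sup>+x. ennreal (f t x) \<partial>complex_gaussian v)"
  proof (rule product_nn_integral_prod[OF finite_lessThan, where f = "\<lambda>t x. ennreal (f t x)"])
    fix t assume "t \<in> {..<n}"
    then have t: "t < n" by simp
    have "f t \<in> borel_measurable (complex_gaussian v)"
      unfolding measurable_cong_sets[OF sets_complex_gaussian refl] by (rule f[OF t])
    then show "(\<lambda>x. ennreal (f t x)) \<in> borel_measurable (complex_gaussian v)"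
      by (rule measurable_compose[OF _ measurable_ennreal])
  qed
  finally show ?thesis .
qed

lemma cn_density_ratio_measurable:
  "(\<lambda>x. cn_density v (y - of_real h * x) / c) \<in> borel_measurable borel"
  by (intro borel_measurable_divide measurable_compose[OF _ cn_density_measurable] borel_measurable_diff borel_measurable_times
      borel_measurable_const measurable_ident) simp

text \<open>Averaging the channel law over Gaussian words gives exactly the Gaussian law of variance
  \<open>k\<close>, so the mean is 1 for each single \<open>y\<close>. This pointwise normalisation
  is what \<open>iid_average_deviation\<close> asks for.\<close>

lemma lik_mean:
  assumes P: "P > 0" and v: "v > 0" and k: "k = v + h\<^sup>2 * P"
  shows "(\<integral>\<^sup>+x. ennreal (lik n h v k x y) \<partial>(\<Pi>\<^sub>M t\<in>{..<n}. complex_gaussian P)) = 1"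
proof -
  have kp: "k > 0" using P v k by (simp add: add_pos_nonneg)
  have one: "(\<integral>\<^sup>+x. ennreal (cn_density v (z - of_real h * x) / cn_density k z) \<partial>complex_gaussian P) = 1" for z
  proof -
    have c: "cn_density k z > 0" by (rule cn_density_pos[OF kp])
    have "(\<integral>\<^sup>+x. ennreal (cn_density v (z - of_real h * x) / cn_density k z) \<partial>complex_gaussian P)
        = (\<integral>\<^sup>+x. ennreal (1 / cn_density k z) * (ennreal (cn_density P x) * ennreal (cn_density v (z - of_real h * x))) \<partial>lborel)"
      unfolding nn_integral_complex_gaussian[OF measurable_compose[OF cn_density_ratio_measurable measurable_ennreal]]
      using P v c by (intro nn_integral_cong) (simp add: ennreal_mult[symmetric] cn_density_nonneg)
    also have "\<dots> = ennreal (1 / cn_density k z) * ennreal (cn_density k z)"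
      by (subst nn_integral_cmult) (simp_all add: cn_density_convolution[OF P v] k)
    also have "\<dots> = 1" using c by (simp add: ennreal_mult[symmetric])
    finally show ?thesis .
  qed
  have "(\<integral>\<^sup>+x. ennreal (lik n h v k x y) \<partial>(\<Pi>\<^sub>M t\<in>{..<n}. complex_gaussian P))
      = (\<Prod>t<n. \<integral>\<^sup>+x. ennreal (cn_density v (y t - of_real h * x) / cn_density k (y t)) \<partial>complex_gaussian P)"
    unfolding lik_def using v kp
    by (intro nn_integral_PiM_complex_gaussian_prod[OF P] cn_density_ratio_measurable) (simp add: cn_density_nonneg)
  then show ?thesis by (simp add: one)
qed

text \<open>The scalar moment bound tensorises over the \<open>n\<close> uses of the
  channel.\<close>

lemma lik_moment:
  assumes P: "P > 0" and v: "v > 0" and s: "\<bar>s\<bar> < 1" and k: "k = v + h\<^sup>2 * P"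
  shows "(\<integral>\<^sup>+y. (\<integral>\<^sup>+x. ennreal (lik n h v k x y powr (1 + s)) \<partial>(\<Pi>\<^sub>M t\<in>{..<n}. complex_gaussian P))
        \<partial>(\<Pi>\<^sub>M t\<in>{..<n}. complex_gaussian k)) \<le> ennreal (((k / v) powr s / (1 - s\<^sup>2)) ^ n)"
proof -
  have kp: "k > 0" using P v k by (simp add: add_pos_nonneg)
  have s2: "s\<^sup>2 < 1" using s by (simp add: abs_square_less_1)
  let ?f = "\<lambda>x y. (cn_density v (y - of_real h * x) / cn_density k y) powr (1 + s)"
  let ?e = "\<lambda>y. \<integral>\<^sup>+x. ennreal (?f x y) \<partial>complex_gaussian P"
  have fm: "(\<lambda>x. ?f x y) \<in> borel_measurable borel" for y
    by (intro powr_real_measurable cn_density_ratio_measurable borel_measurable_const)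
  have em: "?e \<in> borel_measurable borel"
  proof -
    interpret prob_space "complex_gaussian P" by (rule prob_space_complex_gaussian[OF P])
    have "(\<lambda>p. ennreal (?f (snd p) (fst p))) \<in> borel_measurable ((borel :: complex measure) \<Otimes>\<^sub>M complex_gaussian P)"
    proof -
      have "snd \<in> borel_measurable ((borel :: complex measure) \<Otimes>\<^sub>M complex_gaussian P)"
        using measurable_snd[of "borel :: complex measure" "complex_gaussian P"] by (simp add: measurable_cong_sets[OF refl sets_complex_gaussian])
      then show ?thesis
        by (intro measurable_compose[OF _ measurable_ennreal] powr_real_measurable borel_measurable_divide
          measurable_compose[OF _ cn_density_measurable] borel_measurable_diff borel_measurable_times borel_measurable_const measurable_fst)
    qed
    from borel_measurable_nn_integral_fst[OF this] show ?thesis by simp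
  qed
  have lp: "lik n h v k x y powr (1 + s) = (\<Prod>t<n. ?f (x t) (y t))" for x y
    unfolding lik_def by (rule prod_powr_distrib)
  interpret product_sigma_finite "\<lambda>_::nat. complex_gaussian k"
    by (simp add: product_sigma_finite_def prob_space_imp_sigma_finite prob_space_complex_gaussian kp)
  have "(\<integral>\<^sup>+y. (\<integral>\<^sup>+x. ennreal (lik n h v k x y powr (1 + s)) \<partial>(\<Pi>\<^sub>M t\<in>{..<n}. complex_gaussian P)) \<partial>(\<Pi>\<^sub>M t\<in>{..<n}. complex_gaussian k))
      = (\<integral>\<^sup>+y. (\<Prod>t<n. ?e (y t)) \<partial>(\<Pi>\<^sub>M t\<in>{..<n}. complex_gaussian k))"
    unfolding lp by (intro nn_integral_cong nn_integral_PiM_complex_gaussian_prod[OF P] fm) simp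
  also have "\<dots> = (\<Prod>t<n. \<integral>\<^sup>+y. ?e y \<partial>complex_gaussian k)"
    by (rule product_nn_integral_prod[OF finite_lessThan, where f = "\<lambda>_. ?e"], unfold measurable_cong_sets[OF sets_complex_gaussian refl]) (rule em)
  also have "\<dots> \<le> (\<Prod>t<n. ennreal ((k / v) powr s / (1 - s\<^sup>2)))"
    by (intro prod_mono_ennreal gaussian_likelihood_moment[OF P v s k])
  also have "\<dots> = ennreal (((k / v) powr s / (1 - s\<^sup>2)) ^ n)"
    using s2 by (simp add: ennreal_power)
  finally show ?thesis .
qed

lemma codebook_receiver:
  fixes F :: "nat \<Rightarrow> (nat \<Rightarrow> complex) \<Rightarrow> ennreal"
  assumes KK: "finite KK" "KK \<noteq> {}" and C: "wiretap_encoder n P (codebook_law n KK c)" and vl: "vl > 0" and ve: "ve > 0"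
    and F: "\<And>s. F s \<in> borel_measurable (\<Pi>\<^sub>M t\<in>{..<n}. borel)"
  shows "(\<integral>\<^sup>+\<omega>. F (message \<omega>) (receiver_output n hl \<omega>) \<partial>wiretap_space n I vl ve (codebook_law n KK c))
    = (\<Sum>j\<in>KK. \<integral>\<^sup>+y. F (fst j) y \<partial>PiM {..<n} (\<lambda>t. cgauss (of_real hl * c j t) vl)) / card KK" (is "?lhs = _")
proof -
  let ?Xs = "count_space UNIV \<Otimes>\<^sub>M (\<Pi>\<^sub>M t\<in>{..<n}. (borel :: complex measure))"
  let ?L = "\<Pi>\<^sub>M t\<in>{..<n}. complex_gaussian vl"
  let ?f = "\<lambda>c. \<integral>\<^sup>+y. F (fst c) y \<partial>PiM {..<n} (\<lambda>t. cgauss (of_real hl * snd c t) vl)"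
  interpret L: prob_space ?L by (rule prob_space_PiM_complex_gaussian[OF vl])
  have f: "?f \<in> borel_measurable ?Xs"
  proof -
    have y: "(\<lambda>p. \<lambda>t\<in>{..<n}. of_real hl * snd (fst p) t + snd p t) \<in> measurable (?Xs \<Otimes>\<^sub>M ?L) (\<Pi>\<^sub>M t\<in>{..<n}. borel)"
    proof (intro measurable_restrict borel_measurable_add borel_measurable_times borel_measurable_const)
      fix t assume t: "t \<in> {..<n}"
      show "(\<lambda>p. snd (fst p) t) \<in> borel_measurable (?Xs \<Otimes>\<^sub>M ?L)"
        by (rule measurable_compose[OF measurable_compose[OF measurable_fst measurable_snd] measurable_component_singleton[OF t]])
      have "(\<lambda>V. V t) \<in> borel_measurable ?L"
        unfolding measurable_cong_sets[OF sets_PiM_complex_gaussian refl] by (rule measurable_component_singleton[OF t])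
      then show "(\<lambda>p. snd p t) \<in> borel_measurable (?Xs \<Otimes>\<^sub>M ?L)" by (rule measurable_compose[OF measurable_snd])
    qed
    have "(\<lambda>p. F (fst (fst p)) (\<lambda>t\<in>{..<n}. of_real hl * snd (fst p) t + snd p t)) \<in> borel_measurable (?Xs \<Otimes>\<^sub>M ?L)"
      by (rule measurable_compose_countable[OF _ measurable_compose[OF measurable_fst measurable_fst]]) (rule measurable_compose[OF y F])
    from L.borel_measurable_nn_integral_fst[OF this] show ?thesis
      unfolding fst_conv snd_conv nn_integral_PiM_shift[OF vl F] .
  qed
  have "(\<integral>\<^sup>+\<omega>. F (message \<omega>) (receiver_output n hl \<omega>) \<partial>wiretap_space n I vl ve (codebook_law n KK c)) = (\<integral>\<^sup>+c. ?f c \<partial>codebook_law n KK c)"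
    by (rule nn_integral_receiver_output[OF C vl ve F])
  also have "\<dots> = (\<Sum>j\<in>KK. ?f (fst j, restrict (c j) {..<n})) / card KK"
    by (rule nn_integral_codebook_law[OF KK f])
  finally have sum: "?lhs = (\<Sum>j\<in>KK. ?f (fst j, restrict (c j) {..<n})) / card KK" .
  have eq: "?f (fst j, restrict (c j) {..<n}) = (\<integral>\<^sup>+y. F (fst j) y \<partial>PiM {..<n} (\<lambda>t. cgauss (of_real hl * c j t) vl))" for j
  proof -
    have "PiM {..<n} (\<lambda>t. cgauss (of_real hl * restrict (c j) {..<n} t) vl) = PiM {..<n} (\<lambda>t. cgauss (of_real hl * c j t) vl)"
      by (rule PiM_cong) auto
    then show ?thesis by (simp only: fst_conv snd_conv)
  qed
  show ?thesis unfolding sum eq ..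
qed

lemma codebook_eavesdropper:
  fixes h :: "nat \<Rightarrow> (nat \<times> nat \<Rightarrow> complex) \<Rightarrow> ennreal"
  assumes KK: "finite KK" "KK \<noteq> {}" and C: "wiretap_encoder n P (codebook_law n KK c)" and vl: "vl > 0" and ve: "ve > 0"
    and h: "\<And>s. h s \<in> borel_measurable (\<Pi>\<^sub>M ti\<in>{..<n} \<times> I. borel)"
  shows "(\<integral>\<^sup>+\<omega>. h (message \<omega>) (eavesdropper_output n I he \<omega>) \<partial>wiretap_space n I vl ve (codebook_law n KK c))
    = (\<Sum>j\<in>KK. \<integral>\<^sup>+z. h (fst j) z \<partial>PiM ({..<n} \<times> I) (\<lambda>p. cgauss (of_real (he (snd p)) * c j (fst p)) ve)) / card KK" (is "?lhs = _")
proof -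
  let ?Xs = "count_space UNIV \<Otimes>\<^sub>M (\<Pi>\<^sub>M t\<in>{..<n}. (borel :: complex measure))"
  let ?L = "\<Pi>\<^sub>M ti\<in>{..<n} \<times> I. complex_gaussian ve"
  let ?f = "\<lambda>c. \<integral>\<^sup>+z. h (fst c) z \<partial>PiM ({..<n} \<times> I) (\<lambda>p. cgauss (of_real (he (snd p)) * snd c (fst p)) ve)"
  interpret L: prob_space ?L by (rule prob_space_PiM_complex_gaussian[OF ve])
  have f: "?f \<in> borel_measurable ?Xs"
  proof -
    have y: "(\<lambda>p. \<lambda>ti\<in>{..<n} \<times> I. of_real (he (snd ti)) * snd (fst p) (fst ti) + snd p ti) \<in> measurable (?Xs \<Otimes>\<^sub>M ?L) (\<Pi>\<^sub>M ti\<in>{..<n} \<times> I. borel)"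
    proof (intro measurable_restrict borel_measurable_add borel_measurable_times borel_measurable_const)
      fix ti assume ti: "ti \<in> {..<n} \<times> I"
      then have t: "fst ti \<in> {..<n}" by auto
      show "(\<lambda>p. snd (fst p) (fst ti)) \<in> borel_measurable (?Xs \<Otimes>\<^sub>M ?L)"
        by (rule measurable_compose[OF measurable_compose[OF measurable_fst measurable_snd] measurable_component_singleton[OF t]])
      have "(\<lambda>V. V ti) \<in> borel_measurable ?L"
        unfolding measurable_cong_sets[OF sets_PiM_complex_gaussian refl] by (rule measurable_component_singleton[OF ti])
      then show "(\<lambda>p. snd p ti) \<in> borel_measurable (?Xs \<Otimes>\<^sub>M ?L)" by (rule measurable_compose[OF measurable_snd])
    qed
    have "(\<lambda>p. h (fst (fst p)) (\<lambda>ti\<in>{..<n} \<times> I. of_real (he (snd ti)) * snd (fst p) (fst ti) + snd p ti)) \<in> borel_measurable (?Xs \<Otimes>\<^sub>M ?L)"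
      by (rule measurable_compose_countable[OF _ measurable_compose[OF measurable_fst measurable_fst]]) (rule measurable_compose[OF y h])
    from L.borel_measurable_nn_integral_fst[OF this] show ?thesis
      unfolding fst_conv snd_conv nn_integral_PiM_shift[OF ve h] .
  qed
  have "(\<integral>\<^sup>+\<omega>. h (message \<omega>) (eavesdropper_output n I he \<omega>) \<partial>wiretap_space n I vl ve (codebook_law n KK c)) = (\<integral>\<^sup>+c. ?f c \<partial>codebook_law n KK c)"
    by (rule nn_integral_eavesdropper_output[OF C vl ve h])
  also have "\<dots> = (\<Sum>j\<in>KK. ?f (fst j, restrict (c j) {..<n})) / card KK"
    by (rule nn_integral_codebook_law[OF KK f])
  finally have sum: "?lhs = (\<Sum>j\<in>KK. ?f (fst j, restrict (c j) {..<n})) / card KK" .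
  have eq: "?f (fst j, restrict (c j) {..<n}) = (\<integral>\<^sup>+z. h (fst j) z \<partial>PiM ({..<n} \<times> I) (\<lambda>p. cgauss (of_real (he (snd p)) * c j (fst p)) ve))" for j
  proof -
    have "PiM ({..<n} \<times> I) (\<lambda>p. cgauss (of_real (he (snd p)) * restrict (c j) {..<n} (fst p)) ve)
        = PiM ({..<n} \<times> I) (\<lambda>p. cgauss (of_real (he (snd p)) * c j (fst p)) ve)"
      by (rule PiM_cong) auto
    then show ?thesis by (simp only: fst_conv snd_conv)
  qed
  show ?thesis unfolding sum eq ..
qed

section \<open>Secrecy of a codebook\<close>

text \<open>All messages are compared with one reference law, that of a single Gaussian observation
  of variance \<open>k\<close>. A cylinder event becomes a test of that observation; its probability
  given message \<open>s\<close> is the mean of the test weighted by the averaged likelihood ratio,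
  which differs from the reference value by at most the deviation of message
  \<open>s\<close>.\<close>

lemma codebook_secrecy:
  fixes he :: "nat \<Rightarrow> real" and c :: "nat \<times> nat \<Rightarrow> nat \<Rightarrow> complex"
  assumes C: "wiretap_encoder n P (codebook_law n ({..<m} \<times> {..<m'}) c)" and m: "m > 0" "m' > 0"
    and vl: "vl > 0" and ve: "ve > 0" and G: "\<And>J. finite J \<Longrightarrow> J \<subseteq> I \<Longrightarrow> (\<Sum>i\<in>J. (he i)\<^sup>2 / ve) < G"
    and k: "k > 0" and D0: "D \<ge> 0"
    and D: "(\<Sum>s<m. \<integral>\<^sup>+y. ennreal \<bar>(\<Sum>l<m'. lik n 1 (1 / G) k (c (s, l)) y) / m' - 1\<bar> \<partial>(\<Pi>\<^sub>M t\<in>{..<n}. complex_gaussian k))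
        \<le> ennreal (m * D)"
  shows "message_entropy (wiretap_space n I vl ve (codebook_law n ({..<m} \<times> {..<m'}) c))
      - equivocation n I he (wiretap_space n I vl ve (codebook_law n ({..<m} \<times> {..<m'}) c))
      \<le> (1 + ln m) / ln 2 * (2 * D)"
proof -
  let ?KK = "{..<m} \<times> {..<m'}"
  let ?C = "codebook_law n ?KK c"
  let ?W = "wiretap_space n I vl ve ?C"
  let ?Z = "eavesdropper_output n I he"
  let ?Zs = "\<Pi>\<^sub>M ti\<in>{..<n} \<times> I. (borel :: complex measure)"
  let ?L = "distr ?W ?Zs ?Z"
  let ?Q = "\<Pi>\<^sub>M t\<in>{..<n}. complex_gaussian k"
  let ?z = "\<lambda>j. PiM ({..<n} \<times> I) (\<lambda>p. cgauss (of_real (he (snd p)) * c j (fst p)) ve)"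
  define dev where "dev s = (\<integral>\<^sup>+y. ennreal \<bar>(\<Sum>l<m'. lik n 1 (1 / G) k (c (s, l)) y) / m' - 1\<bar> \<partial>?Q)" for s
  have G0: "G > 0" using G[of "{}"] by simp
  then have Gi: "1 / G > 0" by simp
  have KK: "finite ?KK" "?KK \<noteq> {}" using m by auto
  interpret W: prob_space ?W by (rule prob_space_wiretap_space[OF C vl ve])
  note msg = message_measurable[OF C vl ve] and Zm = eavesdropper_output_measurable[OF C vl ve, where he = he]
  interpret L: prob_space ?L by (rule W.prob_space_distr[OF Zm])
  interpret Q: prob_space ?Q by (rule prob_space_PiM_complex_gaussian[OF k])
  have zp: "prob_space (?z j)" for j by (intro prob_space_PiM prob_space_cgauss ve)
  have sz: "sets (?z j) = sets ?Zs" for j by (rule sets_PiM_cong) auto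
  define r where "r s = enn2real (dev s)" for s
  have dev_fin: "dev s = ennreal (r s)" if "s < m" for s
  proof -
    have "dev s \<le> (\<Sum>s<m. dev s)" using that by (intro member_le_sum) auto
    also have "\<dots> \<le> ennreal (m * D)" using D by (simp only: dev_def)
    finally have "dev s < top" by (simp add: le_less_trans)
    then show ?thesis by (simp add: r_def)
  qed
  have r0: "r s \<ge> 0" for s by (simp add: r_def)
  have r_sum: "(\<Sum>s<m. r s) \<le> m * D"
  proof -
    have "ennreal (\<Sum>s<m. r s) = (\<Sum>s<m. dev s)"
      using r0 by (subst sum_ennreal[symmetric]) (auto simp: dev_fin)
    also have "\<dots> \<le> ennreal (m * D)" using D by (simp only: dev_def)
    finally show ?thesis using D0 by (simp add: ennreal_le_iff)
  qed
  have sets_sA: "{\<omega> \<in> space ?W. message \<omega> = s \<and> ?Z \<omega> \<in> A} \<in> sets ?W" if A: "A \<in> sets ?Zs" for s A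
  proof -
    have "{\<omega> \<in> space ?W. message \<omega> = s \<and> ?Z \<omega> \<in> A} = (message -` {s} \<inter> space ?W) \<inter> (?Z -` A \<inter> space ?W)" by auto
    moreover have "message -` {s} \<inter> space ?W \<in> sets ?W" by (rule measurable_sets[OF msg]) simp
    moreover have "?Z -` A \<inter> space ?W \<in> sets ?W" by (rule measurable_sets[OF Zm A])
    ultimately show ?thesis by (simp only: sets.Int)
  qed
  have int_z: "(\<integral>\<^sup>+z. a * indicator A z \<partial>?z j) = a * ennreal (measure (?z j) A)" if A: "A \<in> sets ?Zs" for a A j
  proof -
    interpret z: prob_space "?z j" by (rule zp)
    have "A \<in> sets (?z j)" using A sz by blast
    then show ?thesis by (simp only: nn_integral_cmult_indicator z.emeasure_eq_measure)
  qed
  have mu: "measure ?W {\<omega> \<in> space ?W. message \<omega> = s \<and> ?Z \<omega> \<in> A} = (\<Sum>l<m'. measure (?z (s, l)) A) / m' / m"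
    if s: "s < m" and A: "A \<in> sets ?Zs" for s A
  proof -
    let ?h = "\<lambda>s' z. indicator {s} s' * indicator A z :: ennreal"
    have h: "?h s' \<in> borel_measurable ?Zs" for s'
      by (intro borel_measurable_times_ennreal borel_measurable_const borel_measurable_indicator A)
    have set: "{\<omega> \<in> space ?W. message \<omega> = s \<and> ?Z \<omega> \<in> A} \<in> sets ?W" by (rule sets_sA[OF A])
    have "emeasure ?W {\<omega> \<in> space ?W. message \<omega> = s \<and> ?Z \<omega> \<in> A} = (\<integral>\<^sup>+\<omega>. indicator {\<omega> \<in> space ?W. message \<omega> = s \<and> ?Z \<omega> \<in> A} \<omega> \<partial>?W)"
      by (rule nn_integral_indicator[symmetric, OF set])
    also have "\<dots> = (\<integral>\<^sup>+\<omega>. ?h (message \<omega>) (?Z \<omega>) \<partial>?W)"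
      by (intro nn_integral_cong) (auto simp: indicator_def)
    also have "\<dots> = (\<Sum>j\<in>?KK. \<integral>\<^sup>+z. ?h (fst j) z \<partial>?z j) / card ?KK"
      by (rule codebook_eavesdropper[OF KK C vl ve h])
    also have "(\<Sum>j\<in>?KK. \<integral>\<^sup>+z. ?h (fst j) z \<partial>?z j) = (\<Sum>j\<in>?KK. indicator {s} (fst j) * ennreal (measure (?z j) A))"
      by (simp only: int_z[OF A])
    also have "\<dots> = (\<Sum>s'<m. \<Sum>l<m'. indicator {s} s' * ennreal (measure (?z (s', l)) A))"
      unfolding sum.cartesian_product by (intro sum.cong) auto
    also have "\<dots> = (\<Sum>s'<m. if s' = s then (\<Sum>l<m'. ennreal (measure (?z (s, l)) A)) else 0)"
      by (intro sum.cong) (auto simp: indicator_def)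
    also have "\<dots> = ennreal (\<Sum>l<m'. measure (?z (s, l)) A)"
      using s by simp
    also have "\<dots> / card ?KK = ennreal ((\<Sum>l<m'. measure (?z (s, l)) A) / m' / m)"
      using m by (simp add: card_cartesian_product ennreal_of_nat_eq_real_of_nat divide_ennreal sum_nonneg mult.commute flip: of_nat_mult)
    finally show ?thesis
      by (simp add: measure_def sum_nonneg divide_nonneg_nonneg)
  qed
  have Lsum: "measure ?L A = (\<Sum>s<m. measure ?W {\<omega> \<in> space ?W. message \<omega> = s \<and> ?Z \<omega> \<in> A})" if A: "A \<in> sets ?Zs" for A
  proof -
    let ?h = "\<lambda>(_::nat) z. 1 * indicator A z :: ennreal"
    have h: "?h s' \<in> borel_measurable ?Zs" for s'
      by (intro borel_measurable_times_ennreal borel_measurable_const borel_measurable_indicator A)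
    have "emeasure ?L A = (\<integral>\<^sup>+z. indicator A z \<partial>?L)"
      using A by (intro nn_integral_indicator[symmetric]) simp
    also have "\<dots> = (\<integral>\<^sup>+\<omega>. ?h (message \<omega>) (?Z \<omega>) \<partial>?W)"
      using A by (subst nn_integral_distr[OF Zm]) (simp_all only: measurable_distr_eq1 borel_measurable_indicator mult_1)
    also have "\<dots> = (\<Sum>j\<in>?KK. \<integral>\<^sup>+z. ?h (fst j) z \<partial>?z j) / card ?KK"
      by (rule codebook_eavesdropper[OF KK C vl ve h])
    also have "(\<Sum>j\<in>?KK. \<integral>\<^sup>+z. ?h (fst j) z \<partial>?z j) = (\<Sum>j\<in>?KK. ennreal (measure (?z j) A))"
      unfolding int_z[OF A] by simp
    also have "\<dots> = ennreal (\<Sum>s<m. \<Sum>l<m'. measure (?z (s, l)) A)"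
      by (simp add: sum.cartesian_product case_prod_beta')
    also have "\<dots> / card ?KK = ennreal ((\<Sum>s<m. \<Sum>l<m'. measure (?z (s, l)) A) / m' / m)"
      using m by (simp add: card_cartesian_product ennreal_of_nat_eq_real_of_nat divide_ennreal sum_nonneg mult.commute flip: of_nat_mult)
    finally have "measure ?L A = (\<Sum>s<m. \<Sum>l<m'. measure (?z (s, l)) A) / m' / m"
      by (simp add: measure_def sum_nonneg divide_nonneg_nonneg)
    then show ?thesis
      by (simp add: mu[OF _ A] sum_divide_distrib)
  qed
  \<comment> \<open>\<open>r s\<close> compares message \<open>s\<close> with the reference law, and
    \<open>D\<close> compares the reference law with the mixture over all messages, which is the
    actual law of the observation. Summed over \<open>s\<close> the two shares give at most
    \<open>2 * D\<close>.\<close>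
  define \<delta> where "\<delta> s = (r s + D) / m" for s
  have cyl: "measure ?W {\<omega> \<in> space ?W. message \<omega> = s \<and> ?Z \<omega> \<in> prod_emb ({..<n} \<times> I) (\<lambda>_. borel) F B}
      \<le> measure ?L (prod_emb ({..<n} \<times> I) (\<lambda>_. borel) F B) / m + \<delta> s"
    if s: "s < m" and F: "finite F" "F \<subseteq> {..<n} \<times> I" and B: "B \<in> sets (PiM F (\<lambda>_. borel))" for s F B
  proof -
    let ?A = "prod_emb ({..<n} \<times> I) (\<lambda>_. borel) F B"
    have A: "?A \<in> sets ?Zs" by (rule measurable_prod_emb[OF F(2) B])
    obtain g where g: "g \<in> borel_measurable (\<Pi>\<^sub>M t\<in>{..<n}. borel)" "\<And>y. g y \<le> 1"
      "\<And>x. emeasure (PiM ({..<n} \<times> I) (\<lambda>p. cgauss (of_real (he (snd p)) * x (fst p)) ve)) ?A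
         = (\<integral>\<^sup>+y. g y \<partial>PiM {..<n} (\<lambda>t. cgauss (x t) (1 / G)))"
      using eavesdropper_cylinder_test[OF ve G F B] by blast
    have gQ: "g \<in> borel_measurable ?Q" unfolding measurable_cong_sets[OF sets_PiM_complex_gaussian refl] by (rule g(1))
    \<comment> \<open>Probability of the event under the reference law, the same for all
      messages.\<close>
    define a where "a = enn2real (\<integral>\<^sup>+y. g y \<partial>?Q)"
    have "(\<integral>\<^sup>+y. g y \<partial>?Q) \<le> (\<integral>\<^sup>+y. 1 \<partial>?Q)" by (intro nn_integral_mono g(2))
    then have "(\<integral>\<^sup>+y. g y \<partial>?Q) \<le> 1" by (simp only: nn_integral_const Q.emeasure_space_1 mult_1_right)
    then have a: "(\<integral>\<^sup>+y. g y \<partial>?Q) = ennreal a" by (simp add: a_def ennreal_enn2real le_less_trans[OF _ ennreal_one_less_top])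
    have a0: "a \<ge> 0" by (simp add: a_def)
    let ?avg = "\<lambda>s y. (\<Sum>l<m'. lik n 1 (1 / G) k (c (s, l)) y) / m'"
    have lk0: "lik n 1 (1 / G) k x y \<ge> 0" for x y by (rule lik_nonneg[OF Gi k])
    have lm: "(\<lambda>y. lik n 1 (1 / G) k (c j) y) \<in> borel_measurable ?Q" for j
      unfolding lik_def measurable_cong_sets[OF sets_PiM_complex_gaussian refl]
      by (intro borel_measurable_prod borel_measurable_divide measurable_compose[OF _ cn_density_measurable] borel_measurable_diff
        borel_measurable_const measurable_component_singleton)
    have am: "(\<lambda>y. ?avg s y) \<in> borel_measurable ?Q" for s
      by (intro borel_measurable_divide borel_measurable_sum lm borel_measurable_const)
    have dm: "(\<lambda>y. ennreal \<bar>?avg s y - 1\<bar>) \<in> borel_measurable ?Q" for s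
      by (intro measurable_compose[OF _ measurable_ennreal] borel_measurable_abs borel_measurable_diff am borel_measurable_const)
    have p_int: "ennreal ((\<Sum>l<m'. measure (?z (s, l)) ?A) / m') = (\<integral>\<^sup>+y. ennreal (?avg s y) * g y \<partial>?Q)" for s
    proof -
      have one: "ennreal (measure (?z (s, l)) ?A) = (\<integral>\<^sup>+y. ennreal (lik n 1 (1 / G) k (c (s, l)) y) * g y \<partial>?Q)" for l
      proof -
        interpret z: prob_space "?z (s, l)" by (rule zp)
        have "ennreal (measure (?z (s, l)) ?A) = (\<integral>\<^sup>+y. g y \<partial>PiM {..<n} (\<lambda>t. cgauss (c (s, l) t) (1 / G)))"
          unfolding z.emeasure_eq_measure[symmetric] by (rule g(3))
        also have "\<dots> = (\<integral>\<^sup>+y. ennreal (lik n 1 (1 / G) k (c (s, l)) y) * g y \<partial>?Q)"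
          using nn_integral_lik[OF Gi k g(1), of 1 "c (s, l)"] by simp
        finally show ?thesis .
      qed
      have "ennreal ((\<Sum>l<m'. measure (?z (s, l)) ?A) / m') = ennreal (1 / m') * (\<Sum>l<m'. ennreal (measure (?z (s, l)) ?A))"
        by (simp add: ennreal_mult[symmetric] sum_nonneg)
      also have "\<dots> = ennreal (1 / m') * (\<integral>\<^sup>+y. (\<Sum>l<m'. ennreal (lik n 1 (1 / G) k (c (s, l)) y) * g y) \<partial>?Q)"
        unfolding one by (subst nn_integral_sum)
          (intro borel_measurable_times_ennreal measurable_compose[OF lm measurable_ennreal] gQ, rule refl)
      also have "\<dots> = (\<integral>\<^sup>+y. ennreal (1 / m') * (\<Sum>l<m'. ennreal (lik n 1 (1 / G) k (c (s, l)) y) * g y) \<partial>?Q)"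
        by (rule nn_integral_cmult[symmetric])
          (intro borel_measurable_sum borel_measurable_times_ennreal measurable_compose[OF lm measurable_ennreal] gQ)
      also have "\<dots> = (\<integral>\<^sup>+y. ennreal (?avg s y) * g y \<partial>?Q)"
      proof (rule nn_integral_cong)
        fix y
        have "ennreal (1 / m') * (\<Sum>l<m'. ennreal (lik n 1 (1 / G) k (c (s, l)) y) * g y)
            = ennreal (1 / m') * ennreal (\<Sum>l<m'. lik n 1 (1 / G) k (c (s, l)) y) * g y"
          unfolding sum_distrib_right[symmetric] using lk0 by (simp add: mult.assoc)
        also have "ennreal (1 / m') * ennreal (\<Sum>l<m'. lik n 1 (1 / G) k (c (s, l)) y) = ennreal (?avg s y)"
          using lk0 by (simp add: ennreal_mult[symmetric] sum_nonneg)
        finally show "ennreal (1 / m') * (\<Sum>l<m'. ennreal (lik n 1 (1 / G) k (c (s, l)) y) * g y) = ennreal (?avg s y) * g y" .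
      qed
      finally show ?thesis .
    qed
    define p where "p s = (\<Sum>l<m'. measure (?z (s, l)) ?A) / m'" for s
    have p0: "p s \<ge> 0" for s unfolding p_def by (intro divide_nonneg_nonneg sum_nonneg) auto
    have avg0: "?avg s y \<ge> 0" for s y using lk0 by (intro divide_nonneg_nonneg sum_nonneg) auto
    have up: "p s \<le> a + r s" if "s < m" for s
    proof -
      have "ennreal (p s) = (\<integral>\<^sup>+y. ennreal (?avg s y) * g y \<partial>?Q)" unfolding p_def by (rule p_int)
      also have "\<dots> \<le> (\<integral>\<^sup>+y. g y + ennreal \<bar>?avg s y - 1\<bar> \<partial>?Q)"
      proof (rule nn_integral_mono)
        fix y
        have "ennreal (?avg s y) \<le> ennreal (1 + \<bar>?avg s y - 1\<bar>)" by (intro ennreal_leI) linarith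
        also have "\<dots> = 1 + ennreal \<bar>?avg s y - 1\<bar>" by simp
        finally have "ennreal (?avg s y) * g y \<le> (1 + ennreal \<bar>?avg s y - 1\<bar>) * g y" by (rule mult_right_mono) simp
        also have "\<dots> = g y + ennreal \<bar>?avg s y - 1\<bar> * g y" by (simp add: distrib_right)
        also have "\<dots> \<le> g y + ennreal \<bar>?avg s y - 1\<bar> * 1" by (intro add_left_mono mult_left_mono g(2)) simp
        finally show "ennreal (?avg s y) * g y \<le> g y + ennreal \<bar>?avg s y - 1\<bar>" by simp
      qed
      also have "\<dots> = ennreal a + dev s"
        unfolding nn_integral_add[OF gQ dm] a dev_def ..
      also have "\<dots> = ennreal (a + r s)" unfolding dev_fin[OF that] using a0 r0 by (intro ennreal_plus[symmetric])
      finally show ?thesis using a0 r0[of s] by (subst (asm) ennreal_le_iff) auto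
    qed
    \<comment> \<open>The upper bound is used for the message at hand; the lower bound is summed
      over all messages to compare \<open>a\<close> with the mixture.\<close>
    have lo: "a \<le> p s + r s" if "s < m" for s
    proof -
      have avgm: "(\<lambda>y. ennreal (?avg s y) * g y) \<in> borel_measurable ?Q"
        by (intro borel_measurable_times_ennreal measurable_compose[OF am measurable_ennreal] gQ)
      have "ennreal a = (\<integral>\<^sup>+y. g y \<partial>?Q)" by (rule a[symmetric])
      also have "\<dots> \<le> (\<integral>\<^sup>+y. ennreal (?avg s y) * g y + ennreal \<bar>?avg s y - 1\<bar> \<partial>?Q)"
      proof (rule nn_integral_mono)
        fix y
        have "(1 :: ennreal) = ennreal 1" by simp
        also have "\<dots> \<le> ennreal (?avg s y + \<bar>?avg s y - 1\<bar>)" by (intro ennreal_leI) linarith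
        also have "\<dots> = ennreal (?avg s y) + ennreal \<bar>?avg s y - 1\<bar>" using avg0 by (intro ennreal_plus) auto
        finally have "1 * g y \<le> (ennreal (?avg s y) + ennreal \<bar>?avg s y - 1\<bar>) * g y" by (rule mult_right_mono) simp
        also have "\<dots> = ennreal (?avg s y) * g y + ennreal \<bar>?avg s y - 1\<bar> * g y" by (rule distrib_right)
        also have "\<dots> \<le> ennreal (?avg s y) * g y + ennreal \<bar>?avg s y - 1\<bar> * 1" by (intro add_left_mono mult_left_mono g(2)) simp
        finally show "g y \<le> ennreal (?avg s y) * g y + ennreal \<bar>?avg s y - 1\<bar>" by simp
      qed
      also have "\<dots> = ennreal (p s) + dev s"
        unfolding nn_integral_add[OF avgm dm] dev_def p_def p_int ..
      also have "\<dots> = ennreal (p s + r s)" unfolding dev_fin[OF that] using p0 r0 by (intro ennreal_plus[symmetric])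
      finally show ?thesis using p0[of s] r0[of s] by (subst (asm) ennreal_le_iff) auto
    qed
    have Lp: "measure ?L ?A = (\<Sum>s<m. p s) / m"
      unfolding Lsum[OF A] by (simp add: mu[OF _ A] p_def sum_divide_distrib)
    have "m * a = (\<Sum>s<m. a)" by simp
    also have "\<dots> \<le> (\<Sum>s<m. p s + r s)" by (intro sum_mono lo) simp
    also have "\<dots> \<le> (\<Sum>s<m. p s) + m * D" using r_sum by (simp add: sum.distrib)
    finally have "a \<le> measure ?L ?A + D"
      unfolding Lp using m by (simp add: field_simps)
    then have "p s / m \<le> (measure ?L ?A + D + r s) / m"
      using up[OF s] by (intro divide_right_mono) auto
    then show ?thesis
      unfolding mu[OF s A] p_def[symmetric] \<delta>_def by (simp add: add_divide_distrib)
  qed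
  have all: "measure ?W {\<omega> \<in> space ?W. message \<omega> = s \<and> ?Z \<omega> \<in> A} \<le> measure ?L A / card {..<m} + \<delta> s"
    if s: "s \<in> {..<m}" and A: "A \<in> sets ?Zs" for s A
  proof (rule field_le_epsilon)
    fix e :: real assume e: "e > 0"
    have s': "s < m" using s by simp
    have AL: "A \<in> sets ?L" using A by simp
    \<comment> \<open>The symmetric difference is paid for twice: once for the event joined with the
      message, which the law of the observation dominates, and once divided by
      \<open>m\<close>.\<close>
    have e2: "e / 2 > 0" using e by simp
    obtain F B where FB: "finite F" "F \<subseteq> {..<n} \<times> I" "B \<in> sets (PiM F (\<lambda>_. borel))"
      and close: "measure ?L ((A - prod_emb ({..<n} \<times> I) (\<lambda>_. borel) F B) \<union> (prod_emb ({..<n} \<times> I) (\<lambda>_. borel) F B - A)) < e / 2"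
      by (rule cylinder_approximation[OF L.finite_measure_axioms sets_distr AL e2])
    let ?C' = "prod_emb ({..<n} \<times> I) (\<lambda>_. borel) F B"
    let ?X = "(A - ?C') \<union> (?C' - A)"
    have C': "?C' \<in> sets ?Zs" by (rule measurable_prod_emb[OF FB(2,3)])
    have X: "?X \<in> sets ?Zs" by (intro sets.Un sets.Diff A C')
    have "measure ?W {\<omega> \<in> space ?W. message \<omega> = s \<and> ?Z \<omega> \<in> A}
        \<le> measure ?W ({\<omega> \<in> space ?W. message \<omega> = s \<and> ?Z \<omega> \<in> ?C'} \<union> (?Z -` ?X \<inter> space ?W))"
    proof (rule W.finite_measure_mono)
      show "{\<omega> \<in> space ?W. message \<omega> = s \<and> ?Z \<omega> \<in> ?C'} \<union> (?Z -` ?X \<inter> space ?W) \<in> sets ?W"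
        by (rule sets.Un[OF sets_sA[OF C'] measurable_sets[OF Zm X]])
    qed auto
    also have "\<dots> \<le> measure ?W {\<omega> \<in> space ?W. message \<omega> = s \<and> ?Z \<omega> \<in> ?C'} + measure ?W (?Z -` ?X \<inter> space ?W)"
      by (rule measure_Un_le[OF sets_sA[OF C'] measurable_sets[OF Zm X]])
    also have "measure ?W (?Z -` ?X \<inter> space ?W) = measure ?L ?X" by (rule measure_distr[OF Zm X, symmetric])
    also have "measure ?W {\<omega> \<in> space ?W. message \<omega> = s \<and> ?Z \<omega> \<in> ?C'} \<le> measure ?L ?C' / m + \<delta> s"
      by (rule cyl[OF s' FB])
    also have "measure ?L ?C' \<le> measure ?L A + measure ?L ?X"
    proof -
      have "measure ?L ?C' \<le> measure ?L (A \<union> ?X)"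
        using A X by (intro L.finite_measure_mono) auto
      also have "\<dots> \<le> measure ?L A + measure ?L ?X" by (rule measure_Un_le) (use A X in auto)
      finally show ?thesis .
    qed
    finally have "measure ?W {\<omega> \<in> space ?W. message \<omega> = s \<and> ?Z \<omega> \<in> A} \<le> (measure ?L A + measure ?L ?X) / m + \<delta> s + measure ?L ?X"
      using m by (simp add: divide_right_mono)
    moreover have "measure ?L ?X / m \<le> measure ?L ?X"
      using m by (simp add: divide_le_eq mult_left_le_one_le mult_right_mono[of 1 "real m", simplified] mult.commute)
    ultimately show "measure ?W {\<omega> \<in> space ?W. message \<omega> = s \<and> ?Z \<omega> \<in> A} \<le> measure ?L A / card {..<m} + \<delta> s + e"
      using close by (simp add: add_divide_distrib)
  qed
  have "{..<m} \<noteq> {}" using m by auto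
  from W.leakage_bound[OF msg Zm finite_lessThan this _ all]
  have "message_entropy ?W - equivocation n I he ?W \<le> (1 + ln (card {..<m})) / ln 2 * (\<Sum>s<m. \<delta> s)"
    unfolding message_entropy_def equivocation_def distr_message[OF C vl ve] distr_codebook_law_fst[OF m] by blast
  also have "\<dots> \<le> (1 + ln m) / ln 2 * (2 * D)"
  proof -
    have "(\<Sum>s<m. \<delta> s) = ((\<Sum>s<m. r s) + m * D) / m"
      by (simp add: \<delta>_def sum_divide_distrib[symmetric] sum.distrib)
    also have "\<dots> \<le> (m * D + m * D) / m" by (intro divide_right_mono add_mono r_sum order_refl) simp
    also have "\<dots> = 2 * D" using m by simp
    finally have "(\<Sum>s<m. \<delta> s) \<le> 2 * D" .
    then show ?thesis unfolding card_lessThan using m by (intro mult_left_mono) auto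
  qed
  finally show ?thesis .
qed

section \<open>Random coding\<close>

context
  fixes A :: "'x measure" and Q :: "'y measure" and L :: "'x \<Rightarrow> 'y \<Rightarrow> real" and KK :: "'j set"
  assumes A: "prob_space A" and Q: "prob_space Q" and l0: "\<And>x y. L x y \<ge> 0"
    and lm: "case_prod L \<in> borel_measurable (A \<Otimes>\<^sub>M Q)"
    and l1: "\<And>y. y \<in> space Q \<Longrightarrow> (\<integral>\<^sup>+x. ennreal (L x y) \<partial>A) = 1" and KK: "finite KK"
begin

lemma likelihood_slice_measurable: "y \<in> space Q \<Longrightarrow> (\<lambda>x. L x y) \<in> borel_measurable A"
  by (rule measurable_compose[OF measurable_Pair2' lm, unfolded prod.case])

lemma likelihood_swap_measurable: "(\<lambda>p. L (snd p) (fst p)) \<in> borel_measurable (Q \<Otimes>\<^sub>M A)"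
  by (rule measurable_compose[OF measurable_Pair[OF measurable_snd measurable_fst] lm, unfolded prod.case])

lemma likelihood_component_measurable:
  assumes "j \<in> KK"
  shows "(\<lambda>p. L (fst p j) (snd p)) \<in> borel_measurable (PiM KK (\<lambda>_. A) \<Otimes>\<^sub>M Q)"
proof -
  have "(\<lambda>p. (fst p j, snd p)) \<in> measurable (PiM KK (\<lambda>_. A) \<Otimes>\<^sub>M Q) (A \<Otimes>\<^sub>M Q)"
    by (intro measurable_Pair measurable_compose[OF measurable_fst measurable_component_singleton[OF assms]] measurable_snd)
  from measurable_compose[OF this lm] show ?thesis unfolding prod.case .
qed

text \<open>Exchanging the integrals fixes the output first. The likelihood ratios of the random
  words are then independent with mean 1, and the scalar deviation bound applies to the block
  \<open>S\<close>.\<close>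

lemma expected_deviation:
  assumes S: "S \<subseteq> KK" "S \<noteq> {}" and g: "\<gamma> > 0"
  shows "(\<integral>\<^sup>+c. (\<integral>\<^sup>+y. ennreal \<bar>(\<Sum>j\<in>S. L (c j) y) / card S - 1\<bar> \<partial>Q) \<partial>PiM KK (\<lambda>_. A))
    \<le> ennreal (sqrt (\<gamma> / card S)) + 2 * (\<integral>\<^sup>+y. (\<integral>\<^sup>+x. ennreal (L x y) * indicator {x. L x y > \<gamma>} x \<partial>A) \<partial>Q)"
proof -
  let ?B = "PiM KK (\<lambda>_. A)"
  interpret A: prob_space A by (rule A)
  interpret Q: prob_space Q by (rule Q)
  interpret B: prob_space ?B by (intro prob_space_PiM A)
  interpret BQ: pair_prob_space ?B Q ..
  have Sf: "finite S" using S KK finite_subset by blast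
  let ?d = "\<lambda>c y. ennreal \<bar>(\<Sum>j\<in>S. L (c j) y) / card S - 1\<bar>"
  have m: "(\<lambda>p. ?d (fst p) (snd p)) \<in> borel_measurable (?B \<Otimes>\<^sub>M Q)"
    using S by (intro measurable_compose[OF _ measurable_ennreal] borel_measurable_abs borel_measurable_diff borel_measurable_divide
      borel_measurable_sum likelihood_component_measurable borel_measurable_const) auto
  have im: "(\<lambda>p. ennreal (L (snd p) (fst p)) * indicator {q. L (snd q) (fst q) > \<gamma>} p) \<in> borel_measurable (Q \<Otimes>\<^sub>M A)"
  proof -
    have "(\<lambda>p. (\<lambda>r. ennreal r * indicator {\<gamma><..} r) (L (snd p) (fst p))) \<in> borel_measurable (Q \<Otimes>\<^sub>M A)"
      by (rule measurable_compose[OF likelihood_swap_measurable]) measurable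
    moreover have "(\<lambda>r. ennreal r * indicator {\<gamma><..} r) (L (snd p) (fst p)) = ennreal (L (snd p) (fst p)) * indicator {q. L (snd q) (fst q) > \<gamma>} p" for p
      by (simp add: indicator_def)
    ultimately show ?thesis by (simp only:)
  qed
  have inner_m: "(\<lambda>y. \<integral>\<^sup>+x. ennreal (L x y) * indicator {x. L x y > \<gamma>} x \<partial>A) \<in> borel_measurable Q"
  proof -
    have "indicator {q. L (snd q) (fst q) > \<gamma>} (y, x) = (indicator {x. L x y > \<gamma>} x :: ennreal)" for x y
      by (simp add: indicator_def)
    with A.borel_measurable_nn_integral_fst[OF im] show ?thesis by (simp only: fst_conv snd_conv)
  qed
  have "(\<integral>\<^sup>+c. (\<integral>\<^sup>+y. ?d c y \<partial>Q) \<partial>?B) = (\<integral>\<^sup>+y. (\<integral>\<^sup>+c. ?d c y \<partial>?B) \<partial>Q)"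
    by (rule BQ.Fubini'[symmetric], unfold case_prod_beta', rule m)
  also have "\<dots> \<le> (\<integral>\<^sup>+y. ennreal (sqrt (\<gamma> / card S)) + 2 * (\<integral>\<^sup>+x. ennreal (L x y) * indicator {x. L x y > \<gamma>} x \<partial>A) \<partial>Q)"
  proof (rule nn_integral_mono)
    fix y assume y: "y \<in> space Q"
    note ly = likelihood_slice_measurable[OF y]
    have gm: "(\<lambda>c. ?d c y) \<in> borel_measurable (PiM S (\<lambda>_. A))"
    proof -
      have "(\<lambda>c. L (c i) y) \<in> borel_measurable (PiM S (\<lambda>_. A))" if "i \<in> S" for i
        by (rule measurable_compose[OF measurable_component_singleton[OF that] ly])
      then show ?thesis
        by (intro measurable_compose[OF _ measurable_ennreal] borel_measurable_abs borel_measurable_diff borel_measurable_divide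
          borel_measurable_sum borel_measurable_const)
    qed
    have "(\<integral>\<^sup>+c. ?d c y \<partial>?B) = (\<integral>\<^sup>+c. ?d (restrict c S) y \<partial>?B)"
      by simp
    also have "\<dots> = (\<integral>\<^sup>+c. ?d c y \<partial>PiM S (\<lambda>_. A))"
      by (rule nn_integral_PiM_restrict[OF A Sf S(1) gm])
    also have "\<dots> \<le> ennreal (sqrt (\<gamma> / card S)) + 2 * (\<integral>\<^sup>+x. ennreal (L x y) * indicator {x. L x y > \<gamma>} x \<partial>A)"
      by (rule iid_average_deviation[OF A Sf S(2) ly l0 l1[OF y] g])
    finally show "(\<integral>\<^sup>+c. ?d c y \<partial>?B) \<le> ennreal (sqrt (\<gamma> / card S)) + 2 * (\<integral>\<^sup>+x. ennreal (L x y) * indicator {x. L x y > \<gamma>} x \<partial>A)" .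
  qed
  also have "\<dots> = ennreal (sqrt (\<gamma> / card S)) + 2 * (\<integral>\<^sup>+y. (\<integral>\<^sup>+x. ennreal (L x y) * indicator {x. L x y > \<gamma>} x \<partial>A) \<partial>Q)"
    by (simp only: nn_integral_add[OF borel_measurable_const borel_measurable_times_ennreal[OF borel_measurable_const inner_m]]
        nn_integral_const Q.emeasure_space_1 mult_1_right nn_integral_cmult[OF inner_m])
  finally show ?thesis .
qed

text \<open>For fixed \<open>y\<close> a word other than the sent one is independent of it: the sent
  word contributes its mean 1, and the other ratio exceeds \<open>\<gamma>\<close> with probability
  at most \<open>1 / \<gamma>\<close> by Markov's inequality. What remains is the lower tail of the
  ratio of the sent word.\<close>

lemma expected_error:
  assumes j: "j \<in> KK" and g: "\<gamma> > 0"
  shows "(\<integral>\<^sup>+c. (\<integral>\<^sup>+y. ennreal (L (c j) y) * (indicator {..\<gamma>} (L (c j) y) + (\<Sum>i\<in>KK - {j}. indicator {\<gamma><..} (L (c i) y))) \<partial>Q) \<partial>PiM KK (\<lambda>_. A))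
    \<le> (\<integral>\<^sup>+y. (\<integral>\<^sup>+x. ennreal (L x y) * indicator {..\<gamma>} (L x y) \<partial>A) \<partial>Q) + ennreal (card KK / \<gamma>)"
proof -
  let ?B = "PiM KK (\<lambda>_. A)"
  interpret A: prob_space A by (rule A)
  interpret Q: prob_space Q by (rule Q)
  interpret B: prob_space ?B by (intro prob_space_PiM A)
  interpret BQ: pair_prob_space ?B Q ..
  let ?a = "\<lambda>r::real. ennreal r * indicator {..\<gamma>} r" and ?b = "\<lambda>r::real. indicator {\<gamma><..} r :: ennreal"
  have am: "?a \<in> borel_measurable borel" and bm: "?b \<in> borel_measurable borel" by measurable
  let ?d = "\<lambda>c y. ?a (L (c j) y) + (\<Sum>i\<in>KK - {j}. ennreal (L (c j) y) * ?b (L (c i) y))"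
  have m: "(\<lambda>p. ?d (fst p) (snd p)) \<in> borel_measurable (?B \<Otimes>\<^sub>M Q)"
  proof (rule borel_measurable_add, rule measurable_compose[OF likelihood_component_measurable[OF j] am],
      rule borel_measurable_sum, rule borel_measurable_times_ennreal, rule measurable_compose[OF likelihood_component_measurable[OF j] measurable_ennreal])
    fix i assume "i \<in> KK - {j}"
    then have i: "i \<in> KK" by blast
    show "(\<lambda>p. ?b (L (fst p i) (snd p))) \<in> borel_measurable (?B \<Otimes>\<^sub>M Q)"
      by (rule measurable_compose[OF likelihood_component_measurable[OF i] bm])
  qed
  have im: "(\<lambda>y. \<integral>\<^sup>+x. ?a (L x y) \<partial>A) \<in> borel_measurable Q"
  proof -
    from A.borel_measurable_nn_integral_fst[OF measurable_compose[OF likelihood_swap_measurable am]]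
    show ?thesis unfolding fst_conv snd_conv .
  qed
  have "(\<integral>\<^sup>+c. (\<integral>\<^sup>+y. ennreal (L (c j) y) * (indicator {..\<gamma>} (L (c j) y) + (\<Sum>i\<in>KK - {j}. ?b (L (c i) y))) \<partial>Q) \<partial>?B)
      = (\<integral>\<^sup>+c. (\<integral>\<^sup>+y. ?d c y \<partial>Q) \<partial>?B)"
    by (simp only: distrib_left sum_distrib_left)
  also have "\<dots> = (\<integral>\<^sup>+y. (\<integral>\<^sup>+c. ?d c y \<partial>?B) \<partial>Q)"
    by (rule BQ.Fubini'[symmetric], unfold case_prod_beta', rule m)
  also have "\<dots> \<le> (\<integral>\<^sup>+y. (\<integral>\<^sup>+x. ?a (L x y) \<partial>A) + ennreal (card KK / \<gamma>) \<partial>Q)"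
  proof (rule nn_integral_mono)
    fix y assume y: "y \<in> space Q"
    note ly = likelihood_slice_measurable[OF y]
    have cm: "(\<lambda>c. L (c i) y) \<in> borel_measurable ?B" if "i \<in> KK" for i
      by (rule measurable_compose[OF measurable_component_singleton[OF that] ly])
    have lb2: "(\<lambda>c. ennreal (L (c j) y) * ?b (L (c i) y)) \<in> borel_measurable ?B" if "i \<in> KK - {j}" for i
    proof (rule borel_measurable_times_ennreal[OF measurable_compose[OF cm[OF j] measurable_ennreal]])
      from that have i: "i \<in> KK" by blast
      show "(\<lambda>c. ?b (L (c i) y)) \<in> borel_measurable ?B" by (rule measurable_compose[OF cm[OF i] bm])
    qed
    have "(\<integral>\<^sup>+c. ?d c y \<partial>?B) = (\<integral>\<^sup>+c. ?a (L (c j) y) \<partial>?B) + (\<integral>\<^sup>+c. (\<Sum>i\<in>KK - {j}. ennreal (L (c j) y) * ?b (L (c i) y)) \<partial>?B)"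
      by (rule nn_integral_add[OF measurable_compose[OF cm[OF j] am] borel_measurable_sum[OF lb2]])
    also have "(\<integral>\<^sup>+c. ?a (L (c j) y) \<partial>?B) = (\<integral>\<^sup>+x. ?a (L x y) \<partial>A)"
      by (rule nn_integral_PiM_component[OF A j measurable_compose[OF ly am]])
    also have "(\<integral>\<^sup>+c. (\<Sum>i\<in>KK - {j}. ennreal (L (c j) y) * ?b (L (c i) y)) \<partial>?B)
        = (\<Sum>i\<in>KK - {j}. \<integral>\<^sup>+c. ennreal (L (c j) y) * ?b (L (c i) y) \<partial>?B)"
      by (rule nn_integral_sum[OF lb2])
    also have "\<dots> \<le> (\<Sum>i\<in>KK - {j}. ennreal (1 / \<gamma>))"
    proof (rule sum_mono)
      fix i assume i: "i \<in> KK - {j}"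
      have lb: "(\<lambda>x. ?b (L x y)) \<in> borel_measurable A" by (rule measurable_compose[OF ly bm])
      have le: "(\<lambda>x. ennreal (L x y)) \<in> borel_measurable A" by (rule measurable_compose[OF ly measurable_ennreal])
      have "(\<integral>\<^sup>+c. ennreal (L (c j) y) * ?b (L (c i) y) \<partial>?B) = (\<integral>\<^sup>+x. \<integral>\<^sup>+x'. ennreal (L x y) * ?b (L x' y) \<partial>A \<partial>A)"
      proof (rule nn_integral_PiM_two_components[OF A j])
        show "(\<lambda>(x, x'). ennreal (L x y) * ?b (L x' y)) \<in> borel_measurable (A \<Otimes>\<^sub>M A)"
          unfolding case_prod_beta'
          by (intro borel_measurable_times_ennreal measurable_compose[OF measurable_fst le] measurable_compose[OF measurable_snd lb])
      qed (use i in auto)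
      also have "\<dots> = (\<integral>\<^sup>+x. ennreal (L x y) * (\<integral>\<^sup>+x'. ?b (L x' y) \<partial>A) \<partial>A)"
        by (simp only: nn_integral_cmult[OF lb])
      also have "\<dots> = (\<integral>\<^sup>+x'. ?b (L x' y) \<partial>A)"
        by (simp only: nn_integral_multc[OF le] l1[OF y] mult_1)
      also have "\<dots> \<le> (\<integral>\<^sup>+x'. ennreal (1 / \<gamma>) * ennreal (L x' y) \<partial>A)"
      proof (rule nn_integral_mono)
        fix x'
        have "?b (L x' y) \<le> ennreal (1 / \<gamma> * L x' y)"
        proof (cases "L x' y > \<gamma>")
          case True
          then have "ennreal 1 \<le> ennreal (1 / \<gamma> * L x' y)" using g by (intro ennreal_leI) (simp add: field_simps)
          then show ?thesis using True by simp
        qed simp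
        then show "?b (L x' y) \<le> ennreal (1 / \<gamma>) * ennreal (L x' y)"
          using g l0 by (simp add: ennreal_mult[symmetric])
      qed
      also have "\<dots> = ennreal (1 / \<gamma>)"
        by (simp only: nn_integral_cmult[OF le] l1[OF y] mult_1_right)
      finally show "(\<integral>\<^sup>+c. ennreal (L (c j) y) * ?b (L (c i) y) \<partial>?B) \<le> ennreal (1 / \<gamma>)" .
    qed
    also have "(\<Sum>i\<in>KK - {j}. ennreal (1 / \<gamma>)) = ennreal (card (KK - {j}) * (1 / \<gamma>))"
      using g by (subst sum_ennreal) auto
    also have "\<dots> \<le> ennreal (card KK / \<gamma>)"
    proof (rule ennreal_leI)
      have "card (KK - {j}) \<le> card KK" using KK by (intro card_mono) auto
      then have "real (card (KK - {j})) * (1 / \<gamma>) \<le> real (card KK) * (1 / \<gamma>)" using g by (intro mult_right_mono) auto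
      then show "real (card (KK - {j})) * (1 / \<gamma>) \<le> real (card KK) / \<gamma>" by simp
    qed
    finally show "(\<integral>\<^sup>+c. ?d c y \<partial>?B) \<le> (\<integral>\<^sup>+x. ?a (L x y) \<partial>A) + ennreal (card KK / \<gamma>)"
      by (simp add: add_left_mono)
  qed
  also have "\<dots> = (\<integral>\<^sup>+y. (\<integral>\<^sup>+x. ?a (L x y) \<partial>A) \<partial>Q) + ennreal (card KK / \<gamma>)"
    by (simp only: nn_integral_add[OF im borel_measurable_const] nn_integral_const Q.emeasure_space_1 mult_1_right)
  finally show ?thesis .
qed

end

section \<open>Threshold decoding\<close>

text \<open>If no word passes the threshold, \<open>LEAST\<close> returns some fixed unspecified
  number. Such outputs are harmless: the sent word fails the threshold there, and this is counted as
  an error anyway. \<open>LEAST\<close> also settles ties measurably.\<close>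

definition threshold_decoder ::
  "nat \<Rightarrow> real \<Rightarrow> real \<Rightarrow> real \<Rightarrow> nat \<Rightarrow> nat \<Rightarrow> real \<Rightarrow> (nat \<times> nat \<Rightarrow> nat \<Rightarrow> complex) \<Rightarrow> (nat \<Rightarrow> complex) \<Rightarrow> nat" where
  "threshold_decoder n h v k m m' \<gamma> c y = (LEAST s. s < m \<and> (\<exists>l. l < m' \<and> lik n h v k (c (s, l)) y > \<gamma>))"

lemma lik_output_measurable:
  "(\<lambda>y. lik n h v k x y) \<in> borel_measurable (\<Pi>\<^sub>M t\<in>{..<n}. borel)"
  unfolding lik_def
  by (intro borel_measurable_prod borel_measurable_divide measurable_compose[OF _ cn_density_measurable] borel_measurable_diff
    borel_measurable_const measurable_component_singleton)

lemma threshold_decoder: "wiretap_decoder n (threshold_decoder n h v k m m' \<gamma> c)"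
proof -
  let ?Ys = "\<Pi>\<^sub>M t\<in>{..<n}. (borel :: complex measure)"
  have "Measurable.pred ?Ys (\<lambda>y. s < m \<and> (\<exists>l. l < m' \<and> lik n h v k (c (s, l)) y > \<gamma>))" for s
  proof -
    have "{y \<in> space ?Ys. s < m \<and> (\<exists>l. l < m' \<and> lik n h v k (c (s, l)) y > \<gamma>)}
        = (if s < m then (\<Union>l<m'. {y \<in> space ?Ys. \<gamma> < lik n h v k (c (s, l)) y}) else {})"
      by auto
    moreover have "(\<Union>l<m'. {y \<in> space ?Ys. \<gamma> < lik n h v k (c (s, l)) y}) \<in> sets ?Ys"
      by (intro sets.finite_UN finite_lessThan borel_measurable_less[OF borel_measurable_const lik_output_measurable])
    ultimately show ?thesis unfolding pred_def by (simp only: sets.empty_sets split: if_split) blast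
  qed
  then show ?thesis
    unfolding wiretap_decoder_def threshold_decoder_def[abs_def] by (rule measurable_Least)
qed

text \<open>The union bound counts every other word that passes, also one carrying the same message.
  The private index is thus decoded as well, which is why the number \<open>m * m'\<close> of all
  words has to stay below the information of the receiver.\<close>

lemma threshold_decoder_error:
  assumes j: "j \<in> {..<m} \<times> {..<m'}"
  shows "(indicator {d. d \<noteq> fst j} (threshold_decoder n h v k m m' \<gamma> c y) :: ennreal)
    \<le> indicator {..\<gamma>} (lik n h v k (c j) y) + (\<Sum>i\<in>{..<m} \<times> {..<m'} - {j}. indicator {\<gamma><..} (lik n h v k (c i) y))"
proof (cases "lik n h v k (c j) y > \<gamma> \<and> (\<forall>i\<in>{..<m} \<times> {..<m'} - {j}. \<not> lik n h v k (c i) y > \<gamma>)")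
  case True
  have "threshold_decoder n h v k m m' \<gamma> c y = fst j"
    unfolding threshold_decoder_def
  proof (rule Least_equality)
    show "fst j < m \<and> (\<exists>l. l < m' \<and> lik n h v k (c (fst j, l)) y > \<gamma>)"
      using True j by (auto intro!: exI[of _ "snd j"])
    fix s assume "s < m \<and> (\<exists>l. l < m' \<and> lik n h v k (c (s, l)) y > \<gamma>)"
    then obtain l where "s < m" "l < m'" "lik n h v k (c (s, l)) y > \<gamma>" by blast
    then have "(s, l) = j" using True by (metis (no_types, lifting) Diff_iff SigmaI lessThan_iff singletonD)
    then show "fst j \<le> s" by auto
  qed
  then show ?thesis by simp
next
  case False
  have "(1 :: ennreal) \<le> indicator {..\<gamma>} (lik n h v k (c j) y) + (\<Sum>i\<in>{..<m} \<times> {..<m'} - {j}. indicator {\<gamma><..} (lik n h v k (c i) y))"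
  proof (cases "lik n h v k (c j) y > \<gamma>")
    case g: True
    then obtain i where i: "i \<in> {..<m} \<times> {..<m'} - {j}" "lik n h v k (c i) y > \<gamma>" using False by blast
    then have "(1 :: ennreal) \<le> (\<Sum>i\<in>{..<m} \<times> {..<m'} - {j}. indicator {\<gamma><..} (lik n h v k (c i) y))"
      using member_le_sum[of i "{..<m} \<times> {..<m'} - {j}" "\<lambda>i. indicator {\<gamma><..} (lik n h v k (c i) y) :: ennreal"] by simp
    then show ?thesis using add_increasing[of "indicator {..\<gamma>} (lik n h v k (c j) y) :: ennreal"] by simp
  next
    case g: False
    then show ?thesis by (simp add: add_increasing2)
  qed
  moreover have "(indicator {d. d \<noteq> fst j} (threshold_decoder n h v k m m' \<gamma> c y) :: ennreal) \<le> 1"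
    by (simp add: indicator_def)
  ultimately show ?thesis by (rule order_trans[rotated])
qed

section \<open>Tail bounds from fractional moments and the selection of a codebook\<close>

lemma lik_pair_measurable:
  "case_prod (lik n h v k) \<in> borel_measurable ((\<Pi>\<^sub>M t\<in>{..<n}. complex_gaussian a) \<Otimes>\<^sub>M (\<Pi>\<^sub>M t\<in>{..<n}. complex_gaussian b))"
proof -
  let ?N = "(\<Pi>\<^sub>M t\<in>{..<n}. complex_gaussian a) \<Otimes>\<^sub>M (\<Pi>\<^sub>M t\<in>{..<n}. complex_gaussian b)"
  have sa: "sets (\<Pi>\<^sub>M t\<in>{..<n}. complex_gaussian a) = sets (\<Pi>\<^sub>M t\<in>{..<n}. borel)"
    and sb: "sets (\<Pi>\<^sub>M t\<in>{..<n}. complex_gaussian b) = sets (\<Pi>\<^sub>M t\<in>{..<n}. borel)"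
    by (rule sets_PiM_complex_gaussian)+
  have "fst \<in> measurable ?N (\<Pi>\<^sub>M t\<in>{..<n}. complex_gaussian a)" by (rule measurable_fst)
  then have 1: "fst \<in> measurable ?N (\<Pi>\<^sub>M t\<in>{..<n}. borel)" by (simp only: measurable_cong_sets[OF refl sa])
  have "snd \<in> measurable ?N (\<Pi>\<^sub>M t\<in>{..<n}. complex_gaussian b)" by (rule measurable_snd)
  then have 2: "snd \<in> measurable ?N (\<Pi>\<^sub>M t\<in>{..<n}. borel)" by (simp only: measurable_cong_sets[OF refl sb])
  show ?thesis unfolding case_prod_beta' by (rule lik_measurable[OF 1 2])
qed

text \<open>Chernoff bound in moment form: \<open>\<phi>\<close> stands for a truncation of the
  likelihood ratio, above a threshold with positive \<open>s\<close> or below it with negative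
  \<open>s\<close>.\<close>

lemma lik_dominated_integral:
  assumes P: "P > 0" and v: "v > 0" and s: "\<bar>s\<bar> < 1" and k: "k = v + h\<^sup>2 * P" and c: "c \<ge> 0"
    and \<phi>: "\<And>r. r \<ge> 0 \<Longrightarrow> \<phi> r \<le> ennreal c * ennreal (r powr (1 + s))"
  shows "(\<integral>\<^sup>+y. (\<integral>\<^sup>+x. \<phi> (lik n h v k x y) \<partial>(\<Pi>\<^sub>M t\<in>{..<n}. complex_gaussian P)) \<partial>(\<Pi>\<^sub>M t\<in>{..<n}. complex_gaussian k))
    \<le> ennreal (c * ((k / v) powr s / (1 - s\<^sup>2)) ^ n)"
proof -
  let ?X = "\<Pi>\<^sub>M t\<in>{..<n}. complex_gaussian P" and ?Q = "\<Pi>\<^sub>M t\<in>{..<n}. complex_gaussian k"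
  have kp: "k > 0" using P v k by (simp add: add_pos_nonneg)
  interpret X: prob_space ?X by (rule prob_space_PiM_complex_gaussian[OF P])
  interpret Q: prob_space ?Q by (rule prob_space_PiM_complex_gaussian[OF kp])
  let ?f = "\<lambda>x y. ennreal (lik n h v k x y powr (1 + s))"
  have pm: "(\<lambda>r::real. ennreal (r powr (1 + s))) \<in> borel_measurable borel" by measurable
  have l': "(\<lambda>p. lik n h v k (snd p) (fst p)) \<in> borel_measurable (?Q \<Otimes>\<^sub>M ?X)"
    by (rule measurable_compose[OF measurable_Pair[OF measurable_snd measurable_fst] lik_pair_measurable, unfolded prod.case])
  have fm: "(\<lambda>y. \<integral>\<^sup>+x. ?f x y \<partial>?X) \<in> borel_measurable ?Q"
    using X.borel_measurable_nn_integral_fst[OF measurable_compose[OF l' pm]] unfolding fst_conv snd_conv .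
  have "(\<integral>\<^sup>+y. (\<integral>\<^sup>+x. \<phi> (lik n h v k x y) \<partial>?X) \<partial>?Q) \<le> (\<integral>\<^sup>+y. (\<integral>\<^sup>+x. ennreal c * ?f x y \<partial>?X) \<partial>?Q)"
    by (intro nn_integral_mono \<phi> lik_nonneg v kp)
  also have "\<dots> = (\<integral>\<^sup>+y. ennreal c * (\<integral>\<^sup>+x. ?f x y \<partial>?X) \<partial>?Q)"
  proof (rule nn_integral_cong)
    fix y assume y: "y \<in> space ?Q"
    have "(\<lambda>x. lik n h v k x y) \<in> borel_measurable ?X"
      by (rule measurable_compose[OF measurable_Pair2'[OF y] lik_pair_measurable, unfolded prod.case])
    then show "(\<integral>\<^sup>+x. ennreal c * ?f x y \<partial>?X) = ennreal c * (\<integral>\<^sup>+x. ?f x y \<partial>?X)"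
      by (intro nn_integral_cmult measurable_compose[OF _ pm])
  qed
  also have "\<dots> = ennreal c * (\<integral>\<^sup>+y. (\<integral>\<^sup>+x. ?f x y \<partial>?X) \<partial>?Q)"
    by (rule nn_integral_cmult[OF fm])
  also have "\<dots> \<le> ennreal c * ennreal (((k / v) powr s / (1 - s\<^sup>2)) ^ n)"
    by (intro mult_left_mono lik_moment P v s k) simp
  also have "\<dots> = ennreal (c * ((k / v) powr s / (1 - s\<^sup>2)) ^ n)"
    using c s by (intro ennreal_mult[symmetric]) (auto simp: abs_square_le_1)
  finally show ?thesis .
qed

lemma truncation_above:
  assumes "\<gamma> > 0" "s > 0" "r \<ge> 0"
  shows "ennreal r * indicator {\<gamma><..} r \<le> ennreal (\<gamma> powr (- s)) * ennreal (r powr (1 + s))"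
proof (cases "r > \<gamma>")
  case True
  have "\<gamma> powr s \<le> r powr s" using True assms by (intro powr_mono2) auto
  then have "1 \<le> \<gamma> powr (- s) * r powr s"
    using assms by (simp add: powr_minus field_simps)
  then have "r * 1 \<le> r * (\<gamma> powr (- s) * r powr s)" using assms by (intro mult_left_mono) auto
  also have "\<dots> = \<gamma> powr (- s) * r powr (1 + s)" using True assms by (simp add: powr_add)
  finally show ?thesis using True by (simp add: ennreal_mult[symmetric] ennreal_leI)
qed simp

lemma truncation_below:
  assumes "\<gamma> > 0" "s > 0" "r \<ge> 0"
  shows "ennreal r * indicator {..\<gamma>} r \<le> ennreal (\<gamma> powr s) * ennreal (r powr (1 + - s))"
proof (cases "r \<le> \<gamma> \<and> r > 0")
  case True
  have "r powr s \<le> \<gamma> powr s" using True assms by (intro powr_mono2) auto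
  then have "1 \<le> \<gamma> powr s * r powr (- s)"
    using True by (simp add: powr_minus field_simps)
  then have "r * 1 \<le> r * (\<gamma> powr s * r powr (- s))" using assms by (intro mult_left_mono) auto
  also have "\<dots> = \<gamma> powr s * r powr (1 + - s)" using True by (subst powr_add) simp
  finally show ?thesis using True by (simp add: ennreal_mult[symmetric] ennreal_leI)
next
  case False
  then show ?thesis using assms by (cases "r = 0") auto
qed

text \<open>Power, total deviation and total error are divided by their budgets and added. The mean
  of the sum is below 1, so some codebook has a sum below 1 and therefore every quotient below 1.
  Drawing the words with power \<open>P' < P\<close> leaves the share \<open>1 - P' / P\<close> for
  deviation and error.\<close>

lemma random_codebook:
  assumes n: "n > 0" and m: "m > 0" "m' > 0" and P': "0 < P'" "P' < P" and G: "G > 0" and vl: "vl > 0"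
    and s: "0 < s" "s < 1" and g: "\<gamma>\<^sub>1 > 0" "\<gamma>\<^sub>2 > 0" and D: "D > 0" and e: "e > 0"
    and k1: "k\<^sub>1 = 1 / G + 1\<^sup>2 * P'" and k2: "k\<^sub>2 = vl + hl\<^sup>2 * P'"
    and small: "P' / P + (sqrt (\<gamma>\<^sub>1 / m') + 2 * (\<gamma>\<^sub>1 powr (- s) * ((k\<^sub>1 / (1 / G)) powr s / (1 - s\<^sup>2)) ^ n)) / D
        + (\<gamma>\<^sub>2 powr s * ((k\<^sub>2 / vl) powr (- s) / (1 - (- s)\<^sup>2)) ^ n + real (m * m') / \<gamma>\<^sub>2) / e < 1"
  shows "\<exists>c :: nat \<times> nat \<Rightarrow> nat \<Rightarrow> complex.
    (\<Sum>j\<in>{..<m} \<times> {..<m'}. \<Sum>t<n. (cmod (c j t))\<^sup>2) \<le> real (m * m') * real n * P \<and>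
    (\<Sum>i<m. \<integral>\<^sup>+y. ennreal \<bar>(\<Sum>l<m'. lik n 1 (1 / G) k\<^sub>1 (c (i, l)) y) / m' - 1\<bar> \<partial>(\<Pi>\<^sub>M t\<in>{..<n}. complex_gaussian k\<^sub>1)) \<le> ennreal (m * D) \<and>
    (\<Sum>j\<in>{..<m} \<times> {..<m'}. \<integral>\<^sup>+y. ennreal (lik n hl vl k\<^sub>2 (c j) y) * (indicator {..\<gamma>\<^sub>2} (lik n hl vl k\<^sub>2 (c j) y)
        + (\<Sum>i\<in>{..<m} \<times> {..<m'} - {j}. indicator {\<gamma>\<^sub>2<..} (lik n hl vl k\<^sub>2 (c i) y))) \<partial>(\<Pi>\<^sub>M t\<in>{..<n}. complex_gaussian k\<^sub>2))
      \<le> ennreal (real (m * m') * e)"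
proof -
  let ?KK = "{..<m} \<times> {..<m'}"
  let ?X = "\<Pi>\<^sub>M t\<in>{..<n}. complex_gaussian P'"
  let ?B = "PiM ?KK (\<lambda>_. ?X)"
  let ?Q1 = "\<Pi>\<^sub>M t\<in>{..<n}. complex_gaussian k\<^sub>1" and ?Q2 = "\<Pi>\<^sub>M t\<in>{..<n}. complex_gaussian k\<^sub>2"
  let ?L1 = "lik n 1 (1 / G) k\<^sub>1" and ?L2 = "lik n hl vl k\<^sub>2"
  have Gi: "1 / G > 0" using G by simp
  have kp: "k\<^sub>1 > 0" "k\<^sub>2 > 0" using k1 k2 P' G vl by (auto simp: add_pos_nonneg add_pos_pos)
  have X: "prob_space ?X" by (rule prob_space_PiM_complex_gaussian[OF P'(1)])
  have Q1: "prob_space ?Q1" and Q2: "prob_space ?Q2" by (intro prob_space_PiM_complex_gaussian kp)+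
  interpret X: prob_space ?X by (rule X)
  interpret Q1: prob_space ?Q1 by (rule Q1)
  interpret Q2: prob_space ?Q2 by (rule Q2)
  interpret B: prob_space ?B by (intro prob_space_PiM X)
  have KK: "finite ?KK" by simp
  have card: "card ?KK = m * m'" by (simp add: card_cartesian_product)
  have mm: "real (m * m') > 0" using m by simp
  note ctx1 = X Q1 lik_nonneg[OF Gi kp(1)] lik_pair_measurable lik_mean[OF P'(1) Gi k1] KK
  note ctx2 = X Q2 lik_nonneg[OF vl kp(2)] lik_pair_measurable lik_mean[OF P'(1) vl k2] KK
  define E1 where "E1 = sqrt (\<gamma>\<^sub>1 / m') + 2 * (\<gamma>\<^sub>1 powr (- s) * ((k\<^sub>1 / (1 / G)) powr s / (1 - s\<^sup>2)) ^ n)"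
  define E2 where "E2 = \<gamma>\<^sub>2 powr s * ((k\<^sub>2 / vl) powr (- s) / (1 - (- s)\<^sup>2)) ^ n + real (m * m') / \<gamma>\<^sub>2"
  have s2: "1 - s\<^sup>2 > 0" using s by (simp add: power_less_one_iff)
  have E10: "E1 \<ge> 0" unfolding E1_def using s2 g by (intro add_nonneg_nonneg mult_nonneg_nonneg zero_le_power divide_nonneg_nonneg) auto
  have E20: "E2 \<ge> 0" unfolding E2_def using s2 g by (intro add_nonneg_nonneg mult_nonneg_nonneg zero_le_power divide_nonneg_nonneg) auto
  define pow where "pow c = (\<Sum>j\<in>?KK. \<Sum>t<n. ennreal ((cmod (c j t))\<^sup>2))" for c :: "nat \<times> nat \<Rightarrow> nat \<Rightarrow> complex"
  define dev where "dev i c = (\<integral>\<^sup>+y. ennreal \<bar>(\<Sum>l<m'. ?L1 (c (i, l)) y) / m' - 1\<bar> \<partial>?Q1)" for i and c :: "nat \<times> nat \<Rightarrow> nat \<Rightarrow> complex"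
  define err where "err j c = (\<integral>\<^sup>+y. ennreal (?L2 (c j) y) * (indicator {..\<gamma>\<^sub>2} (?L2 (c j) y)
        + (\<Sum>i\<in>?KK - {j}. indicator {\<gamma>\<^sub>2<..} (?L2 (c i) y))) \<partial>?Q2)" for j and c :: "nat \<times> nat \<Rightarrow> nat \<Rightarrow> complex"
  have Xt: "(\<lambda>x. ennreal ((cmod (x t))\<^sup>2)) \<in> borel_measurable ?X" if "t < n" for t
    unfolding measurable_cong_sets[OF sets_PiM_complex_gaussian refl] using that
    by (intro measurable_compose[OF _ measurable_ennreal] borel_measurable_power measurable_compose[OF _ borel_measurable_norm] measurable_component_singleton) simp
  have powm: "pow \<in> borel_measurable ?B"
    unfolding pow_def by (intro borel_measurable_sum measurable_compose[OF measurable_component_singleton[where M = "\<lambda>_. ?X"] Xt]) auto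
  have powi: "(\<integral>\<^sup>+c. pow c \<partial>?B) = ennreal (real (m * m') * n * P')"
  proof -
    have one: "(\<integral>\<^sup>+c. ennreal ((cmod (c j t))\<^sup>2) \<partial>?B) = ennreal P'" if j: "j \<in> ?KK" and t: "t < n" for j t
    proof -
      have t': "t \<in> {..<n}" using t by simp
      have sq: "(\<lambda>z::complex. ennreal ((cmod z)\<^sup>2)) \<in> borel_measurable (complex_gaussian P')"
        unfolding complex_gaussian_def by simp
      have "(\<integral>\<^sup>+c. ennreal ((cmod (c j t))\<^sup>2) \<partial>?B) = (\<integral>\<^sup>+x. ennreal ((cmod (x t))\<^sup>2) \<partial>?X)"
        by (rule nn_integral_PiM_component[OF X j Xt[OF t]])
      also have "\<dots> = (\<integral>\<^sup>+z. ennreal ((cmod z)\<^sup>2) \<partial>complex_gaussian P')"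
        by (rule nn_integral_PiM_component[OF prob_space_complex_gaussian[OF P'(1)] t' sq])
      also have "\<dots> = ennreal P'" by (rule complex_gaussian_second_moment[OF P'(1)])
      finally show ?thesis .
    qed
    have mt: "(\<lambda>c. ennreal ((cmod (c j t))\<^sup>2)) \<in> borel_measurable ?B" if "j \<in> ?KK" "t < n" for j t
      by (rule measurable_compose[OF measurable_component_singleton[OF that(1), where M = "\<lambda>_. ?X"] Xt[OF that(2)]])
    have "(\<integral>\<^sup>+c. pow c \<partial>?B) = (\<Sum>j\<in>?KK. \<integral>\<^sup>+c. (\<Sum>t<n. ennreal ((cmod (c j t))\<^sup>2)) \<partial>?B)"
      unfolding pow_def by (intro nn_integral_sum borel_measurable_sum mt) simp_all
    also have "\<dots> = (\<Sum>j\<in>?KK. \<Sum>t<n. \<integral>\<^sup>+c. ennreal ((cmod (c j t))\<^sup>2) \<partial>?B)"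
      by (intro sum.cong refl nn_integral_sum mt) simp_all
    also have "\<dots> = (\<Sum>j\<in>?KK. \<Sum>t<n. ennreal P')"
      by (intro sum.cong refl one) simp_all
    also have "\<dots> = ennreal (\<Sum>j\<in>?KK. \<Sum>t<n. P')"
      by (simp only: sum_ennreal sum_nonneg less_imp_le[OF P'(1)])
    also have "(\<Sum>j\<in>?KK. \<Sum>t<n. P') = real (m * m') * n * P'"
      by (simp add: card_cartesian_product)
    finally show ?thesis .
  qed
  have L1m: "(\<lambda>p. ?L1 (fst p j) (snd p)) \<in> borel_measurable (?B \<Otimes>\<^sub>M ?Q1)" if "j \<in> ?KK" for j
    by (rule likelihood_component_measurable[OF ctx1 that])
  have L2m: "(\<lambda>p. ?L2 (fst p j) (snd p)) \<in> borel_measurable (?B \<Otimes>\<^sub>M ?Q2)" if "j \<in> ?KK" for j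
    by (rule likelihood_component_measurable[OF ctx2 that])
  have devm: "dev i \<in> borel_measurable ?B" if i: "i < m" for i
  proof -
    have "(\<lambda>p. ennreal \<bar>(\<Sum>l<m'. ?L1 (fst p (i, l)) (snd p)) / m' - 1\<bar>) \<in> borel_measurable (?B \<Otimes>\<^sub>M ?Q1)"
      using i by (intro measurable_compose[OF _ measurable_ennreal] borel_measurable_abs borel_measurable_diff borel_measurable_divide
        borel_measurable_sum L1m borel_measurable_const) auto
    from Q1.borel_measurable_nn_integral_fst[OF this] show ?thesis unfolding dev_def[abs_def] fst_conv snd_conv .
  qed
  have errm: "err j \<in> borel_measurable ?B" if j: "j \<in> ?KK" for j
  proof -
    have im: "(\<lambda>r::real. indicator {..\<gamma>\<^sub>2} r :: ennreal) \<in> borel_measurable borel" "(\<lambda>r::real. indicator {\<gamma>\<^sub>2<..} r :: ennreal) \<in> borel_measurable borel"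
      by simp_all
    have "(\<lambda>p. ennreal (?L2 (fst p j) (snd p)) * (indicator {..\<gamma>\<^sub>2} (?L2 (fst p j) (snd p))
        + (\<Sum>i\<in>?KK - {j}. indicator {\<gamma>\<^sub>2<..} (?L2 (fst p i) (snd p))))) \<in> borel_measurable (?B \<Otimes>\<^sub>M ?Q2)"
    proof (rule borel_measurable_times_ennreal[OF measurable_compose[OF L2m[OF j] measurable_ennreal]],
        rule borel_measurable_add[OF measurable_compose[OF L2m[OF j] im(1)]], rule borel_measurable_sum)
      fix i assume "i \<in> ?KK - {j}"
      then have i: "i \<in> ?KK" by blast
      show "(\<lambda>p. indicator {\<gamma>\<^sub>2<..} (?L2 (fst p i) (snd p)) :: ennreal) \<in> borel_measurable (?B \<Otimes>\<^sub>M ?Q2)"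
        by (rule measurable_compose[OF L2m[OF i] im(2)])
    qed
    from Q2.borel_measurable_nn_integral_fst[OF this] show ?thesis unfolding err_def[abs_def] fst_conv snd_conv .
  qed
  have devi: "(\<integral>\<^sup>+c. dev i c \<partial>?B) \<le> ennreal E1" if i: "i < m" for i
  proof -
    \<comment> \<open>The words that carry message \<open>i\<close>.\<close>
    let ?S = "Pair i ` {..<m'}"
    have S: "?S \<subseteq> ?KK" "?S \<noteq> {}" using i m by auto
    have cS: "card ?S = m'" by (subst card_image) (auto simp: inj_on_def)
    have sumS: "(\<Sum>j\<in>?S. f j) = (\<Sum>l<m'. f (i, l))" for f :: "nat \<times> nat \<Rightarrow> real"
      by (subst sum.reindex) (auto simp: inj_on_def)
    have "(\<integral>\<^sup>+c. dev i c \<partial>?B) \<le> ennreal (sqrt (\<gamma>\<^sub>1 / m')) + 2 * (\<integral>\<^sup>+y. (\<integral>\<^sup>+x. ennreal (?L1 x y) * indicator {x. ?L1 x y > \<gamma>\<^sub>1} x \<partial>?X) \<partial>?Q1)"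
      using expected_deviation[OF ctx1 S g(1)] unfolding cS sumS dev_def .
    also have "(\<integral>\<^sup>+y. (\<integral>\<^sup>+x. ennreal (?L1 x y) * indicator {x. ?L1 x y > \<gamma>\<^sub>1} x \<partial>?X) \<partial>?Q1)
        = (\<integral>\<^sup>+y. (\<integral>\<^sup>+x. (\<lambda>r. ennreal r * indicator {\<gamma>\<^sub>1<..} r) (?L1 x y) \<partial>?X) \<partial>?Q1)"
      by (intro nn_integral_cong) (simp add: indicator_def)
    also have "\<dots> \<le> ennreal (\<gamma>\<^sub>1 powr (- s) * ((k\<^sub>1 / (1 / G)) powr s / (1 - s\<^sup>2)) ^ n)"
      using s by (intro lik_dominated_integral P' Gi k1 truncation_above g) auto
    finally have "(\<integral>\<^sup>+c. dev i c \<partial>?B) \<le> ennreal (sqrt (\<gamma>\<^sub>1 / m')) + 2 * ennreal (\<gamma>\<^sub>1 powr (- s) * ((k\<^sub>1 / (1 / G)) powr s / (1 - s\<^sup>2)) ^ n)"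
      by (simp add: add_left_mono mult_left_mono)
    also have "\<dots> = ennreal E1"
    proof -
      let ?b = "\<gamma>\<^sub>1 powr (- s) * ((k\<^sub>1 / (1 / G)) powr s / (1 - s\<^sup>2)) ^ n"
      have "?b \<ge> 0" using s2 by (intro mult_nonneg_nonneg zero_le_power divide_nonneg_nonneg) auto
      then have "2 * ennreal ?b = ennreal (2 * ?b)" by (subst ennreal_mult) auto
      then show ?thesis unfolding E1_def using \<open>?b \<ge> 0\<close> g by (subst ennreal_plus) auto
    qed
    finally show ?thesis .
  qed
  have erri: "(\<integral>\<^sup>+c. err j c \<partial>?B) \<le> ennreal E2" if j: "j \<in> ?KK" for j
  proof -
    have "(\<integral>\<^sup>+c. err j c \<partial>?B) \<le> (\<integral>\<^sup>+y. (\<integral>\<^sup>+x. ennreal (?L2 x y) * indicator {..\<gamma>\<^sub>2} (?L2 x y) \<partial>?X) \<partial>?Q2) + ennreal (real (m * m') / \<gamma>\<^sub>2)"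
      using expected_error[OF ctx2 j g(2)] unfolding card err_def .
    also have "(\<integral>\<^sup>+y. (\<integral>\<^sup>+x. ennreal (?L2 x y) * indicator {..\<gamma>\<^sub>2} (?L2 x y) \<partial>?X) \<partial>?Q2)
        \<le> ennreal (\<gamma>\<^sub>2 powr s * ((k\<^sub>2 / vl) powr (- s) / (1 - (- s)\<^sup>2)) ^ n)"
      using s by (intro lik_dominated_integral[where \<phi> = "\<lambda>r. ennreal r * indicator {..\<gamma>\<^sub>2} r"] P' vl k2 truncation_below g) auto
    finally have "(\<integral>\<^sup>+c. err j c \<partial>?B) \<le> ennreal (\<gamma>\<^sub>2 powr s * ((k\<^sub>2 / vl) powr (- s) / (1 - (- s)\<^sup>2)) ^ n) + ennreal (real (m * m') / \<gamma>\<^sub>2)"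
      by (simp add: add_right_mono)
    also have "\<dots> = ennreal E2"
      unfolding E2_def using s2 g by (intro ennreal_plus[symmetric] mult_nonneg_nonneg zero_le_power divide_nonneg_nonneg) auto
    finally show ?thesis .
  qed
  let ?c1 = "ennreal (1 / (real (m * m') * n * P))" and ?c2 = "ennreal (1 / (m * D))" and ?c3 = "ennreal (1 / (real (m * m') * e))"
  have P0: "P > 0" using P' by simp
  have sdm: "(\<lambda>c. \<Sum>i<m. dev i c) \<in> borel_measurable ?B" by (rule borel_measurable_sum) (simp add: devm)
  have sem: "(\<lambda>c. \<Sum>j\<in>?KK. err j c) \<in> borel_measurable ?B" by (rule borel_measurable_sum) (rule errm)
  have sdi: "(\<integral>\<^sup>+c. (\<Sum>i<m. dev i c) \<partial>?B) \<le> ennreal (m * E1)"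
  proof -
    have "(\<integral>\<^sup>+c. (\<Sum>i<m. dev i c) \<partial>?B) = (\<Sum>i<m. \<integral>\<^sup>+c. dev i c \<partial>?B)" by (rule nn_integral_sum) (simp add: devm)
    also have "\<dots> \<le> (\<Sum>i<m. ennreal E1)" by (intro sum_mono devi) simp
    also have "\<dots> = ennreal (m * E1)" using E10 by (subst sum_ennreal) auto
    finally show ?thesis .
  qed
  have sei: "(\<integral>\<^sup>+c. (\<Sum>j\<in>?KK. err j c) \<partial>?B) \<le> ennreal (real (m * m') * E2)"
  proof -
    have "(\<integral>\<^sup>+c. (\<Sum>j\<in>?KK. err j c) \<partial>?B) = (\<Sum>j\<in>?KK. \<integral>\<^sup>+c. err j c \<partial>?B)" by (rule nn_integral_sum) (rule errm)
    also have "\<dots> \<le> (\<Sum>j\<in>?KK. ennreal E2)" by (intro sum_mono erri)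
    also have "\<dots> = ennreal (real (m * m') * E2)" using E20 by (subst sum_ennreal) (auto simp: card_cartesian_product)
    finally show ?thesis .
  qed
  define T where "T c = ?c1 * pow c + ?c2 * (\<Sum>i<m. dev i c) + ?c3 * (\<Sum>j\<in>?KK. err j c)" for c
  have "(\<integral>\<^sup>+c. T c \<partial>?B) = ?c1 * (\<integral>\<^sup>+c. pow c \<partial>?B) + ?c2 * (\<integral>\<^sup>+c. (\<Sum>i<m. dev i c) \<partial>?B) + ?c3 * (\<integral>\<^sup>+c. (\<Sum>j\<in>?KK. err j c) \<partial>?B)"
    unfolding T_def by (simp only: nn_integral_add nn_integral_cmult borel_measurable_add borel_measurable_times_ennreal borel_measurable_const powm sdm sem)
  also have "\<dots> \<le> ?c1 * ennreal (real (m * m') * n * P') + ?c2 * ennreal (m * E1) + ?c3 * ennreal (real (m * m') * E2)"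
    unfolding powi by (intro add_mono mult_left_mono order_refl sdi sei) auto
  also have "\<dots> = ennreal (P' / P) + ennreal (E1 / D) + ennreal (E2 / e)"
    using m n P' D e E10 E20 by (simp add: ennreal_mult[symmetric])
  also have "\<dots> = ennreal (P' / P + E1 / D + E2 / e)"
    using P' D e E10 E20 by (simp add: ennreal_plus)
  also have "\<dots> < 1"
    using small P' D e E10 E20 unfolding E1_def[symmetric] E2_def[symmetric] by (simp add: ennreal_less_one_iff del: ennreal_plus)
  finally have lt: "(\<integral>\<^sup>+c. T c \<partial>?B) < 1" .
  obtain c where c: "T c < 1"
  proof (rule ccontr)
    assume "\<not> thesis"
    then have "\<And>c. 1 \<le> T c" using that by (meson not_le)
    then have "(\<integral>\<^sup>+c. 1 \<partial>?B) \<le> (\<integral>\<^sup>+c. T c \<partial>?B)" by (intro nn_integral_mono)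
    then show False using lt by (simp add: B.emeasure_space_1 leD)
  qed
  \<comment> \<open>Returns from a quotient below 1 to a bound by the budget, for quantities that
    may be infinite a priori.\<close>
  have conv: "q \<le> ennreal b" if "ennreal (1 / b) * q < 1" "b > 0" for q b
  proof -
    have "ennreal b * (ennreal (1 / b) * q) \<le> ennreal b * 1" using that by (intro mult_left_mono) auto
    moreover have "ennreal b * (ennreal (1 / b) * q) = q"
      using that by (simp add: mult.assoc[symmetric] ennreal_mult[symmetric])
    ultimately show ?thesis by simp
  qed
  have c1: "pow c \<le> ennreal (real (m * m') * n * P)"
    using c mm n P0 by (intro conv) (auto simp: T_def intro: le_less_trans[rotated] add_increasing2)
  have c2: "(\<Sum>i<m. dev i c) \<le> ennreal (m * D)"
    using c m D by (intro conv) (auto simp: T_def intro: le_less_trans[rotated] add_increasing2 add_increasing)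
  have c3: "(\<Sum>j\<in>?KK. err j c) \<le> ennreal (real (m * m') * e)"
    using c mm e by (intro conv) (auto simp: T_def intro: le_less_trans[rotated] add_increasing2 add_increasing)
  have "(\<Sum>j\<in>?KK. \<Sum>t<n. (cmod (c j t))\<^sup>2) \<le> real (m * m') * n * P"
    using c1 mm n P0 unfolding pow_def by (simp add: sum_nonneg ennreal_le_iff)
  then show ?thesis
    using c2 c3 unfolding dev_def err_def by blast
qed

section \<open>Performance of the selected code\<close>

lemma codebook_error:
  assumes KK: "finite KK" "KK \<noteq> {}" and C: "wiretap_encoder n P (codebook_law n KK c)" and vl: "vl > 0" and ve: "ve > 0"
    and dec: "wiretap_decoder n dec"
  shows "emeasure (wiretap_space n I vl ve (codebook_law n KK c))
      {\<omega> \<in> space (wiretap_space n I vl ve (codebook_law n KK c)). dec (receiver_output n hl \<omega>) \<noteq> message \<omega>}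
    = (\<Sum>j\<in>KK. \<integral>\<^sup>+y. indicator {d. d \<noteq> fst j} (dec y) \<partial>PiM {..<n} (\<lambda>t. cgauss (of_real hl * c j t) vl)) / card KK"
proof -
  let ?W = "wiretap_space n I vl ve (codebook_law n KK c)"
  let ?E = "{\<omega> \<in> space ?W. dec (receiver_output n hl \<omega>) \<noteq> message \<omega>}"
  have decm: "dec \<in> measurable (\<Pi>\<^sub>M t\<in>{..<n}. borel) (count_space UNIV)"
    using dec unfolding wiretap_decoder_def .
  have E: "?E \<in> sets ?W"
    by (rule sets_nat_eq(2)[OF measurable_compose[OF receiver_output_measurable[OF C vl ve] decm] message_measurable[OF C vl ve]])
  have F: "(\<lambda>y. indicator {d. d \<noteq> s} (dec y) :: ennreal) \<in> borel_measurable (\<Pi>\<^sub>M t\<in>{..<n}. borel)" for s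
    by (rule measurable_compose[OF decm]) simp
  have "emeasure ?W ?E = (\<integral>\<^sup>+\<omega>. indicator ?E \<omega> \<partial>?W)" by (rule nn_integral_indicator[OF E, symmetric])
  also have "\<dots> = (\<integral>\<^sup>+\<omega>. indicator {d. d \<noteq> message \<omega>} (dec (receiver_output n hl \<omega>)) \<partial>?W)"
    by (rule nn_integral_cong) (simp add: indicator_def)
  also have "\<dots> = (\<Sum>j\<in>KK. \<integral>\<^sup>+y. indicator {d. d \<noteq> fst j} (dec y) \<partial>PiM {..<n} (\<lambda>t. cgauss (of_real hl * c j t) vl)) / card KK"
    by (rule codebook_receiver[OF KK C vl ve F])
  finally show ?thesis .
qed

text \<open>The colluding eavesdroppers enter as one observation of unit gain and noise variance
  \<open>1 / G\<close>. \<open>k\<^sub>1\<close> and \<open>k\<^sub>2\<close> are the output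
  variances at input power \<open>P'\<close>, so the logarithms of \<open>k\<^sub>1 * G\<close> and
  \<open>k\<^sub>2 / vl\<close> are the informations of eavesdroppers and receiver.\<close>

lemma random_code:
  assumes n: "n > 0" and m: "m > 0" "m' > 0" and P': "0 < P'" "P' < P" and G: "G > 0" and vl: "vl > 0" and ve: "ve > 0"
    and s: "0 < s" "s < 1" and g: "\<gamma>\<^sub>1 > 0" "\<gamma>\<^sub>2 > 0" and D: "D > 0" and e: "e > 0"
    and k1: "k\<^sub>1 = 1 / G + 1\<^sup>2 * P'" and k2: "k\<^sub>2 = vl + hl\<^sup>2 * P'"
    and small: "P' / P + (sqrt (\<gamma>\<^sub>1 / m') + 2 * (\<gamma>\<^sub>1 powr (- s) * ((k\<^sub>1 / (1 / G)) powr s / (1 - s\<^sup>2)) ^ n)) / D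
        + (\<gamma>\<^sub>2 powr s * ((k\<^sub>2 / vl) powr (- s) / (1 - (- s)\<^sup>2)) ^ n + real (m * m') / \<gamma>\<^sub>2) / e < 1"
    and he: "\<And>J. finite J \<Longrightarrow> J \<subseteq> I \<Longrightarrow> (\<Sum>i\<in>J. (he i)\<^sup>2 / ve) < G"
  shows "\<exists>C dec. wiretap_encoder n P C \<and> wiretap_decoder n dec \<and>
        (let \<Omega> = wiretap_space n I vl ve C in
           message_entropy \<Omega> = log 2 m \<and>
           equivocation n I he \<Omega> \<ge> message_entropy \<Omega> - (1 + ln m) / ln 2 * (2 * D) \<and>
           measure \<Omega> {\<omega> \<in> space \<Omega>. dec (receiver_output n hl \<omega>) \<noteq> message \<omega>} \<le> e)"
proof -
  let ?KK = "{..<m} \<times> {..<m'}"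
  obtain c :: "nat \<times> nat \<Rightarrow> nat \<Rightarrow> complex" where
    pow: "(\<Sum>j\<in>?KK. \<Sum>t<n. (cmod (c j t))\<^sup>2) \<le> real (m * m') * real n * P" and
    dev: "(\<Sum>i<m. \<integral>\<^sup>+y. ennreal \<bar>(\<Sum>l<m'. lik n 1 (1 / G) k\<^sub>1 (c (i, l)) y) / m' - 1\<bar> \<partial>(\<Pi>\<^sub>M t\<in>{..<n}. complex_gaussian k\<^sub>1)) \<le> ennreal (m * D)" and
    err: "(\<Sum>j\<in>?KK. \<integral>\<^sup>+y. ennreal (lik n hl vl k\<^sub>2 (c j) y) * (indicator {..\<gamma>\<^sub>2} (lik n hl vl k\<^sub>2 (c j) y)
        + (\<Sum>i\<in>?KK - {j}. indicator {\<gamma>\<^sub>2<..} (lik n hl vl k\<^sub>2 (c i) y))) \<partial>(\<Pi>\<^sub>M t\<in>{..<n}. complex_gaussian k\<^sub>2))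
      \<le> ennreal (real (m * m') * e)"
    using random_codebook[OF n m P' G vl s g D e k1 k2 small] by blast
  let ?C = "codebook_law n ?KK c"
  let ?W = "wiretap_space n I vl ve ?C"
  define dec where "dec = threshold_decoder n hl vl k\<^sub>2 m m' \<gamma>\<^sub>2 c"
  have kp: "k\<^sub>1 > 0" "k\<^sub>2 > 0" using k1 k2 P' G vl by (auto simp: add_pos_nonneg add_pos_pos)
  have C: "wiretap_encoder n P ?C" using P' by (intro codebook_encoder n m pow) simp
  have decw: "wiretap_decoder n dec" unfolding dec_def by (rule threshold_decoder)
  then have decm: "dec \<in> measurable (\<Pi>\<^sub>M t\<in>{..<n}. borel) (count_space UNIV)"
    unfolding wiretap_decoder_def .
  have KK: "finite ?KK" "?KK \<noteq> {}" using m by auto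
  let ?Q = "\<Pi>\<^sub>M t\<in>{..<n}. complex_gaussian k\<^sub>2"
  let ?E = "{\<omega> \<in> space ?W. dec (receiver_output n hl \<omega>) \<noteq> message \<omega>}"
  have F: "(\<lambda>y. indicator {d. d \<noteq> s} (dec y) :: ennreal) \<in> borel_measurable (\<Pi>\<^sub>M t\<in>{..<n}. borel)" for s
    by (rule measurable_compose[OF decm]) simp
  have "emeasure ?W ?E = (\<Sum>j\<in>?KK. \<integral>\<^sup>+y. indicator {d. d \<noteq> fst j} (dec y) \<partial>PiM {..<n} (\<lambda>t. cgauss (of_real hl * c j t) vl)) / card ?KK"
    by (rule codebook_error[OF KK C vl ve decw])
  also have "\<dots> = (\<Sum>j\<in>?KK. \<integral>\<^sup>+y. ennreal (lik n hl vl k\<^sub>2 (c j) y) * indicator {d. d \<noteq> fst j} (dec y) \<partial>?Q) / card ?KK"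
    by (simp only: nn_integral_lik[OF vl kp(2) F])
  also have "\<dots> \<le> (\<Sum>j\<in>?KK. \<integral>\<^sup>+y. ennreal (lik n hl vl k\<^sub>2 (c j) y) * (indicator {..\<gamma>\<^sub>2} (lik n hl vl k\<^sub>2 (c j) y)
        + (\<Sum>i\<in>?KK - {j}. indicator {\<gamma>\<^sub>2<..} (lik n hl vl k\<^sub>2 (c i) y))) \<partial>?Q) / card ?KK"
    unfolding dec_def by (intro divide_right_mono_ennreal sum_mono nn_integral_mono mult_left_mono threshold_decoder_error) auto
  also have "\<dots> \<le> ennreal (real (m * m') * e) / card ?KK"
    by (rule divide_right_mono_ennreal[OF err])
  also have "\<dots> = ennreal (real (m * m') * e) / ennreal (real (m * m'))"
    unfolding ennreal_of_nat_eq_real_of_nat by (simp only: card_cartesian_product card_lessThan)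
  also have "\<dots> = ennreal e"
    using m e by (subst divide_ennreal) auto
  finally have "emeasure ?W ?E \<le> ennreal e" .
  then have "measure ?W ?E \<le> e" unfolding measure_def using e by (intro enn2real_leI) auto
  moreover have "message_entropy ?W - equivocation n I he ?W \<le> (1 + ln m) / ln 2 * (2 * D)"
    by (rule codebook_secrecy[OF C m vl ve he kp(1) less_imp_le[OF D] dev])
  moreover have "message_entropy ?W = log 2 m" by (rule codebook_message_entropy[OF C m vl ve])
  ultimately show ?thesis
    using C decw unfolding Let_def by (intro exI[of _ ?C] exI[of _ dec]) simp
qed

text \<open>Attains rate 0 with a single message and the zero word. As there is only one message,
  \<open>leakage_bound\<close> holds with \<open>\<delta> = 0\<close> and yields the bound on the
  equivocation.\<close>

lemma silent_code:
  assumes n: "n > 0" and P: "P \<ge> 0" and vl: "vl > 0" and ve: "ve > 0"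
  shows "\<exists>C dec. wiretap_encoder n P C \<and> wiretap_decoder n dec \<and>
        (let \<Omega> = wiretap_space n I vl ve C in
           message_entropy \<Omega> = 0 \<and> equivocation n I he \<Omega> \<ge> 0 \<and>
           measure \<Omega> {\<omega> \<in> space \<Omega>. dec (receiver_output n hl \<omega>) \<noteq> message \<omega>} = 0)"
proof -
  let ?KK = "{..<1} \<times> {..<1} :: (nat \<times> nat) set"
  let ?C = "codebook_law n ?KK (\<lambda>_ _. 0)"
  let ?W = "wiretap_space n I vl ve ?C"
  let ?E = "{\<omega> \<in> space ?W. 0 \<noteq> message \<omega>}"
  have C: "wiretap_encoder n P ?C" using P by (intro codebook_encoder n) auto
  interpret W: prob_space ?W by (rule prob_space_wiretap_space[OF C vl ve])
  have dec: "wiretap_decoder n (\<lambda>_. 0)" by (simp add: wiretap_decoder_def)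
  have ent: "message_entropy ?W = 0"
    using codebook_message_entropy[OF C _ _ vl ve, where I = I] by simp
  have "(0, 0) \<in> ?KK" by simp
  then have KK: "?KK \<noteq> {}" by blast
  have "emeasure ?W ?E = (\<Sum>j\<in>?KK. \<integral>\<^sup>+y. indicator {d. d \<noteq> fst j} 0 \<partial>PiM {..<n} (\<lambda>t. cgauss (of_real hl * 0) vl)) / card ?KK"
    by (rule codebook_error[OF _ KK C vl ve dec]) simp
  also have "\<dots> = 0" by simp
  finally have err: "measure ?W ?E = 0" by (simp add: measure_def)
  have Zm: "eavesdropper_output n I he \<in> measurable ?W (\<Pi>\<^sub>M ti\<in>{..<n} \<times> I. borel)"
    by (rule eavesdropper_output_measurable[OF C vl ve, where he = he])
  have d: "distr ?W (count_space UNIV) message = measure_pmf (pmf_of_set {..<1})"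
    unfolding distr_message[OF C vl ve] by (rule distr_codebook_law_fst) simp_all
  have bound: "measure ?W {\<omega> \<in> space ?W. message \<omega> = s \<and> eavesdropper_output n I he \<omega> \<in> A}
      \<le> measure (distr ?W (\<Pi>\<^sub>M ti\<in>{..<n} \<times> I. borel) (eavesdropper_output n I he)) A / card {..<1::nat} + 0"
    if A: "A \<in> sets (\<Pi>\<^sub>M ti\<in>{..<n} \<times> I. borel)" for s :: nat and A
  proof -
    have "measure ?W {\<omega> \<in> space ?W. message \<omega> = s \<and> eavesdropper_output n I he \<omega> \<in> A}
      \<le> measure ?W (eavesdropper_output n I he -` A \<inter> space ?W)"
      by (intro W.finite_measure_mono measurable_sets[OF Zm A]) auto
    then show ?thesis unfolding measure_distr[OF Zm A] by simp
  qed
  have "0 \<in> {..<1::nat}" by simp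
  then have ne: "{..<1::nat} \<noteq> {}" by blast
  have "message_entropy ?W - equivocation n I he ?W \<le> (1 + ln (card {..<1::nat})) / ln 2 * (\<Sum>s<1::nat. 0)"
    unfolding message_entropy_def equivocation_def
    by (rule W.leakage_bound[OF message_measurable[OF C vl ve] Zm finite_lessThan ne d bound])
  then have "equivocation n I he ?W \<ge> 0" using ent by simp
  then show ?thesis
    using C dec ent err unfolding Let_def by (intro exI[of _ ?C] exI[of _ "\<lambda>_. 0"]) simp
qed

section \<open>Choice of rates, thresholds and exponents\<close>

lemma neg_ln_one_minus_le:
  fixes x :: real
  assumes "0 \<le> x" "x \<le> 1 / 2"
  shows "- ln (1 - x) \<le> 2 * x"
proof -
  have "- ln (1 - x) = ln (1 / (1 - x))" using assms by (simp add: ln_div)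
  also have "\<dots> \<le> 1 / (1 - x) - 1" using assms by (intro ln_le_minus_one) auto
  also have "\<dots> = x / (1 - x)" using assms by (simp add: field_simps)
  also have "\<dots> \<le> x / (1 / 2)" using assms by (intro divide_left_mono) auto
  finally show ?thesis by simp
qed

text \<open>The private rate is \<open>x\<^sub>1 + \<eta>\<close>, just above the information of the
  eavesdroppers. The threshold \<open>\<gamma>\<^sub>1\<close> lies halfway between: far enough
  above \<open>x\<^sub>1\<close> for the upper tail to decay, and below \<open>m'\<close> by the
  factor \<open>exp (- n * \<eta> / 2)\<close>. Likewise \<open>\<gamma>\<^sub>2\<close> lies below
  \<open>x\<^sub>2\<close> by \<open>\<eta> / 2\<close>, while the total rate
  \<open>r + x\<^sub>1 - 3 * \<eta>\<close> is at most \<open>x\<^sub>2 - 2 * \<eta>\<close>, so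
  collisions decay too.\<close>

lemma eventually_random_code_condition:
  fixes \<eta> r x\<^sub>1 x\<^sub>2 q e s :: real
  defines "m \<equiv> \<lambda>n::nat. nat \<lceil>exp (n * (r - 4 * \<eta>))\<rceil>" and "m' \<equiv> \<lambda>n::nat. nat \<lceil>exp (n * (x\<^sub>1 + \<eta>))\<rceil>"
    and "\<gamma>\<^sub>1 \<equiv> \<lambda>n::nat. exp (n * (x\<^sub>1 + \<eta> / 2))" and "\<gamma>\<^sub>2 \<equiv> \<lambda>n::nat. exp (n * (x\<^sub>2 - \<eta> / 2))"
    and "D \<equiv> \<lambda>n::nat. e * ln 2 / (2 * (1 + ln (real (nat \<lceil>exp (n * (r - 4 * \<eta>))\<rceil>))))"
  assumes \<eta>: "\<eta> > 0" "4 * \<eta> \<le> r" and x1: "x\<^sub>1 \<ge> 0" and r: "r \<le> x\<^sub>2 - x\<^sub>1 + \<eta>" and q: "q < 1" and e: "e > 0"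
    and s: "0 < s" "s \<le> 1 / 2" "s \<le> \<eta> / 8"
  shows "\<forall>\<^sub>F n in sequentially. q + (sqrt (\<gamma>\<^sub>1 n / m' n) + 2 * (\<gamma>\<^sub>1 n powr (- s) * (exp x\<^sub>1 powr s / (1 - s\<^sup>2)) ^ n)) / D n
        + (\<gamma>\<^sub>2 n powr s * (exp x\<^sub>2 powr (- s) / (1 - (- s)\<^sup>2)) ^ n + real (m n * m' n) / \<gamma>\<^sub>2 n) / e < 1"
proof -
  have D_eq: "D n = e * ln 2 / (2 * (1 + ln (m n)))" for n by (simp add: D_def m_def)
  \<comment> \<open>Both tails have the drift \<open>s * \<eta> / 2 = 2 * \<kappa>\<close> per
    symbol. As \<open>s \<le> \<eta> / 8\<close>, the second-order loss
    \<open>- ln (1 - s\<^sup>2)\<close> uses up at most one \<open>\<kappa>\<close> and the other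
    remains as exponent.\<close>
  define \<kappa> where "\<kappa> = s * \<eta> / 4"
  have \<kappa>: "\<kappa> > 0" using s \<eta> by (simp add: \<kappa>_def)
  have \<kappa>4: "\<kappa> \<le> \<eta> / 4" using mult_right_mono[OF s(2), of \<eta>] \<eta> by (simp add: \<kappa>_def)
  have s2: "s\<^sup>2 \<le> 1 / 4" using power_mono[OF s(2), of 2] s by (simp add: power2_eq_square)
  have lns: "- ln (1 - s\<^sup>2) \<le> \<kappa>"
  proof -
    have "- ln (1 - s\<^sup>2) \<le> 2 * s\<^sup>2" using s2 by (intro neg_ln_one_minus_le) auto
    also have "\<dots> \<le> \<kappa>" using mult_left_mono[OF s(3), of "2 * s"] s by (simp add: \<kappa>_def power2_eq_square)
    finally show ?thesis .
  qed
  have inv: "1 / (1 - s\<^sup>2) = exp (- ln (1 - s\<^sup>2))" using s2 by (simp add: exp_minus field_simps)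
  \<comment> \<open>Every error term is a multiple of \<open>exp (- \<kappa>) ^ n\<close>. The
    factor \<open>n\<close> in the last summand comes from \<open>1 / D n\<close>, which grows like
    the logarithm of the number of messages.\<close>
  have bound: "(q + (sqrt (\<gamma>\<^sub>1 n / m' n) + 2 * (\<gamma>\<^sub>1 n powr (- s) * (exp x\<^sub>1 powr s / (1 - s\<^sup>2)) ^ n)) / D n
        + (\<gamma>\<^sub>2 n powr s * (exp x\<^sub>2 powr (- s) / (1 - (- s)\<^sup>2)) ^ n + real (m n * m' n) / \<gamma>\<^sub>2 n) / e)
      \<le> q + (12 / (e * ln 2) + 5 / e) * exp (- \<kappa>) ^ n + 6 * r / (e * ln 2) * (n * exp (- \<kappa>) ^ n)" for n
  proof -
    define E where "E = exp (- \<kappa>) ^ n"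
    have E: "E = exp (n * - \<kappa>)" unfolding E_def by (rule exp_of_nat_mult[symmetric])
    have E0: "E > 0" unfolding E by simp
    \<comment> \<open>For a nonnegative exponent the exponential is at least 1, so rounding up at
      most doubles it.\<close>
    have ceil: "real (nat \<lceil>exp y\<rceil>) \<ge> exp y" "real (nat \<lceil>exp y\<rceil>) \<le> 2 * exp y" if "y \<ge> 0" for y :: real
    proof -
      have "exp y \<ge> 1" using that by simp
      moreover have "real (nat \<lceil>exp y\<rceil>) = of_int \<lceil>exp y\<rceil>"
      proof -
        have "0 < \<lceil>exp y\<rceil>" by simp
        then show ?thesis by simp
      qed
      moreover have "of_int \<lceil>exp y\<rceil> < exp y + 1" "exp y \<le> of_int \<lceil>exp y\<rceil>" by linarith+
      ultimately show "real (nat \<lceil>exp y\<rceil>) \<ge> exp y" "real (nat \<lceil>exp y\<rceil>) \<le> 2 * exp y" by linarith+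
    qed
    have nm: "n * (r - 4 * \<eta>) \<ge> 0" "n * (x\<^sub>1 + \<eta>) \<ge> 0" using \<eta> x1 by auto
    have mb: "real (m n) \<ge> exp (n * (r - 4 * \<eta>))" "real (m n) \<le> 2 * exp (n * (r - 4 * \<eta>))"
      unfolding m_def using ceil[OF nm(1)] by auto
    have m'b: "real (m' n) \<ge> exp (n * (x\<^sub>1 + \<eta>))" "real (m' n) \<le> 2 * exp (n * (x\<^sub>1 + \<eta>))"
      unfolding m'_def using ceil[OF nm(2)] by auto
    have mpos: "real (m n) \<ge> 1" "real (m' n) > 0"
      using order_trans[OF _ mb(1), of 1] nm(1) less_le_trans[OF exp_gt_zero m'b(1)] by simp_all
    have B1: "sqrt (\<gamma>\<^sub>1 n / m' n) \<le> E"
    proof -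
      have "\<gamma>\<^sub>1 n / m' n \<le> \<gamma>\<^sub>1 n / exp (n * (x\<^sub>1 + \<eta>))"
        using m'b mpos by (intro divide_left_mono) (auto simp: \<gamma>\<^sub>1_def)
      also have "\<dots> = exp (- (n * \<eta> / 2))" unfolding \<gamma>\<^sub>1_def exp_diff[symmetric] by (simp add: algebra_simps)
      also have "\<dots> \<le> exp (2 * (n * - \<kappa>))" using mult_left_mono[OF \<kappa>4, of "real n"] by simp
      also have "\<dots> = E\<^sup>2" unfolding E by (rule exp_double)
      finally show ?thesis using E0 by (intro real_le_lsqrt) (auto simp: \<gamma>\<^sub>1_def)
    qed
    have lnn: "n * - ln (1 - s\<^sup>2) \<le> n * \<kappa>" using lns by (rule mult_left_mono) simp
    have B2: "\<gamma>\<^sub>1 n powr (- s) * (exp x\<^sub>1 powr s / (1 - s\<^sup>2)) ^ n \<le> E"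
    proof -
      have "\<gamma>\<^sub>1 n powr (- s) = exp (- s * (n * (x\<^sub>1 + \<eta> / 2)))" unfolding \<gamma>\<^sub>1_def by (simp add: powr_def)
      moreover have "(exp x\<^sub>1 powr s / (1 - s\<^sup>2)) ^ n = exp (n * (s * x\<^sub>1 + - ln (1 - s\<^sup>2)))"
        unfolding exp_of_nat_mult exp_add inv[symmetric] by (simp add: powr_def)
      ultimately have "\<gamma>\<^sub>1 n powr (- s) * (exp x\<^sub>1 powr s / (1 - s\<^sup>2)) ^ n
        = exp (- s * (n * (x\<^sub>1 + \<eta> / 2)) + n * (s * x\<^sub>1 + - ln (1 - s\<^sup>2)))" by (simp only: exp_add)
      also have "- s * (n * (x\<^sub>1 + \<eta> / 2)) + n * (s * x\<^sub>1 + - ln (1 - s\<^sup>2)) = n * - ln (1 - s\<^sup>2) - 2 * (n * \<kappa>)"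
        by (simp add: \<kappa>_def algebra_simps)
      also have "exp (n * - ln (1 - s\<^sup>2) - 2 * (n * \<kappa>)) \<le> E" unfolding E exp_le_cancel_iff using lnn by linarith
      finally show ?thesis .
    qed
    have B3: "\<gamma>\<^sub>2 n powr s * (exp x\<^sub>2 powr (- s) / (1 - (- s)\<^sup>2)) ^ n \<le> E"
    proof -
      have "\<gamma>\<^sub>2 n powr s = exp (s * (n * (x\<^sub>2 - \<eta> / 2)))" unfolding \<gamma>\<^sub>2_def by (simp add: powr_def)
      moreover have "(exp x\<^sub>2 powr (- s) / (1 - (- s)\<^sup>2)) ^ n = exp (n * (- s * x\<^sub>2 + - ln (1 - s\<^sup>2)))"
        unfolding exp_of_nat_mult exp_add inv[symmetric] by (simp add: powr_def)
      ultimately have "\<gamma>\<^sub>2 n powr s * (exp x\<^sub>2 powr (- s) / (1 - (- s)\<^sup>2)) ^ n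
        = exp (s * (n * (x\<^sub>2 - \<eta> / 2)) + n * (- s * x\<^sub>2 + - ln (1 - s\<^sup>2)))" by (simp only: exp_add)
      also have "s * (n * (x\<^sub>2 - \<eta> / 2)) + n * (- s * x\<^sub>2 + - ln (1 - s\<^sup>2)) = n * - ln (1 - s\<^sup>2) - 2 * (n * \<kappa>)"
        by (simp add: \<kappa>_def algebra_simps)
      also have "exp (n * - ln (1 - s\<^sup>2) - 2 * (n * \<kappa>)) \<le> E" unfolding E exp_le_cancel_iff using lnn by linarith
      finally show ?thesis .
    qed
    have B4: "real (m n * m' n) / \<gamma>\<^sub>2 n \<le> 4 * E"
    proof -
      have "real (m n * m' n) \<le> (2 * exp (n * (r - 4 * \<eta>))) * (2 * exp (n * (x\<^sub>1 + \<eta>)))"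
        unfolding of_nat_mult using mb m'b by (intro mult_mono) auto
      then have "real (m n * m' n) / \<gamma>\<^sub>2 n \<le> (2 * exp (n * (r - 4 * \<eta>))) * (2 * exp (n * (x\<^sub>1 + \<eta>))) / \<gamma>\<^sub>2 n"
        by (intro divide_right_mono) (auto simp: \<gamma>\<^sub>2_def)
      also have "\<dots> = 4 * exp (n * (r - 4 * \<eta>) + n * (x\<^sub>1 + \<eta>) - n * (x\<^sub>2 - \<eta> / 2))"
        unfolding \<gamma>\<^sub>2_def exp_diff exp_add by simp
      also have "\<dots> = 4 * exp (n * (r - 4 * \<eta> + x\<^sub>1 + \<eta> - x\<^sub>2 + \<eta> / 2))" by (simp add: algebra_simps)
      also have "\<dots> \<le> 4 * exp (n * - \<kappa>)"
      proof -
        have "r - 4 * \<eta> + x\<^sub>1 + \<eta> - x\<^sub>2 + \<eta> / 2 \<le> - \<kappa>" using r \<eta> \<kappa>4 by argo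
        from mult_left_mono[OF this, of "real n"] show ?thesis by simp
      qed
      finally show ?thesis unfolding E .
    qed
    have lnm: "1 + ln (m n) \<le> 2 + n * r" "1 + ln (m n) > 0"
    proof -
      have "ln (real (m n)) \<le> ln (2 * exp (n * (r - 4 * \<eta>)))" using mb mpos by (intro ln_mono) auto
      also have "\<dots> = ln 2 + n * (r - 4 * \<eta>)" by (subst ln_mult) auto
      also have "\<dots> \<le> 1 + n * r"
        using ln_2_less_1 \<eta> by (intro add_mono mult_left_mono) auto
      finally show "1 + ln (m n) \<le> 2 + n * r" by simp
      have "ln (real (m n)) \<ge> 0" using mpos by simp
      then show "1 + ln (m n) > 0" by linarith
    qed
    have "(sqrt (\<gamma>\<^sub>1 n / m' n) + 2 * (\<gamma>\<^sub>1 n powr (- s) * (exp x\<^sub>1 powr s / (1 - s\<^sup>2)) ^ n)) / D n \<le> (E + 2 * E) / D n"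
      using e lnm B1 B2 by (intro divide_right_mono add_mono mult_left_mono) (auto simp: D_eq)
    also have "\<dots> = 6 * E / (e * ln 2) * (1 + ln (m n))" by (simp add: D_eq)
    also have "\<dots> \<le> 6 * E / (e * ln 2) * (2 + n * r)" using lnm E0 e by (intro mult_left_mono) auto
    finally have T1: "(sqrt (\<gamma>\<^sub>1 n / m' n) + 2 * (\<gamma>\<^sub>1 n powr (- s) * (exp x\<^sub>1 powr s / (1 - s\<^sup>2)) ^ n)) / D n
      \<le> 6 * E / (e * ln 2) * (2 + n * r)" .
    have T2: "(\<gamma>\<^sub>2 n powr s * (exp x\<^sub>2 powr (- s) / (1 - (- s)\<^sup>2)) ^ n + real (m n * m' n) / \<gamma>\<^sub>2 n) / e \<le> (E + 4 * E) / e"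
      using e B3 B4 by (intro divide_right_mono add_mono) auto
    have "6 * E / (e * ln 2) * (2 + n * r) + (E + 4 * E) / e = (12 / (e * ln 2) + 5 / e) * E + 6 * r / (e * ln 2) * (n * E)"
      by (simp add: algebra_simps add_divide_distrib)
    then show ?thesis using T1 T2 unfolding E_def[symmetric] by linarith
  qed
  have "(\<lambda>n. q + (12 / (e * ln 2) + 5 / e) * exp (- \<kappa>) ^ n + 6 * r / (e * ln 2) * (real n * exp (- \<kappa>) ^ n))
      \<longlonglongrightarrow> q + (12 / (e * ln 2) + 5 / e) * 0 + 6 * r / (e * ln 2) * 0"
    using \<kappa> by (intro tendsto_add tendsto_mult tendsto_const LIMSEQ_power_zero powser_times_n_limit_0) auto
  then have "\<forall>\<^sub>F n in sequentially. q + (12 / (e * ln 2) + 5 / e) * exp (- \<kappa>) ^ n + 6 * r / (e * ln 2) * (real n * exp (- \<kappa>) ^ n) < 1"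
    using q by (intro order_tendstoD(2)) auto
  then show ?thesis
    by (rule eventually_mono) (rule le_less_trans[OF bound])
qed

text \<open>The logarithm has slope at most 1 beyond 1, so small changes of power and gain cost at
  most the same amount of information.\<close>

lemma ln_le_ln_add:
  fixes u w d :: real
  assumes "1 \<le> u" "0 < w" "w \<le> u + d" "d \<ge> 0"
  shows "ln w \<le> ln u + d"
proof -
  have "w \<le> u * (1 + d)" using assms mult_right_mono[of 1 u d] by (simp add: algebra_simps)
  then have "ln w \<le> ln (u * (1 + d))" using assms by (intro ln_mono) auto
  also have "\<dots> = ln u + ln (1 + d)" using assms by (intro ln_mult_pos) auto
  also have "ln (1 + d) \<le> d" using assms by (intro ln_add_one_self_le_self)
  finally show ?thesis by simp
qed

text \<open>Random coding is run at slightly lower power against a slightly stronger eavesdropper.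
  Each change costs at most \<open>\<eta> / 2\<close> of information, which explains the slack
  \<open>\<eta>\<close> in the hypothesis \<open>r \<le> x\<^sub>2 - x\<^sub>1 + \<eta>\<close> of
  the exponent lemma.\<close>

lemma achievability_positive:
  fixes he :: "nat \<Rightarrow> real"
  assumes P: "P > 0" and hl: "hl > 0" and vl: "vl > 0" and ve: "ve > 0" and sm: "(\<lambda>i. (he i)\<^sup>2) summable_on I"
    and rdef: "r = ln (1 + P * hl\<^sup>2 / vl) - ln (1 + P * (\<Sum>\<^sub>\<infinity>i\<in>I. (he i)\<^sup>2) / ve)" and r: "r > 0"
  shows "achievable_with_strong_secrecy P hl vl I he ve (r / ln 2)"
  unfolding achievable_with_strong_secrecy_def
proof (intro allI impI)
  fix e :: real assume e: "e > 0"
  define \<Sigma> where "\<Sigma> = (\<Sum>\<^sub>\<infinity>i\<in>I. (he i)\<^sup>2)"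
  have \<Sigma>0: "\<Sigma> \<ge> 0" unfolding \<Sigma>_def by (rule infsum_nonneg) simp
  \<comment> \<open>The message rate gives up \<open>4 * \<eta>\<close> nats. The two bounds keep
    this loss within \<open>e\<close> bits and the exponent of the number of messages
    nonnegative.\<close>
  define \<eta> where "\<eta> = min (e * ln 2) r / 4"
  have \<eta>: "\<eta> > 0" "4 * \<eta> \<le> r" "4 * \<eta> \<le> e * ln 2" using e r by (auto simp: \<eta>_def)
  \<comment> \<open>Strictly above the total precision of the eavesdroppers, as the degradation
    argument requires. The surplus raises \<open>G * P\<close> by \<open>\<eta> / 2\<close>.\<close>
  define G where "G = \<Sigma> / ve + \<eta> / (2 * P)"
  have G: "G > 0" unfolding G_def using \<Sigma>0 ve \<eta> P by (intro add_nonneg_pos) auto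
  \<comment> \<open>The reduction lowers the receiver's signal-to-noise ratio by at most
    \<open>\<eta> / 2\<close>; the cap \<open>P / 2\<close> keeps \<open>P'\<close>
    positive.\<close>
  define P' where "P' = P - min (P / 2) (\<eta> * vl / (2 * hl\<^sup>2))"
  have P': "0 < P'" "P' < P" unfolding P'_def using P \<eta> vl hl by (auto simp: min_def)
  define x\<^sub>1 where "x\<^sub>1 = ln (1 + G * P')"
  define x\<^sub>2 where "x\<^sub>2 = ln (1 + hl\<^sup>2 * P' / vl)"
  have pos1: "1 + G * P' > 0" using G P' by (simp add: add_pos_pos)
  have pos2: "1 + hl\<^sup>2 * P' / vl \<ge> 1" using P' vl by simp
  have ex1: "exp x\<^sub>1 = 1 + G * P'" unfolding x\<^sub>1_def using pos1 by simp
  have ex2: "exp x\<^sub>2 = 1 + hl\<^sup>2 * P' / vl" unfolding x\<^sub>2_def using pos2 by simp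
  have x10: "x\<^sub>1 \<ge> 0" unfolding x\<^sub>1_def using G P' by simp
  have "x\<^sub>1 \<le> ln (1 + P * \<Sigma> / ve) + \<eta> / 2"
    unfolding x\<^sub>1_def
  proof (rule ln_le_ln_add)
    have "G * P' \<le> G * P" using G P' by simp
    also have "\<dots> = P * \<Sigma> / ve + \<eta> / 2" using P ve by (simp add: G_def field_simps)
    finally show "1 + G * P' \<le> 1 + P * \<Sigma> / ve + \<eta> / 2" by simp
  qed (use pos1 \<eta> P ve \<Sigma>0 in auto)
  moreover have "ln (1 + P * hl\<^sup>2 / vl) \<le> x\<^sub>2 + \<eta> / 2"
    unfolding x\<^sub>2_def
  proof (rule ln_le_ln_add)
    have "P - \<eta> * vl / (2 * hl\<^sup>2) \<le> P'" unfolding P'_def by simp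
    then have "hl\<^sup>2 / vl * (P - \<eta> * vl / (2 * hl\<^sup>2)) \<le> hl\<^sup>2 / vl * P'" using vl by (intro mult_left_mono) auto
    moreover have "hl\<^sup>2 / vl * (P - \<eta> * vl / (2 * hl\<^sup>2)) = P * hl\<^sup>2 / vl - \<eta> / 2"
      using vl hl by (simp add: field_simps)
    ultimately show "1 + P * hl\<^sup>2 / vl \<le> 1 + hl\<^sup>2 * P' / vl + \<eta> / 2" by simp
    show "0 < 1 + P * hl\<^sup>2 / vl" using P vl by (intro add_pos_nonneg) auto
  qed (use pos2 \<eta> in auto)
  ultimately have rx: "r \<le> x\<^sub>2 - x\<^sub>1 + \<eta>" unfolding rdef \<Sigma>_def[symmetric] by linarith
  define s where "s = min (1 / 2) (\<eta> / 8)"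
  have s: "0 < s" "s \<le> 1 / 2" "s \<le> \<eta> / 8" "s < 1" using \<eta> by (auto simp: s_def)
  have he: "(\<Sum>i\<in>J. (he i)\<^sup>2 / ve) < G" if J: "finite J" "J \<subseteq> I" for J
  proof -
    have "(\<Sum>i\<in>J. (he i)\<^sup>2) \<le> \<Sigma>" unfolding \<Sigma>_def using J by (intro finite_sum_le_infsum sm) auto
    then have "(\<Sum>i\<in>J. (he i)\<^sup>2 / ve) \<le> \<Sigma> / ve"
      unfolding sum_divide_distrib[symmetric] using ve by (intro divide_right_mono) auto
    moreover have "\<eta> / (2 * P) > 0" using \<eta> P by simp
    ultimately show ?thesis unfolding G_def by linarith
  qed
  have q: "P' / P < 1" using P' P by simp
  let ?m = "\<lambda>n::nat. nat \<lceil>exp (n * (r - 4 * \<eta>))\<rceil>" and ?m' = "\<lambda>n::nat. nat \<lceil>exp (n * (x\<^sub>1 + \<eta>))\<rceil>"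
  note ev = eventually_random_code_condition[OF \<eta>(1,2) x10 rx q e s(1-3)]
  show "\<forall>\<^sub>F n in sequentially. \<exists>C dec.
        wiretap_encoder n P C \<and> wiretap_decoder n dec \<and>
        (let \<Omega> = wiretap_space n I vl ve C in
           message_entropy \<Omega> / real n \<ge> r / ln 2 - e \<and>
           equivocation n I he \<Omega> \<ge> message_entropy \<Omega> - e \<and>
           measure \<Omega> {\<omega> \<in> space \<Omega>. dec (receiver_output n hl \<omega>) \<noteq> message \<omega>} \<le> e)"
    using ev eventually_gt_at_top[of 0]
  proof eventually_elim
    case (elim n)
    have n: "n > 0" using elim by simp
    have nat_ceil: "0 < nat \<lceil>exp y\<rceil>" for y :: real by simp
    have mge: "real (?m n) \<ge> exp (n * (r - 4 * \<eta>))" by (rule real_nat_ceiling_ge)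
    have "ln (real (?m n)) \<ge> ln (exp (n * (r - 4 * \<eta>)))" by (intro ln_mono mge) simp
    then have lnm: "ln (real (?m n)) \<ge> n * (r - 4 * \<eta>)" by simp
    have lnm0: "1 + ln (real (?m n)) > 0"
    proof -
      have "n * (r - 4 * \<eta>) \<ge> 0" using \<eta> by simp
      then show ?thesis using lnm by linarith
    qed
    \<comment> \<open>The deviation for which the leakage bound of \<open>random_code\<close> is
      exactly \<open>e\<close>.\<close>
    define D where "D = e * ln 2 / (2 * (1 + ln (real (?m n))))"
    have D: "D > 0" using e lnm0 by (simp add: D_def)
    have k1: "(1 / G + 1\<^sup>2 * P') / (1 / G) = exp x\<^sub>1" unfolding ex1 using G by (simp add: field_simps)
    have k2: "(vl + hl\<^sup>2 * P') / vl = exp x\<^sub>2" unfolding ex2 using vl by (simp add: field_simps)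
    from elim(1) have cond: "P' / P + (sqrt (exp (n * (x\<^sub>1 + \<eta> / 2)) / ?m' n)
          + 2 * (exp (n * (x\<^sub>1 + \<eta> / 2)) powr (- s) * (((1 / G + 1\<^sup>2 * P') / (1 / G)) powr s / (1 - s\<^sup>2)) ^ n)) / D
        + (exp (n * (x\<^sub>2 - \<eta> / 2)) powr s * (((vl + hl\<^sup>2 * P') / vl) powr (- s) / (1 - (- s)\<^sup>2)) ^ n
          + real (?m n * ?m' n) / exp (n * (x\<^sub>2 - \<eta> / 2))) / e < 1"
      unfolding k1 k2 D_def .
    obtain C dec where code: "wiretap_encoder n P C" "wiretap_decoder n dec"
      "message_entropy (wiretap_space n I vl ve C) = log 2 (?m n)"
      "equivocation n I he (wiretap_space n I vl ve C)
        \<ge> message_entropy (wiretap_space n I vl ve C) - (1 + ln (?m n)) / ln 2 * (2 * D)"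
      "measure (wiretap_space n I vl ve C)
        {\<omega> \<in> space (wiretap_space n I vl ve C). dec (receiver_output n hl \<omega>) \<noteq> message \<omega>} \<le> e"
      using random_code[OF n nat_ceil nat_ceil P' G vl ve s(1,4) exp_gt_zero exp_gt_zero D e refl refl cond he]
      unfolding Let_def by blast
    have "a / ln 2 * (2 * (e * ln 2 / (2 * a))) = e" if "a > 0" for a :: real using that by simp
    from this[OF lnm0] have "(1 + ln (?m n)) / ln 2 * (2 * D) = e" unfolding D_def .
    with code(4) have "equivocation n I he (wiretap_space n I vl ve C) \<ge> message_entropy (wiretap_space n I vl ve C) - e" by simp
    moreover have "message_entropy (wiretap_space n I vl ve C) / n \<ge> r / ln 2 - e"
    proof -
      have "r / ln 2 - e = (r - e * ln 2) / ln 2" by (simp add: diff_divide_distrib)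
      also have "\<dots> \<le> (r - 4 * \<eta>) / ln 2" using \<eta> by (intro divide_right_mono) auto
      also have "\<dots> = (n * (r - 4 * \<eta>)) / ln 2 / n" using n by simp
      also have "\<dots> \<le> log 2 (?m n) / n" unfolding log_def using lnm by (intro divide_right_mono) auto
      finally show ?thesis unfolding code(3) .
    qed
    ultimately show ?case using code unfolding Let_def by blast
  qed
qed

text \<open>A positive difference of informations forces \<open>P > 0\<close> and is reached by
  random coding. In all other cases, a diverging sum included, the rate is 0 and silence attains
  it.\<close>

lemma achievability:
  fixes he :: "nat \<Rightarrow> real"
  assumes P: "P \<ge> 0" and hl: "hl > 0" and vl: "vl > 0" and ve: "ve > 0"
  shows "achievable_with_strong_secrecy P hl vl I he ve (if (\<lambda>i. (he i)\<^sup>2) summable_on I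
            then max 0 (log 2 (1 + P * hl\<^sup>2 / vl) - log 2 (1 + P * (\<Sum>\<^sub>\<infinity>i\<in>I. (he i)\<^sup>2) / ve)) else 0)"
proof -
  define r where "r = ln (1 + P * hl\<^sup>2 / vl) - ln (1 + P * (\<Sum>\<^sub>\<infinity>i\<in>I. (he i)\<^sup>2) / ve)"
  have lr: "log 2 (1 + P * hl\<^sup>2 / vl) - log 2 (1 + P * (\<Sum>\<^sub>\<infinity>i\<in>I. (he i)\<^sup>2) / ve) = r / ln 2"
    by (simp add: log_def r_def diff_divide_distrib)
  show ?thesis
  proof (cases "(\<lambda>i. (he i)\<^sup>2) summable_on I \<and> r > 0")
    case True
    then have "P \<noteq> 0" by (auto simp: r_def)
    with P have "P > 0" by simp
    from achievability_positive[OF this hl vl ve _ r_def] True show ?thesis unfolding lr by simp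
  next
    case False
    then have z: "(if (\<lambda>i. (he i)\<^sup>2) summable_on I then max 0 (r / ln 2) else 0) = 0"
      by (auto simp: max_def field_simps not_less)
    have "achievable_with_strong_secrecy P hl vl I he ve 0"
      unfolding achievable_with_strong_secrecy_def
    proof (intro allI impI)
      fix e :: real assume e: "e > 0"
      show "\<forall>\<^sub>F n in sequentially. \<exists>C dec. wiretap_encoder n P C \<and> wiretap_decoder n dec \<and>
        (let \<Omega> = wiretap_space n I vl ve C in
           message_entropy \<Omega> / real n \<ge> 0 - e \<and>
           equivocation n I he \<Omega> \<ge> message_entropy \<Omega> - e \<and>
           measure \<Omega> {\<omega> \<in> space \<Omega>. dec (receiver_output n hl \<omega>) \<noteq> message \<omega>} \<le> e)"
        using eventually_gt_at_top[of 0]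
      proof eventually_elim
        case (elim n)
        obtain C dec where "wiretap_encoder n P C" "wiretap_decoder n dec"
          "message_entropy (wiretap_space n I vl ve C) = 0" "equivocation n I he (wiretap_space n I vl ve C) \<ge> 0"
          "measure (wiretap_space n I vl ve C)
            {\<omega> \<in> space (wiretap_space n I vl ve C). dec (receiver_output n hl \<omega>) \<noteq> message \<omega>} = 0"
          using silent_code[OF elim P vl ve] unfolding Let_def by blast
        then show ?case using e unfolding Let_def by (intro exI[of _ C] exI[of _ dec]) simp
      qed
    qed
    then show ?thesis unfolding lr z .
  qed
qed

theorem theorem6p1:
  fixes g :: "real \<Rightarrow> real"
    and P r\<^sub>l \<sigma>\<^sub>l \<sigma>\<^sub>e :: real
    and N :: enat
    and X :: "nat \<Rightarrow> real ^ 2"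
  defines "I \<equiv> {i. enat i < N}"
    and "R \<equiv> \<lambda>i. norm (X i)"
  assumes g_pos: "\<And>r. r > 0 \<Longrightarrow> g r > 0"
    and g_cont: "continuous_on {0<..} g"
    and g_decr: "strict_antimono_on {0<..} g"
    and g_lim: "(g \<longlongrightarrow> 0) at_top"
    and P: "P \<ge> 0"
    and r\<^sub>l: "r\<^sub>l > 0"
    and \<sigma>\<^sub>l: "\<sigma>\<^sub>l > 0"
    and \<sigma>\<^sub>e: "\<sigma>\<^sub>e > 0"
    and R_pos: "\<And>i. i \<in> I \<Longrightarrow> R i > 0"
    and R_mono: "mono_on I R"
  shows "is_maximum_secrecy_rate P (sqrt (g r\<^sub>l)) (\<sigma>\<^sub>l\<^sup>2) I (\<lambda>i. sqrt (g (R i))) (\<sigma>\<^sub>e\<^sup>2)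
           (if (\<lambda>i. g (R i)) summable_on I
            then max 0 (log 2 (1 + P * g r\<^sub>l / \<sigma>\<^sub>l\<^sup>2)
                      - log 2 (1 + P * (\<Sum>\<^sub>\<infinity>i\<in>I. g (R i)) / \<sigma>\<^sub>e\<^sup>2))
            else 0)"
proof -
  have gr: "g (R i) > 0" if "i \<in> I" for i by (rule g_pos[OF R_pos[OF that]])
  have gl: "g r\<^sub>l > 0" by (rule g_pos[OF r\<^sub>l])
  have sq: "(sqrt (g (R i)))\<^sup>2 = g (R i)" if "i \<in> I" for i using gr[OF that] by simp
  have sql: "(sqrt (g r\<^sub>l))\<^sup>2 = g r\<^sub>l" using gl by simp
  have sm: "(\<lambda>i. (sqrt (g (R i)))\<^sup>2) summable_on I \<longleftrightarrow> (\<lambda>i. g (R i)) summable_on I"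
    by (rule summable_on_cong) (rule sq)
  have inf: "(\<Sum>\<^sub>\<infinity>i\<in>I. (sqrt (g (R i)))\<^sup>2) = (\<Sum>\<^sub>\<infinity>i\<in>I. g (R i))"
    by (rule infsum_cong) (rule sq)
  have pos: "sqrt (g r\<^sub>l) > 0" "\<sigma>\<^sub>l\<^sup>2 > 0" "\<sigma>\<^sub>e\<^sup>2 > 0" using gl \<sigma>\<^sub>l \<sigma>\<^sub>e by simp_all
  show ?thesis
    unfolding is_maximum_secrecy_rate_def
  proof (intro conjI allI impI)
    show "achievable_with_strong_secrecy P (sqrt (g r\<^sub>l)) (\<sigma>\<^sub>l\<^sup>2) I (\<lambda>i. sqrt (g (R i))) (\<sigma>\<^sub>e\<^sup>2)
           (if (\<lambda>i. g (R i)) summable_on I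
            then max 0 (log 2 (1 + P * g r\<^sub>l / \<sigma>\<^sub>l\<^sup>2)
                      - log 2 (1 + P * (\<Sum>\<^sub>\<infinity>i\<in>I. g (R i)) / \<sigma>\<^sub>e\<^sup>2))
            else 0)"
      using achievability[OF P pos, of I "\<lambda>i. sqrt (g (R i))"] unfolding sm inf sql .
    fix rate
    assume "achievable_with_strong_secrecy P (sqrt (g r\<^sub>l)) (\<sigma>\<^sub>l\<^sup>2) I (\<lambda>i. sqrt (g (R i))) (\<sigma>\<^sub>e\<^sup>2) rate"
    from converse[OF this P pos] show "rate \<le> (if (\<lambda>i. g (R i)) summable_on I
            then max 0 (log 2 (1 + P * g r\<^sub>l / \<sigma>\<^sub>l\<^sup>2)
                      - log 2 (1 + P * (\<Sum>\<^sub>\<infinity>i\<in>I. g (R i)) / \<sigma>\<^sub>e\<^sup>2))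
            else 0)"
      unfolding sm inf sql .
  qed
qed

end
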